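(* Suppose that $\Omega$ is simply connected and that $\partial\Omega$ is connected. For all $0\le\beta<1/2$, if $\boldsymbol{u}\in\boldsymbol{V}^0_\beta(\Omega)$ satisfies $\mathrm{div}\,\boldsymbol{u}=0$ in $\Omega$, then there exists a unique $\boldsymbol{\psi}\in\boldsymbol{\mathrm{Z}}^\beta_T(1)$ such that $\boldsymbol{u}=\mathrm{curl}\,\boldsymbol{\psi}$.
   Context: $\Omega\subset\mathbb{R}^3$ is a bounded connected open set with Lipschitz boundary and unit outward normal $\nu$, containing the origin $O$; $r=|x|$; $\boldsymbol{L}^2(\Omega)=(L^2(\Omega))^3$. For $\beta\in\mathbb{R}$, $V^0_\beta(\Omega)$ is the closure of $C^\infty_0(\overline{\Omega}\setminus\{O\})$ (smooth functions supported in $\overline\Omega\setminus\{O\}$) for the norm $\|\varphi\|_{V^0_\beta(\Omega)}=\|r^\beta\varphi\|_{L^2(\Omega)}$, and $\boldsymbol{V}^0_\beta(\Omega)=(V^0_\beta(\Omega))^3$. $\boldsymbol{\mathrm{Z}}^\beta_T(1)=\{\boldsymbol{u}\in\boldsymbol{L}^2(\Omega):\mathrm{curl}\,\boldsymbol{u}\in\boldsymbol{V}^0_\beta(\Omega),\ \mathrm{div}\,\boldsymbol{u}=0\text{ in }\Omega,\ \boldsymbol{u}\cdot\nu=0\text{ on }\partial\Omega\}$. *)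

theory Defs
  imports "HOL-Analysis.Analysis"
begin

text \<open>
  Fields are complex-valued (\<open>complex\<close>, \<open>complex^3\<close>) and represented by functions on all of
  \<open>real^3\<close>, of which only the values on \<open>\<Omega>\<close>, up to null sets, matter.
\<close>


definition pderiv3 :: "3 \<Rightarrow> (real^3 \<Rightarrow> complex) \<Rightarrow> real^3 \<Rightarrow> complex" where
  "pderiv3 i f x = frechet_derivative f (at x) (axis i 1)"

primrec Ck :: "nat \<Rightarrow> (real^3 \<Rightarrow> complex) \<Rightarrow> bool" where
  "Ck 0 f \<longleftrightarrow> continuous_on UNIV f"
| "Ck (Suc k) f \<longleftrightarrow> f differentiable_on UNIV \<and> (\<forall>i. Ck k (pderiv3 i f))"

definition smooth :: "(real^3 \<Rightarrow> complex) \<Rightarrow> bool" where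
  "smooth f \<longleftrightarrow> (\<forall>k. Ck k f)"

definition grad :: "(real^3 \<Rightarrow> complex) \<Rightarrow> real^3 \<Rightarrow> complex^3" where
  "grad f x = (\<chi> i. pderiv3 i f x)"

definition curl :: "(real^3 \<Rightarrow> complex^3) \<Rightarrow> real^3 \<Rightarrow> complex^3" where
  "curl f x = vector
     [pderiv3 2 (\<lambda>y. f y $ 3) x - pderiv3 3 (\<lambda>y. f y $ 2) x,
      pderiv3 3 (\<lambda>y. f y $ 1) x - pderiv3 1 (\<lambda>y. f y $ 3) x,
      pderiv3 1 (\<lambda>y. f y $ 2) x - pderiv3 2 (\<lambda>y. f y $ 1) x]"

text \<open>The complex bilinear product; the library's \<open>\<bullet>\<close> on \<open>complex^3\<close> is the real inner product.\<close>

definition cdot :: "complex^3 \<Rightarrow> complex^3 \<Rightarrow> complex" where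
  "cdot a b = (\<Sum>i\<in>UNIV. a $ i * b $ i)"


definition test_functions :: "(real^3) set \<Rightarrow> (real^3 \<Rightarrow> complex) set" where
  "test_functions \<Omega> =
     {f. smooth f \<and> (\<exists>K. compact K \<and> K \<subseteq> \<Omega> \<and> (\<forall>x. x \<notin> K \<longrightarrow> f x = 0))}"

text \<open>
  Smoothness up to the boundary means having a smooth extension to the whole space. Such functions
  vanish near the origin but need not vanish on the boundary of \<open>\<Omega>\<close>; the values outside
  \<open>closure \<Omega>\<close> belong to the extension and are irrelevant.
\<close>

definition test_functions_off_origin :: "(real^3) set \<Rightarrow> (real^3 \<Rightarrow> complex) set" where
  "test_functions_off_origin \<Omega> =
     {f. smooth f \<and>
         (\<exists>K. compact K \<and> K \<subseteq> closure \<Omega> - {0} \<and> (\<forall>x \<in> closure \<Omega> - K. f x = 0))}"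


definition L2 :: "(real^3) set \<Rightarrow> (real^3 \<Rightarrow> complex) set" where
  "L2 \<Omega> = {f. f \<in> borel_measurable (lebesgue_on \<Omega>) \<and>
              integrable (lebesgue_on \<Omega>) (\<lambda>x. (cmod (f x))\<^sup>2)}"

definition L2_norm :: "(real^3) set \<Rightarrow> (real^3 \<Rightarrow> complex) \<Rightarrow> real" where
  "L2_norm \<Omega> f = sqrt (\<integral>x. (cmod (f x))\<^sup>2 \<partial>lebesgue_on \<Omega>)"

definition weighted :: "real \<Rightarrow> (real^3 \<Rightarrow> complex) \<Rightarrow> real^3 \<Rightarrow> complex" where
  "weighted \<beta> f x = of_real (norm x powr \<beta>) * f x"

definition V0_norm :: "real \<Rightarrow> (real^3) set \<Rightarrow> (real^3 \<Rightarrow> complex) \<Rightarrow> real" where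
  "V0_norm \<beta> \<Omega> f = L2_norm \<Omega> (weighted \<beta> f)"

text \<open>The closure is taken within the functions of finite weighted norm.\<close>

definition V0 :: "real \<Rightarrow> (real^3) set \<Rightarrow> (real^3 \<Rightarrow> complex) set" where
  "V0 \<beta> \<Omega> = {f. weighted \<beta> f \<in> L2 \<Omega> \<and>
     (\<forall>\<epsilon>>0. \<exists>\<phi> \<in> test_functions_off_origin \<Omega>. V0_norm \<beta> \<Omega> (\<lambda>x. f x - \<phi> x) < \<epsilon>)}"

definition componentwise ::
    "(real^3 \<Rightarrow> complex) set \<Rightarrow> (real^3 \<Rightarrow> complex^3) set" where
  "componentwise X = {u. \<forall>i. (\<lambda>x. u x $ i) \<in> X}"


definition locally_integrable ::
    "(real^3) set \<Rightarrow> (real^3 \<Rightarrow> 'b::{banach, second_countable_topology}) \<Rightarrow> bool" where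
  "locally_integrable \<Omega> f \<longleftrightarrow> (\<forall>K. compact K \<and> K \<subseteq> \<Omega> \<longrightarrow> set_integrable lebesgue K f)"

text \<open>\<open>has_weak_grad \<Omega> p g\<close> states that \<open>\<nabla>p = g\<close> in the sense of distributions in \<open>\<Omega>\<close>;
  similarly for \<open>div u = f\<close> and \<open>curl u = w\<close>.\<close>

definition has_weak_grad ::
    "(real^3) set \<Rightarrow> (real^3 \<Rightarrow> complex) \<Rightarrow> (real^3 \<Rightarrow> complex^3) \<Rightarrow> bool" where
  "has_weak_grad \<Omega> p g \<longleftrightarrow> locally_integrable \<Omega> p \<and> locally_integrable \<Omega> g \<and>
     (\<forall>\<phi> \<in> test_functions \<Omega>. \<forall>i.
        (\<integral>x. p x * pderiv3 i \<phi> x \<partial>lebesgue_on \<Omega>) = - (\<integral>x. g x $ i * \<phi> x \<partial>lebesgue_on \<Omega>))"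

definition has_weak_div ::
    "(real^3) set \<Rightarrow> (real^3 \<Rightarrow> complex^3) \<Rightarrow> (real^3 \<Rightarrow> complex) \<Rightarrow> bool" where
  "has_weak_div \<Omega> u f \<longleftrightarrow> locally_integrable \<Omega> u \<and> locally_integrable \<Omega> f \<and>
     (\<forall>\<phi> \<in> test_functions \<Omega>.
        (\<integral>x. cdot (u x) (grad \<phi> x) \<partial>lebesgue_on \<Omega>) = - (\<integral>x. f x * \<phi> x \<partial>lebesgue_on \<Omega>))"

definition has_weak_curl ::
    "(real^3) set \<Rightarrow> (real^3 \<Rightarrow> complex^3) \<Rightarrow> (real^3 \<Rightarrow> complex^3) \<Rightarrow> bool" where
  "has_weak_curl \<Omega> u w \<longleftrightarrow> locally_integrable \<Omega> u \<and> locally_integrable \<Omega> w \<and>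
     (\<forall>\<phi> \<in> componentwise (test_functions \<Omega>).
        (\<integral>x. cdot (u x) (curl \<phi> x) \<partial>lebesgue_on \<Omega>) = (\<integral>x. cdot (w x) (\<phi> x) \<partial>lebesgue_on \<Omega>))"


text \<open>
  For a square-integrable field \<open>u\<close> with square-integrable divergence on a Lipschitz domain, the
  trace \<open>u \<cdot> \<nu>\<close> is the element of \<open>H\<^sup>-\<^sup>1\<^sup>/\<^sup>2(\<partial>\<Omega>)\<close> defined by Green's formula
  \<open>\<langle>u \<cdot> \<nu>, p\<rangle> = \<integral>\<^sub>\<Omega> u \<cdot> \<nabla>p + (div u) p\<close> for \<open>p \<in> H\<^sup>1(\<Omega>)\<close>.
\<close>

definition zero_normal_trace :: "(real^3) set \<Rightarrow> (real^3 \<Rightarrow> complex^3) \<Rightarrow> bool" where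
  "zero_normal_trace \<Omega> u \<longleftrightarrow> u \<in> componentwise (L2 \<Omega>) \<and>
     (\<exists>f \<in> L2 \<Omega>. has_weak_div \<Omega> u f \<and>
       (\<forall>p \<in> L2 \<Omega>. \<forall>g \<in> componentwise (L2 \<Omega>). has_weak_grad \<Omega> p g \<longrightarrow>
          (\<integral>x. cdot (u x) (g x) + f x * p x \<partial>lebesgue_on \<Omega>) = 0))"

definition ZT :: "real \<Rightarrow> (real^3) set \<Rightarrow> (real^3 \<Rightarrow> complex^3) set" where
  "ZT \<beta> \<Omega> = {u \<in> componentwise (L2 \<Omega>).
     (\<exists>w \<in> componentwise (V0 \<beta> \<Omega>). has_weak_curl \<Omega> u w) \<and>
     has_weak_div \<Omega> u (\<lambda>_. 0) \<and> zero_normal_trace \<Omega> u}"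


text \<open>
  Near each boundary point and in suitable orthonormal coordinates, \<open>\<Omega>\<close> lies exactly on one side
  of the graph of a Lipschitz function.
\<close>

definition lipschitz_boundary :: "(real^3) set \<Rightarrow> bool" where
  "lipschitz_boundary \<Omega> \<longleftrightarrow>
     (\<forall>z \<in> frontier \<Omega>. \<exists>\<delta>>0. \<exists>(T :: real^3 \<Rightarrow> real^3) (g :: real \<times> real \<Rightarrow> real) L.
        orthogonal_transformation T \<and> L-lipschitz_on UNIV g \<and>
        (\<forall>x \<in> ball z \<delta>. x \<in> \<Omega> \<longleftrightarrow> T x $ 3 < g (T x $ 1, T x $ 2)))"

end

theory Submission
 imports Defs "HOL-Real_Asymp.Real_Asymp"
begin

text \<open>
  \<^emph>\<open>Existence.\<close> The Riesz representative of \<open>\<phi> \<mapsto> \<integral> u \<cdot> \<phi>\<close> in the closure of the curls of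
  test fields is the conjugate of a potential \<open>\<psi>\<close>. Curls of test fields are orthogonal to all
  gradients, so \<open>div \<psi> = 0\<close> and \<open>\<psi> \<cdot> \<nu> = 0\<close> come for free. It remains to bound \<open>\<integral> u \<cdot> \<phi>\<close> by
  the \<open>L\<^sup>2\<close> norm of \<open>curl \<phi>\<close>. Line integrals from a suitable vertex \<open>y\<close>, found by averaging over a ball,
  give \<open>\<phi> = \<nabla>q - A\<close> on a large ball, where \<open>r\<^sup>-\<^sup>\<beta> A\<close> is controlled because \<open>\<beta> < 1/2\<close>. Outside \<open>\<Omega>\<close>
  we have \<open>\<phi> = 0\<close>, hence \<open>\<nabla>q = A\<close>, and a Poincare inequality along the connected boundary bounds
  \<open>q\<close>, up to a constant, in an exterior collar. Finally \<open>\<integral> u \<cdot> \<nabla>f\<close>, for \<open>f\<close> supported near a boundary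
  point, depends only on the exterior values of \<open>f\<close>, since subtracting the reflection of \<open>f\<close> in the
  Lipschitz graph leaves a function that vanishes outside \<open>\<Omega>\<close>.

  \<^emph>\<open>Uniqueness.\<close> The difference \<open>w\<close> of two potentials is curl-free. Line integrals give
  potentials of \<open>w\<close> on balls; the constants by which they differ form a cocycle, which is a coboundary as
  \<open>\<Omega>\<close> is simply connected, so \<open>w = \<nabla>p\<close>. Near the boundary \<open>p\<close> is square integrable because \<open>\<Omega>\<close> is
  locally star-shaped with respect to a ball. Green's formula with the conjugate of \<open>p\<close> gives
  \<open>\<integral> \<bar>w\<bar>\<^sup>2 = 0\<close>.
\<close>

section \<open>Calculus of complex-valued functions\<close>

text \<open>The obstacle is that u need not be square integrable at the origin, so its pairing with
  \<phi> must be controlled by the unweighted norm of curl \<phi> through the dual weight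
  r^(-\<beta>). The remainder A at x is an integral of curl \<phi> along the segment from y to x.
  Squaring it, weighting by r^(-2 \<beta>) and averaging over y leads, for t near 1, to the integral
  of (1 - t)^(-2 \<beta>) over [0,1), which converges because \<beta> < 1/2.

  The gradient part contributes nothing in the interior, because div u = 0; near the boundary, away
  from the origin, u is square integrable and the reflection can be estimated by Cauchy-Schwarz.
  There only exterior values matter, and in the exterior grad q is as small as A.

  The pairing \<open>cdot\<close> is bilinear, whereas the Riesz representation is made with the
  real inner product; this is the reason for the conjugates in both halves of the proof. The
  orthogonality of \<psi> to curl-free fields is used twice: for the boundary condition, and again
  when a second potential is compared with \<psi>.\<close>

abbreviation (input) lborel_integral :: "('a::euclidean_space => 'b::{banach, second_countable_topology}) => 'b" (binder "LI " 10)
 where "LI x. f x \<equiv> integral\<^sup>L lborel f"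

abbreviation (input) lborel_nn_integral :: "('a::euclidean_space => ennreal) => ennreal" (binder "NI " 10)
 where "NI x. f x \<equiv> integral\<^sup>N lborel f"

abbreviation (input) nsq :: "'a::real_normed_vector => ennreal"
 where "nsq a \<equiv> ennreal ((norm a)\<^sup>2)"

lemma pderiv3_eqI:
 assumes "(f has_derivative D) (at x)"
 shows "pderiv3 i f x = D (axis i 1)"
 unfolding pderiv3_def using frechet_derivative_at[OF assms] by simp

lemma has_derivative_pderiv3:
 assumes "f differentiable (at x)"
 shows "(f has_derivative (%h. \<Sum>i\<in>UNIV. h $ i *\<^sub>R pderiv3 i f x)) (at x)"
proof -
 obtain D where D: "(f has_derivative D) (at x)" using assms by (auto simp: differentiable_def)
 interpret D: bounded_linear D using D by (rule has_derivative_bounded_linear)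
 have "D h = (\<Sum>i\<in>UNIV. h $ i *\<^sub>R pderiv3 i f x)" for h
 proof -
  have "D h = D (\<Sum>i\<in>UNIV. h $ i *\<^sub>R axis i 1)"
   by (simp add: basis_expansion flip: scalar_mult_eq_scaleR)
  also have "\<dots> = (\<Sum>i\<in>UNIV. h $ i *\<^sub>R D (axis i 1))"
   by (simp add: D.sum D.scaleR)
  finally show ?thesis by (simp add: pderiv3_eqI[OF D])
 qed
 then have "D = (%h. \<Sum>i\<in>UNIV. h $ i *\<^sub>R pderiv3 i f x)" by blast
 with D show ?thesis by simp
qed

lemma Ck_differentiable: "Ck (Suc k) f ==> f differentiable (at x)"
 by (auto simp: differentiable_on_def)

lemma Ck_continuous: "Ck k f ==> continuous_on UNIV f"
 by (cases k) (auto intro: differentiable_imp_continuous_on)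

lemma Ck_Suc_D: "Ck (Suc k) f ==> Ck k f"
proof (induction k arbitrary: f)
 case 0 then show ?case using Ck_continuous[of "Suc 0" f] by simp
next
 case (Suc k) then show ?case by simp
qed

lemma Ck_le: "Ck k f ==> j <= k ==> Ck j f"
 by (induction k) (auto dest: Ck_Suc_D simp: le_Suc_eq simp del: Ck.simps)

lemma smooth_Ck: "smooth f ==> Ck k f" by (simp add: smooth_def)

lemma smooth_pderiv3: "smooth f ==> smooth (pderiv3 i f)"
 unfolding smooth_def by (metis Ck.simps(2))

lemma smooth_differentiable: "smooth f ==> f differentiable (at x)"
 using Ck_differentiable smooth_Ck by blast

lemma pderiv3_const [simp]: "pderiv3 i (%x. c) = (%x. 0)"
 by (auto intro!: ext pderiv3_eqI[where D="%_. 0"])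

lemma sum_axis_scaleR: "(\<Sum>j\<in>UNIV. axis i (1::real) $ j *\<^sub>R v j) = (v i :: 'a::real_vector)"
proof -
 have "(\<Sum>j\<in>UNIV. axis i (1::real) $ j *\<^sub>R v j) = (\<Sum>j\<in>UNIV. if j = i then v j else 0)"
  by (intro sum.cong) (auto simp: axis_def)
 then show ?thesis by simp
qed

lemma pderiv3_add:
 assumes "f differentiable (at x)" "g differentiable (at x)"
 shows "pderiv3 i (%x. f x + g x) x = pderiv3 i f x + pderiv3 i g x"
 by (rule trans[OF pderiv3_eqI[OF has_derivative_add[OF has_derivative_pderiv3[OF assms(1)] has_derivative_pderiv3[OF assms(2)]]]]) (simp add: sum_axis_scaleR)

lemma pderiv3_diff:
 assumes "f differentiable (at x)" "g differentiable (at x)"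
 shows "pderiv3 i (%x. f x - g x) x = pderiv3 i f x - pderiv3 i g x"
 by (rule trans[OF pderiv3_eqI[OF has_derivative_diff[OF has_derivative_pderiv3[OF assms(1)] has_derivative_pderiv3[OF assms(2)]]]]) (simp add: sum_axis_scaleR)

lemma pderiv3_mult:
 assumes "f differentiable (at x)" "g differentiable (at x)"
 shows "pderiv3 i (%x. f x * g x) x = f x * pderiv3 i g x + pderiv3 i f x * g x"
 by (rule trans[OF pderiv3_eqI[OF has_derivative_mult[OF has_derivative_pderiv3[OF assms(1)] has_derivative_pderiv3[OF assms(2)]]]]) (simp add: sum_axis_scaleR)

lemma pderiv3_bounded_linear:
 assumes "bounded_linear L" "f differentiable (at x)"
 shows "pderiv3 i (%x. L (f x)) x = L (pderiv3 i f x)"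
 by (rule trans[OF pderiv3_eqI[OF bounded_linear.has_derivative[OF assms(1) has_derivative_pderiv3[OF assms(2)]]]]) (simp add: sum_axis_scaleR)

lemma has_derivative_affine_arg:
 fixes f :: "real^3 => complex"
 assumes "f differentiable (at (a + s *\<^sub>R x))"
 shows "((%x. f (a + s *\<^sub>R x)) has_derivative
  (%h. \<Sum>i\<in>UNIV. (s *\<^sub>R h) $ i *\<^sub>R pderiv3 i f (a + s *\<^sub>R x))) (at x)"
proof -
 have "((%x. a + s *\<^sub>R x) has_derivative (%h. s *\<^sub>R h)) (at x)"
  by (auto intro!: derivative_eq_intros)
 from has_derivative_compose[OF this, of f, OF has_derivative_pderiv3[OF assms]] show ?thesis .
qed

lemma pderiv3_affine_arg:
 assumes "f differentiable (at (a + s *\<^sub>R x))"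
 shows "pderiv3 i (%x. f (a + s *\<^sub>R x)) x = of_real s * pderiv3 i f (a + s *\<^sub>R x)"
 by (rule trans[OF pderiv3_eqI[OF has_derivative_affine_arg[OF assms]]])
   (simp add: scaleR_sum_right[symmetric] sum_axis_scaleR flip: scaleR_scaleR, simp add: scaleR_conv_of_real)

section \<open>Closure properties of C^k and smooth functions\<close>

lemma Ck_const: "Ck k (%x. c)"
 by (induction k arbitrary: c) (auto simp: differentiable_on_def)

lemma Ck_add: "Ck k f ==> Ck k g ==> Ck k (%x. f x + g x)"
proof (induction k arbitrary: f g)
 case 0 then show ?case by (auto intro: continuous_intros)
next
 case (Suc k)
 have "pderiv3 i (%x. f x + g x) = (%x. pderiv3 i f x + pderiv3 i g x)" for i
  using Suc.prems Ck_differentiable by (intro ext pderiv3_add) blast+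
 with Suc show ?case by (auto simp: differentiable_on_def)
qed

lemma Ck_mult: "Ck k f ==> Ck k g ==> Ck k (%x. f x * g x)"
proof (induction k arbitrary: f g)
 case 0 then show ?case by (auto intro: continuous_intros)
next
 case (Suc k)
 have "pderiv3 i (%x. f x * g x) = (%x. f x * pderiv3 i g x + pderiv3 i f x * g x)" for i
  using Suc.prems Ck_differentiable by (intro ext pderiv3_mult) blast+
 moreover have "Ck k f" "Ck k g" using Suc.prems Ck_Suc_D by blast+
 ultimately show ?case using Suc by (auto simp: differentiable_on_def intro!: Ck_add)
qed

lemma Ck_diff: "Ck k f ==> Ck k g ==> Ck k (%x. f x - g x)"
 using Ck_add[of k f "%x. (- 1) * g x"] Ck_mult[of k "%_. - 1" g] Ck_const by simp

lemma Ck_prod: "(!!j. j \<in> J ==> Ck k (f j)) ==> Ck k (%x. \<Prod>j\<in>J. f j x)"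
 by (induction J rule: infinite_finite_induct) (auto intro: Ck_const Ck_mult)

lemma Ck_bounded_linear:
 assumes L: "bounded_linear L"
 shows "Ck k f ==> Ck k (%x. L (f x))"
proof (induction k arbitrary: f)
 case 0 then show ?case using bounded_linear.continuous_on[OF L] by auto
next
 case (Suc k)
 have "pderiv3 i (%x. L (f x)) = (%x. L (pderiv3 i f x))" for i
  using Suc.prems Ck_differentiable by (intro ext pderiv3_bounded_linear[OF L]) blast
 moreover have "(%x. L (f x)) differentiable_on UNIV"
  using bounded_linear.has_derivative[OF L has_derivative_pderiv3[OF Ck_differentiable[OF Suc.prems]]]
  unfolding differentiable_on_def differentiable_def by blast
 ultimately show ?case using Suc by auto
qed

lemma Ck_affine_arg: "Ck k f ==> Ck k (%x. f (a + s *\<^sub>R x))"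
proof (induction k arbitrary: f)
 case 0 then show ?case
  by (auto intro!: continuous_on_compose2[of UNIV f] continuous_intros)
next
 case (Suc k)
 have "pderiv3 i (%x. f (a + s *\<^sub>R x)) = (%x. of_real s * pderiv3 i f (a + s *\<^sub>R x))" for i
  using Suc.prems Ck_differentiable by (intro ext pderiv3_affine_arg) blast
 moreover have "(%x. f (a + s *\<^sub>R x)) differentiable_on UNIV"
  using has_derivative_affine_arg[OF Ck_differentiable[OF Suc.prems]]
  unfolding differentiable_on_def differentiable_def by blast
 ultimately show ?case using Suc by (auto intro!: Ck_mult Ck_const)
qed

lemma smooth_const: "smooth (%x. c)" by (simp add: smooth_def Ck_const)
lemma smooth_add: "smooth f ==> smooth g ==> smooth (%x. f x + g x)" by (simp add: smooth_def Ck_add)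
lemma smooth_diff: "smooth f ==> smooth g ==> smooth (%x. f x - g x)" by (simp add: smooth_def Ck_diff)
lemma smooth_mult: "smooth f ==> smooth g ==> smooth (%x. f x * g x)" by (simp add: smooth_def Ck_mult)
lemma smooth_prod: "(!!j. j \<in> J ==> smooth (f j)) ==> smooth (%x. \<Prod>j\<in>J. f j x)"
 by (simp add: smooth_def Ck_prod)
lemma smooth_cnj: "smooth f ==> smooth (%x. cnj (f x))"
 by (simp add: smooth_def Ck_bounded_linear bounded_linear_cnj)
lemma smooth_affine_arg: "smooth f ==> smooth (%x. f (a + s *\<^sub>R x))"
 by (simp add: smooth_def Ck_affine_arg)

text \<open>The power \<open>s ^ n\<close> is carried along because this family, with n varying, is
  closed under differentiation up to linear combinations. Smoothness then follows by induction on k,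
  for all n at once.\<close>

definition flat_exp :: "nat => real => real" where
 "flat_exp n s = (if s > 0 then exp (- (1 / s)) / s ^ n else 0)"

lemma flat_exp_nonneg: "flat_exp n s >= 0" by (simp add: flat_exp_def)

lemma has_derivative_flat_exp:
 "(flat_exp n has_real_derivative flat_exp (n + 2) s - n * flat_exp (n + 1) s) (at s)"
proof -
 consider "s > 0" | "s < 0" | "s = 0" by linarith
 then show ?thesis
 proof cases
  case 1
  have "((%s. exp (- (1 / s)) / s ^ n) has_real_derivative
    flat_exp (n + 2) s - n * flat_exp (n + 1) s) (at s)"
  proof (cases n)
   case 0
   show ?thesis using 1 unfolding 0
    by (auto intro!: derivative_eq_intros simp: flat_exp_def field_simps power2_eq_square)
  next
   case (Suc m)
   have "((%s. exp (- (1 / s))) has_real_derivative exp (- (1 / s)) / s\<^sup>2) (at s)"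
    using 1 by (auto intro!: derivative_eq_intros simp: field_simps power2_eq_square)
   from DERIV_divide[OF this DERIV_power_Suc[OF DERIV_ident, of m]]
   have "((%s. exp (- (1 / s)) / s ^ Suc m) has_real_derivative
     (exp (- (1 / s)) / s\<^sup>2 * s ^ Suc m - exp (- (1 / s)) * ((1 + real m) * s ^ m)) / (s ^ Suc m * s ^ Suc m)) (at s)"
    using 1 by simp
   moreover have "(exp (- (1 / s)) / s\<^sup>2 * s ^ Suc m - exp (- (1 / s)) * ((1 + real m) * s ^ m)) / (s ^ Suc m * s ^ Suc m)
     = flat_exp (n + 2) s - n * flat_exp (n + 1) s"
    using 1 by (simp add: Suc flat_exp_def field_simps power2_eq_square)
   ultimately show ?thesis by (simp only: Suc)
  qed
  then show ?thesis
   by (rule has_field_derivative_transform_within_open[of _ _ _ "{0<..}"])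
     (use 1 in \<open>auto simp: flat_exp_def\<close>)
 next
  case 2
  have "((%s. 0) has_real_derivative 0) (at s)" by simp
  then have "(flat_exp n has_real_derivative 0) (at s)"
   by (rule has_field_derivative_transform_within_open[of _ _ _ "{..<0}"])
     (use 2 in \<open>auto simp: flat_exp_def\<close>)
  with 2 show ?thesis by (simp add: flat_exp_def)
 next
  case 3
  have "((%h. (flat_exp n (0 + h) - flat_exp n 0) / h) \<longlongrightarrow> 0) (at_right 0)"
  proof -
   \<comment> \<open>From the right the difference quotient at 0 belongs to the same family, with n
     + 1, and the exponential beats every power; from the left it is 0.\<close>
   have "((%h::real. exp (- (1 / h)) / h ^ (n + 1)) \<longlongrightarrow> 0) (at_right 0)"
    by real_asymp
   then show ?thesis
    by (rule Lim_transform_eventually)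
      (auto simp: flat_exp_def eventually_at_filter)
  qed
  moreover have "((%h. (flat_exp n (0 + h) - flat_exp n 0) / h) \<longlongrightarrow> 0) (at_left 0)"
   by (rule Lim_transform_eventually[of "%_. 0"]) (auto simp: flat_exp_def eventually_at_filter)
  ultimately have "((%h. (flat_exp n (0 + h) - flat_exp n 0) / h) \<longlongrightarrow> 0) (at 0)"
   by (simp add: filterlim_split_at)
  then show ?thesis using 3 by (simp add: DERIV_def flat_exp_def)
 qed
qed

lemma has_derivative_flat_exp_coord:
 "((%x::real^3. complex_of_real (flat_exp n (a + s * x $ i))) has_derivative
   (%h. of_real (s * h $ i * (flat_exp (n + 2) (a + s * x $ i) - n * flat_exp (n + 1) (a + s * x $ i))))) (at x)"
proof -
 have "((%x::real^3. a + s * x $ i) has_derivative (%h. s * h $ i)) (at x)"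
  by (auto intro!: derivative_eq_intros bounded_linear.has_derivative[OF bounded_linear_vec_nth])
 from has_derivative_compose[OF this, of "flat_exp n" , OF has_derivative_flat_exp[unfolded has_field_derivative_def]]
 have "((%x. flat_exp n (a + s * x $ i)) has_derivative
   (%h. s * h $ i * (flat_exp (n + 2) (a + s * x $ i) - n * flat_exp (n + 1) (a + s * x $ i)))) (at x)"
  by (simp add: mult.commute)
 from bounded_linear.has_derivative[OF bounded_linear_of_real this] show ?thesis .
qed

lemma Ck_flat_exp: "Ck k (%x. complex_of_real (flat_exp n (a + s * x $ i)))"
proof (induction k arbitrary: n)
 case 0
 have "continuous (at x) (%x::real^3. complex_of_real (flat_exp n (a + s * x $ i)))" for x
  using has_derivative_continuous[OF has_derivative_flat_exp_coord] .
 then show ?case unfolding Ck.simps by (intro continuous_at_imp_continuous_on ballI)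
next
 case (Suc k)
 have "pderiv3 j (%x. complex_of_real (flat_exp n (a + s * x $ i))) =
   (%x. complex_of_real (s * axis j 1 $ i) * (complex_of_real (flat_exp (n + 2) (a + s * x $ i)) - of_nat n * complex_of_real (flat_exp (n + 1) (a + s * x $ i))))" for j
  by (rule ext, subst pderiv3_eqI[OF has_derivative_flat_exp_coord]) simp
 moreover have "Ck k (%x. complex_of_real (s * axis j 1 $ i) * (complex_of_real (flat_exp (n + 2) (a + s * x $ i)) - of_nat n * complex_of_real (flat_exp (n + 1) (a + s * x $ i))))" for j
  by (intro Ck_mult Ck_diff Suc.IH Ck_const)
 ultimately show ?case
  using has_derivative_flat_exp_coord[of n a s i]
  unfolding Ck.simps differentiable_on_def differentiable_def by fastforce
qed

section \<open>Mollification\<close>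

lemma integrable_compact_support:
 fixes f :: "'a::euclidean_space => 'b::{banach, second_countable_topology}"
 assumes "continuous_on UNIV f" "compact K" "!!x. x \<notin> K ==> f x = 0"
 shows "integrable lborel f"
proof -
 have "integrable lborel (%x. indicator K x *\<^sub>R f x)"
  using assms by (intro borel_integrable_compact) (auto intro: continuous_on_subset)
 moreover have "(%x. indicator K x *\<^sub>R f x) = f"
  using assms(3) by (auto simp: indicator_def fun_eq_iff)
 ultimately show ?thesis by simp
qed

lemma bounded_compact_support:
 fixes f :: "'a::euclidean_space => 'b::real_normed_vector"
 assumes "continuous_on UNIV f" "compact K" "!!x. x \<notin> K ==> f x = 0"
 obtains B where "B > 0" "!!x. norm (f x) <= B"
proof -
 have "bounded (f ` K)"
  using assms by (intro compact_imp_bounded compact_continuous_image) (auto intro: continuous_on_subset)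
 then obtain B where B: "B > 0" "!!x. x \<in> K ==> norm (f x) <= B" by (force simp: bounded_pos)
 moreover have "norm (f x) <= B" for x using B assms(3) by (cases "x \<in> K") auto
 ultimately show ?thesis using that by blast
qed

lemma uniform_continuity_compact_support:
 fixes f :: "'a::euclidean_space => 'b::real_normed_vector"
 assumes "continuous_on UNIV f" "compact K" "!!x. x \<notin> K ==> f x = 0" "e > 0"
 obtains d where "d > 0" "!!x y. norm (x - y) < d ==> norm (f x - f y) < e"
proof -
 obtain R where R: "!!x. x \<in> K ==> norm x <= R"
  using compact_imp_bounded[OF assms(2)] by (auto simp: bounded_iff)
 \<comment> \<open>With the margin 1, both points of a pair at distance below 1 lie in this ball as
   soon as one of them lies in K; if neither does, both values are 0.\<close>
 have "uniformly_continuous_on (cball 0 (R + 1)) f"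
  using assms by (intro compact_uniformly_continuous) (auto intro: continuous_on_subset)
 then obtain d where d: "d > 0" "!!x y. x \<in> cball 0 (R+1) ==> y \<in> cball 0 (R+1) ==> dist x y < d ==> dist (f x) (f y) < e"
  using assms(4) unfolding uniformly_continuous_on_def by metis
 have "norm (f x - f y) < e" if xy: "norm (x - y) < min d 1" for x y
 proof (cases "x \<in> K \<or> y \<in> K")
  case True
  have "norm x <= norm y + norm (x - y)" "norm y <= norm x + norm (x - y)"
   using norm_triangle_sub norm_triangle_sub[of y x] by (auto simp: norm_minus_commute add.commute)
  then have "norm x <= R + 1" "norm y <= R + 1" using R True xy by fastforce+
  with d(2)[of x y] xy show ?thesis by (auto simp: dist_norm)
 next
  case False then show ?thesis using assms(3,4) by simp
 qed
 with d(1) show ?thesis by (intro that[of "min d 1"]) auto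
qed

lemma pderiv3_zero_off_support:
 assumes "closed K" "!!x. x \<notin> K ==> f x = 0" "x \<notin> K"
 shows "pderiv3 i f x = 0"
proof -
 have "(f has_derivative (%_. 0)) (at x)"
  by (rule has_derivative_transform_within_open[of "%_. 0" _ _ _ "- K"]) (use assms in auto)
 then show ?thesis by (rule pderiv3_eqI)
qed

lemma norm_sum_scaleR_le:
 fixes h :: "real^3" and v :: "3 => 'a::real_normed_vector"
 shows "norm (\<Sum>i\<in>UNIV. h $ i *\<^sub>R v i) <= norm h * (\<Sum>i\<in>UNIV. norm (v i))"
proof -
 have "norm (\<Sum>i\<in>UNIV. h $ i *\<^sub>R v i) <= (\<Sum>i\<in>UNIV. norm h * norm (v i))"
  by (intro sum_norm_le) (auto simp: component_le_norm_cart mult_right_mono)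
 then show ?thesis by (simp add: sum_distrib_left)
qed


text \<open>The mean value inequality for f minus its linearization at z, combined with the modulus
  of continuity of the three partial derivatives. Compact support makes that modulus, and hence d,
  independent of z.\<close>

lemma uniform_differentiability_compact_support:
 assumes f: "Ck (Suc 0) f" and K: "compact K" "!!x. x \<notin> K ==> f x = 0" and e: "e > 0"
 obtains d where "d > 0"
  "!!z h. norm h < d ==> norm (f (z + h) - f z - (\<Sum>i\<in>UNIV. h $ i *\<^sub>R pderiv3 i f z)) <= e * norm h"
proof -
 have "\<exists>d>0. \<forall>x y. norm (x - y) < d --> norm (pderiv3 i f x - pderiv3 i f y) < e / 3" for i
 proof -
  have "continuous_on UNIV (pderiv3 i f)" using f by simp
  from uniform_continuity_compact_support[OF this K(1) pderiv3_zero_off_support[OF compact_imp_closed[OF K(1)] K(2)], of "e / 3"]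
  show ?thesis using e by (metis divide_pos_pos zero_less_numeral)
 qed
 then obtain d where d: "!!i. d i > 0" "!!i x y. norm (x - y) < d i ==> norm (pderiv3 i f x - pderiv3 i f y) < e / 3"
  by metis
 define d0 where "d0 = Min (range d)"
 have d0: "d0 > 0" "!!i. d0 <= d i" using d(1) by (auto simp: d0_def)
 have "norm (f (z + h) - f z - (\<Sum>i\<in>UNIV. h $ i *\<^sub>R pderiv3 i f z)) <= e * norm h" if h: "norm h < d0" for z h
 proof -
  let ?f' = "%x h. \<Sum>i\<in>UNIV. h $ i *\<^sub>R pderiv3 i f x"
  have "norm (f (z + h) - f z - ?f' z (z + h - z)) <= norm (z + h - z) * e"
  proof (rule differentiable_bound_linearization[where S = "ball z d0"])
   show "(f has_derivative ?f' x) (at x within ball z d0)" for x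
    using has_derivative_pderiv3[OF Ck_differentiable[OF f]] by (rule has_derivative_at_withinI)
   show "z + t *\<^sub>R (z + h - z) \<in> ball z d0" if t: "t \<in> {0..1}" for t
   proof -
    have "t * norm h <= 1 * norm h" using t by (intro mult_right_mono) auto
    with h t show ?thesis by (simp add: dist_norm)
   qed
   show "onorm (?f' x - ?f' z) <= e" if "x \<in> ball z d0" for x
   proof (rule onorm_le)
    fix v :: "real^3"
    have "(?f' x - ?f' z) v = (\<Sum>i\<in>UNIV. v $ i *\<^sub>R (pderiv3 i f x - pderiv3 i f z))"
     by (simp add: scaleR_diff_right sum_subtractf)
    also have "norm \<dots> <= norm v * (\<Sum>i\<in>UNIV. norm (pderiv3 i f x - pderiv3 i f z))"
     by (rule norm_sum_scaleR_le)
    also have "\<dots> <= norm v * (\<Sum>i\<in>(UNIV::3 set). e / 3)"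
    proof (intro mult_left_mono sum_mono)
     fix i :: 3
     have "norm (x - z) < d i" using that d0(2)[of i] by (simp add: dist_norm norm_minus_commute)
     from d(2)[OF this] show "norm (pderiv3 i f x - pderiv3 i f z) <= e / 3" by simp
    qed simp
    finally show "norm ((?f' x - ?f' z) v) <= e * norm v" by (simp add: mult.commute)
   qed
   show "z \<in> ball z d0" using d0 by simp
  qed
  then show ?thesis by (simp add: mult.commute)
 qed
 with d0(1) show ?thesis by (rule that)
qed

section \<open>Affine changes of variables\<close>

lemma nn_integral_lborel_affine:
 fixes f :: "'a::euclidean_space => ennreal"
 assumes [measurable]: "f \<in> borel_measurable borel" and c: "c ~= 0"
 shows "(NI x. f x) = ennreal (\<bar>c\<bar> ^ DIM('a)) * (NI x. f (t + c *\<^sub>R x))"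
 by (subst lborel_affine[OF c, of t])
   (simp add: nn_integral_density nn_integral_distr nn_integral_cmult)

lemma nn_integral_lborel_shift:
 fixes f :: "'a::euclidean_space => ennreal"
 assumes "f \<in> borel_measurable borel"
 shows "(NI x. f (x + t)) = (NI x. f x)"
 using nn_integral_lborel_affine[OF assms, of 1 t] by (simp add: add.commute)

lemma distr_lborel_reflect:
 fixes t :: "'a::euclidean_space"
 shows "distr lborel borel (%x. t - x) = lborel"
 using lborel_affine[of "-1" t] by (simp add: density_1)

lemma distr_lborel_shift:
 fixes t :: "'a::euclidean_space"
 shows "distr lborel borel (%x. x + t) = lborel"
 using lborel_affine[of "1" t] by (simp add: density_1 add.commute)

lemma integral_lborel_shift:
 fixes f :: "'a::euclidean_space => 'b::{banach, second_countable_topology}"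
 assumes "f \<in> borel_measurable borel"
 shows "(LI x. f (x + t)) = (LI x. f x)"
 using integral_distr[of "%x. x + t" lborel borel f] assms by (simp add: distr_lborel_shift)

lemma integrable_lborel_shift:
 fixes f :: "'a::euclidean_space => 'b::{banach, second_countable_topology}"
 assumes "integrable lborel f"
 shows "integrable lborel (%x. f (x + t))"
 using integrable_distr_eq[of "%x. x + t" lborel borel f] assms by (simp add: distr_lborel_shift)

lemma integral_lborel_reflect:
 fixes f :: "'a::euclidean_space => 'b::{banach, second_countable_topology}"
 assumes "f \<in> borel_measurable borel"
 shows "(LI x. f (t - x)) = (LI x. f x)"
 using integral_distr[of "%x. t - x" lborel borel f] assms by (simp add: distr_lborel_reflect)

lemma integrable_lborel_reflect:
 fixes f :: "'a::euclidean_space => 'b::{banach, second_countable_topology}"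
 assumes "integrable lborel f"
 shows "integrable lborel (%x. f (t - x))"
 using integrable_distr_eq[of "%x. t - x" lborel borel f] assms by (simp add: distr_lborel_reflect)

lemma integrable_bounded_mult:
 fixes F :: "'a::euclidean_space => complex"
 assumes F: "integrable lborel F" and g: "g \<in> borel_measurable borel" "!!x. norm (g x) <= B"
 shows "integrable lborel (%x. g x * F x)"
proof (rule Bochner_Integration.integrable_bound)
 show "integrable lborel (%x. B * norm (F x))" using F by simp
 show "(%x. g x * F x) \<in> borel_measurable lborel"
  using F g by measurable
 show "AE x in lborel. norm (g x * F x) <= norm (B * norm (F x))"
  using order_trans[OF g(2) abs_ge_self[of B]]
  by (auto simp: norm_mult abs_mult intro!: always_eventually mult_right_mono)
qed

lemma norm_integral_le:
 fixes f :: "'a => 'b::{banach, second_countable_topology}"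
 assumes "integrable M f" "integrable M g" "!!x. norm (f x) <= g x"
 shows "norm (\<integral>x. f x \<partial>M) <= (\<integral>x. g x \<partial>M)"
 using assms by (intro order_trans[OF integral_norm_bound integral_mono]) auto

section \<open>Convolution with a compactly supported kernel\<close>

definition conv :: "(real^3 => complex) => (real^3 => complex) => real^3 => complex" where
 "conv \<eta> F x = (LI y. \<eta> (x - y) * F y)"

locale compactly_supported =
 fixes \<eta> :: "real^3 => complex" and K
 assumes cont: "continuous_on UNIV \<eta>" and K: "compact K" and off: "!!x. x \<notin> K ==> \<eta> x = 0"
begin

lemma conv_integrable:
 assumes "integrable lborel F"
 shows "integrable lborel (%y. \<eta> (x - y) * F y)"
proof -
 obtain B where "!!x. norm (\<eta> x) <= B" using bounded_compact_support[OF cont K off] by metis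
 then show ?thesis using assms cont
  by (intro integrable_bounded_mult[where B = B]) (auto intro!: borel_measurable_continuous_onI
   continuous_on_compose2[OF cont] continuous_intros)
qed

lemma continuous_conv:
 assumes F: "integrable lborel F"
 shows "continuous_on UNIV (conv \<eta> F)"
 unfolding continuous_on_iff
proof (intro ballI allI impI)
 fix x and e :: real assume e: "e > 0"
 define I where "I = (LI y. norm (F y))"
 have I: "I >= 0" by (simp add: I_def)
 with e have "e / (I + 1) > 0" by simp
 then obtain d where d: "d > 0" "!!x y. norm (x - y) < d ==> norm (\<eta> x - \<eta> y) < e / (I + 1)"
  using uniform_continuity_compact_support[OF cont K off] by metis
 have "dist (conv \<eta> F x') (conv \<eta> F x) < e" if "dist x' x < d" for x'
 proof -
  have "conv \<eta> F x' - conv \<eta> F x = (LI y. \<eta> (x' - y) * F y - \<eta> (x - y) * F y)"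
   unfolding conv_def using conv_integrable[OF F] by simp
  also have "norm \<dots> <= (LI y. e / (I + 1) * norm (F y))"
  proof (rule norm_integral_le)
   fix y have "norm (\<eta> (x' - y) - \<eta> (x - y)) <= e / (I + 1)"
    using d(2)[of "x' - y" "x - y"] that by (simp add: dist_norm)
   then have "norm (\<eta> (x' - y) - \<eta> (x - y)) * norm (F y) <= e / (I + 1) * norm (F y)"
    by (intro mult_right_mono) auto
   then show "norm (\<eta> (x' - y) * F y - \<eta> (x - y) * F y) <= e / (I + 1) * norm (F y)"
    by (simp add: norm_mult flip: left_diff_distrib)
  qed (use conv_integrable[OF F] F in auto)
  also have "\<dots> = e * (I / (I + 1))" by (simp add: I_def)
  also have "\<dots> < e" using e I by (simp add: field_simps)
  finally show ?thesis by (simp add: dist_norm)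
 qed
 with d(1) show "\<exists>d>0. \<forall>x'\<in>UNIV. dist x' x < d --> dist (conv \<eta> F x') (conv \<eta> F x) < e" by auto
qed

lemma compactly_supported_pderiv3:
 assumes "Ck (Suc 0) \<eta>"
 shows "compactly_supported (pderiv3 i \<eta>) K"
 using assms K pderiv3_zero_off_support[OF compact_imp_closed[OF K] off]
 by unfold_locales auto

text \<open>The derivative falls on the kernel, so F only has to be integrable. The first-order
  remainder of \<eta> is small uniformly in z and can therefore be integrated against |F|.\<close>

lemma has_derivative_conv:
 assumes C: "Ck (Suc 0) \<eta>" and F: "integrable lborel F"
 shows "(conv \<eta> F has_derivative (%h. \<Sum>i\<in>UNIV. h $ i *\<^sub>R conv (pderiv3 i \<eta>) F x)) (at x)"
 unfolding has_derivative_at_alt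
proof (intro conjI allI impI)
 show "bounded_linear (%h. \<Sum>i\<in>UNIV. h $ i *\<^sub>R conv (pderiv3 i \<eta>) F x)"
  by (intro bounded_linear_sum bounded_linear_scaleR_const bounded_linear_vec_nth)
 fix e :: real assume e: "e > 0"
 define I where "I = (LI y. norm (F y))"
 have I: "I >= 0" by (simp add: I_def)
 with e have e': "e / (I + 1) > 0" by simp
 obtain d where d: "d > 0" "!!z h. norm h < d ==>
   norm (\<eta> (z + h) - \<eta> z - (\<Sum>i\<in>UNIV. h $ i *\<^sub>R pderiv3 i \<eta> z)) <= e / (I + 1) * norm h"
  using uniform_differentiability_compact_support[OF C K off e'] by metis
 have "norm (conv \<eta> F y - conv \<eta> F x - (\<Sum>i\<in>UNIV. (y - x) $ i *\<^sub>R conv (pderiv3 i \<eta>) F x)) <= e * norm (y - x)"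
  if y: "norm (y - x) < d" for y
 proof -
  define h where "h = y - x"
  note int = conv_integrable[OF F] compactly_supported.conv_integrable[OF compactly_supported_pderiv3[OF C] F]
  have "conv \<eta> F y - conv \<eta> F x - (\<Sum>i\<in>UNIV. h $ i *\<^sub>R conv (pderiv3 i \<eta>) F x)
    = (LI z. \<eta> (y - z) * F z - \<eta> (x - z) * F z - (\<Sum>i\<in>UNIV. h $ i *\<^sub>R (pderiv3 i \<eta> (x - z) * F z)))"
   unfolding conv_def using int by simp
  also have "norm \<dots> <= (LI z. (e / (I + 1) * norm h) * norm (F z))"
  proof (rule norm_integral_le)
   fix z
   have "\<eta> (y - z) * F z - \<eta> (x - z) * F z - (\<Sum>i\<in>UNIV. h $ i *\<^sub>R (pderiv3 i \<eta> (x - z) * F z))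
    = (\<eta> ((x - z) + h) - \<eta> (x - z) - (\<Sum>i\<in>UNIV. h $ i *\<^sub>R pderiv3 i \<eta> (x - z))) * F z"
    by (simp add: h_def algebra_simps sum_distrib_left)
   then show "norm (\<eta> (y - z) * F z - \<eta> (x - z) * F z - (\<Sum>i\<in>UNIV. h $ i *\<^sub>R (pderiv3 i \<eta> (x - z) * F z)))
     <= (e / (I + 1) * norm h) * norm (F z)"
    using d(2)[of h "x - z"] y by (simp only: norm_mult) (intro mult_right_mono, auto simp: h_def)
  qed (use int F in auto)
  also have "\<dots> = norm h * e * (I / (I + 1))" by (simp add: I_def)
  also have "\<dots> <= norm h * e" using e I by (intro mult_left_le) auto
  finally show ?thesis by (simp add: h_def mult.commute)
 qed
 with d(1) show "\<exists>d>0. \<forall>y. norm (y - x) < d -->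
   norm (conv \<eta> F y - conv \<eta> F x - (\<Sum>i\<in>UNIV. (y - x) $ i *\<^sub>R conv (pderiv3 i \<eta>) F x)) <= e * norm (y - x)"
  by blast
qed

lemma pderiv3_conv:
 assumes C: "Ck (Suc 0) \<eta>" and F: "integrable lborel F"
 shows "pderiv3 i (conv \<eta> F) = conv (pderiv3 i \<eta>) F"
 by (rule ext, rule trans[OF pderiv3_eqI[OF has_derivative_conv[OF assms]]]) (simp add: sum_axis_scaleR)

end

text \<open>The induction generalizes over the kernel, because each derivative replaces \<eta> by
  one of its partial derivatives, supported in the same K.\<close>

lemma Ck_conv:
 assumes "Ck k \<eta>" "compact K" "!!x. x \<notin> K ==> \<eta> x = 0" "integrable lborel F"
 shows "Ck k (conv \<eta> F)"
 using assms
proof (induction k arbitrary: \<eta>)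
 case 0
 then interpret compactly_supported \<eta> K by unfold_locales auto
 show ?case using continuous_conv 0 by simp
next
 case (Suc k)
 then interpret compactly_supported \<eta> K by unfold_locales (auto dest: Ck_continuous simp del: Ck.simps)
 have 1: "Ck (Suc 0) \<eta>" using Suc.prems(1) Ck_le by blast
 then show ?case
  using has_derivative_conv[OF 1 Suc.prems(4)] Suc compactly_supported.off[OF compactly_supported_pderiv3[OF 1]]
  by (simp add: pderiv3_conv[OF 1 Suc.prems(4)]) (auto simp: differentiable_on_def differentiable_def)
qed

lemma smooth_conv:
 assumes "smooth \<eta>" "compact K" "!!x. x \<notin> K ==> \<eta> x = 0" "integrable lborel F"
 shows "smooth (conv \<eta> F)"
 using assms unfolding smooth_def by (blast intro: Ck_conv)

text \<open>A predicate rather than the rescalings of one bump, so that estimates can be stated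
  uniformly over all mollifiers of small radius.\<close>

definition is_mollifier :: "real => (real^3 => real) => bool" where
 "is_mollifier \<epsilon> m \<longleftrightarrow> smooth (%x. complex_of_real (m x)) \<and> (\<forall>x. m x >= 0) \<and>
   (\<forall>x. norm x >= \<epsilon> --> m x = 0) \<and> (LI x. m x) = 1"

lemma mollifier_exists:
 assumes "\<epsilon> > 0"
 shows "\<exists>m. is_mollifier \<epsilon> m"
proof -
 \<comment> \<open>The factors confine each coordinate to |x_i| < \<epsilon>/3, so that the l^1
   norm, and with it the Euclidean norm, stays below \<epsilon>.\<close>
 define b :: "real^3 => real" where "b x = (\<Prod>i\<in>UNIV. flat_exp 0 (\<epsilon> / 3 + 1 * x $ i) * flat_exp 0 (\<epsilon> / 3 + (-1) * x $ i))" for x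
 have sm: "smooth (%x. complex_of_real (b x))"
  unfolding b_def of_real_prod of_real_mult
  by (intro smooth_prod smooth_mult) (simp_all only: smooth_def Ck_flat_exp simp_thms)
 have nn: "b x >= 0" for x by (auto simp: b_def intro!: prod_nonneg mult_nonneg_nonneg flat_exp_nonneg)
 have off: "b x = 0" if "norm x >= \<epsilon>" for x
 proof (rule ccontr)
  assume "b x ~= 0"
  then have "flat_exp 0 (\<epsilon> / 3 + 1 * x $ i) ~= 0 \<and> flat_exp 0 (\<epsilon> / 3 + (-1) * x $ i) ~= 0" for i
   by (auto simp: b_def)
  moreover have "flat_exp 0 t ~= 0 ==> t > 0" for t
   by (simp add: flat_exp_def split: if_splits)
  ultimately have pos: "\<epsilon> / 3 + 1 * x $ i > 0 \<and> \<epsilon> / 3 + (-1) * x $ i > 0" for i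
   by blast
  have "\<bar>x $ i\<bar> < \<epsilon> / 3" for i
   using pos[of i] by linarith
  then have "(\<Sum>i\<in>UNIV. \<bar>x $ i\<bar>) < (\<Sum>i\<in>(UNIV :: 3 set). \<epsilon> / 3)"
   by (intro sum_strict_mono) auto
  with norm_le_l1_cart[of x] that show False by simp
 qed
 have cont: "continuous_on UNIV b"
  using Ck_continuous[OF smooth_Ck[OF sm]] continuous_on_Re by fastforce
 have int: "integrable lborel b"
  using off by (intro integrable_compact_support[OF cont compact_cball[of 0 \<epsilon>]]) auto
 \<comment> \<open>A nonnegative b with integral 0 would vanish almost everywhere, and then
   everywhere since its zero set is closed; but \<open>b 0\<close> is positive.\<close>
 have "(LI x. b x) > 0"
 proof (rule ccontr)
  assume "\<not> (LI x. b x) > 0"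
  moreover have "(LI x. b x) >= 0" using nn by (intro integral_nonneg_AE) auto
  ultimately have "(LI x. b x) = 0" by linarith
  then have "AE x in lborel. b x = 0"
   using integral_nonneg_eq_0_iff_AE[OF int] nn by auto
  then have "AE x in lebesgue. x \<in> {x. b x = 0}"
   by (auto intro: AE_completion)
  moreover have "closed {x. b x = 0}"
   using cont by (intro closed_Collect_eq) auto
  ultimately have "0 \<in> {x. b x = 0}"
   by (intro mem_closed_if_AE_lebesgue)
  moreover have "b 0 > 0" using assms by (auto simp: b_def flat_exp_def intro!: prod_pos)
  ultimately show False by auto
 qed
 then have "is_mollifier \<epsilon> (%x. inverse (LI x. b x) * b x)"
  using nn off sm unfolding is_mollifier_def
  by (auto simp: smooth_mult smooth_const)
 then show ?thesis by blast
qed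

locale mollifier =
 fixes \<epsilon> :: real and m :: "real^3 => real"
 assumes mol: "is_mollifier \<epsilon> m"
begin

abbreviation "cm \<equiv> %x. complex_of_real (m x)"

lemma smooth_cm: "smooth cm" and nonneg: "m x >= 0" and integral_m: "(LI x. m x) = 1"
 and off_eps: "norm x >= \<epsilon> ==> m x = 0"
 using mol by (auto simp: is_mollifier_def)

sublocale compactly_supported cm "cball 0 \<epsilon>"
 using off_eps Ck_continuous[OF smooth_Ck[OF smooth_cm]] by unfold_locales auto

lemma Ck_cm: "Ck k cm" by (rule smooth_Ck[OF smooth_cm])

lemma continuous_m: "continuous_on UNIV m"
 using cont continuous_on_Re by fastforce

lemma borel_m [measurable]: "m \<in> borel_measurable borel"
 by (rule borel_measurable_continuous_onI[OF continuous_m])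

lemma integrable_m: "integrable lborel m"
 using off_eps by (intro integrable_compact_support[OF continuous_m compact_cball[of 0 \<epsilon>]]) auto

lemma integral_m_reflect: "(LI y. m (x - y)) = 1"
 using integral_lborel_reflect[of m x] integral_m by simp

lemma integrable_m_reflect: "integrable lborel (%y. m (x - y))"
 by (rule integrable_lborel_reflect[OF integrable_m])

lemma smooth_conv_cm: "integrable lborel F ==> smooth (conv cm F)"
 by (rule smooth_conv[OF smooth_cm K off])

lemma norm_weighted_integral_le:
 assumes H: "integrable lborel (%y. cm (x - y) * H y)"
  and le: "!!y. norm (x - y) < \<epsilon> ==> norm (H y) <= e"
 shows "norm (LI y. cm (x - y) * H y) <= e"
proof -
 have "norm (LI y. cm (x - y) * H y) <= (LI y. m (x - y) * e)"
 proof (rule norm_integral_le[OF H])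
  fix y show "norm (cm (x - y) * H y) <= m (x - y) * e"
   using le[of y] off_eps[of "x - y"] nonneg[of "x - y"]
   by (cases "norm (x - y) < \<epsilon>") (auto simp: norm_mult mult_left_mono)
 qed (use integrable_m_reflect in auto)
 then show ?thesis using integral_m_reflect by simp
qed

lemma conv_close:
 assumes F: "integrable lborel F" and le: "!!y. norm (x - y) < \<epsilon> ==> norm (F y - c) <= e"
 shows "norm (conv cm F x - c) <= e"
proof -
 have i1: "integrable lborel (%y. cm (x - y) * c)"
  using integrable_m_reflect[of x] by simp
 have "(LI y. cm (x - y) * c) = c" using integral_m_reflect[of x] by simp
 then have "conv cm F x - c = (LI y. cm (x - y) * F y - cm (x - y) * c)"
  unfolding conv_def using Bochner_Integration.integral_diff[OF conv_integrable[OF F] i1] by metis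
 also have "\<dots> = (LI y. cm (x - y) * (F y - c))" by (simp add: algebra_simps)
 also have "norm \<dots> <= e"
  using conv_integrable[OF F, of x] i1 le by (intro norm_weighted_integral_le) (auto simp: right_diff_distrib)
 finally show ?thesis .
qed

text \<open>Stated through difference quotients of F, so that it covers a C^1 function, with c its
  derivative at x, and also a function that is only Lipschitz, with c = 0. The arbitrary e' absorbs
  the gap between the derivative of the mollification and its difference quotient at step s.\<close>

lemma pderiv3_conv_close:
 assumes F: "integrable lborel F" and d: "d > 0"
  and le: "!!y s. norm (x - y) < \<epsilon> ==> \<bar>s\<bar> < d ==> norm (F (y + s *\<^sub>R axis i 1) - F y - of_real s * c) <= e * \<bar>s\<bar>"
 shows "norm (pderiv3 i (conv cm F) x - c) <= e"
proof (rule field_le_epsilon)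
 fix e' :: real assume e': "e' > 0"
 let ?D = "%h. \<Sum>i\<in>UNIV. h $ i *\<^sub>R pderiv3 i (conv cm F) x"
 have "(conv cm F has_derivative ?D) (at x)"
  by (rule has_derivative_pderiv3[OF smooth_differentiable[OF smooth_conv_cm[OF F]]])
 then obtain d' where d': "d' > 0" "!!y. norm (y - x) < d' ==> norm (conv cm F y - conv cm F x - ?D (y - x)) <= e' * norm (y - x)"
  using e' unfolding has_derivative_at_alt by blast
 define s where "s = min d d' / 2"
 have s: "s > 0" "s < d" "s < d'" using d d'(1) by (auto simp: s_def)
 define v :: "real^3" where "v = s *\<^sub>R axis i 1"
 have "?D v = s *\<^sub>R (\<Sum>j\<in>UNIV. axis i 1 $ j *\<^sub>R pderiv3 j (conv cm F) x)"
  by (simp add: v_def scaleR_sum_right)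
 then have Dv: "?D v = of_real s * pderiv3 i (conv cm F) x"
  unfolding sum_axis_scaleR by (simp only: scaleR_conv_of_real)
 have "norm (x + v - x) < d'" using s by (simp add: v_def norm_axis_1)
 from d'(2)[OF this] have 1: "norm (conv cm F (x + v) - conv cm F x - of_real s * pderiv3 i (conv cm F) x) <= e' * s"
  using s Dv by (simp add: v_def norm_axis_1)
 have Fv: "integrable lborel (%y. F (y + v))" by (rule integrable_lborel_shift[OF F])
 have [measurable]: "F \<in> borel_measurable borel" using F by auto
 have "conv cm F (x + v) = (LI y. cm (x + v - (y + v)) * F (y + v))"
  unfolding conv_def by (rule integral_lborel_shift[symmetric]) measurable
 then have sh: "conv cm F (x + v) = (LI y. cm (x - y) * F (y + v))" by simp
 have i1: "integrable lborel (%y. cm (x - y) * (of_real s * c))"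
  using integrable_m_reflect[of x] by simp
 have "(LI y. cm (x - y) * (of_real s * c)) = of_real s * c" using integral_m_reflect[of x] by simp
 then have "conv cm F (x + v) - conv cm F x - of_real s * c =
  (LI y. cm (x - y) * F (y + v) - cm (x - y) * F y - cm (x - y) * (of_real s * c))"
  using conv_integrable[OF F] conv_integrable[OF Fv] i1 by (simp add: sh) (simp add: conv_def)
 also have "\<dots> = (LI y. cm (x - y) * (F (y + v) - F y - of_real s * c))"
  by (simp add: algebra_simps)
 also have "norm \<dots> <= e * s"
 proof (rule norm_weighted_integral_le)
  show "integrable lborel (%y. cm (x - y) * (F (y + v) - F y - of_real s * c))"
   using conv_integrable[OF F, of x] conv_integrable[OF Fv, of x] i1 by (simp add: right_diff_distrib)
  show "norm (F (y + v) - F y - of_real s * c) <= e * s" if "norm (x - y) < \<epsilon>" for y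
   using le[OF that, of s] s by (simp add: v_def)
 qed
 finally have 2: "norm (conv cm F (x + v) - conv cm F x - of_real s * c) <= e * s" .
 have "s * norm (pderiv3 i (conv cm F) x - c) = norm (of_real s * (pderiv3 i (conv cm F) x - c))"
  using s by (simp add: norm_mult)
 also have "of_real s * (pderiv3 i (conv cm F) x - c) = (conv cm F (x + v) - conv cm F x - of_real s * c)
   - (conv cm F (x + v) - conv cm F x - of_real s * pderiv3 i (conv cm F) x)"
  by (simp add: algebra_simps)
 also have "norm \<dots> <= e * s + e' * s" using norm_triangle_ineq4 1 2 by (meson add_mono order_trans)
 finally have "s * norm (pderiv3 i (conv cm F) x - c) <= s * (e + e')" by (simp add: algebra_simps)
 then show "norm (pderiv3 i (conv cm F) x - c) <= e + e'" using s by simp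
qed

lemma conv_eq_0:
 assumes "!!y. norm (x - y) < \<epsilon> ==> F y = 0"
 shows "conv cm F x = 0"
proof -
 have "cm (x - y) * F y = 0" for y
  using assms[of y] off_eps[of "x - y"] by (cases "norm (x - y) < \<epsilon>") auto
 then have "(%y. cm (x - y) * F y) = (%_. 0)" by blast
 then show ?thesis unfolding conv_def by simp
qed

text \<open>Tonelli, with the integral of m(x - y) over x equal to 1.\<close>

lemma nn_integral_norm_conv_le:
 assumes F: "integrable lborel F"
 shows "(NI x. norm (conv cm F x)) <= (NI x. norm (F x))"
proof -
 have [measurable]: "F \<in> borel_measurable borel" using F by auto
 have "(NI x. norm (conv cm F x)) <= (NI x. (NI y. ennreal (m (x - y)) * norm (F y)))"
 proof (rule nn_integral_mono)
  fix x
  have "ennreal (norm (conv cm F x)) <= (NI y. norm (cm (x - y) * F y))"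
   unfolding conv_def by (rule integral_norm_bound_ennreal[OF conv_integrable[OF F]])
  then show "ennreal (norm (conv cm F x)) <= (NI y. ennreal (m (x - y)) * norm (F y))"
   using nonneg by (simp add: norm_mult ennreal_mult)
 qed
 also have "\<dots> = (NI y. (NI x. ennreal (m (x - y)) * norm (F y)))"
  by (rule lborel_pair.Fubini') measurable
 also have "\<dots> = (NI y. (NI x. ennreal (m x)) * norm (F y))"
  using nn_integral_lborel_shift[of "%x. ennreal (m x)" "- _"]
  by (simp add: nn_integral_multc)
 also have "(NI x. ennreal (m x)) = 1"
  using nn_integral_eq_integral[OF integrable_m] nonneg integral_m by simp
 finally show ?thesis by simp
qed

end

text \<open>Density of compactly supported continuous functions in L^1, by induction over integrable
  functions. For an indicator, a Urysohn function interpolates between a closed subset and an open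
  superset that differ from the set by little measure. Truncation to the ball keeps all supports in
  one compact set throughout the induction.\<close>

lemma integrable_approx_continuous:
 fixes F :: "real^3 => complex"
 assumes "integrable lborel F" "\<delta> > 0" "R > 0"
 shows "\<exists>g. continuous_on UNIV g \<and> (\<forall>x. norm x > R --> g x = 0) \<and>
  (LI x. norm (indicator (ball 0 R) x *\<^sub>R F x - g x)) <= \<delta>"
 using assms
proof (induction F arbitrary: \<delta> rule: integrable_induct)
 case (base A c)
 define A' where "A' = A \<inter> ball 0 R"
 have A': "A' \<in> sets borel" "A' \<in> sets lebesgue" using base by (auto simp: A'_def)
 \<comment> \<open>Chosen so that \<open>norm c * (2 * e)\<close> stays at most \<delta>; the
   summand 1 covers c = 0.\<close>
 define d where "d = \<delta> / (1 + norm c)"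
 define e where "e = d / 2"
 have e: "e > 0" using base by (auto simp: e_def d_def add_pos_nonneg)
 obtain T where T: "closed T" "T \<subseteq> A'" "A' - T \<in> lmeasurable" "emeasure lebesgue (A' - T) < ennreal e"
  using sets_lebesgue_inner_closed[OF A'(2) e] by metis
 obtain U where U: "open U" "A' \<subseteq> U" "U - A' \<in> lmeasurable" "emeasure lebesgue (U - A') < ennreal e"
  using sets_lebesgue_outer_open[OF A'(2) e] by metis
 define V where "V = U \<inter> ball 0 R"
 have V: "open V" "A' \<subseteq> V" using U by (auto simp: V_def A'_def)
 obtain g :: "real^3 => real" where g: "continuous_on UNIV g" "!!x. g x \<in> closed_segment 1 0"
  "!!x. x \<in> T ==> g x = 1" "!!x. x \<in> - V ==> g x = 0"
 proof (rule Urysohn[of T "- V" "1::real" 0])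
  show "T \<inter> - V = {}" using T V by blast
 qed (use T V in auto)
 have g01: "0 <= g x" "g x <= 1" for x using g(2)[of x] by (auto simp: closed_segment_eq_real_ivl)
 have gint: "integrable lborel g" using g(4)
  by (intro integrable_compact_support[OF g(1) compact_cball[of 0 R]]) (auto simp: V_def)
 have em: "emeasure lborel (V - T) < ennreal (2 * e)"
 proof -
  have "emeasure lborel (V - T) = emeasure lebesgue (V - T)" using V T by simp
  also have "\<dots> <= emeasure lebesgue ((A' - T) \<union> (U - A'))"
   using T U A' by (intro emeasure_mono) (auto simp: V_def)
  also have "\<dots> <= emeasure lebesgue (A' - T) + emeasure lebesgue (U - A')"
   using T U A' by (intro emeasure_subadditive) auto
  also have "\<dots> < ennreal e + ennreal e" using T(4) U(4) by (rule add_strict_mono)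
  finally show ?thesis using e by (simp flip: ennreal_plus)
 qed
 have "(LI x. norm (indicator A' x *\<^sub>R c - g x *\<^sub>R c)) <= (LI x. norm c * indicator (V - T) x)"
 proof (rule integral_mono)
  show "integrable lborel (%x. norm c * indicator (V - T) x)"
   using less_trans[OF em ennreal_less_top] V T
   by (intro integrable_mult_right integrable_real_indicator) simp_all
  show "integrable lborel (%x. norm (indicator A' x *\<^sub>R c - g x *\<^sub>R c))"
   using gint A' V em base by (intro integrable_norm Bochner_Integration.integrable_diff integrable_scaleR_left)
    (auto simp: A'_def intro!: integrable_real_indicator le_less_trans[OF emeasure_mono, of "A \<inter> ball 0 R" A])
  fix x
  have "norm (indicator A' x *\<^sub>R c - g x *\<^sub>R c) = \<bar>indicator A' x - g x\<bar> * norm c"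
   by (simp flip: scaleR_diff_left)
  also have "\<bar>indicator A' x - g x\<bar> <= indicator (V - T) x"
   using g01[of x] g(3,4)[of x] T(2) V(2) by (auto simp: indicator_def)
  finally show "norm (indicator A' x *\<^sub>R c - g x *\<^sub>R c) <= norm c * indicator (V - T) x"
   by (simp add: mult.commute mult_right_mono)
 qed
 also have "\<dots> = norm c * measure lborel (V - T)" using V T by simp
 also have "\<dots> <= norm c * (2 * e)"
 proof (rule mult_left_mono)
  have "ennreal (measure lborel (V - T)) <= ennreal (2 * e)"
   using em by (subst emeasure_eq_ennreal_measure[symmetric]) (auto simp: top_unique)
  then show "measure lborel (V - T) <= 2 * e" using e by simp
 qed simp
 also have "\<dots> = \<delta> * (norm c / (1 + norm c))" by (simp add: e_def) (simp add: d_def)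
 also have "\<dots> <= \<delta>" using base by (intro mult_left_le) (auto simp: divide_le_eq add_pos_nonneg)
 finally have "(LI x. norm (indicator A' x *\<^sub>R c - g x *\<^sub>R c)) <= \<delta>" .
 moreover have "indicator (ball 0 R) x *\<^sub>R indicator A x *\<^sub>R c = indicator A' x *\<^sub>R c" for x
  by (auto simp: A'_def indicator_def)
 ultimately have "(LI x. norm (indicator (ball 0 R) x *\<^sub>R indicator A x *\<^sub>R c - g x *\<^sub>R c)) <= \<delta>"
  by (simp only:)
 moreover have "continuous_on UNIV (%x. g x *\<^sub>R c)" using g(1) by (intro continuous_intros)
 moreover have "g x *\<^sub>R c = 0" if "norm x > R" for x
 proof -
  have "x \<in> - V" using that by (simp add: V_def)
  then show ?thesis using g(4) by simp
 qed
 ultimately show ?case by blast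
next
 case (add f h)
 have "\<delta> / 2 > 0" using add by simp
 note d = this
 obtain g1 where g1: "continuous_on UNIV g1" "\<forall>x. norm x > R --> g1 x = 0" "(LI x. norm (indicator (ball 0 R) x *\<^sub>R f x - g1 x)) <= \<delta> / 2"
  using add(3)[OF d add.prems(2)] by blast
 obtain g2 where g2: "continuous_on UNIV g2" "\<forall>x. norm x > R --> g2 x = 0" "(LI x. norm (indicator (ball 0 R) x *\<^sub>R h x - g2 x)) <= \<delta> / 2"
  using add(4)[OF d add.prems(2)] by blast
 note g = g1 g2
 have gi: "integrable lborel g1" "integrable lborel g2"
  by (intro integrable_compact_support[OF g(1) compact_cball[of 0 R]] integrable_compact_support[OF g(4) compact_cball[of 0 R]]; use g in force)+
 have fi: "integrable lborel (%x. indicator (ball 0 R) x *\<^sub>R f x)" "integrable lborel (%x. indicator (ball 0 R) x *\<^sub>R h x)"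
  using add by (auto intro!: integrable_mult_indicator)
 have "(LI x. norm (indicator (ball 0 R) x *\<^sub>R (f x + h x) - (g1 x + g2 x)))
   <= (LI x. norm (indicator (ball 0 R) x *\<^sub>R f x - g1 x) + norm (indicator (ball 0 R) x *\<^sub>R h x - g2 x))"
  using gi fi by (intro integral_mono) (auto simp: scaleR_add_right add_diff_add intro: norm_triangle_ineq)
 also have "\<dots> <= \<delta>" using gi fi g by simp
 finally show ?case using g by (intro exI[of _ "%x. g1 x + g2 x"]) (auto intro: continuous_intros)
next
 case (lim f s)
 let ?i = "%x. indicator (ball 0 R) x :: real"
 have fi: "integrable lborel (%x. ?i x *\<^sub>R f x)" "!!i. integrable lborel (%x. ?i x *\<^sub>R s i x)"
  using lim by (auto intro!: integrable_mult_indicator)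
 have "(%i. LI x. norm (?i x *\<^sub>R f x - ?i x *\<^sub>R s i x)) \<longlonglongrightarrow> (\<integral>x. norm (0::complex) \<partial>(lborel :: (real^3) measure))"
 proof (rule integral_dominated_convergence[where w = "%x. 3 * norm (f x)"])
  show "integrable lborel (%x. 3 * norm (f x))" using lim by simp
  show "AE x in lborel. (%i. norm (?i x *\<^sub>R f x - ?i x *\<^sub>R s i x)) \<longlonglongrightarrow> norm (0::complex)"
  proof (intro always_eventually allI)
   fix x
   have "(%i. ?i x *\<^sub>R f x - ?i x *\<^sub>R s i x) \<longlonglongrightarrow> ?i x *\<^sub>R f x - ?i x *\<^sub>R f x"
    using lim(2)[of x] by (intro tendsto_intros) auto
   then show "(%i. norm (?i x *\<^sub>R f x - ?i x *\<^sub>R s i x)) \<longlonglongrightarrow> norm (0::complex)"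
    by (intro tendsto_norm) simp
  qed
  fix i show "AE x in lborel. norm (norm (?i x *\<^sub>R f x - ?i x *\<^sub>R s i x)) <= 3 * norm (f x)"
  proof (intro always_eventually allI)
   fix x
   have "norm (f x - s i x) <= norm (f x) + norm (s i x)" by (rule norm_triangle_ineq4)
   also have "\<dots> <= 3 * norm (f x)" using lim(3)[of x i] by simp
   finally show "norm (norm (?i x *\<^sub>R f x - ?i x *\<^sub>R s i x)) <= 3 * norm (f x)"
    by (auto simp: indicator_def)
  qed
 qed (use fi in \<open>auto intro!: borel_measurable_norm borel_measurable_diff\<close>)
 then have "(%i. LI x. norm (?i x *\<^sub>R f x - ?i x *\<^sub>R s i x)) \<longlonglongrightarrow> 0" by simp
 then have "\<forall>\<^sub>F i in sequentially. (LI x. norm (?i x *\<^sub>R f x - ?i x *\<^sub>R s i x)) < \<delta> / 2"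
  using lim.prems by (intro order_tendstoD) auto
 then obtain i where i: "(LI x. norm (?i x *\<^sub>R f x - ?i x *\<^sub>R s i x)) < \<delta> / 2"
  by (auto simp: eventually_sequentially)
 have "\<delta> / 2 > 0" using lim by simp
 from lim.IH[OF this lim.prems(2)] obtain g where g: "continuous_on UNIV g" "\<forall>x. norm x > R --> g x = 0"
   "(LI x. norm (?i x *\<^sub>R s i x - g x)) <= \<delta> / 2" by blast
 have gi: "integrable lborel g"
  by (intro integrable_compact_support[OF g(1) compact_cball[of 0 R]]) (use g in force)
 have "(LI x. norm (?i x *\<^sub>R f x - g x))
   <= (LI x. norm (?i x *\<^sub>R f x - ?i x *\<^sub>R s i x) + norm (?i x *\<^sub>R s i x - g x))"
 proof (rule integral_mono)
  fix x
  have tri: "norm (a - c) <= norm (a - b) + norm (b - c)" for a b c :: complex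
   using norm_triangle_ineq[of "a - b" "b - c"] by simp
  show "norm (?i x *\<^sub>R f x - g x) <= norm (?i x *\<^sub>R f x - ?i x *\<^sub>R s i x) + norm (?i x *\<^sub>R s i x - g x)"
   by (rule tri)
 qed (use gi fi in auto)
 also have "\<dots> <= \<delta>" using gi fi g i by simp
 finally show ?case using g by blast
qed


lemma conv_diff:
 assumes "compactly_supported \<eta> K" "integrable lborel F" "integrable lborel G"
 shows "conv \<eta> (%x. F x - G x) x = conv \<eta> F x - conv \<eta> G x"
proof -
 interpret compactly_supported \<eta> K by fact
 show ?thesis
  unfolding conv_def using conv_integrable[OF assms(2), of x] conv_integrable[OF assms(3), of x]
  by (simp add: right_diff_distrib)
qed

text \<open>Splitting through a continuous g of compact support: mollification does not increase the
  L^1 norm of F - g, and it moves g uniformly little on a bounded set. The threshold serves all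
  mollifiers of smaller radius, so one radius can later be shared by the three components of a
  field.\<close>

lemma conv_L1_approx:
 assumes F: "integrable lborel F" and R: "!!x. norm x >= R ==> F x = 0" and \<delta>: "\<delta> > 0"
 shows "\<exists>\<epsilon>0>0. \<forall>\<epsilon> m. \<epsilon> <= \<epsilon>0 --> is_mollifier \<epsilon> m -->
  (NI x. norm (conv (%x. complex_of_real (m x)) F x - F x)) <= ennreal \<delta>"
proof -
 define R' where "R' = max R 1"
 have R': "R' > 0" "!!x. norm x >= R' ==> F x = 0" using R by (auto simp: R'_def)
 have [measurable]: "F \<in> borel_measurable borel" using F by auto
 have "\<delta> / 3 > 0" using \<delta> by simp
 then obtain g where g: "continuous_on UNIV g" "!!x. norm x > R' ==> g x = 0"
  "(LI x. norm (indicator (ball 0 R') x *\<^sub>R F x - g x)) <= \<delta> / 3"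
  using integrable_approx_continuous[OF F _ R'(1)] by blast
 have gi: "integrable lborel g"
  using g(2) by (intro integrable_compact_support[OF g(1) compact_cball[of 0 R']]) auto
 have [measurable]: "g \<in> borel_measurable borel" using gi by auto
 have "indicator (ball 0 R') x *\<^sub>R F x = F x" for x using R'(2)[of x] by (auto simp: indicator_def)
 with g(3) have g3: "(LI x. norm (F x - g x)) <= \<delta> / 3" by simp
 have g4: "(NI x. norm (F x - g x)) <= ennreal (\<delta> / 3)"
  using F gi g3 by (subst nn_integral_eq_integral) (auto intro: ennreal_leI)
 define vol where "vol = measure lborel (cball (0::real^3) (R' + 1))"
 have vol: "vol >= 0" by (simp add: vol_def)
 have emb: "emeasure lborel (cball (0::real^3) (R' + 1)) = ennreal vol"
  unfolding vol_def using emeasure_lborel_cball_finite[of "0::real^3" "R' + 1"]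
  by (intro emeasure_eq_ennreal_measure) auto
 define e where "e = (\<delta> / 3) / (vol + 1)"
 have e: "e > 0" using \<delta> vol by (simp add: e_def)
 have goff: "x \<notin> cball 0 R' ==> g x = 0" for x using g(2) by simp
 obtain d where d: "d > 0" "!!x y. norm (x - y) < d ==> norm (g x - g y) < e"
  using uniform_continuity_compact_support[OF g(1) compact_cball goff e] by metis
 show ?thesis
 proof (intro exI[of _ "min d 1"] conjI allI impI)
  show "min d 1 > 0" using d by simp
  fix \<epsilon> m assume eps: "\<epsilon> <= min d 1" and m: "is_mollifier \<epsilon> m"
  interpret mollifier \<epsilon> m by unfold_locales fact
  have cont': "continuous_on UNIV (conv cm G)" if "integrable lborel G" for G
   by (rule continuous_conv[OF that])
  have [measurable]: "conv cm g \<in> borel_measurable borel" "conv cm F \<in> borel_measurable borel"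
   "conv cm (%x. F x - g x) \<in> borel_measurable borel"
   using cont' F gi by (auto intro!: borel_measurable_continuous_onI)
  have cg: "norm (conv cm g x - g x) <= e * indicator (cball 0 (R' + 1)) x" for x
  proof (cases "norm x <= R' + 1")
   case True
   have "norm (conv cm g x - g x) <= e"
   proof (rule conv_close[OF gi])
    fix y assume "norm (x - y) < \<epsilon>"
    with eps have "norm (y - x) < d" by (simp add: norm_minus_commute)
    from d(2)[OF this] show "norm (g y - g x) <= e" by simp
   qed
   with True show ?thesis by simp
  next
   case False
   have "g y = 0" if "norm (x - y) < \<epsilon>" for y
    using g(2)[of y] that False eps norm_triangle_sub[of x y] by auto
   then have "conv cm g x = 0" by (rule conv_eq_0)
   with False g(2)[of x] show ?thesis by simp
  qed
  have "(NI x. norm (conv cm F x - F x)) <=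
    (NI x. (ennreal (norm (conv cm (%x. F x - g x) x)) + ennreal e * indicator (cball 0 (R' + 1)) x) + ennreal (norm (F x - g x)))"
  proof (rule nn_integral_mono)
   fix x
   have "conv cm F x - F x = conv cm (%x. F x - g x) x + (conv cm g x - g x) - (F x - g x)"
    by (simp add: conv_diff[OF compactly_supported_axioms F gi])
   then have "norm (conv cm F x - F x) <= norm (conv cm (%x. F x - g x) x) + norm (conv cm g x - g x) + norm (F x - g x)"
    using norm_triangle_ineq norm_triangle_ineq4 by (smt (verit))
   also have "\<dots> <= norm (conv cm (%x. F x - g x) x) + e * indicator (cball 0 (R' + 1)) x + norm (F x - g x)"
    using cg[of x] by simp
   finally have "ennreal (norm (conv cm F x - F x)) <= ennreal (norm (conv cm (%x. F x - g x) x) + e * indicator (cball 0 (R' + 1)) x + norm (F x - g x))"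
    by (rule ennreal_leI)
   then show "ennreal (norm (conv cm F x - F x)) <= (ennreal (norm (conv cm (%x. F x - g x) x)) + ennreal e * indicator (cball 0 (R' + 1)) x) + ennreal (norm (F x - g x))"
    using e by (simp add: ennreal_plus ennreal_mult ennreal_indicator)
  qed
  also have "\<dots> = (NI x. norm (conv cm (%x. F x - g x) x)) + ennreal e * ennreal vol + (NI x. norm (F x - g x))"
  proof -
   have m1: "(%x. ennreal (norm (conv cm (%x. F x - g x) x))) \<in> borel_measurable lborel" by simp
   have m2: "(%x. ennreal e * indicator (cball (0::real^3) (R' + 1)) x) \<in> borel_measurable lborel"
    by (intro borel_measurable_times_ennreal borel_measurable_const borel_measurable_indicator) simp
   have m3: "(%x. ennreal (norm (F x - g x))) \<in> borel_measurable lborel" by simp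
   show ?thesis
    unfolding nn_integral_add[OF borel_measurable_add[OF m1 m2] m3] nn_integral_add[OF m1 m2]
    by (simp add: nn_integral_cmult_indicator emb)
  qed
  also have "\<dots> <= (NI x. norm (F x - g x)) + ennreal e * ennreal vol + (NI x. norm (F x - g x))"
   using nn_integral_norm_conv_le[of "%x. F x - g x"] F gi by (intro add_right_mono) auto
  also have "\<dots> <= ennreal (\<delta> / 3) + ennreal (\<delta> / 3) + ennreal (\<delta> / 3)"
  proof (intro add_mono g4)
   have "e * vol = \<delta> / 3 * (vol / (vol + 1))" by (simp add: e_def)
   also have "\<dots> <= \<delta> / 3" using \<delta> vol by (intro mult_left_le) auto
   finally have "ennreal (e * vol) <= ennreal (\<delta> / 3)" by (rule ennreal_leI)
   then show "ennreal e * ennreal vol <= ennreal (\<delta> / 3)"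
    using e vol by (simp add: ennreal_mult)
  qed
  also have "\<dots> = ennreal \<delta>" using \<delta> by (simp flip: ennreal_plus)
  finally show "(NI x. norm (conv cm F x - F x)) <= ennreal \<delta>" .
 qed
qed

text \<open>Translation invariance: f(x + v) - f(x) integrates to 0, and it differs from s times the
  partial derivative by at most s times a small constant on a fixed ball. Division by s leaves an
  arbitrarily small bound.\<close>

lemma integral_pderiv3_eq_0:
 assumes f: "Ck (Suc 0) f" and K: "compact K" "!!x. x \<notin> K ==> f x = 0"
 shows "(LI x. pderiv3 i f x) = 0"
proof -
 obtain R where R: "R > 0" "!!x. x \<in> K ==> norm x <= R"
  using compact_imp_bounded[OF K(1)] by (auto simp: bounded_pos)
 define vol where "vol = measure lborel (cball (0::real^3) (R + 1))"
 have vol: "vol >= 0" by (simp add: vol_def)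
 have cf: "continuous_on UNIV f" using f Ck_continuous by blast
 have fi: "integrable lborel f" by (rule integrable_compact_support[OF cf K])
 have di: "integrable lborel (pderiv3 i f)"
  using f by (intro integrable_compact_support[OF _ K(1) pderiv3_zero_off_support[OF compact_imp_closed[OF K(1)] K(2)]]) auto
 have "norm (LI x. pderiv3 i f x) <= 0 + e" if "e > 0" for e
 proof -
  have e': "e / (vol + 1) > 0" using that vol by simp
  obtain d where d: "d > 0" "!!z h. norm h < d ==> norm (f (z + h) - f z - (\<Sum>i\<in>UNIV. h $ i *\<^sub>R pderiv3 i f z)) <= e / (vol + 1) * norm h"
   using uniform_differentiability_compact_support[OF f K e'] by metis
  define s where "s = min d 1 / 2"
  have s: "s > 0" "s < d" "s < 1" using d by (auto simp: s_def)
  define v :: "real^3" where "v = s *\<^sub>R axis i 1"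
  have nv: "norm v = s" using s by (simp add: v_def norm_axis_1)
  have fv: "integrable lborel (%x. f (x + v))" by (rule integrable_lborel_shift[OF fi])
  have "(\<Sum>j\<in>UNIV. v $ j *\<^sub>R pderiv3 j f z) = s *\<^sub>R (\<Sum>j\<in>UNIV. axis i 1 $ j *\<^sub>R pderiv3 j f z)" for z
   by (simp add: v_def scaleR_sum_right)
  then have Dv: "(\<Sum>j\<in>UNIV. v $ j *\<^sub>R pderiv3 j f z) = s *\<^sub>R pderiv3 i f z" for z
   unfolding sum_axis_scaleR .
  have "(LI x. f (x + v) - f x - s *\<^sub>R pderiv3 i f x) = - (s *\<^sub>R (LI x. pderiv3 i f x))"
   using fi fv di integral_lborel_shift[of f v] by simp
  then have "s * norm (LI x. pderiv3 i f x) = norm (LI x. f (x + v) - f x - s *\<^sub>R pderiv3 i f x)"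
   using s by simp
  also have "\<dots> <= (LI x. (e / (vol + 1) * s) * indicator (cball (0::real^3) (R + 1)) x)"
  proof (rule norm_integral_le)
   show "norm (f (x + v) - f x - s *\<^sub>R pderiv3 i f x) <= (e / (vol + 1) * s) * indicator (cball 0 (R + 1)) x" for x
   proof (cases "norm x <= R + 1")
    case True
    then show ?thesis using d(2)[of v x] nv s Dv by simp
   next
    case False
    have "norm x <= norm (x + v) + norm v" using norm_triangle_ineq4[of "x + v" v] by simp
    then have "x + v \<notin> K" "x \<notin> K" using R(2)[of x] R(2)[of "x + v"] False nv s by auto
    then show ?thesis using K False pderiv3_zero_off_support[OF compact_imp_closed[OF K(1)] K(2)] by simp
   qed
   have ci: "integrable lborel (indicat_real (cball (0::real^3) (R + 1)))"
    by (auto intro!: integrable_real_indicator emeasure_lborel_cball_finite)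
   then show "integrable lborel (%x::real^3. (e / (vol + 1) * s) * indicator (cball 0 (R + 1)) x)"
    by (rule integrable_mult_right)
  qed (use fi fv di in auto)
  also have "\<dots> = s * (e * (vol / (vol + 1)))" by (simp add: vol_def)
  also have "\<dots> <= s * e"
  proof (rule mult_left_mono)
   show "e * (vol / (vol + 1)) <= e" using vol that by (intro mult_left_le) auto
  qed (use s in simp)
  finally have "s * norm (LI x. pderiv3 i f x) <= s * e" .
  then show ?thesis using s by simp
 qed
 then have "norm (LI x. pderiv3 i f x) <= 0" by (rule field_le_epsilon)
 then show ?thesis by simp
qed

section \<open>Integrals along segments\<close>

lemma nn_integral_scaled_le:
 fixes F :: "real^3 => ennreal"
 assumes [measurable]: "F \<in> borel_measurable borel" and c: "c >= 1 / 2"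
 shows "(NI x. F (a + c *\<^sub>R x)) <= 8 * (NI x. F x)"
proof -
 have "(NI x. F x) = ennreal (c ^ 3) * (NI x. F (a + c *\<^sub>R x))"
  using nn_integral_lborel_affine[of F c a] c by simp
 then have eq: "8 * (NI x. F x) = ennreal (8 * c ^ 3) * (NI x. F (a + c *\<^sub>R x))"
  using c by (simp add: ennreal_mult mult.assoc)
 have "(1 / 2) ^ 3 <= c ^ 3" using c by (intro power_mono) auto
 then have "1 <= ennreal (8 * c ^ 3)" by (simp add: power_divide ennreal_leI flip: ennreal_1)
 then show ?thesis unfolding eq by (metis mult_1 mult_right_mono zero_le)
qed

text \<open>The point \<open>y + t (x - y)\<close> is substituted for \<open>y\<close> when \<open>t \<le> 1/2\<close> and for \<open>x\<close> when \<open>t \<ge> 1/2\<close>;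
  both Jacobians are at most \<open>8\<close>.\<close>

lemma segment_estimate:
 fixes F \<omega> :: "real^3 => ennreal"
 assumes [measurable]: "F \<in> borel_measurable borel" "\<omega> \<in> borel_measurable borel" "X \<in> sets borel" "D \<in> sets borel"
  and A: "(NI x. \<omega> x * indicator X x) <= A"
  and B: "!!z. (NI t. NI y. \<omega> ((1 / t) *\<^sub>R (z - (1 - t) *\<^sub>R y)) * indicator {1/2..<1} t * indicator D y) <= B"
 shows "(NI y. NI x. NI t. \<omega> x * F (y + t *\<^sub>R (x - y)) * indicator {0..<1::real} t * indicator X x * indicator D y)
  <= 8 * (A + B) * (NI x. F x)"
proof -
 define I where "I = (NI x. F x)"
 define H1 where "H1 y x t = \<omega> x * F (y + t *\<^sub>R (x - y)) * indicator {0..1/2::real} t * indicator X x" for y x t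
 define H2 where "H2 y x t = \<omega> x * F (y + t *\<^sub>R (x - y)) * indicator {1/2..<1::real} t * indicator D y" for y x t
 have [measurable]: "(%(y, x, t). H1 y x t) \<in> borel_measurable (borel \<Otimes>\<^sub>M borel \<Otimes>\<^sub>M borel)"
   "(%(y, x, t). H2 y x t) \<in> borel_measurable (borel \<Otimes>\<^sub>M borel \<Otimes>\<^sub>M borel)"
   "(%x. H1 (fst (fst x)) (snd (fst x)) (snd x)) \<in> borel_measurable ((borel \<Otimes>\<^sub>M borel) \<Otimes>\<^sub>M borel)"
   "(%x. H2 (fst (fst x)) (snd (fst x)) (snd x)) \<in> borel_measurable ((borel \<Otimes>\<^sub>M borel) \<Otimes>\<^sub>M borel)"
   "(%x. H1 (snd (fst x)) (fst (fst x)) (snd x)) \<in> borel_measurable ((borel \<Otimes>\<^sub>M borel) \<Otimes>\<^sub>M borel)"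
   "(%x. H2 (snd (fst x)) (fst (fst x)) (snd x)) \<in> borel_measurable ((borel \<Otimes>\<^sub>M borel) \<Otimes>\<^sub>M borel)"
  unfolding H1_def H2_def by measurable
 have "(NI y. NI x. NI t. \<omega> x * F (y + t *\<^sub>R (x - y)) * indicator {0..<1::real} t * indicator X x * indicator D y)
   <= (NI y. NI x. NI t. H1 y x t + H2 y x t)"
  by (intro nn_integral_mono) (auto simp: H1_def H2_def indicator_def)
 also have "\<dots> = (NI y. NI x. NI t. H1 y x t) + (NI y. NI x. NI t. H2 y x t)"
 proof -
  have 1: "(NI t. H1 y x t + H2 y x t) = (NI t. H1 y x t) + (NI t. H2 y x t)" for y x
   by (rule nn_integral_add) measurable
  have 2: "(NI x. (NI t. H1 y x t) + (NI t. H2 y x t))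
    = (NI x. NI t. H1 y x t) + (NI x. NI t. H2 y x t)" for y
   by (rule nn_integral_add) measurable
  show ?thesis unfolding 1 2 by (rule nn_integral_add) measurable
 qed
 also have "(NI y. NI x. NI t. H1 y x t) <= 8 * A * I"
 proof -
  have "(NI y. NI x. NI t. H1 y x t) = (NI x. NI y. NI t. H1 y x t)"
   by (rule lborel_pair.Fubini') (unfold H1_def H2_def, measurable)
  also have "\<dots> = (NI x. NI t. NI y. H1 y x t)"
   by (intro nn_integral_cong lborel_pair.Fubini') (unfold H1_def H2_def, measurable)
  also have "\<dots> <= (NI x. NI t. (8 * I) * (\<omega> x * indicator X x) * indicator {0..1/2::real} t)"
  proof (intro nn_integral_mono)
   fix x :: "real^3" and t :: real
   have "(NI y. H1 y x t) = (NI y. F (t *\<^sub>R x + (1 - t) *\<^sub>R y) * (\<omega> x * indicator X x * indicator {0..1/2::real} t))"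
    by (intro nn_integral_cong) (simp add: H1_def algebra_simps)
   also have "\<dots> = (NI y. F (t *\<^sub>R x + (1 - t) *\<^sub>R y)) * (\<omega> x * indicator X x * indicator {0..1/2::real} t)"
    by (rule nn_integral_multc) measurable
   also have "\<dots> <= (8 * I) * (\<omega> x * indicator X x * indicator {0..1/2::real} t)"
   proof (cases "t \<in> {0..1/2}")
    case True
    then show ?thesis unfolding I_def by (intro mult_right_mono nn_integral_scaled_le) auto
   qed simp
   finally show "(NI y. H1 y x t) <= (8 * I) * (\<omega> x * indicator X x) * indicator {0..1/2::real} t"
    by (simp add: mult.assoc)
  qed
  also have "\<dots> = (8 * I) * (NI x. \<omega> x * indicator X x) * ennreal (1 / 2)"
   by (simp add: nn_integral_cmult nn_integral_multc)
  also have "\<dots> <= (8 * I) * A * 1"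
  proof (intro mult_mono A)
   have "ennreal (1 / 2) <= ennreal 1" by (rule ennreal_leI) simp
   then show "ennreal (1 / 2) <= 1" by (simp only: ennreal_1)
  qed auto
  finally show ?thesis by (simp add: ac_simps)
 qed
 also have "(NI y. NI x. NI t. H2 y x t) <= 8 * B * I"
 proof -
  define G where "G z t y = \<omega> ((1 / t) *\<^sub>R (z - (1 - t) *\<^sub>R y)) * indicator {1/2..<1} t * indicator D y" for z y :: "real^3" and t :: real
  have [measurable]: "(%(z, t, y). G z t y) \<in> borel_measurable (borel \<Otimes>\<^sub>M borel \<Otimes>\<^sub>M borel)"
   unfolding G_def by measurable
  have Gz: "(%z. G z t y) \<in> borel_measurable borel" for t y
   unfolding G_def by measurable
  have "(NI y. NI x. NI t. H2 y x t) = (NI y. NI t. NI x. H2 y x t)"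
   by (intro nn_integral_cong lborel_pair.Fubini') (unfold H1_def H2_def G_def, measurable)
  also have "\<dots> = (NI t. NI y. NI x. H2 y x t)"
   by (rule lborel_pair.Fubini') (unfold H1_def H2_def G_def, measurable)
  also have "\<dots> <= (NI t. NI y. NI z. 8 * (G z t y * F z))"
  proof (rule nn_integral_mono, rule nn_integral_mono)
   fix y :: "real^3" and t :: real
   show "(NI x. H2 y x t) <= (NI z. 8 * (G z t y * F z))"
   proof (cases "t \<in> {1/2..<1} \<and> y \<in> D")
    case True
    then have t: "t >= 1 / 2" "t ~= 0" by auto
    have "(NI x. H2 y x t) = (NI x. (%z. G z t y * F z) ((1 - t) *\<^sub>R y + t *\<^sub>R x))"
     using True t by (intro nn_integral_cong) (simp add: H2_def G_def algebra_simps)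
    also have "\<dots> <= 8 * (NI z. G z t y * F z)"
     using t by (intro nn_integral_scaled_le) (unfold G_def, measurable)
    finally show ?thesis using Gz by (subst nn_integral_cmult) auto
   next
    case False then show ?thesis by (auto simp: H2_def)
   qed
  qed
  also have "\<dots> = (NI t. NI z. NI y. 8 * (G z t y * F z))"
   by (intro nn_integral_cong lborel_pair.Fubini') (unfold H1_def H2_def G_def, measurable)
  also have "\<dots> = (NI z. NI t. NI y. 8 * (G z t y * F z))"
   by (rule lborel_pair.Fubini') (unfold H1_def H2_def G_def, measurable)
  also have "\<dots> = (NI z. 8 * ((NI t. NI y. G z t y) * F z))"
  proof (rule nn_integral_cong)
   fix z
   have Gy: "(%y. G z t y) \<in> borel_measurable borel" for t unfolding G_def by measurable
   have Gt: "(%t. NI y. G z t y) \<in> borel_measurable borel" unfolding G_def by measurable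
   have "(NI y. 8 * (G z t y * F z)) = 8 * ((NI y. G z t y) * F z)" for t
    using Gy by (simp add: nn_integral_cmult nn_integral_multc)
   then show "(NI t. NI y. 8 * (G z t y * F z)) = 8 * ((NI t. NI y. G z t y) * F z)"
    using Gt by (simp add: nn_integral_cmult nn_integral_multc)
  qed
  also have "\<dots> <= (NI z. 8 * (B * F z))"
   using B unfolding G_def by (intro nn_integral_mono mult_left_mono mult_right_mono) auto
  also have "\<dots> = 8 * B * I" by (simp add: nn_integral_cmult I_def mult.assoc)
  finally show ?thesis .
 qed
 finally show ?thesis by (simp add: I_def algebra_simps)
qed

lemma segment_estimate_unweighted:
 fixes F :: "real^3 => ennreal"
 assumes [measurable]: "F \<in> borel_measurable borel" "X \<in> sets borel" "D \<in> sets borel"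
 shows "(NI y. NI x. NI t. F (y + t *\<^sub>R (x - y)) * indicator {0..<1::real} t * indicator X x * indicator D y)
  <= 8 * (emeasure lborel X + emeasure lborel D) * (NI x. F x)"
proof -
 have "(NI t. NI y. 1 * indicator {1/2..<1::real} t * indicator D y) <= emeasure lborel D"
 proof -
  have "(NI t. NI y. 1 * indicator {1/2..<1::real} t * indicator D y) = ennreal (1 / 2) * emeasure lborel D"
   by (simp add: nn_integral_cmult nn_integral_multc)
  also have "ennreal (1 / 2) <= ennreal 1" by (rule ennreal_leI) simp
  then have "ennreal (1 / 2) * emeasure lborel D <= 1 * emeasure lborel D"
   by (intro mult_right_mono) (simp_all only: ennreal_1 zero_le)
  finally show ?thesis by simp
 qed
 from segment_estimate[of F "%_. 1" X D, OF _ _ _ _ order_refl this] show ?thesis by simp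
qed

text \<open>Some point of D has a value at most twice the mean bound C / d. The factor 2 gives the
  contradiction for C > 0; for C = 0 the function would be positive on D while its integral over D
  vanishes.\<close>

lemma pigeonhole_nn_integral:
 assumes [measurable]: "g \<in> borel_measurable M" "D \<in> sets M"
  and D: "emeasure M D = ennreal d" "d > 0"
  and le: "(\<integral>\<^sup>+y. g y * indicator D y \<partial>M) <= ennreal C" and C: "C >= 0"
 obtains y where "y \<in> D" "g y <= ennreal (2 * C / d)"
proof -
 have "\<exists>y\<in>D. g y <= ennreal (2 * C / d)"
 proof (rule ccontr)
  assume "\<not> (\<exists>y\<in>D. g y <= ennreal (2 * C / d))"
  then have gt: "!!y. y \<in> D ==> ennreal (2 * C / d) < g y" by auto
  have "ennreal (2 * C) = ennreal (2 * C / d) * emeasure M D"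
   using D C by (simp flip: ennreal_mult)
  also have "\<dots> = (\<integral>\<^sup>+y. ennreal (2 * C / d) * indicator D y \<partial>M)" by (simp add: nn_integral_cmult_indicator)
  also have "\<dots> <= (\<integral>\<^sup>+y. g y * indicator D y \<partial>M)"
   using gt by (intro nn_integral_mono) (auto simp: indicator_def less_imp_le)
  finally have "ennreal (2 * C) <= ennreal C" using le by (rule order_trans)
  then have "C = 0" using C by simp
  with le have "(\<integral>\<^sup>+y. g y * indicator D y \<partial>M) = 0" by simp
  then have "AE y in M. g y * indicator D y = 0" by (subst (asm) nn_integral_0_iff_AE) auto
  then have "AE y in M. y \<notin> D"
  proof eventually_elim
   case (elim y)
   then show ?case using gt[of y] \<open>C = 0\<close> by (auto simp: indicator_def split: if_splits)
  qed
  then have "emeasure M D = 0" using AE_iff_measurable[of D M "%y. y \<notin> D"] sets.sets_into_space[OF assms(2)] by auto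
  with D show False by simp
 qed
 then show ?thesis using that by blast
qed

text \<open>In the unit ball 1/|y| is 1 plus the integral of t^(-2) from |y| to 1. After exchanging
  the order of integration the inner integral is t^(-2) times the volume of the ball of radius t,
  which is of order t.\<close>

lemma nn_integral_inverse_norm_finite:
 "(NI y. ennreal (1 / norm y) * indicator (ball (0::real^3) 1) y) < \<infinity>"
proof -
 define v where "v = unit_ball_vol 3"
 have v: "v >= 0" by (simp add: v_def)
 have eb: "emeasure lborel (ball (0::real^3) t) = ennreal (v * t ^ 3)" if "t >= 0" for t
  using emeasure_ball[of t "0::real^3"] that by (simp add: v_def)
 have pt: "ennreal (1 / norm y) * indicator (ball 0 1) y <=
   indicator (ball 0 1) y + (NI t. ennreal (1 / t\<^sup>2) * indicator {0<..<1} t * indicator (ball 0 t) y)" for y :: "real^3"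
 proof (cases "y = 0 \<or> norm y >= 1")
  case False
  then have n: "0 < norm y" "norm y < 1" by auto
  have "(NI t. ennreal (1 / t\<^sup>2) * indicator {norm y..1} t) = ennreal ((- (1 / 1)) - (- (1 / norm y)))"
   using n by (intro nn_integral_FTC_Icc[where F = "%t. - (1 / t)"])
    (auto intro!: derivative_eq_intros simp: has_real_derivative_iff_has_vector_derivative[symmetric] power2_eq_square)
  moreover have "(NI t. ennreal (1 / t\<^sup>2) * indicator {norm y..1} t) <= (NI t. ennreal (1 / t\<^sup>2) * indicator {0<..<1} t * indicator (ball 0 t) y)"
  proof (rule nn_integral_mono_AE)
   have "AE t in lborel. t ~= norm y \<and> t ~= 1"
    using AE_lborel_singleton[of "norm y"] AE_lborel_singleton[of "1::real"] by eventually_elim auto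
   then show "AE t in lborel. ennreal (1 / t\<^sup>2) * indicator {norm y..1} t <= ennreal (1 / t\<^sup>2) * indicator {0<..<1} t * indicator (ball 0 t) y"
    by eventually_elim (auto simp: indicator_def dest: less_trans[OF n(1)])
  qed
  ultimately have "ennreal (1 / norm y - 1) <= (NI t. ennreal (1 / t\<^sup>2) * indicator {0<..<1} t * indicator (ball 0 t) y)"
   by simp
  moreover have "ennreal (1 / norm y) = 1 + ennreal (1 / norm y - 1)"
   using n by (simp flip: ennreal_plus ennreal_1)
  ultimately show ?thesis using n by (simp add: add_left_mono)
 qed auto
 have [measurable]: "Measurable.pred (borel \<Otimes>\<^sub>M borel) (%(y::real^3, t::real). y \<in> ball 0 t)"
  by simp
 have "(NI y. ennreal (1 / norm y) * indicator (ball (0::real^3) 1) y) <=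
  (NI y. indicator (ball (0::real^3) 1) y + (NI t. ennreal (1 / t\<^sup>2) * indicator {0<..<1} t * indicator (ball 0 t) y))"
  by (intro nn_integral_mono pt)
 also have "\<dots> = emeasure lborel (ball (0::real^3) 1) + (NI y. NI t. ennreal (1 / t\<^sup>2) * indicator {0<..<1} t * indicator (ball (0::real^3) t) y)"
  by (subst nn_integral_add) (simp_all add: indicator_def)
 also have "(NI y. NI t. ennreal (1 / t\<^sup>2) * indicator {0<..<1} t * indicator (ball (0::real^3) t) y)
   = (NI t. NI y. ennreal (1 / t\<^sup>2) * indicator {0<..<1} t * indicator (ball (0::real^3) t) y)"
  by (rule lborel_pair.Fubini') (simp add: indicator_def)
 also have "\<dots> <= (NI t. ennreal v * indicator {0..1::real} t)"
 proof (intro nn_integral_mono)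
  fix t :: real
  show "(NI y. ennreal (1 / t\<^sup>2) * indicator {0<..<1} t * indicator (ball (0::real^3) t) y) <= ennreal v * indicator {0..1::real} t"
  proof (cases "0 < t \<and> t < 1")
   case True
   have "ennreal (1 / t\<^sup>2) * ennreal (v * t ^ 3) = ennreal (v * t)"
    using v True by (simp add: power2_eq_square power3_eq_cube flip: ennreal_mult)
   also have "\<dots> <= ennreal v" using v True by (intro ennreal_leI mult_left_le) auto
   finally show ?thesis using True eb[of t] by (simp add: nn_integral_cmult_indicator)
  qed auto
 qed
 also have "\<dots> = ennreal v" by (simp add: nn_integral_cmult_indicator)
 finally show ?thesis using eb[of 1]
  by (simp add: order_le_less_trans add_left_mono top.not_eq_extremum flip: ennreal_plus[OF v v])
qed


lemma nn_integral_powr_unit_interval_finite: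
 assumes "a < 1"
 shows "(NI t. ennreal ((1 - t) powr (- a)) * indicator {0..<1} t) < \<infinity>"
proof -
 have "((%s::real. s powr (- a)) has_integral (1 powr (- a + 1) / (- a + 1))) {0..1}"
  using assms by (intro has_integral_powr_from_0) auto
 then have "(\<integral>\<^sup>+s\<in>{0..1::real}. ennreal (s powr (- a)) \<partial>lborel) = ennreal (1 powr (- a + 1) / (- a + 1))"
  by (intro nn_integral_has_integral_lebesgue') auto
 moreover have "(NI t. ennreal ((1 - t) powr (- a)) * indicator {0..<1} t)
   <= (\<integral>\<^sup>+s\<in>{0..1::real}. ennreal (s powr (- a)) \<partial>lborel)"
 proof -
  have "(\<integral>\<^sup>+s\<in>{0..1::real}. ennreal (s powr (- a)) \<partial>lborel)
    = (NI s. ennreal ((1 - s) powr (- a)) * indicator {0..1} (1 - s))"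
   by (subst nn_integral_real_affine[where c = "-1" and t = 1]) auto
  then show ?thesis by (auto intro!: nn_integral_mono simp: indicator_def)
 qed
 ultimately show ?thesis by (simp add: order_le_less_trans)
qed

text \<open>For 0 <= a < 1 the weight is at most 1 at distance at least 1 from c and at most 1/|c -
  y| closer by; translation invariance then removes c from the bound.\<close>

lemma powr_weight_integral_bound:
 assumes a: "0 <= a" "a < 1" and D: "D \<in> sets borel" "emeasure lborel D < \<infinity>"
 shows "\<exists>M::real. M >= 0 \<and> (\<forall>c::real^3. (NI y. ennreal (norm (c - y) powr (- a)) * indicator D y) <= ennreal M)"
proof -
 define J where "J = emeasure lborel D + (NI y. ennreal (1 / norm y) * indicator (ball (0::real^3) 1) y)"
 have J: "J < \<infinity>" using D(2) nn_integral_inverse_norm_finite by (auto simp: J_def)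
 have [measurable]: "D \<in> sets borel" by (rule D)
 have m: "(%z. ennreal (1 / norm z) * indicator (ball (0::real^3) 1) z) \<in> borel_measurable borel"
  by (intro borel_measurable_times_ennreal borel_measurable_indicator) auto
 have "(NI y. ennreal (norm (c - y) powr (- a)) * indicator D y) <= J" for c :: "real^3"
 proof -
  have pw: "r powr (- a) <= 1" if "r >= 1" for r :: real
   using powr_mono[of "- a" 0 r] a that by simp
  have pw': "r powr (- a) <= 1 / r" if "0 < r" "r < 1" for r :: real
   using powr_mono'[of "- 1" "- a" r] a that by (simp add: powr_minus divide_inverse)
  have "(NI y. ennreal (norm (c - y) powr (- a)) * indicator D y) <=
    (NI y. indicator D y + ennreal (1 / norm (c - y)) * indicator (ball (0::real^3) 1) (c - y))"
  proof (intro nn_integral_mono)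
   fix y :: "real^3"
   \<comment> \<open>The case y = c is trivial because \<open>0 powr (- a)\<close> is 0.\<close>
   consider "norm (c - y) >= 1" | "norm (c - y) = 0" | "0 < norm (c - y)" "norm (c - y) < 1" by fastforce
   then show "ennreal (norm (c - y) powr (- a)) * indicator D y <= indicator D y + ennreal (1 / norm (c - y)) * indicator (ball (0::real^3) 1) (c - y)"
   proof cases
    case 1
    then have "ennreal (norm (c - y) powr (- a)) <= ennreal 1" by (intro ennreal_leI pw)
    then have "ennreal (norm (c - y) powr (- a)) * indicator D y <= indicator D y"
     by (auto simp: indicator_def)
    then show ?thesis by (rule order_trans) simp
   next
    case 3
    then have "ennreal (norm (c - y) powr (- a)) <= ennreal (1 / norm (c - y))" by (intro ennreal_leI pw')
    then have "ennreal (norm (c - y) powr (- a)) * indicator D y <= ennreal (1 / norm (c - y)) * indicator (ball (0::real^3) 1) (c - y)"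
     using 3 by (auto simp: indicator_def)
    then show ?thesis by (rule order_trans) simp
   qed simp
  qed
  also have "\<dots> = emeasure lborel D + (NI y. ennreal (1 / norm (c - y)) * indicator (ball (0::real^3) 1) (c - y))"
  proof -
   from measurable_compose[OF _ m, of "%y. c - y" borel]
   have "(%y. ennreal (1 / norm (c - y)) * indicator (ball (0::real^3) 1) (c - y)) \<in> borel_measurable borel"
    by simp
   then show ?thesis by (subst nn_integral_add) auto
  qed
  also have "(NI y. ennreal (1 / norm (c - y)) * indicator (ball (0::real^3) 1) (c - y))
    = (NI y. ennreal (1 / norm y) * indicator (ball (0::real^3) 1) y)"
   using m nn_integral_lborel_affine[of "%y. ennreal (1 / norm y) * indicator (ball (0::real^3) 1) y" "-1" c] by simp
  finally show ?thesis by (simp add: J_def)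
 qed
 moreover have "J = ennreal (enn2real J)" using J by simp
 ultimately show ?thesis by (metis enn2real_nonneg)
qed

text \<open>With z = y + t (x - y) fixed, x is (1 - t)/t times the vector z/(1 - t) - y, so the
  weight at x is at most (1 - t)^(-a) times a translated weight in y. The first factor is integrable
  over [0,1) because a < 1, the second over D uniformly in the translation.\<close>

lemma segment_estimate_powr:
 assumes a: "0 <= a" "a < 1" and D [measurable]: "D \<in> sets borel" and Df: "emeasure lborel D < \<infinity>"
  and X [measurable]: "X \<in> sets borel" and Xf: "emeasure lborel X < \<infinity>"
 shows "\<exists>C::real. C >= 0 \<and> (\<forall>F :: real^3 => ennreal. F \<in> borel_measurable borel -->
  (NI y. NI x. NI t. ennreal (norm x powr (- a)) * F (y + t *\<^sub>R (x - y)) * indicator {0..<1::real} t * indicator X x * indicator D y)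
  <= ennreal C * (NI x. F x))"
proof -
 obtain MX :: real where MX: "MX >= 0" "!!c::real^3. (NI y. ennreal (norm (c - y) powr (- a)) * indicator X y) <= ennreal MX"
  using powr_weight_integral_bound[OF a X Xf] by blast
 obtain MD :: real where MD: "MD >= 0" "!!c::real^3. (NI y. ennreal (norm (c - y) powr (- a)) * indicator D y) <= ennreal MD"
  using powr_weight_integral_bound[OF a D Df] by blast
 define P where "P = (NI t. ennreal ((1 - t) powr (- a)) * indicator {0..<1} t)"
 have P: "P < \<infinity>" unfolding P_def by (rule nn_integral_powr_unit_interval_finite[OF a(2)])
 have A: "(NI x. ennreal (norm x powr (- a)) * indicator X x) <= ennreal MX"
  using MX(2)[of 0] by simp
 have B: "(NI t. NI y. ennreal (norm ((1 / t) *\<^sub>R (z - (1 - t) *\<^sub>R y)) powr (- a)) * indicator {1/2..<1} t * indicator D y) <= P * ennreal MD"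
  for z :: "real^3"
 proof -
  have "(NI t. NI y. ennreal (norm ((1 / t) *\<^sub>R (z - (1 - t) *\<^sub>R y)) powr (- a)) * indicator {1/2..<1} t * indicator D y)
   <= (NI t. ennreal ((1 - t) powr (- a)) * indicator {0..<1} t * ennreal MD)"
  proof (rule nn_integral_mono)
   fix t :: real
   show "(NI y. ennreal (norm ((1 / t) *\<^sub>R (z - (1 - t) *\<^sub>R y)) powr (- a)) * indicator {1/2..<1} t * indicator D y)
     <= ennreal ((1 - t) powr (- a)) * indicator {0..<1} t * ennreal MD"
   proof (cases "t \<in> {1/2..<1}")
    case True
    then have t: "0 < t" "0 < 1 - t" "1 - t <= (1 - t) / t"
     using mult_left_le[of t "1 - t"] by (auto simp: pos_le_divide_eq)
    have "norm ((1 / t) *\<^sub>R (z - (1 - t) *\<^sub>R y)) powr (- a) <= (1 - t) powr (- a) * norm ((1 / (1 - t)) *\<^sub>R z - y) powr (- a)" for y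
    proof -
     have "(1 / t) *\<^sub>R (z - (1 - t) *\<^sub>R y) = ((1 - t) / t) *\<^sub>R ((1 / (1 - t)) *\<^sub>R z - y)"
      using t by (simp add: scaleR_diff_right)
     then have eq: "norm ((1 / t) *\<^sub>R (z - (1 - t) *\<^sub>R y)) = ((1 - t) / t) * norm ((1 / (1 - t)) *\<^sub>R z - y)"
      using t by simp
     have "norm ((1 / t) *\<^sub>R (z - (1 - t) *\<^sub>R y)) powr (- a) = ((1 - t) / t) powr (- a) * norm ((1 / (1 - t)) *\<^sub>R z - y) powr (- a)"
      by (simp only: eq powr_mult)
     also have "((1 - t) / t) powr (- a) <= (1 - t) powr (- a)"
      using t a by (intro powr_mono2') auto
     finally show ?thesis by (simp add: mult_right_mono)
    qed
    then have "(NI y. ennreal (norm ((1 / t) *\<^sub>R (z - (1 - t) *\<^sub>R y)) powr (- a)) * indicator {1/2..<1} t * indicator D y)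
     <= (NI y. ennreal ((1 - t) powr (- a)) * (ennreal (norm ((1 / (1 - t)) *\<^sub>R z - y) powr (- a)) * indicator D y))"
     using True by (intro nn_integral_mono) (auto simp: indicator_def ennreal_leI simp flip: ennreal_mult)
    also have "\<dots> = ennreal ((1 - t) powr (- a)) * (NI y. ennreal (norm ((1 / (1 - t)) *\<^sub>R z - y) powr (- a)) * indicator D y)"
     by (rule nn_integral_cmult) measurable
    also have "\<dots> <= ennreal ((1 - t) powr (- a)) * ennreal MD" by (intro mult_left_mono MD(2)) simp
    finally show ?thesis using True by simp
   qed auto
  qed
  also have "\<dots> = P * ennreal MD" unfolding P_def by (rule nn_integral_multc) measurable
  finally show ?thesis .
 qed
 define C where "C = enn2real (8 * (ennreal MX + P * ennreal MD))"
 have C: "8 * (ennreal MX + P * ennreal MD) = ennreal C"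
  unfolding C_def using P by (simp add: ennreal_mult_less_top)
 show ?thesis
 proof (intro exI[of _ C] conjI allI impI)
  show "C >= 0" by (simp add: C_def)
  fix F :: "real^3 => ennreal" assume F: "F \<in> borel_measurable borel"
  show "(NI y. NI x. NI t. ennreal (norm x powr (- a)) * F (y + t *\<^sub>R (x - y)) * indicator {0..<1::real} t * indicator X x * indicator D y)
  <= ennreal C * (NI x. F x)"
   unfolding C[symmetric] by (rule segment_estimate[OF F _ X D A B]) measurable
 qed
qed

section \<open>The homotopy formula\<close>

definition cvec :: "real^3 => complex^3" where
 "cvec v = (\<chi> i. of_real (v $ i))"

lemma norm_cvec [simp]: "norm (cvec v) = norm v"
 by (simp add: cvec_def norm_vec_def L2_set_def)

lemma norm_cdot_le: "norm (cdot a b) <= norm a * norm b"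
proof -
 have "norm (cdot a b) <= (\<Sum>i\<in>UNIV. \<bar>norm (a $ i)\<bar> * \<bar>norm (b $ i)\<bar>)"
  unfolding cdot_def by (rule order_trans[OF norm_sum]) (simp add: norm_mult)
 also have "\<dots> <= norm a * norm b" unfolding norm_vec_def by (rule L2_set_mult_ineq)
 finally show ?thesis .
qed

lemma cdot_diff_left: "cdot (a - b) c = cdot a c - cdot b c"
 by (simp add: cdot_def left_diff_distrib sum_subtractf)
lemma cdot_add_right: "cdot a (b + c) = cdot a b + cdot a c"
 by (simp add: cdot_def distrib_left sum.distrib)
lemma cdot_diff_right: "cdot a (b - c) = cdot a b - cdot a c"
 by (simp add: cdot_def right_diff_distrib sum_subtractf)
lemma cdot_zero [simp]: "cdot 0 a = 0" "cdot a 0 = 0"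
 by (simp_all add: cdot_def)

lemma continuous_on_vec_nth_iff:
 fixes f :: "'a::topological_space => 'b::real_normed_vector^3"
 shows "continuous_on S f \<longleftrightarrow> (\<forall>i. continuous_on S (%x. f x $ i))"
proof
 assume "\<forall>i. continuous_on S (%x. f x $ i)"
 then have "continuous_on S (%x. \<chi> i. f x $ i)" by (intro continuous_on_vec_lambda) auto
 then show "continuous_on S f" by simp
qed (auto intro: continuous_intros)

lemma continuous_on_cdot [continuous_intros]:
 "continuous_on S f ==> continuous_on S g ==> continuous_on S (%x. cdot (f x) (g x))"
 unfolding cdot_def by (intro continuous_intros)

lemma continuous_on_cvec [continuous_intros]:
 "continuous_on S f ==> continuous_on S (%x. cvec (f x))"
 unfolding cvec_def by (intro continuous_intros)

lemma borel_measurable_cvec [measurable]: "cvec \<in> borel_measurable borel"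
 by (intro borel_measurable_continuous_onI continuous_intros)

lemma borel_measurable_cdot [measurable]:
 assumes "f \<in> borel_measurable M" "g \<in> borel_measurable M"
 shows "(%x. cdot (f x) (g x)) \<in> borel_measurable M"
proof -
 have "(%p. cdot (fst p) (snd p)) \<in> borel_measurable (borel :: ((complex^3) \<times> (complex^3)) measure)"
  by (intro borel_measurable_continuous_onI continuous_intros)
 then have "(%p. cdot (fst p) (snd p)) \<in> borel_measurable ((borel :: (complex^3) measure) \<Otimes>\<^sub>M borel)"
  by (simp add: borel_prod)
 from measurable_compose[OF measurable_Pair[OF assms] this] show ?thesis by simp
qed

text \<open>Half-open to match the segment estimates, where the weight (1 - t)^(-a) is singular at t
  = 1. As a Lebesgue integral it is 0 when the integrand is not integrable, so the norm bounds below
  hold without an integrability hypothesis.\<close>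

definition uint :: "(real => complex) => complex" where
 "uint f = (LI t. indicator {0..<1} t *\<^sub>R f t)"

lemma uint_integrable:
 assumes "continuous_on {0..1} f"
 shows "integrable lborel (%t. indicator {0..<1::real} t *\<^sub>R (f t :: complex))"
proof -
 have "integrable lborel (%t. indicator {0..1} t *\<^sub>R f t)"
  by (rule borel_integrable_compact[OF compact_Icc assms])
 from integrable_mult_indicator[OF _ this, of "{0..<1}"] show ?thesis
  by (rule back_subst[of "integrable lborel"]) (auto simp: indicator_def fun_eq_iff)
qed

lemma uint_eq_integral:
 assumes "continuous_on {0..1} f"
 shows "uint f = integral {0..1} f"
proof -
 have i: "integrable lborel (%t. indicator {0..1} t *\<^sub>R f t)"
  by (rule borel_integrable_compact[OF compact_Icc assms])
 have "uint f = (LI t. indicator {0..1} t *\<^sub>R f t)"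
  unfolding uint_def
 proof (rule integral_cong_AE)
  show "AE t in lborel. indicator {0..<1} t *\<^sub>R f t = indicator {0..1} t *\<^sub>R f t"
   using AE_lborel_singleton[of "1::real"] by eventually_elim (auto simp: indicator_def)
 qed (use i uint_integrable[OF assms] in auto)
 also have "\<dots> = integral {0..1} f"
  using set_borel_integral_eq_integral(2)[of "{0..1}" f] i by (simp add: set_integrable_def set_lebesgue_integral_def)
 finally show ?thesis .
qed

lemma norm_uint_le: "ennreal (norm (uint f)) <= (NI t. ennreal (norm (f t)) * indicator {0..<1} t)"
proof (cases "integrable lborel (%t. indicator {0..<1} t *\<^sub>R f t)")
 case True
 then show ?thesis unfolding uint_def
  by (rule order_trans[OF integral_norm_bound_ennreal]) (auto intro!: nn_integral_mono simp: indicator_def)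
qed (simp add: uint_def not_integrable_integral_eq)

text \<open>Jensen's inequality without integrability of f: for c the norm of the integral, 2 c |f|
  <= |f|^2 + c^2 integrates to 2 c^2 <= I + c^2, where I is the right-hand side, and the finite c^2
  cancels.\<close>

lemma norm_uint_square_le:
 assumes f [measurable]: "f \<in> borel_measurable borel"
 shows "nsq (uint f) <= (NI t. nsq (f t) * indicator {0..<1} t)"
proof -
 define c where "c = norm (uint f)"
 have "ennreal (c * c) + ennreal (c * c) = ennreal (2 * c) * ennreal c"
  by (simp add: c_def flip: ennreal_plus ennreal_mult)
 also have "\<dots> <= ennreal (2 * c) * (NI t. ennreal (norm (f t)) * indicator {0..<1} t)"
  unfolding c_def by (intro mult_left_mono norm_uint_le) simp
 also have "\<dots> = (NI t. ennreal (2 * c) * (ennreal (norm (f t)) * indicator {0..<1} t))"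
  by (rule nn_integral_cmult[symmetric]) measurable
 also have "\<dots> <= (NI t. nsq (f t) * indicator {0..<1} t + ennreal (c * c) * indicator {0..<1} t)"
 proof (rule nn_integral_mono)
  fix t
  have "2 * c * norm (f t) <= (norm (f t))\<^sup>2 + c * c"
   using zero_le_power2[of "norm (f t) - c"] by (simp add: power2_eq_square algebra_simps)
  then have "ennreal (2 * c * norm (f t)) <= ennreal ((norm (f t))\<^sup>2 + c * c)" by (rule ennreal_leI)
  then show "ennreal (2 * c) * (ennreal (norm (f t)) * indicator {0..<1} t) <= nsq (f t) * indicator {0..<1} t + ennreal (c * c) * indicator {0..<1} t"
   by (auto simp: indicator_def c_def ennreal_mult)
 qed
 also have "\<dots> = (NI t. nsq (f t) * indicator {0..<1} t) + ennreal (c * c)"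
  by (subst nn_integral_add) (simp_all add: nn_integral_cmult_indicator)
 finally show ?thesis by (simp add: c_def power2_eq_square ennreal_add_left_cancel_le add.commute)
qed

definition line_int :: "(real^3 => complex^3) => real^3 => real^3 => complex" where
 "line_int w y x = uint (%t. cdot (w (y + t *\<^sub>R (x - y))) (cvec (x - y)))"

lemma continuous_on_line:
 fixes \<phi> :: "real^3 => 'a::topological_space"
 assumes "continuous_on UNIV \<phi>"
 shows "continuous_on S (%t. \<phi> (y + t *\<^sub>R (x - y)))"
 by (rule continuous_on_compose2[OF assms]) (auto intro!: continuous_intros)

lemma cdot_grad_cvec: "cdot (grad q p) (cvec v) = (\<Sum>i\<in>UNIV. v $ i *\<^sub>R pderiv3 i q p)"
 by (simp add: cdot_def grad_def cvec_def scaleR_conv_of_real mult.commute)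

lemma has_vector_derivative_line:
 assumes q: "q differentiable (at (y + t *\<^sub>R (x - y)))"
 shows "((%t. q (y + t *\<^sub>R (x - y))) has_vector_derivative cdot (grad q (y + t *\<^sub>R (x - y))) (cvec (x - y))) (at t within S)"
proof -
 have "((%t. y + t *\<^sub>R (x - y)) has_derivative (%h. h *\<^sub>R (x - y))) (at t)"
  by (auto intro!: derivative_eq_intros)
 from has_derivative_compose[OF this has_derivative_pderiv3[OF q]]
 have "((%t. q (y + t *\<^sub>R (x - y))) has_derivative
  (%h. h *\<^sub>R cdot (grad q (y + t *\<^sub>R (x - y))) (cvec (x - y)))) (at t)"
  by (rule back_subst[of "\<lambda>D. (_ has_derivative D) _"])
    (simp add: cdot_grad_cvec scaleR_sum_right)
 then show ?thesis unfolding has_vector_derivative_def by (rule has_derivative_at_withinI)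
qed

lemma continuous_grad: "Ck (Suc 0) q ==> continuous_on UNIV (grad q)"
 by (auto simp: grad_def intro!: continuous_on_vec_lambda)

lemma line_int_grad:
 assumes q: "Ck (Suc 0) q"
 shows "line_int (grad q) y x = q x - q y"
proof -
 have "((%t. cdot (grad q (y + t *\<^sub>R (x - y))) (cvec (x - y))) has_integral (q (y + 1 *\<^sub>R (x - y)) - q (y + 0 *\<^sub>R (x - y)))) {0..1}"
  by (intro fundamental_theorem_of_calculus has_vector_derivative_line Ck_differentiable[OF q]) simp
 moreover have "continuous_on {0..1} (%t. cdot (grad q (y + t *\<^sub>R (x - y))) (cvec (x - y)))"
  by (intro continuous_intros continuous_on_line continuous_grad q)
 ultimately show ?thesis unfolding line_int_def by (simp add: uint_eq_integral integral_unique)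
qed

lemma norm_line_int_square_le:
 assumes [measurable]: "w \<in> borel_measurable borel"
 shows "nsq (line_int w y x) <=
  nsq (x - y) * (NI t. nsq (w (y + t *\<^sub>R (x - y))) * indicator {0..<1} t)"
proof -
 have "nsq (line_int w y x) <= (NI t. nsq (cdot (w (y + t *\<^sub>R (x - y))) (cvec (x - y))) * indicator {0..<1} t)"
  unfolding line_int_def by (rule norm_uint_square_le) measurable
 also have "\<dots> <= (NI t. nsq (x - y) * (nsq (w (y + t *\<^sub>R (x - y))) * indicator {0..<1} t))"
 proof (rule nn_integral_mono)
  fix t
  have "(norm (cdot (w (y + t *\<^sub>R (x - y))) (cvec (x - y))))\<^sup>2 <= (norm (w (y + t *\<^sub>R (x - y))) * norm (x - y))\<^sup>2"
   using norm_cdot_le[of "w (y + t *\<^sub>R (x - y))" "cvec (x - y)"] by (intro power_mono) auto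
  then have "nsq (cdot (w (y + t *\<^sub>R (x - y))) (cvec (x - y))) <= nsq (x - y) * nsq (w (y + t *\<^sub>R (x - y)))"
   by (simp add: power_mult_distrib mult.commute ennreal_leI flip: ennreal_mult)
  then show "nsq (cdot (w (y + t *\<^sub>R (x - y))) (cvec (x - y))) * indicator {0..<1} t <= nsq (x - y) * (nsq (w (y + t *\<^sub>R (x - y))) * indicator {0..<1} t)"
   by (auto simp: indicator_def)
 qed
 also have "\<dots> = nsq (x - y) * (NI t. nsq (w (y + t *\<^sub>R (x - y))) * indicator {0..<1} t)"
  by (rule nn_integral_cmult) measurable
 finally show ?thesis .
qed

lemma norm_line_int_le:
 assumes [measurable]: "w \<in> borel_measurable borel"
 shows "ennreal (norm (line_int w y x)) <=
  ennreal (norm (x - y)) * (NI t. ennreal (norm (w (y + t *\<^sub>R (x - y)))) * indicator {0..<1} t)"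
proof -
 have "ennreal (norm (line_int w y x)) <= (NI t. ennreal (norm (cdot (w (y + t *\<^sub>R (x - y))) (cvec (x - y)))) * indicator {0..<1} t)"
  unfolding line_int_def by (rule norm_uint_le)
 also have "\<dots> <= (NI t. ennreal (norm (x - y)) * (ennreal (norm (w (y + t *\<^sub>R (x - y)))) * indicator {0..<1} t))"
 proof (rule nn_integral_mono)
  fix t
  have "ennreal (norm (cdot (w (y + t *\<^sub>R (x - y))) (cvec (x - y)))) <= ennreal (norm (x - y)) * ennreal (norm (w (y + t *\<^sub>R (x - y))))"
   using norm_cdot_le[of "w (y + t *\<^sub>R (x - y))" "cvec (x - y)"] by (simp add: mult.commute ennreal_leI flip: ennreal_mult)
  then show "ennreal (norm (cdot (w (y + t *\<^sub>R (x - y))) (cvec (x - y)))) * indicator {0..<1} t <= ennreal (norm (x - y)) * (ennreal (norm (w (y + t *\<^sub>R (x - y)))) * indicator {0..<1} t)"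
   by (auto simp: indicator_def)
 qed
 also have "\<dots> = ennreal (norm (x - y)) * (NI t. ennreal (norm (w (y + t *\<^sub>R (x - y)))) * indicator {0..<1} t)"
  by (rule nn_integral_cmult) measurable
 finally show ?thesis .
qed

text \<open>The j-th component of the Poincare homotopy operator with vertex y, applied to the
  differential of the 1-form \<phi>. Each bracket is 0 or, up to sign, a component of curl
  \<phi>.\<close>

definition homotopy_rem :: "(real^3 => complex^3) => real^3 => real^3 => 3 => complex" where
 "homotopy_rem \<phi> y x j = uint (%t. of_real t * (\<Sum>i\<in>UNIV.
   (pderiv3 j (%z. \<phi> z $ i) (y + t *\<^sub>R (x - y)) - pderiv3 i (%z. \<phi> z $ j) (y + t *\<^sub>R (x - y))) * of_real ((x - y) $ i)))"

lemma sum_rearrange: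
 fixes h v :: "real^3" and b :: "3 => 3 => complex"
 shows "(\<Sum>i\<in>UNIV. a i * of_real (h $ i) + (\<Sum>j\<in>UNIV. (t *\<^sub>R h) $ j *\<^sub>R b i j) * of_real (v $ i))
   = (\<Sum>j\<in>UNIV. h $ j *\<^sub>R (a j + of_real t * (\<Sum>i\<in>UNIV. b i j * of_real (v $ i))))"
 unfolding vector_scaleR_component real_scaleR_def
 by (simp add: sum_3 scaleR_conv_of_real algebra_simps)

lemma has_derivative_line_int:
 fixes y :: "real^3" and \<phi> :: "real^3 => complex^3"
 assumes \<phi>: "!!i. Ck (Suc 0) (%z. \<phi> z $ i)"
 defines "c \<equiv> %j x t. \<phi> (y + t *\<^sub>R (x - y)) $ j + of_real t * (\<Sum>i\<in>UNIV. pderiv3 j (%z. \<phi> z $ i) (y + t *\<^sub>R (x - y)) * of_real ((x - y) $ i))"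
 shows "(line_int \<phi> y has_derivative (%h. \<Sum>j\<in>UNIV. h $ j *\<^sub>R integral {0..1} (c j x))) (at x)"
  and "continuous_on UNIV (%x. integral {0..1} (c j x))"
proof -
 have cd: "continuous_on UNIV (pderiv3 j (%z. \<phi> z $ i))" for i j using \<phi> by simp
 have c\<phi>: "continuous_on UNIV (%z. \<phi> z $ i)" for i using \<phi> Ck_continuous by blast
 then have cv: "continuous_on UNIV \<phi>" by (simp add: continuous_on_vec_nth_iff)
 define f where "f x t = cdot (\<phi> (y + t *\<^sub>R (x - y))) (cvec (x - y))" for x t
 have line: "line_int \<phi> y = (%x. integral (cbox 0 1) (f x))"
  unfolding line_int_def f_def
  by (intro ext, subst uint_eq_integral) (auto intro!: continuous_intros continuous_on_line cv)
 have cc: "continuous_on S (%(x, t). c j x t)" for j S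
  unfolding c_def case_prod_beta
  by (intro continuous_intros continuous_on_compose2[OF c\<phi>] continuous_on_compose2[OF cd]) auto
 \<comment> \<open>\<open>leibniz_rule\<close> takes the derivative in x as a continuous family of
   bounded linear maps; \<open>fx\<close> is this family, assembled from the coordinate
   functionals.\<close>
 define B where "B j = Blinfun (%h::real^3. h $ j)" for j
 have B: "blinfun_apply (B j) h = h $ j" for j h
  unfolding B_def by (subst bounded_linear_Blinfun_apply) (auto intro: bounded_linear_vec_nth)
 define fx where "fx x t = (\<Sum>j\<in>UNIV. blinfun_scaleR_left (c j x t) o\<^sub>L B j)" for x t
 have fx: "blinfun_apply (fx x t) h = (\<Sum>j\<in>UNIV. h $ j *\<^sub>R c j x t)" for x t h
  unfolding fx_def by (simp add: blinfun.sum_left B)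
 have cfx: "continuous_on (UNIV \<times> cbox 0 1) (%(x, t). fx x t)"
  using cc unfolding fx_def case_prod_beta
  by (intro continuous_intros bounded_linear.continuous_on[OF bounded_linear_blinfun_scaleR_left])
 have der: "((%x. f x t) has_derivative blinfun_apply (fx x t)) (at x within UNIV)" for x t
 proof -
  let ?p = "y + t *\<^sub>R (x - y)"
  have "((%x. y + t *\<^sub>R (x - y)) has_derivative (%h. t *\<^sub>R h)) (at x)"
   by (auto intro!: derivative_eq_intros)
  from has_derivative_compose[OF this has_derivative_pderiv3[OF Ck_differentiable[OF \<phi>]]]
  have 1: "((%x. \<phi> (y + t *\<^sub>R (x - y)) $ i) has_derivative (%h. \<Sum>j\<in>UNIV. (t *\<^sub>R h) $ j *\<^sub>R pderiv3 j (%z. \<phi> z $ i) ?p)) (at x)" for i .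
  have 2: "((%x. complex_of_real ((x - y) $ i)) has_derivative (%h. of_real (h $ i))) (at x)" for i
   by (intro bounded_linear.has_derivative[OF bounded_linear_of_real] bounded_linear.has_derivative[OF bounded_linear_vec_nth])
     (auto intro!: derivative_eq_intros)
  have "((%x. f x t) has_derivative (%h. \<Sum>i\<in>UNIV. \<phi> ?p $ i * of_real (h $ i) + (\<Sum>j\<in>UNIV. (t *\<^sub>R h) $ j *\<^sub>R pderiv3 j (%z. \<phi> z $ i) ?p) * of_real ((x - y) $ i))) (at x)"
   unfolding f_def cdot_def cvec_def vec_lambda_beta
   by (intro has_derivative_sum has_derivative_mult 1 2)
  moreover have "(\<Sum>i\<in>UNIV. \<phi> ?p $ i * of_real (h $ i) + (\<Sum>j\<in>UNIV. (t *\<^sub>R h) $ j *\<^sub>R pderiv3 j (%z. \<phi> z $ i) ?p) * of_real ((x - y) $ i))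
    = blinfun_apply (fx x t) h" for h
   unfolding fx c_def by (rule sum_rearrange)
  ultimately show ?thesis by simp
 qed
 have "((%x. integral (cbox 0 1) (f x)) has_derivative integral (cbox 0 1) (fx x)) (at x within UNIV)"
  using der cfx
  by (intro leibniz_rule) (auto simp: f_def intro!: integrable_continuous_interval continuous_intros continuous_on_line cv)
 moreover have "blinfun_apply (integral (cbox 0 1) (fx x)) = (%h. \<Sum>j\<in>UNIV. h $ j *\<^sub>R integral {0..1} (c j x))"
 proof
  fix h
  have int: "c j x integrable_on {0..1}" for j
   using cc[of "{x} \<times> UNIV" j] unfolding c_def
   by (intro integrable_continuous_interval continuous_intros continuous_on_line c\<phi> cd)
  have "continuous_on (cbox 0 1) (%t. case (x, t) of (x, t) => fx x t)"
   by (rule continuous_on_compose2[OF cfx]) (auto intro!: continuous_intros)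
  then have ifx: "fx x integrable_on cbox 0 1" by (intro integrable_continuous) simp
  have "blinfun_apply (integral (cbox 0 1) (fx x)) h = integral (cbox 0 1) (%t. blinfun_apply (fx x t) h)"
   by (rule blinfun_apply_integral[OF ifx])
  also have "\<dots> = integral {0..1} (%t. \<Sum>j\<in>UNIV. h $ j *\<^sub>R c j x t)" by (simp add: fx)
  also have "\<dots> = (\<Sum>j\<in>UNIV. h $ j *\<^sub>R integral {0..1} (c j x))"
   using int by (subst integral_sum) (auto intro!: integrable_cmul)
  finally show "blinfun_apply (integral (cbox 0 1) (fx x)) h = (\<Sum>j\<in>UNIV. h $ j *\<^sub>R integral {0..1} (c j x))" .
 qed
 ultimately show "(line_int \<phi> y has_derivative (%h. \<Sum>j\<in>UNIV. h $ j *\<^sub>R integral {0..1} (c j x))) (at x)"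
  unfolding line by simp
 show "continuous_on UNIV (%x. integral {0..1} (c j x))"
  using integral_continuous_on_param[OF cc, of UNIV 0 1 j] by simp
qed

lemma pderiv3_line_int:
 assumes \<phi>: "!!i. Ck (Suc 0) (%z. \<phi> z $ i)"
 shows "Ck (Suc 0) (line_int \<phi> y)"
  and "pderiv3 j (line_int \<phi> y) x = \<phi> x $ j + homotopy_rem \<phi> y x j"
proof -
 define c where "c = (%j x t. \<phi> (y + t *\<^sub>R (x - y)) $ j + of_real t * (\<Sum>i\<in>UNIV. pderiv3 j (%z. \<phi> z $ i) (y + t *\<^sub>R (x - y)) * of_real ((x - y) $ i)))"
 have D: "(line_int \<phi> y has_derivative (%h. \<Sum>j\<in>UNIV. h $ j *\<^sub>R integral {0..1} (c j x))) (at x)" for x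
  using has_derivative_line_int(1)[OF \<phi>, of y x] unfolding c_def .
 have Dc: "continuous_on UNIV (%x. integral {0..1} (c j x))" for j
  using has_derivative_line_int(2)[OF \<phi>, of y j] unfolding c_def .
 have cd: "continuous_on UNIV (pderiv3 j (%z. \<phi> z $ i))" for i j using \<phi> by simp
 have c\<phi>: "continuous_on UNIV (%z. \<phi> z $ i)" for i using \<phi> Ck_continuous by blast
 have pd: "pderiv3 j (line_int \<phi> y) = (%x. integral {0..1} (c j x))" for j
  by (rule ext, rule trans[OF pderiv3_eqI[OF D] sum_axis_scaleR])
 show "Ck (Suc 0) (line_int \<phi> y)"
  using D Dc unfolding Ck.simps pd differentiable_on_def differentiable_def by blast
 \<comment> \<open>\<open>e\<close> is the t-derivative of t times the j-th component of \<phi> at y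
   + t (x - y), so it integrates to that component at x. Subtracting it from \<open>c\<close> turns
   the derivatives in direction j into the antisymmetric brackets of
   \<open>homotopy_rem\<close>.\<close>
 define e where "e t = \<phi> (y + t *\<^sub>R (x - y)) $ j + of_real t * cdot (grad (%z. \<phi> z $ j) (y + t *\<^sub>R (x - y))) (cvec (x - y))" for t
 have "(e has_integral (of_real 1 * \<phi> (y + 1 *\<^sub>R (x - y)) $ j - of_real 0 * \<phi> (y + 0 *\<^sub>R (x - y)) $ j)) {0..1}"
 proof (rule fundamental_theorem_of_calculus)
  fix t :: real
  have "((%t. complex_of_real t) has_vector_derivative 1) (at t within {0..1})"
   by (auto intro!: derivative_eq_intros)
  from has_vector_derivative_mult[OF this has_vector_derivative_line[OF Ck_differentiable[OF \<phi>]]]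
  show "((%t. of_real t * \<phi> (y + t *\<^sub>R (x - y)) $ j) has_vector_derivative e t) (at t within {0..1})"
   unfolding e_def by (simp add: add.commute)
 qed simp
 then have e: "integral {0..1} e = \<phi> x $ j" "e integrable_on {0..1}" by (auto simp: integral_unique)
 define r where "r = (%t. of_real t * (\<Sum>i\<in>UNIV.
   (pderiv3 j (%z. \<phi> z $ i) (y + t *\<^sub>R (x - y)) - pderiv3 i (%z. \<phi> z $ j) (y + t *\<^sub>R (x - y))) * of_real ((x - y) $ i)))"
 have cr: "continuous_on {0..1} r"
  unfolding r_def by (intro continuous_intros continuous_on_line cd)
 have "c j x = (%t. e t + r t)"
  by (auto simp: fun_eq_iff c_def e_def r_def cdot_def grad_def cvec_def sum_3 algebra_simps)
 then have "integral {0..1} (c j x) = integral {0..1} e + integral {0..1} r"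
  using e integrable_continuous_interval[OF cr] by (simp add: integral_add)
 also have "integral {0..1} r = homotopy_rem \<phi> y x j"
  unfolding homotopy_rem_def r_def[symmetric] using cr by (simp add: uint_eq_integral)
 finally show "pderiv3 j (line_int \<phi> y) x = \<phi> x $ j + homotopy_rem \<phi> y x j" by (simp add: pd e)
qed

lemma curl_component_le:
 "norm (pderiv3 j (%z. \<phi> z $ i) x - pderiv3 i (%z. \<phi> z $ j) x) <= norm (curl \<phi> x)"
proof -
 have "i = 1 \<or> i = 2 \<or> i = 3" "j = 1 \<or> j = 2 \<or> j = 3" using exhaust_3 by auto
 then show ?thesis
  using Finite_Cartesian_Product.norm_nth_le[of "curl \<phi> x" 1] Finite_Cartesian_Product.norm_nth_le[of "curl \<phi> x" 2]
   Finite_Cartesian_Product.norm_nth_le[of "curl \<phi> x" 3]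
  by (auto simp: curl_def norm_minus_commute)
qed

lemma continuous_curl:
 assumes "!!i. Ck (Suc 0) (%z. \<phi> z $ i)"
 shows "continuous_on UNIV (curl \<phi>)"
 unfolding continuous_on_vec_nth_iff using assms
 by (auto simp: curl_def forall_3 intro!: continuous_intros)

lemma homotopy_rem_square_le:
 assumes \<phi>: "!!i. Ck (Suc 0) (%z. \<phi> z $ i)"
 shows "nsq (homotopy_rem \<phi> y x j) <=
  ennreal (9 * (norm (x - y))\<^sup>2) * (NI t. nsq (curl \<phi> (y + t *\<^sub>R (x - y))) * indicator {0..<1} t)"
proof -
 have cd [measurable]: "pderiv3 j (%z. \<phi> z $ i) \<in> borel_measurable borel" for i j using \<phi>
  by (intro borel_measurable_continuous_onI) simp
 have [measurable]: "curl \<phi> \<in> borel_measurable borel"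
  by (intro borel_measurable_continuous_onI continuous_curl \<phi>)
 define r where "r = (%t::real. of_real t * (\<Sum>i\<in>UNIV.
   (pderiv3 j (%z. \<phi> z $ i) (y + t *\<^sub>R (x - y)) - pderiv3 i (%z. \<phi> z $ j) (y + t *\<^sub>R (x - y))) * complex_of_real ((x - y) $ i)))"
 have "nsq (homotopy_rem \<phi> y x j) <= (NI t. nsq (r t) * indicator {0..<1} t)"
  unfolding homotopy_rem_def r_def by (rule norm_uint_square_le) measurable
 also have "\<dots> <= (NI t. ennreal (9 * (norm (x - y))\<^sup>2) * (nsq (curl \<phi> (y + t *\<^sub>R (x - y))) * indicator {0..<1} t))"
 proof (rule nn_integral_mono)
  fix t :: real
  show "nsq (r t) * indicator {0..<1} t <= ennreal (9 * (norm (x - y))\<^sup>2) * (nsq (curl \<phi> (y + t *\<^sub>R (x - y))) * indicator {0..<1} t)"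
  proof (cases "t \<in> {0..<1}")
   case True
   let ?p = "y + t *\<^sub>R (x - y)"
   \<comment> \<open>Three summands, each at most |curl \<phi>| |x - y|; squaring gives the constant
     9.\<close>
   have "norm (\<Sum>i\<in>UNIV. (pderiv3 j (%z. \<phi> z $ i) ?p - pderiv3 i (%z. \<phi> z $ j) ?p) * complex_of_real ((x - y) $ i))
     <= (\<Sum>i\<in>(UNIV::3 set). norm (curl \<phi> ?p) * norm (x - y))"
   proof (rule sum_norm_le)
    fix i
    have "norm (complex_of_real ((x - y) $ i)) <= norm (x - y)"
     unfolding norm_of_real by (rule component_le_norm_cart)
    then show "norm ((pderiv3 j (%z. \<phi> z $ i) ?p - pderiv3 i (%z. \<phi> z $ j) ?p) * complex_of_real ((x - y) $ i)) <= norm (curl \<phi> ?p) * norm (x - y)"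
     unfolding norm_mult by (intro mult_mono curl_component_le) auto
   qed
   then have s: "norm (\<Sum>i\<in>UNIV. (pderiv3 j (%z. \<phi> z $ i) ?p - pderiv3 i (%z. \<phi> z $ j) ?p) * complex_of_real ((x - y) $ i))
     <= 3 * norm (x - y) * norm (curl \<phi> ?p)" unfolding sum_constant by (simp add: mult_ac)
   have "norm (r t) <= 1 * (3 * norm (x - y) * norm (curl \<phi> ?p))"
    unfolding r_def norm_mult using True by (intro mult_mono s) auto
   then have "(norm (r t))\<^sup>2 <= (3 * norm (x - y) * norm (curl \<phi> ?p))\<^sup>2"
    by (intro power_mono) auto
   then have "nsq (r t) <= ennreal (9 * (norm (x - y))\<^sup>2) * nsq (curl \<phi> ?p)"
    by (simp add: power_mult_distrib ennreal_leI flip: ennreal_mult)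
   with True show ?thesis by simp
  qed simp
 qed
 also have "\<dots> = ennreal (9 * (norm (x - y))\<^sup>2) * (NI t. nsq (curl \<phi> (y + t *\<^sub>R (x - y))) * indicator {0..<1} t)"
  by (rule nn_integral_cmult) measurable
 finally show ?thesis .
qed

section \<open>Square-integrable fields\<close>

definition L2field :: "('a::euclidean_space => 'b::euclidean_space) => bool" where
 "L2field f \<longleftrightarrow> f \<in> borel_measurable borel \<and> integrable lborel (%x. (norm (f x))\<^sup>2)"

definition sqn :: "('a::euclidean_space => 'b::euclidean_space) => real" where
 "sqn f = (LI x. (norm (f x))\<^sup>2)"

lemma sqn_nonneg: "sqn f >= 0" by (simp add: sqn_def)

lemma nn_integral_sqn: "L2field f ==> (NI x. nsq (f x)) = ennreal (sqn f)"
 unfolding sqn_def L2field_def by (intro nn_integral_eq_integral) auto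

lemma L2fieldI_nn_integral:
 assumes "f \<in> borel_measurable borel" "(NI x. nsq (f x)) < \<infinity>"
 shows "L2field f"
 using assms unfolding L2field_def by (auto intro!: integrableI_bounded)

lemma sqn_le:
 assumes "f \<in> borel_measurable borel" "(NI x. nsq (f x)) <= ennreal e" "e >= 0"
 shows "L2field f" "sqn f <= e"
proof -
 show "L2field f" using assms by (intro L2fieldI_nn_integral) (auto intro: le_less_trans)
 then show "sqn f <= e" using assms by (simp add: nn_integral_sqn)
qed

lemma L2field_inner:
 assumes "L2field f" "L2field g"
 shows "integrable lborel (%x. f x \<bullet> g x)"
proof (rule Bochner_Integration.integrable_bound)
 show "integrable lborel (%x. (norm (f x))\<^sup>2 + (norm (g x))\<^sup>2)" using assms by (auto simp: L2field_def)
 show "(%x. f x \<bullet> g x) \<in> borel_measurable lborel" using assms by (auto simp: L2field_def)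
 show "AE x in lborel. norm (f x \<bullet> g x) <= norm ((norm (f x))\<^sup>2 + (norm (g x))\<^sup>2)"
 proof (intro always_eventually allI)
  fix x
  have "\<bar>f x \<bullet> g x\<bar> <= norm (f x) * norm (g x)" by (rule Cauchy_Schwarz_ineq2)
  also have "\<dots> <= (norm (f x))\<^sup>2 + (norm (g x))\<^sup>2"
   using sum_squares_bound[of "norm (f x)" "norm (g x)"] mult_nonneg_nonneg[OF norm_ge_zero norm_ge_zero, of "f x" "g x"]
   by linarith
  finally show "norm (f x \<bullet> g x) <= norm ((norm (f x))\<^sup>2 + (norm (g x))\<^sup>2)" by simp
 qed
qed

lemma norm_add_scaleR_square:
 fixes a b :: "'a::real_inner"
 shows "(norm (a + s *\<^sub>R b))\<^sup>2 = (norm a)\<^sup>2 + 2 * s * (a \<bullet> b) + s\<^sup>2 * (norm b)\<^sup>2"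
 using dot_norm[of a "s *\<^sub>R b"] by (simp add: power_mult_distrib)

lemma L2field_add_scaleR:
 assumes "L2field f" "L2field g"
 shows "L2field (%x. f x + s *\<^sub>R g x)"
  and "sqn (%x. f x + s *\<^sub>R g x) = sqn f + 2 * s * (LI x. f x \<bullet> g x) + s\<^sup>2 * sqn g"
 using assms L2field_inner[OF assms] unfolding L2field_def sqn_def norm_add_scaleR_square by auto

lemma L2field_diff:
 assumes "L2field f" "L2field g"
 shows "L2field (%x. f x - g x)"
 using L2field_add_scaleR(1)[OF assms, of "-1"] by simp

text \<open>The squared norm of f + s g is a nonnegative quadratic in s. If g is not null, s is its
  minimizer; otherwise s is a value at which a nonzero linear term would make it negative.\<close>

lemma L2_Cauchy_Schwarz:
 assumes "L2field f" "L2field g"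
 shows "\<bar>(LI x. f x \<bullet> g x)\<bar> <= sqrt (sqn f) * sqrt (sqn g)"
proof -
 define i where "i = (LI x. f x \<bullet> g x)"
 have q: "0 <= sqn f + 2 * s * i + s\<^sup>2 * sqn g" for s
  using L2field_add_scaleR(2)[OF assms, of s] sqn_nonneg[of "%x. f x + s *\<^sub>R g x"] by (simp add: i_def)
 have "i\<^sup>2 <= sqn f * sqn g"
 proof (cases "sqn g = 0")
  case True
  have "i = 0"
  proof (rule ccontr)
   assume "i ~= 0"
   then have "2 * (- (sqn f + 1) / (2 * i)) * i = - (sqn f + 1)" by simp
   then show False using q[of "- (sqn f + 1) / (2 * i)"] True by simp
  qed
  then show ?thesis using True by simp
 next
  case False
  then have "sqn g > 0" using sqn_nonneg[of g] by simp
  moreover from q[of "- i / sqn g"] have "0 <= sqn f - i\<^sup>2 / sqn g"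
   using False by (simp add: power2_eq_square field_simps)
  ultimately show ?thesis by (simp add: field_simps)
 qed
 then have "sqrt (i\<^sup>2) <= sqrt (sqn f * sqn g)" by (rule real_sqrt_le_mono)
 then show ?thesis by (simp add: i_def real_sqrt_mult)
qed

text \<open>Riesz-Fischer. Along a subsequence the squared increments, weighted by 2^k, have a
  finite integrated sum, so at almost every point the increments decay geometrically. Fatou's lemma
  then bounds the distance of the whole sequence to the limit.\<close>

lemma L2_complete:
 fixes f :: "nat => 'a::euclidean_space => 'b::euclidean_space"
 assumes f: "!!n. L2field (f n)"
  and cauchy: "!!e. e > 0 ==> \<exists>N. \<forall>m\<ge>N. \<forall>n\<ge>N. sqn (%x. f m x - f n x) <= e"
 obtains g where "L2field g" "(%n. sqn (%x. f n x - g x)) \<longlonglongrightarrow> 0"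
proof -
 have [measurable]: "f n \<in> borel_measurable borel" for n using f by (auto simp: L2field_def)
 obtain N where N: "!!e m n. e > 0 ==> m >= N e ==> n >= N e ==> sqn (%x. f m x - f n x) <= e"
  using cauchy by metis
 \<comment> \<open>Adding up the thresholds, plus 1 each time, makes \<open>r\<close> increasing
   with both r(k) >= k and r(k) >= \<open>N ((1 / 4) ^ k)\<close>.\<close>
 define r where "r k = (\<Sum>i\<le>k. N ((1 / 4) ^ i) + 1)" for k
 have rN: "r k >= N ((1 / 4) ^ k)" for k
 proof -
  have "N ((1 / 4) ^ k) + 1 <= r k" unfolding r_def by (rule member_le_sum[of k "{..k}" "%i. N ((1 / 4) ^ i) + 1"]) auto
  then show ?thesis by simp
 qed
 have rk: "r k >= k" for k by (induction k) (auto simp: r_def)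
 have rmono: "r k <= r (Suc k)" for k by (simp add: r_def)
 have r': "r (Suc k) >= N ((1 / 4) ^ k)" for k using rN[of k] rmono[of k] by simp
 define h where "h k x = ennreal (2 ^ k) * nsq (f (r (Suc k)) x - f (r k) x)" for k x
 have [measurable]: "h k \<in> borel_measurable lborel" for k unfolding h_def by measurable
 have ih: "(NI x. h k x) <= ennreal ((1 / 2) ^ k)" for k
 proof -
  have "(NI x. h k x) = ennreal (2 ^ k) * (NI x. nsq (f (r (Suc k)) x - f (r k) x))"
   unfolding h_def by (rule nn_integral_cmult) measurable
  also have "\<dots> = ennreal (2 ^ k * sqn (%x. f (r (Suc k)) x - f (r k) x))"
   by (simp add: nn_integral_sqn[OF L2field_diff[OF f f]] ennreal_mult sqn_nonneg)
  also have "\<dots> <= ennreal (2 ^ k * (1 / 4) ^ k)"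
   using N[OF _ r' rN] by (intro ennreal_leI mult_left_mono) auto
  also have "2 ^ k * (1 / 4) ^ k = ((1 / 2) ^ k :: real)" by (simp flip: power_mult_distrib)
  finally show ?thesis .
 qed
 have "(NI x. (\<Sum>k. h k x)) = (\<Sum>k. NI x. h k x)"
  by (rule nn_integral_suminf) measurable
 also have "\<dots> <= (\<Sum>k. ennreal ((1 / 2) ^ k))" by (intro suminf_le ih) auto
 also have "\<dots> = ennreal (\<Sum>k. (1 / 2) ^ k)" by (intro suminf_ennreal2) (auto simp: summable_geometric)
 also have "\<dots> < \<infinity>" by simp
 finally have "AE x in lborel. (\<Sum>k. h k x) ~= \<infinity>" by (intro nn_integral_PInf_AE) auto
 then have conv: "AE x in lborel. convergent (%k. f (r k) x)"
 proof eventually_elim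
  case (elim x)
  define S where "S = enn2real (\<Sum>k. h k x)"
  have S: "(\<Sum>k. h k x) = ennreal S" using elim by (simp add: S_def less_top)
  have S0: "S >= 0" by (simp add: S_def)
  have hk: "norm (f (r (Suc k)) x - f (r k) x) <= sqrt S * sqrt (1 / 2) ^ k" for k
  proof -
   have "h k x = sum (%k. h k x) {k}" by simp
   also have "\<dots> <= (\<Sum>k. h k x)" by (rule sum_le_suminf) auto
   also have "\<dots> = ennreal S" by (rule S)
   finally have "ennreal (2 ^ k * (norm (f (r (Suc k)) x - f (r k) x))\<^sup>2) <= ennreal S"
    unfolding h_def by (simp add: ennreal_mult)
   then have "2 ^ k * (norm (f (r (Suc k)) x - f (r k) x))\<^sup>2 <= S" using S0 by simp
   then have "(norm (f (r (Suc k)) x - f (r k) x))\<^sup>2 <= S * (1 / 2) ^ k"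
    by (simp add: field_simps)
   then have "sqrt ((norm (f (r (Suc k)) x - f (r k) x))\<^sup>2) <= sqrt (S * (1 / 2) ^ k)" by (rule real_sqrt_le_mono)
   then show ?thesis by (simp add: real_sqrt_mult real_sqrt_power)
  qed
  have "summable (%k. sqrt S * sqrt (1 / 2) ^ k)"
   by (intro summable_mult summable_geometric) (simp add: real_less_lsqrt)
  then have "summable (%k. f (r (Suc k)) x - f (r k) x)"
   by (rule summable_comparison_test'[where N = 0]) (use hk in auto)
  then have "convergent (%n. \<Sum>k<n. f (r (Suc k)) x - f (r k) x)"
   by (simp add: summable_iff_convergent)
  then have "convergent (%n. f (r n) x - f (r 0) x)" by (simp add: sum_lessThan_telescope[of "%k. f (r k) x"])
  then have "convergent (%n. (f (r n) x - f (r 0) x) + f (r 0) x)"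
   by (intro convergent_add convergent_const)
  then show ?case by simp
 qed
 define g where "g x = lim (%k. f (r k) x)" for x
 have g [measurable]: "g \<in> borel_measurable borel"
  unfolding g_def using borel_measurable_lim_metric[of "%k. f (r k)" borel] by simp
 have lim: "AE x in lborel. (%k. f (r k) x) \<longlonglongrightarrow> g x"
  using conv by eventually_elim (simp add: g_def convergent_LIMSEQ_iff)
 have dist: "L2field (%x. f n x - g x) \<and> sqn (%x. f n x - g x) <= e" if e: "e > 0" "n >= N e" for e n
 proof -
  have "(NI x. nsq (f n x - g x)) = (NI x. liminf (%k. nsq (f n x - f (r k) x)))"
  proof (rule nn_integral_cong_AE)
   show "AE x in lborel. nsq (f n x - g x) = liminf (%k. nsq (f n x - f (r k) x))"
    using lim
   proof eventually_elim
    case (elim x)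
    have "(%k. nsq (f n x - f (r k) x)) \<longlonglongrightarrow> nsq (f n x - g x)"
     by (intro tendsto_ennrealI tendsto_intros elim)
    from lim_imp_Liminf[OF _ this] show ?case by simp
   qed
  qed
  also have "\<dots> <= liminf (%k. NI x. nsq (f n x - f (r k) x))"
   by (rule nn_integral_liminf) measurable
  also have "\<dots> = liminf (%k. ennreal (sqn (%x. f n x - f (r k) x)))"
   by (simp add: nn_integral_sqn[OF L2field_diff[OF f f]])
  also have "\<dots> <= ennreal e"
  proof -
   have "\<forall>\<^sub>F k in sequentially. ennreal (sqn (%x. f n x - f (r k) x)) <= ennreal e"
    using eventually_ge_at_top[of "N e"]
   proof eventually_elim
    case (elim k)
    then show ?case using N[OF e(1,2), of "r k"] rk[of k] by (intro ennreal_leI) simp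
   qed
   then show ?thesis by (intro Liminf_le) auto
  qed
  finally have "(NI x. nsq (f n x - g x)) <= ennreal e" .
  from sqn_le[OF _ this] e show ?thesis by simp
 qed
 show ?thesis
 proof (rule that[of g])
  have "L2field (%x. f (N 1) x - g x)"
   using dist[of 1 "N 1"] by simp
  from L2field_diff[OF f[of "N 1"] this] show "L2field g" by simp
  show "(%n. sqn (%x. f n x - g x)) \<longlonglongrightarrow> 0"
  proof (rule LIMSEQ_I)
   fix e :: real assume e: "e > 0"
   have "norm (sqn (%x. f n x - g x) - 0) < e" if "n >= N (e / 2)" for n
    using dist[of "e / 2" n] that e sqn_nonneg[of "%x. f n x - g x"] by auto
   then show "\<exists>n0. \<forall>n\<ge>n0. norm (sqn (%x. f n x - g x) - 0) < e" by blast
  qed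
 qed
qed

text \<open>\<open>P\<close> is the graph of a bounded real functional on a subspace; pairs instead
  of a function avoid choosing a \<phi> for a given curl \<phi>. The expression |f|^2 - 2 a is
  minimized, and the parallelogram identity makes a minimizing sequence Cauchy. The sequence is
  returned as well, to witness that \<psi> lies in the closure.\<close>

lemma riesz_L2:
 fixes P :: "(('a::euclidean_space => 'b::euclidean_space) \<times> real) set"
 assumes ne: "(%_. 0, 0) \<in> P"
  and L2: "!!f a. (f, a) \<in> P ==> L2field f"
  and lin: "!!f a g b s. (f, a) \<in> P ==> (g, b) \<in> P ==> (%x. f x + s *\<^sub>R g x, a + s * b) \<in> P"
  and bnd: "!!f a. (f, a) \<in> P ==> \<bar>a\<bar> <= C * sqrt (sqn f)"
 obtains \<psi> p where "L2field \<psi>" "!!n. p n \<in> P" "(%n. sqn (%x. fst (p n) x - \<psi> x)) \<longlonglongrightarrow> 0"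
  "!!f a. (f, a) \<in> P ==> (LI x. \<psi> x \<bullet> f x) = a"
proof -
 define J where "J p = sqn (fst p) - 2 * snd p" for p :: "('a => 'b) \<times> real"
 have Jge: "- C\<^sup>2 <= J p" if "p \<in> P" for p
 proof -
  obtain f a where p: "p = (f, a)" by (cases p)
  have "0 <= (sqrt (sqn f) - C)\<^sup>2" by simp
  then have "0 <= sqn f - 2 * (C * sqrt (sqn f)) + C\<^sup>2"
   by (simp add: power2_diff sqn_nonneg mult.commute)
  moreover have "a <= C * sqrt (sqn f)" using bnd[of f a] that p by auto
  ultimately show ?thesis by (simp add: J_def p)
 qed
 define m where "m = Inf (J ` P)"
 have bdd: "bdd_below (J ` P)" using Jge by (intro bdd_belowI[of _ "- C\<^sup>2"]) auto
 have mle: "m <= J p" if "p \<in> P" for p unfolding m_def using bdd that by (intro cInf_lower) auto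
 have "\<exists>p\<in>P. J p < m + 1 / real (Suc n)" for n
 proof -
  have "m < m + 1 / real (Suc n)" by simp
  then show ?thesis using cInf_less_iff[of "J ` P" "m + 1 / real (Suc n)"] bdd ne unfolding m_def by blast
 qed
 then obtain p where p: "!!n. p n \<in> P" "!!n. J (p n) < m + 1 / real (Suc n)" by metis
 define f where "f n = fst (p n)" for n
 define a where "a n = snd (p n)" for n
 have fa: "(f n, a n) \<in> P" for n using p(1)[of n] by (simp add: f_def a_def)
 have fL: "L2field (f n)" for n using L2[OF fa] .
 have J: "J (p n) = sqn (f n) - 2 * a n" for n by (simp add: J_def f_def a_def)
 have par: "sqn (%x. f j x - f k x) <= 2 / real (Suc j) + 2 / real (Suc k)" for j k
 proof -
  let ?i = "LI x. f j x \<bullet> f k x"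
  \<comment> \<open>The closure rule has the form f + s g, so half of \<open>f j\<close> is obtained
    as f - f/2.\<close>
  have "(%x. f j x + (- 1 / 2) *\<^sub>R f j x, a j + (- 1 / 2) * a j) \<in> P" by (rule lin[OF fa fa])
  from lin[OF this fa, of "1 / 2" k]
  have mid: "(%x. (1 / 2) *\<^sub>R f j x + (1 / 2) *\<^sub>R f k x, (1 / 2) * a j + (1 / 2) * a k) \<in> P"
   by (rule back_subst[of "%q. q \<in> P"]) (auto simp: fun_eq_iff algebra_simps simp flip: scaleR_left.add scaleR_add_left)
  have half: "L2field (%x. (1 / 2) *\<^sub>R f j x)" "sqn (%x. (1 / 2) *\<^sub>R f j x) = (1 / 4) * sqn (f j)"
   "(LI x. ((1 / 2) *\<^sub>R f j x) \<bullet> f k x) = (1 / 2) * ?i"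
   using fL[of j] by (auto simp: L2field_def sqn_def power_divide)
  have "m <= sqn (%x. (1 / 2) *\<^sub>R f j x + (1 / 2) *\<^sub>R f k x) - (a j + a k)"
   using mle[OF mid] by (simp add: J_def)
  also have "sqn (%x. (1 / 2) *\<^sub>R f j x + (1 / 2) *\<^sub>R f k x) = (1 / 4) * sqn (f j) + (1 / 2) * ?i + (1 / 4) * sqn (f k)"
   using L2field_add_scaleR(2)[OF half(1) fL[of k], of "1 / 2"] half(2,3) by (simp add: power_divide)
  finally have m: "m <= (1 / 4) * sqn (f j) + (1 / 2) * ?i + (1 / 4) * sqn (f k) - (a j + a k)" .
  have "sqn (%x. f j x - f k x) = sqn (f j) - 2 * ?i + sqn (f k)"
   using L2field_add_scaleR(2)[OF fL[of j] fL[of k], of "- 1"] by simp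
  also have "\<dots> = 2 * J (p j) + 2 * J (p k) - 4 * ((1 / 4) * sqn (f j) + (1 / 2) * ?i + (1 / 4) * sqn (f k) - (a j + a k))"
   by (simp add: J algebra_simps)
  also have "\<dots> <= 2 * (m + 1 / real (Suc j)) + 2 * (m + 1 / real (Suc k)) - 4 * m"
  proof -
   have "2 * A + 2 * B - 4 * X <= 2 * (m + c) + 2 * (m + d) - 4 * m" if "A < m + c" "B < m + d" "m <= X" for A B X c d
    using that(1,2) mult_left_mono[OF that(3), of 4] by (simp add: algebra_simps)
   then show ?thesis using p(2) m by blast
  qed
  finally show ?thesis by simp
 qed
 have lim0: "(%n. 4 / real (Suc n)) \<longlonglongrightarrow> 0"
  using tendsto_mult[OF tendsto_const[of 4] LIMSEQ_inverse_real_of_nat] by (simp add: divide_inverse)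
 have "\<exists>N. \<forall>j\<ge>N. \<forall>k\<ge>N. sqn (%x. f j x - f k x) <= e" if "e > 0" for e
 proof -
  obtain N where N: "4 / real (Suc N) < e"
   using order_tendstoD(2)[OF lim0 \<open>e > 0\<close>] by (auto simp: eventually_sequentially)
  have le: "2 / real (Suc j) <= 2 / real (Suc N)" if "j >= N" for j
   using that by (intro divide_left_mono) auto
  have "sqn (%x. f j x - f k x) <= e" if "j >= N" "k >= N" for j k
  proof -
   have "2 / real (Suc N) + 2 / real (Suc N) = 4 / real (Suc N)" by (simp flip: add_divide_distrib)
   with le[OF that(1)] le[OF that(2)] par[of j k] N show ?thesis by linarith
  qed
  then show ?thesis by blast
 qed
 then obtain \<psi> where \<psi>: "L2field \<psi>" "(%n. sqn (%x. f n x - \<psi> x)) \<longlonglongrightarrow> 0"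
  using L2_complete[of f, OF fL] by blast
 have "(LI x. \<psi> x \<bullet> h x) = b" if hb: "(h, b) \<in> P" for h b
 proof -
  have hL: "L2field h" by (rule L2[OF hb])
  define I where "I = (LI x. \<psi> x \<bullet> h x)"
  have "(%n. (LI x. f n x \<bullet> h x) - I) \<longlonglongrightarrow> 0"
  proof (rule tendsto_rabs_zero_cancel, rule tendsto_sandwich)
   show "\<forall>\<^sub>F n in sequentially. 0 <= \<bar>(LI x. f n x \<bullet> h x) - I\<bar>" by simp
   show "\<forall>\<^sub>F n in sequentially. \<bar>(LI x. f n x \<bullet> h x) - I\<bar> <= sqrt (sqn (%x. f n x - \<psi> x)) * sqrt (sqn h)"
   proof (intro always_eventually allI)
    fix n
    have "(LI x. f n x \<bullet> h x) - I = (LI x. (f n x - \<psi> x) \<bullet> h x)"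
     unfolding I_def using L2field_inner[OF fL hL] L2field_inner[OF \<psi>(1) hL] by (simp add: inner_diff_left)
    then show "\<bar>(LI x. f n x \<bullet> h x) - I\<bar> <= sqrt (sqn (%x. f n x - \<psi> x)) * sqrt (sqn h)"
     using L2_Cauchy_Schwarz[OF L2field_diff[OF fL \<psi>(1)] hL] by simp
   qed
   have "(%n. sqrt (sqn (%x. f n x - \<psi> x)) * sqrt (sqn h)) \<longlonglongrightarrow> sqrt 0 * sqrt (sqn h)"
    by (intro tendsto_intros \<psi>)
   then show "(%n. sqrt (sqn (%x. f n x - \<psi> x)) * sqrt (sqn h)) \<longlonglongrightarrow> 0" by simp
  qed simp
  then have limI: "(%n. LI x. f n x \<bullet> h x) \<longlonglongrightarrow> I" by (rule LIM_zero_cancel)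
  \<comment> \<open>First variation of the minimization in direction h, in the limit of large n. A
    quadratic in s without constant term is nonnegative for all s only if its linear coefficient
    vanishes.\<close>
  have key: "0 <= 2 * s * (I - b) + s\<^sup>2 * sqn h" for s
  proof -
   have "0 <= 1 / real (Suc n) + 2 * s * ((LI x. f n x \<bullet> h x) - b) + s\<^sup>2 * sqn h" for n
   proof -
    have "m <= sqn (%x. f n x + s *\<^sub>R h x) - 2 * (a n + s * b)"
     using mle[OF lin[OF fa hb]] by (simp add: J_def)
    also have "\<dots> = J (p n) + 2 * s * ((LI x. f n x \<bullet> h x) - b) + s\<^sup>2 * sqn h"
     using L2field_add_scaleR(2)[OF fL hL, of n s] by (simp add: J algebra_simps)
    finally show ?thesis using p(2)[of n] by linarith
   qed
   moreover have "(%n. 1 / real (Suc n) + 2 * s * ((LI x. f n x \<bullet> h x) - b) + s\<^sup>2 * sqn h) \<longlonglongrightarrow> 0 + 2 * s * (I - b) + s\<^sup>2 * sqn h"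
    using LIMSEQ_inverse_real_of_nat by (intro tendsto_intros limI) (simp add: divide_inverse)
   ultimately show ?thesis by (intro LIMSEQ_le_const[of _ _ 0]) auto
  qed
  have "I = b"
  proof (rule ccontr)
   assume ne: "I ~= b"
   show False
   proof (cases "sqn h = 0")
    case True
    define d where "d = I - b"
    have "d ~= 0" using ne by (simp add: d_def)
    then show False using key[of "- 1 / d", folded d_def] True by simp
   next
    case False
    then have pos: "sqn h > 0" using sqn_nonneg[of h] by simp
    have "2 * (- (I - b) / sqn h) * (I - b) + (- (I - b) / sqn h)\<^sup>2 * sqn h = - ((I - b)\<^sup>2 / sqn h)"
     using pos by (simp add: power2_eq_square field_simps)
    then have "0 <= - ((I - b)\<^sup>2 / sqn h)" using key[of "- (I - b) / sqn h"] by simp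
    moreover have "(I - b)\<^sup>2 / sqn h > 0" using pos ne by simp
    ultimately show False by simp
   qed
  qed
  then show ?thesis by (simp add: I_def)
 qed
 then show ?thesis using that[of \<psi> p] \<psi> p(1) by (simp add: f_def)
qed

section \<open>Divergence-free fields and reflection in a Lipschitz graph\<close>

lemma norm_vec3_le:
 fixes x :: "'a::real_normed_vector^3"
 assumes "!!i. norm (x $ i) <= c"
 shows "norm x <= 3 * c"
proof -
 have "norm x <= (\<Sum>i\<in>UNIV. norm (x $ i))" unfolding norm_vec_def by (rule L2_set_le_sum) simp
 also have "\<dots> <= (\<Sum>i\<in>(UNIV::3 set). c)" by (intro sum_mono assms)
 finally show ?thesis by simp
qed

lemma norm_grad_has_derivative:
 assumes "f differentiable (at x)"
 shows "(f has_derivative (%h. cdot (grad f x) (cvec h))) (at x)"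
 unfolding cdot_grad_cvec by (rule has_derivative_pderiv3[OF assms])

text \<open>Fields are extended by zero. Integrability is asked instead of square integrability,
  which a field in the weighted space may lack at the origin.\<close>

definition divfree :: "(real^3) set => (real^3 => complex^3) => bool" where
 "divfree \<Omega> u \<longleftrightarrow> integrable lborel u \<and> (\<forall>x. x \<notin> \<Omega> --> u x = 0) \<and>
   (\<forall>\<phi>\<in>test_functions \<Omega>. (LI x. cdot (u x) (grad \<phi> x)) = 0)"

lemma integrable_cdot_bounded:
 assumes u: "integrable lborel u" and v: "v \<in> borel_measurable borel" "!!x. norm (v x) <= B"
 shows "integrable lborel (%x::real^3. cdot (u x) (v x))"
proof (rule Bochner_Integration.integrable_bound)
 show "integrable lborel (%x. B * norm (u x))" using u by simp
 have [measurable]: "u \<in> borel_measurable borel" "v \<in> borel_measurable borel" using u v by auto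
 show "(%x. cdot (u x) (v x)) \<in> borel_measurable lborel" by simp
 show "AE x in lborel. norm (cdot (u x) (v x)) <= norm (B * norm (u x))"
 proof (intro always_eventually allI)
  fix x
  have "norm (cdot (u x) (v x)) <= norm (u x) * norm (v x)" by (rule norm_cdot_le)
  also have "\<dots> <= norm (u x) * B" by (intro mult_left_mono v) auto
  also have "\<dots> <= norm (B * norm (u x))" by (simp add: mult.commute)
  finally show "norm (cdot (u x) (v x)) <= norm (B * norm (u x))" .
 qed
qed

lemma grad_bounded_compact_support:
 assumes f: "Ck (Suc 0) f" and K: "compact K" "!!x. x \<notin> K ==> f x = 0"
 obtains B where "B > 0" "!!x. norm (grad f x) <= B"
proof (rule bounded_compact_support[OF continuous_grad[OF f] K(1)])
 show "grad f x = 0" if "x \<notin> K" for x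
  using pderiv3_zero_off_support[OF compact_imp_closed[OF K(1)] K(2) that] by (simp add: grad_def vec_eq_iff)
qed (rule that)

lemma borel_grad: "Ck (Suc 0) f ==> grad f \<in> borel_measurable borel"
 by (intro borel_measurable_continuous_onI continuous_grad)

lemma compact_thicken:
 fixes K \<Omega> :: "(real^3) set"
 assumes "compact K" "open \<Omega>" "K \<subseteq> \<Omega>"
 obtains \<epsilon> where "\<epsilon> > 0" "compact {x + y | x y. x \<in> K \<and> y \<in> cball 0 \<epsilon>}" "{x + y | x y. x \<in> K \<and> y \<in> cball 0 \<epsilon>} \<subseteq> \<Omega>"
proof -
 obtain e where e: "e > 0" "(\<Union>x\<in>K. cball x e) \<subseteq> \<Omega>"
  using compact_subset_open_imp_cball_epsilon_subset[OF assms] by blast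
 have "{x + y | x y. x \<in> K \<and> y \<in> cball 0 e} \<subseteq> (\<Union>x\<in>K. cball x e)" by (auto simp: dist_norm)
 with e have "{x + y | x y. x \<in> K \<and> y \<in> cball 0 e} \<subseteq> \<Omega>" by (rule_tac order_trans)
 with e(1) show ?thesis using compact_sums[OF assms(1) compact_cball] by (intro that)
qed

lemma (in mollifier) conv_test_function:
 assumes h: "integrable lborel h" "!!x. x \<notin> K ==> h x = 0"
  and K: "compact {x + y | x y. x \<in> K \<and> y \<in> cball 0 \<epsilon>0}" "{x + y | x y. x \<in> K \<and> y \<in> cball 0 \<epsilon>0} \<subseteq> \<Omega>"
  and "\<epsilon> <= \<epsilon>0"
 shows "conv cm h \<in> test_functions \<Omega>"
proof -
 let ?K = "{x + y | x y. x \<in> K \<and> y \<in> cball 0 \<epsilon>0}"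
 have "conv cm h x = 0" if "x \<notin> ?K" for x
 proof (rule conv_eq_0, rule h(2))
  fix y assume "norm (x - y) < \<epsilon>"
  then have "x - y \<in> cball 0 \<epsilon>0" using assms(5) by simp
  then have "y + (x - y) \<in> ?K" if "y \<in> K" using that by blast
  then show "y \<notin> K" using that by auto
 qed
 then show ?thesis unfolding test_functions_def using smooth_conv_cm[OF h(1)] K by blast
qed

text \<open>f and F differ only on a compact subset of \<Omega>, so their mollified difference is a
  test function and the pairing may be moved from f to F. There the local Lipschitz constant M of F
  bounds each partial derivative of the mollification, whence the factor 3. This admits an F that is
  not differentiable, as composition with a folding along a Lipschitz graph produces.\<close>

lemma divfree_gradient_estimate:
 assumes \<Omega>: "open \<Omega>" and u: "divfree \<Omega> u"
  and f: "Ck (Suc 0) f" "compact Kf" "!!x. x \<notin> Kf ==> f x = 0"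
  and F: "continuous_on UNIV F" "compact KF" "!!x. x \<notin> KF ==> F x = 0"
  and Kc: "compact Kc" "Kc \<subseteq> \<Omega>" "!!x. x \<notin> Kc ==> f x = F x"
  and M: "M \<in> borel_measurable borel" "!!x. 0 <= M x" "!!x. M x <= B"
  and lip: "!!e. e > 0 ==> \<exists>d>0. \<forall>x a b. norm (a - x) < d --> norm (b - x) < d --> norm (F a - F b) <= (M x + e) * norm (a - b)"
 shows "norm (LI x. cdot (u x) (grad f x)) <= 3 * (LI x. norm (u x) * M x)"
proof -
 have ui: "integrable lborel u" using u by (simp add: divfree_def)
 have [measurable]: "u \<in> borel_measurable borel" "M \<in> borel_measurable borel" using ui M by auto
 have uM: "integrable lborel (%x. norm (u x) * M x)"
 proof (rule Bochner_Integration.integrable_bound)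
  show "integrable lborel (%x. B * norm (u x))" using ui by simp
  show "AE x in lborel. norm (norm (u x) * M x) <= norm (B * norm (u x))"
  proof (intro always_eventually allI)
   fix x
   have "0 <= B" using M(2,3)[of x] by linarith
   then show "norm (norm (u x) * M x) <= norm (B * norm (u x))"
    using mult_left_mono[OF M(3)[of x] norm_ge_zero[of "u x"]] M(2)[of x] by (simp add: abs_mult mult.commute)
  qed
 qed simp
 define I where "I = (LI x. norm (u x))"
 have fi: "integrable lborel f" by (rule integrable_compact_support[OF Ck_continuous[OF f(1)] f(2,3)])
 have Fi: "integrable lborel F" by (rule integrable_compact_support[OF F])
 obtain Bf where Bf: "Bf > 0" "!!x. norm (grad f x) <= Bf" using grad_bounded_compact_support[OF f] by metis
 obtain \<epsilon>0 where \<epsilon>0: "\<epsilon>0 > 0" "compact {x + y | x y. x \<in> Kc \<and> y \<in> cball 0 \<epsilon>0}" "{x + y | x y. x \<in> Kc \<and> y \<in> cball 0 \<epsilon>0} \<subseteq> \<Omega>"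
  using compact_thicken[OF Kc(1) \<Omega> Kc(2)] by blast
 have main: "norm (LI x. cdot (u x) (grad f x)) <= 3 * (LI x. norm (u x) * M x) + 6 * I * e" if e: "e > 0" for e
 proof -
  obtain d1 where d1: "d1 > 0" "!!x a b. norm (a - x) < d1 ==> norm (b - x) < d1 ==> norm (F a - F b) <= (M x + e) * norm (a - b)"
   using lip[OF e] by blast
  have e2: "e / 2 > 0" using e by simp
  obtain d2 where d2: "d2 > 0" "!!z h. norm h < d2 ==> norm (f (z + h) - f z - (\<Sum>i\<in>UNIV. h $ i *\<^sub>R pderiv3 i f z)) <= (e / 2) * norm h"
   using uniform_differentiability_compact_support[OF f e2] by metis
  have "\<exists>d>0. \<forall>x y. norm (x - y) < d --> norm (pderiv3 i f x - pderiv3 i f y) < e / 2" for i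
  proof -
   have "continuous_on UNIV (pderiv3 i f)" using f by simp
   from uniform_continuity_compact_support[OF this f(2) pderiv3_zero_off_support[OF compact_imp_closed[OF f(2)] f(3)] e2]
   show ?thesis by metis
  qed
  then obtain d3 where d3: "!!i. d3 i > 0" "!!i x y. norm (x - y) < d3 i ==> norm (pderiv3 i f x - pderiv3 i f y) < e / 2"
   by metis
  \<comment> \<open>\<open>\<epsilon>0\<close> keeps the mollified difference supported in \<Omega>;
    d1 / 2 leaves room for the increments, also below d1 / 2, in the difference quotients of F;
    \<open>d3\<close> freezes the derivatives of f.\<close>
  define \<epsilon> where "\<epsilon> = Min {\<epsilon>0, d1 / 2, d3 1, d3 2, d3 3}"
  have \<epsilon>: "\<epsilon> > 0" "\<epsilon> <= \<epsilon>0" "\<epsilon> <= d1 / 2" "!!i. \<epsilon> <= d3 i"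
  proof -
   show "\<epsilon> > 0" "\<epsilon> <= \<epsilon>0" "\<epsilon> <= d1 / 2" using \<epsilon>0(1) d1(1) d3(1) by (auto simp: \<epsilon>_def)
   fix i :: 3 show "\<epsilon> <= d3 i" using exhaust_3[of i] by (auto simp: \<epsilon>_def)
  qed
  obtain m where "is_mollifier \<epsilon> m" using mollifier_exists[OF \<epsilon>(1)] by blast
  then interpret mollifier \<epsilon> m by unfold_locales
  have cf: "norm (pderiv3 i (conv cm f) x - pderiv3 i f x) <= e" for i x
  proof (rule pderiv3_conv_close[OF fi d2(1)])
   fix y and s :: real assume y: "norm (x - y) < \<epsilon>" and s: "\<bar>s\<bar> < d2"
   have 1: "norm (f (y + s *\<^sub>R axis i 1) - f y - s *\<^sub>R pderiv3 i f y) <= (e / 2) * \<bar>s\<bar>"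
   proof -
    have "(\<Sum>j\<in>UNIV. (s *\<^sub>R axis i 1) $ j *\<^sub>R pderiv3 j f y) = s *\<^sub>R (\<Sum>j\<in>UNIV. axis i 1 $ j *\<^sub>R pderiv3 j f y)"
     by (simp add: scaleR_sum_right)
    then show ?thesis using d2(2)[of "s *\<^sub>R axis i 1" y] s unfolding sum_axis_scaleR by (simp add: norm_axis_1)
   qed
   have "norm (pderiv3 i f y - pderiv3 i f x) < e / 2"
    using y \<epsilon>(4)[of i] by (intro d3(2)) (simp add: norm_minus_commute)
   then have 2: "norm (s *\<^sub>R (pderiv3 i f y - pderiv3 i f x)) <= (e / 2) * \<bar>s\<bar>"
    using mult_left_mono[of "norm (pderiv3 i f y - pderiv3 i f x)" "e / 2" "\<bar>s\<bar>"] unfolding norm_scaleR by (simp add: mult.commute)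
   have "f (y + s *\<^sub>R axis i 1) - f y - of_real s * pderiv3 i f x =
    (f (y + s *\<^sub>R axis i 1) - f y - s *\<^sub>R pderiv3 i f y) + s *\<^sub>R (pderiv3 i f y - pderiv3 i f x)"
    by (simp add: scaleR_conv_of_real algebra_simps)
   also have "norm \<dots> <= (e / 2) * \<bar>s\<bar> + (e / 2) * \<bar>s\<bar>"
    by (rule order_trans[OF norm_triangle_ineq add_mono[OF 1 2]])
   finally show "norm (f (y + s *\<^sub>R axis i 1) - f y - of_real s * pderiv3 i f x) <= e * \<bar>s\<bar>" by simp
  qed
  have cF: "norm (pderiv3 i (conv cm F) x) <= M x + e" for i x
  proof -
   have "d1 / 2 > 0" using d1 by simp
   have "norm (pderiv3 i (conv cm F) x - 0) <= M x + e"
   proof (rule pderiv3_conv_close[OF Fi \<open>d1 / 2 > 0\<close>])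
    fix y and s :: real assume y: "norm (x - y) < \<epsilon>" and s: "\<bar>s\<bar> < d1 / 2"
    have yx: "norm (y - x) < d1 / 2" using y \<epsilon>(3) by (simp add: norm_minus_commute)
    have "norm (y + s *\<^sub>R axis i 1 - x) <= norm (y - x) + norm (s *\<^sub>R axis i (1::real))"
     using norm_triangle_ineq[of "y - x" "s *\<^sub>R axis i 1"] by (simp add: algebra_simps)
    also have "\<dots> < d1" using yx s by (simp add: norm_axis_1)
    finally have "norm (F (y + s *\<^sub>R axis i 1) - F y) <= (M x + e) * norm (y + s *\<^sub>R axis i 1 - y)"
     using yx d1(1) by (intro d1(2)) auto
    then show "norm (F (y + s *\<^sub>R axis i 1) - F y - of_real s * 0) <= (M x + e) * \<bar>s\<bar>"
     by (simp add: norm_axis_1)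
   qed
   then show ?thesis by simp
  qed
  have sm: "smooth (conv cm f)" "smooth (conv cm F)" using smooth_conv_cm fi Fi by auto
  have gb: "grad (conv cm f) \<in> borel_measurable borel" "grad (conv cm F) \<in> borel_measurable borel" "grad f \<in> borel_measurable borel"
   using borel_grad smooth_Ck[OF sm(1)] smooth_Ck[OF sm(2)] f(1) by blast+
  have n1: "norm (grad (conv cm f) x - grad f x) <= 3 * e" for x
   by (rule norm_vec3_le) (simp add: grad_def cf)
  have n2: "norm (grad (conv cm F) x) <= 3 * (M x + e)" for x
   by (rule norm_vec3_le) (simp add: grad_def cF)
  have n2': "norm (grad (conv cm F) x) <= 3 * (B + e)" for x using n2[of x] M(3)[of x] by simp
  have n1': "norm (grad (conv cm f) x) <= 3 * e + Bf" for x
   using norm_triangle_ineq[of "grad (conv cm f) x - grad f x" "grad f x"] n1[of x] Bf(2)[of x] by simp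
  have if1: "integrable lborel (%x. cdot (u x) (grad (conv cm f) x))" by (rule integrable_cdot_bounded[OF ui gb(1) n1'])
  have if2: "integrable lborel (%x. cdot (u x) (grad (conv cm F) x))" by (rule integrable_cdot_bounded[OF ui gb(2) n2'])
  have if3: "integrable lborel (%x. cdot (u x) (grad f x))" by (rule integrable_cdot_bounded[OF ui gb(3) Bf(2)])
  have "conv cm (%x. f x - F x) \<in> test_functions \<Omega>"
   using Kc(3) fi Fi by (intro conv_test_function[OF _ _ \<epsilon>0(2,3) \<epsilon>(2)]) auto
  then have "(LI x. cdot (u x) (grad (conv cm (%x. f x - F x)) x)) = 0" using u by (simp add: divfree_def)
  moreover have "grad (conv cm (%x. f x - F x)) x = grad (conv cm f) x - grad (conv cm F) x" for x
  proof -
   have "conv cm (%x. f x - F x) = (%x. conv cm f x - conv cm F x)"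
    using conv_diff[OF compactly_supported_axioms fi Fi] by blast
   then show ?thesis by (simp add: grad_def vec_eq_iff pderiv3_diff smooth_differentiable[OF sm(1)] smooth_differentiable[OF sm(2)])
  qed
  ultimately have eq: "(LI x. cdot (u x) (grad (conv cm f) x)) = (LI x. cdot (u x) (grad (conv cm F) x))"
   using if1 if2 by (simp add: cdot_diff_right)
  have "(LI x. cdot (u x) (grad f x)) = (LI x. cdot (u x) (grad (conv cm F) x) - (cdot (u x) (grad (conv cm f) x) - cdot (u x) (grad f x)))"
   using if1 if2 if3 eq by simp
  also have "norm \<dots> <= (LI x. 3 * (norm (u x) * M x) + 6 * e * norm (u x))"
  proof (rule norm_integral_le)
   fix x
   have "norm (cdot (u x) (grad (conv cm F) x) - (cdot (u x) (grad (conv cm f) x) - cdot (u x) (grad f x)))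
    <= norm (cdot (u x) (grad (conv cm F) x)) + norm (cdot (u x) (grad (conv cm f) x - grad f x))"
    unfolding cdot_diff_right by (rule norm_triangle_ineq4)
   also have "\<dots> <= norm (u x) * (3 * (M x + e)) + norm (u x) * (3 * e)"
    by (intro add_mono order_trans[OF norm_cdot_le] mult_left_mono n1 n2) auto
   also have "\<dots> = 3 * (norm (u x) * M x) + 6 * e * norm (u x)" by (simp add: algebra_simps)
   finally show "norm (cdot (u x) (grad (conv cm F) x) - (cdot (u x) (grad (conv cm f) x) - cdot (u x) (grad f x)))
    <= 3 * (norm (u x) * M x) + 6 * e * norm (u x)" .
  qed (use if1 if2 if3 uM ui in auto)
  also have "\<dots> = 3 * (LI x. norm (u x) * M x) + 6 * I * e"
   using uM ui by (simp add: I_def)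
  finally show ?thesis .
 qed
 show ?thesis
 proof (rule field_le_epsilon)
  fix e' :: real assume e': "e' > 0"
  have I0: "I >= 0" by (simp add: I_def)
  define e where "e = e' / (6 * I + 1)"
  have e: "e > 0" using e' I0 by (simp add: e_def)
  have "6 * I * e <= e'" using e' I0 by (simp add: e_def field_simps)
  with main[OF e] show "norm (LI x. cdot (u x) (grad f x)) <= 3 * (LI x. norm (u x) * M x) + e'"
   by linarith
 qed
qed

lemma divfree_C1_test:
 assumes "open \<Omega>" "divfree \<Omega> u" "Ck (Suc 0) f" "compact K" "K \<subseteq> \<Omega>" "!!x. x \<notin> K ==> f x = 0"
 shows "(LI x. cdot (u x) (grad f x)) = 0"
proof -
 have "norm (LI x. cdot (u x) (grad f x)) <= 3 * (LI x. norm (u x) * 0)"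
  by (rule divfree_gradient_estimate[OF assms(1-4,6), where F = "%_. 0" and M = "%_. 0" and KF = "{}" and Kc = K and B = 0])
    (use assms in \<open>auto intro!: exI[of _ 1] mult_nonneg_nonneg\<close>)
 then show ?thesis by simp
qed

section \<open>Geometry of a Lipschitz graph and its vertical reflection\<close>

locale lipschitz_graph =
 fixes T :: "real^3 => real^3" and g :: "real \<times> real => real" and L :: real
 assumes T: "orthogonal_transformation T" and g: "L-lipschitz_on UNIV g"
begin

definition height :: "real^3 => real" where "height x = T x $ 3"
definition graph :: "real^3 => real" where "graph x = g (T x $ 1, T x $ 2)"
definition up :: "real^3" where "up = (SOME v. T v = axis 3 1)"
text \<open>\<open>fold\<close> mirrors the points below the graph vertically to the other side and
  fixes the rest, so that f composed with \<open>fold\<close> depends only on values of f on or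
  above the graph. \<open>refl\<close> is the corresponding global involution.\<close>

definition fold :: "real^3 => real^3" where "fold x = x + (2 * max 0 (graph x - height x)) *\<^sub>R up"
definition refl :: "real^3 => real^3" where "refl x = x + (2 * (graph x - height x)) *\<^sub>R up"

lemma T_linear: "linear T" using T by (simp add: orthogonal_transformation_linear)
lemma norm_T: "norm (T x) = norm x" using T by (simp add: orthogonal_transformation_norm)
lemma T_up: "T up = axis 3 1"
 unfolding up_def by (rule someI_ex) (use orthogonal_transformation_surj[OF T] in \<open>metis surjD\<close>)
lemma norm_up: "norm up = 1" using norm_T[of up] by (simp add: T_up norm_axis_1)
lemma L_nonneg: "L >= 0" using g by (simp add: lipschitz_on_def)

lemma T_shift: "T (x + s *\<^sub>R up) = T x + s *\<^sub>R axis 3 1"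
 using T_linear by (simp add: linear_add linear_scale T_up)

lemma height_shift: "height (x + s *\<^sub>R up) = height x + s"
 by (simp add: height_def T_shift)

lemma graph_shift: "graph (x + s *\<^sub>R up) = graph x"
 by (simp add: graph_def T_shift axis_def)

lemma height_lipschitz: "\<bar>height x - height y\<bar> <= norm (x - y)"
proof -
 have "height x - height y = T (x - y) $ 3" by (simp add: height_def linear_diff[OF T_linear])
 then show ?thesis using component_le_norm_cart[of "T (x - y)" 3] by (simp add: norm_T)
qed

lemma graph_lipschitz: "\<bar>graph x - graph y\<bar> <= L * norm (x - y)"
proof -
 have "\<bar>graph x - graph y\<bar> <= L * dist (T x $ 1, T x $ 2) (T y $ 1, T y $ 2)"
  using lipschitz_onD[OF g, of "(T x $ 1, T x $ 2)" "(T y $ 1, T y $ 2)"] by (simp add: graph_def dist_real_def)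
 also have "dist (T x $ 1, T x $ 2) (T y $ 1, T y $ 2) = sqrt ((T (x - y) $ 1)\<^sup>2 + (T (x - y) $ 2)\<^sup>2)"
  by (simp add: dist_prod_def dist_real_def linear_diff[OF T_linear])
 also have "\<dots> <= norm (T (x - y))"
  unfolding norm_vec_def L2_set_def by (intro real_sqrt_le_mono) (simp add: sum_3)
 finally show ?thesis using L_nonneg by (simp add: norm_T mult_left_mono)
qed

lemma gap_lipschitz: "\<bar>(graph x - height x) - (graph y - height y)\<bar> <= (L + 1) * norm (x - y)"
 using height_lipschitz[of x y] graph_lipschitz[of x y] by (simp add: algebra_simps abs_if split: if_splits)

lemma continuous_gap: "continuous_on UNIV (%x. graph x - height x)"
proof -
 have "(L + 1)-lipschitz_on UNIV (%x. graph x - height x)"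
  using gap_lipschitz L_nonneg by (intro lipschitz_onI) (auto simp: dist_real_def dist_norm)
 then show ?thesis by (rule lipschitz_on_continuous_on)
qed

lemma borel_gap [measurable]: "(%x. graph x - height x) \<in> borel_measurable borel"
 by (rule borel_measurable_continuous_onI[OF continuous_gap])

lemma borel_refl [measurable]: "refl \<in> borel_measurable borel"
 unfolding refl_def by measurable

lemma continuous_fold: "continuous_on UNIV fold"
 unfolding fold_def by (intro continuous_intros continuous_gap)

lemma fold_lipschitz: "norm (fold x - fold y) <= (3 + 2 * L) * norm (x - y)"
proof -
 have "fold x - fold y = (x - y) + (2 * (max 0 (graph x - height x) - max 0 (graph y - height y))) *\<^sub>R up"
  by (simp add: fold_def algebra_simps)
 also have "norm \<dots> <= norm (x - y) + 2 * \<bar>max 0 (graph x - height x) - max 0 (graph y - height y)\<bar>"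
 proof -
  have "norm ((2 * D) *\<^sub>R up) = 2 * \<bar>D\<bar>" for D by (simp add: norm_up abs_mult)
  then show ?thesis by (metis norm_triangle_ineq)
 qed
 also have "\<bar>max 0 (graph x - height x) - max 0 (graph y - height y)\<bar> <= (L + 1) * norm (x - y)"
  using gap_lipschitz[of x y] by linarith
 finally show ?thesis by (simp add: algebra_simps)
qed

lemma gap_fold: "graph (fold x) - height (fold x) = - \<bar>graph x - height x\<bar>"
 by (simp add: fold_def graph_shift height_shift max_def)

lemma norm_fold_diff: "norm (fold x - x) <= 2 * \<bar>graph (fold x) - height (fold x)\<bar>"
 unfolding gap_fold by (simp add: fold_def norm_up)

text \<open>On each line in direction \<open>up\<close> the map is s -> 2 a - s, hence measure
  preserving, however rough the graph is. To apply Tonelli in this direction without rotating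
  coordinates, the integral is averaged over the translations \<open>x + s *\<^sub>R up\<close> with
  s in [0,1].\<close>

lemma nn_integral_refl:
 assumes [measurable]: "H \<in> borel_measurable borel"
 shows "(NI x. H (refl x)) = (NI x. H x)"
proof -
 define a where "a x = graph x - height x" for x
 have am [measurable]: "a \<in> borel_measurable borel" unfolding a_def by measurable
 have a_shift: "a (x + s *\<^sub>R up) = a x - s" for x s by (simp add: a_def graph_shift height_shift)
 have refl: "refl (x + s *\<^sub>R up) = x + (2 * a x - s) *\<^sub>R up" for x s
  using a_shift[of x s] by (simp add: refl_def a_def[symmetric] algebra_simps flip: scaleR_add_left)
 let ?J = "indicator {0..1::real} :: real => ennreal"
 have "(NI x. H (refl x)) = (NI s. ?J s * (NI x. H (refl x)))"
  by (simp add: nn_integral_multc)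
 also have "\<dots> = (NI s. (NI x. ?J s * H (x + (2 * a x - s) *\<^sub>R up)))"
 proof (rule nn_integral_cong)
  fix s :: real
  have "(NI x. H (refl x)) = (NI x. H (refl (x + s *\<^sub>R up)))"
   by (rule nn_integral_lborel_shift[symmetric]) measurable
  then show "?J s * (NI x. H (refl x)) = (NI x. ?J s * H (x + (2 * a x - s) *\<^sub>R up))"
   unfolding refl by (simp add: nn_integral_cmult)
 qed
 also have "\<dots> = (NI x. (NI s. ?J s * H (x + (2 * a x - s) *\<^sub>R up)))"
  by (rule lborel_pair.Fubini') measurable
 also have "\<dots> = (NI x. (NI s. ?J (2 * a x - s) * H (x + s *\<^sub>R up)))"
 proof (rule nn_integral_cong)
  fix x
  show "(NI s. ?J s * H (x + (2 * a x - s) *\<^sub>R up)) = (NI s. ?J (2 * a x - s) * H (x + s *\<^sub>R up))"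
   by (subst nn_integral_real_affine[where c = "-1" and t = "2 * a x"]) auto
 qed
 also have "\<dots> = (NI s. (NI x. ?J (2 * a x - s) * H (x + s *\<^sub>R up)))"
  by (rule lborel_pair.Fubini') measurable
 also have "\<dots> = (NI s. (NI x. ?J (2 * a x + s) * H x))"
 proof (rule nn_integral_cong)
  fix s :: real
  have "(NI x. ?J (2 * a x + s) * H x) = (NI x. ?J (2 * a (x + s *\<^sub>R up) + s) * H (x + s *\<^sub>R up))"
   by (rule nn_integral_lborel_shift[symmetric]) measurable
  also have "\<dots> = (NI x. ?J (2 * a x - s) * H (x + s *\<^sub>R up))"
   unfolding a_shift by (simp add: algebra_simps)
  finally show "(NI x. ?J (2 * a x - s) * H (x + s *\<^sub>R up)) = (NI x. ?J (2 * a x + s) * H x)" ..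
 qed
 also have "\<dots> = (NI x. (NI s. ?J (2 * a x + s) * H x))"
  by (rule lborel_pair.Fubini') measurable
 also have "\<dots> = (NI x. H x)"
 proof (rule nn_integral_cong)
  fix x
  have "(NI s. ?J (2 * a x + s) * H x) = (NI s. ?J (2 * a x + s)) * H x"
   by (rule nn_integral_multc) measurable
  also have "(NI s. ?J (2 * a x + s)) = (NI s. ?J s)"
   by (subst (2) nn_integral_real_affine[where c = 1 and t = "2 * a x"]) auto
  finally show "(NI s. ?J (2 * a x + s) * H x) = H x" by simp
 qed
 finally show ?thesis .
qed


text \<open>x and its image differ by at most twice the gap at the image, and that gap is at most (L
  + 1) \<rho> since z lies on the graph. The sum \<rho> + 2 (L + 1) \<rho> is the origin of 3 + 2 L,
  which is also the Lipschitz constant of \<open>fold\<close>.\<close>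

lemma fold_image_bound:
 assumes "norm (fold x - z) <= \<rho>" "graph z = height z"
 shows "norm (x - z) <= (3 + 2 * L) * \<rho>"
proof -
 have "\<bar>graph (fold x) - height (fold x)\<bar> <= (L + 1) * norm (fold x - z)"
  using gap_lipschitz[of "fold x" z] assms(2) by simp
 also have "\<dots> <= (L + 1) * \<rho>" using assms(1) L_nonneg by (intro mult_left_mono) auto
 finally have "norm (fold x - x) <= 2 * ((L + 1) * \<rho>)"
  by (intro order_trans[OF norm_fold_diff]) simp
 moreover have "norm (x - z) <= norm (fold x - z) + norm (fold x - x)"
  using norm_triangle_ineq4[of "fold x - z" "fold x - x"] by simp
 ultimately show ?thesis using assms(1) by (simp add: algebra_simps)
qed

text \<open>The difference of f and f composed with \<open>fold\<close> vanishes outside \<Omega>,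
  but its support may reach the boundary. Shifting both functions by t along \<open>up\<close>
  confines the difference to points with gap at least t, a compact subset of \<Omega>. The gradient
  estimate applies there, and t tends to 0 by dominated convergence.\<close>

lemma reflection_estimate:
 assumes \<Omega>: "open \<Omega>" and u: "divfree \<Omega> u"
  and loc: "!!x. x \<in> ball z \<delta> ==> x \<in> \<Omega> \<longleftrightarrow> height x < graph x"
  and z: "graph z = height z"
  and \<rho>: "\<rho> > 0" "(3 + 2 * L) * \<rho> < \<delta>"
  and f: "Ck (Suc 0) f" "!!x. x \<notin> cball z \<rho> ==> f x = 0"
 shows "norm (LI x. cdot (u x) (grad f x)) <= 3 * (LI x. norm (u x) * ((3 + 2 * L) * norm (grad f (fold x))))"
proof -
 define \<kappa> where "\<kappa> = 3 + 2 * L"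
 have \<kappa>: "\<kappa> > 0" "\<kappa> >= 1" using L_nonneg by (auto simp: \<kappa>_def)
 define \<rho>' where "\<rho>' = \<kappa> * \<rho>"
 have ui: "integrable lborel u" using u by (simp add: divfree_def)
 have [measurable]: "u \<in> borel_measurable borel" using ui by auto
 have cg: "continuous_on UNIV (grad f)" by (rule continuous_grad[OF f(1)])
 have cgo: "grad f x = 0" if "x \<notin> cball z \<rho>" for x
  using pderiv3_zero_off_support[OF closed_cball f(2) that] by (simp add: grad_def vec_eq_iff)
 obtain B where B: "B > 0" "!!x. norm (grad f x) <= B" using grad_bounded_compact_support[OF f(1) compact_cball f(2)] by metis
 \<comment> \<open>Half of the remaining room: supports of radius at most \<rho>', shifted by at
   most t0, stay in the ball where \<Omega> is the region below the graph.\<close>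
 define t0 where "t0 = (\<delta> - \<rho>') / 2"
 have t0: "t0 > 0" "\<rho>' + t0 < \<delta>" using \<rho> by (auto simp: t0_def \<rho>'_def \<kappa>_def field_simps)
 have main: "norm (LI x. cdot (u x) (grad f (x + t *\<^sub>R up))) <= 3 * (LI x. norm (u x) * (\<kappa> * norm (grad f (fold (x + t *\<^sub>R up)))))"
  if t: "0 < t" "t <= t0" for t
 proof -
  define ft where "ft x = f (t *\<^sub>R up + 1 *\<^sub>R x)" for x
  define Ft where "Ft x = f (fold (x + t *\<^sub>R up))" for x
  have ft: "Ck (Suc 0) ft" unfolding ft_def by (rule Ck_affine_arg[OF f(1)])
  have gft: "grad ft x = grad f (x + t *\<^sub>R up)" for x
   unfolding ft_def grad_def by (subst pderiv3_affine_arg[OF Ck_differentiable[OF f(1)]]) (simp add: add.commute)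
  have "norm (LI x. cdot (u x) (grad ft x)) <= 3 * (LI x. norm (u x) * (\<kappa> * norm (grad f (fold (x + t *\<^sub>R up)))))"
  proof (rule divfree_gradient_estimate[OF \<Omega> u ft])
   show "compact (cball (z - t *\<^sub>R up) \<rho>)" by simp
   show "ft x = 0" if "x \<notin> cball (z - t *\<^sub>R up) \<rho>" for x
    unfolding ft_def using that by (intro f(2)) (simp add: dist_norm algebra_simps)
   show "continuous_on UNIV Ft" unfolding Ft_def
    by (intro continuous_on_compose2[OF Ck_continuous[OF f(1)]] continuous_on_compose2[OF continuous_fold] continuous_intros) auto
   show "compact (cball (z - t *\<^sub>R up) \<rho>')" by simp
   show "Ft x = 0" if "x \<notin> cball (z - t *\<^sub>R up) \<rho>'" for x
   proof (rule ccontr)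
    assume "Ft x ~= 0"
    then have "norm (fold (x + t *\<^sub>R up) - z) <= \<rho>" using f(2) unfolding Ft_def by (metis dist_commute dist_norm mem_cball)
    from fold_image_bound[OF this z] that show False by (simp add: \<rho>'_def \<kappa>_def dist_norm algebra_simps norm_minus_commute)
   qed
   define Kc where "Kc = cball (z - t *\<^sub>R up) \<rho>' \<inter> {x. t <= graph x - height x}"
   have "closed {x. t <= graph x - height x}" by (intro closed_Collect_le continuous_gap continuous_on_const)
   then show "compact Kc" unfolding Kc_def by (intro compact_Int_closed) auto
   show "Kc \<subseteq> \<Omega>"
   proof
    fix x assume x: "x \<in> Kc"
    have "norm (x - z) <= norm (x - (z - t *\<^sub>R up)) + norm (t *\<^sub>R up)"
     using norm_triangle_ineq4[of "x - (z - t *\<^sub>R up)" "t *\<^sub>R up"] by (simp add: algebra_simps)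
    also have "\<dots> <= \<rho>' + t" using x t by (simp add: Kc_def dist_norm norm_minus_commute norm_up)
    also have "\<dots> < \<delta>" using t t0 by simp
    finally have "x \<in> ball z \<delta>" by (simp add: dist_norm norm_minus_commute)
    with loc[OF this] x t show "x \<in> \<Omega>" by (simp add: Kc_def)
   qed
   show "ft x = Ft x" if "x \<notin> Kc" for x
   proof (rule ccontr)
    assume ne: "ft x ~= Ft x"
    define y where "y = x + t *\<^sub>R up"
    have fy: "f y ~= f (fold y)" using ne by (simp add: ft_def Ft_def y_def add.commute)
    then have "fold y ~= y" by auto
    then have gap: "graph y - height y > 0" unfolding fold_def by (simp add: max_def split: if_splits)
    then have gx: "t < graph x - height x" by (simp add: y_def graph_shift height_shift)
    have "norm (y - z) <= \<rho>'"
    proof (cases "f (fold y) = 0")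
     case True
     then have "y \<in> cball z \<rho>" using fy f(2) by metis
     then have "norm (y - z) <= \<rho>" by (simp add: dist_norm norm_minus_commute)
     also have "\<rho> <= \<rho>'" using \<rho> \<kappa> by (simp add: \<rho>'_def)
     finally show ?thesis .
    next
     case False
     then have "norm (fold y - z) <= \<rho>" using f(2) by (metis dist_commute dist_norm mem_cball)
     from fold_image_bound[OF this z] show ?thesis by (simp add: \<rho>'_def \<kappa>_def)
    qed
    then have "x \<in> Kc" using gx unfolding Kc_def y_def by (simp add: dist_norm norm_minus_commute algebra_simps)
    with that show False by simp
   qed
   show "(%x. \<kappa> * norm (grad f (fold (x + t *\<^sub>R up)))) \<in> borel_measurable borel"
    by (intro borel_measurable_continuous_onI continuous_intros continuous_on_compose2[OF cg] continuous_on_compose2[OF continuous_fold]) auto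
   show "0 <= \<kappa> * norm (grad f (fold (x + t *\<^sub>R up)))" for x using \<kappa> by simp
   show "\<kappa> * norm (grad f (fold (x + t *\<^sub>R up))) <= \<kappa> * B" for x using \<kappa> B by (intro mult_left_mono) auto
   fix e :: real assume e: "e > 0"
   then have "e / \<kappa> > 0" using \<kappa> by simp
   then obtain \<eta> where \<eta>: "\<eta> > 0" "!!p q. norm (p - q) < \<eta> ==> norm (grad f p - grad f q) < e / \<kappa>"
    using uniform_continuity_compact_support[OF cg compact_cball cgo] by metis
   show "\<exists>d>0. \<forall>x a b. norm (a - x) < d --> norm (b - x) < d -->
     norm (Ft a - Ft b) <= (\<kappa> * norm (grad f (fold (x + t *\<^sub>R up))) + e) * norm (a - b)"
   proof (intro exI[of _ "\<eta> / \<kappa>"] conjI allI impI)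
    show "\<eta> / \<kappa> > 0" using \<eta> \<kappa> by simp
    fix x a b :: "real^3" assume ab: "norm (a - x) < \<eta> / \<kappa>" "norm (b - x) < \<eta> / \<kappa>"
    define p where "p y = fold (y + t *\<^sub>R up)" for y
    have plip: "norm (p y - p y') <= \<kappa> * norm (y - y')" for y y' :: "real^3"
     using fold_lipschitz[of "y + t *\<^sub>R up" "y' + t *\<^sub>R up"] by (simp add: p_def \<kappa>_def)
    have pb: "p y \<in> ball (p x) \<eta>" if "norm (y - x) < \<eta> / \<kappa>" for y
    proof -
     have "norm (p y - p x) <= \<kappa> * norm (y - x)" by (rule plip)
     also have "\<dots> < \<eta>" using that \<kappa> by (simp add: field_simps)
     finally show ?thesis by (simp add: dist_norm norm_minus_commute)
    qed
    \<comment> \<open>The local Lipschitz constant at x: near p(x) the gradient of f varies by at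
      most e/\<kappa>, and p stretches distances by at most \<kappa>.\<close>
    have "norm (f (p a) - f (p b)) <= (norm (grad f (p x)) + e / \<kappa>) * norm (p a - p b)"
    proof (rule differentiable_bound[of "ball (p x) \<eta>"])
     show "convex (ball (p x) \<eta>)" by simp
     fix q assume q: "q \<in> ball (p x) \<eta>"
     show "(f has_derivative (%h. cdot (grad f q) (cvec h))) (at q within ball (p x) \<eta>)"
      by (rule has_derivative_at_withinI[OF norm_grad_has_derivative[OF Ck_differentiable[OF f(1)]]])
     have "norm (grad f q) <= norm (grad f (p x)) + norm (grad f q - grad f (p x))"
      using norm_triangle_sub by blast
     also have "\<dots> <= norm (grad f (p x)) + e / \<kappa>"
      using \<eta>(2)[of q "p x"] q by (simp add: dist_norm norm_minus_commute)
     finally have gq: "norm (grad f q) <= norm (grad f (p x)) + e / \<kappa>" .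
     show "onorm (%h. cdot (grad f q) (cvec h)) <= norm (grad f (p x)) + e / \<kappa>"
     proof (rule onorm_le)
      fix h
      have "norm (cdot (grad f q) (cvec h)) <= norm (grad f q) * norm h"
       using norm_cdot_le[of "grad f q" "cvec h"] by simp
      also have "\<dots> <= (norm (grad f (p x)) + e / \<kappa>) * norm h" by (intro mult_right_mono gq) simp
      finally show "norm (cdot (grad f q) (cvec h)) <= (norm (grad f (p x)) + e / \<kappa>) * norm h" .
     qed
    qed (use pb ab in auto)
    also have "\<dots> <= (norm (grad f (p x)) + e / \<kappa>) * (\<kappa> * norm (a - b))"
     using e \<kappa> by (intro mult_left_mono plip) auto
    also have "\<dots> = (\<kappa> * norm (grad f (p x)) + e) * norm (a - b)"
     using \<kappa> by (simp add: field_simps)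
    finally show "norm (Ft a - Ft b) <= (\<kappa> * norm (grad f (fold (x + t *\<^sub>R up))) + e) * norm (a - b)"
     by (simp add: Ft_def p_def)
   qed
  qed
  then show ?thesis by (simp add: gft)
 qed
 define tn where "tn n = t0 / real (Suc n)" for n
 have tn: "0 < tn n" "tn n <= t0" for n using t0(1) by (auto simp: tn_def field_simps)
 have tn0: "tn \<longlonglongrightarrow> 0"
  using tendsto_mult[OF tendsto_const[of t0] LIMSEQ_inverse_real_of_nat] by (simp add: tn_def[abs_def] divide_inverse)
 have pt: "(%n. x + tn n *\<^sub>R up) \<longlonglongrightarrow> x" for x
  using tendsto_add[OF tendsto_const[of x] tendsto_scaleR[OF tn0 tendsto_const[of up]]] by simp
 have mb: "(%x. grad f (x + s *\<^sub>R up)) \<in> borel_measurable borel" "(%x. grad f (fold (x + s *\<^sub>R up))) \<in> borel_measurable borel" for s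
  by (intro borel_measurable_continuous_onI continuous_on_compose2[OF cg] continuous_on_compose2[OF continuous_fold] continuous_intros; auto)+
 have [measurable]: "grad f \<in> borel_measurable borel" "fold \<in> borel_measurable borel"
  using borel_grad[OF f(1)] borel_measurable_continuous_onI[OF continuous_fold] by auto
 have l1: "(%n. LI x. cdot (u x) (grad f (x + tn n *\<^sub>R up))) \<longlonglongrightarrow> (LI x. cdot (u x) (grad f x))"
 proof (rule integral_dominated_convergence[where w = "%x. norm (u x) * B"])
  show "AE x in lborel. (%n. cdot (u x) (grad f (x + tn n *\<^sub>R up))) \<longlonglongrightarrow> cdot (u x) (grad f x)"
  proof (intro always_eventually allI)
   fix x
   have "continuous_on UNIV (%y. cdot (u x) (grad f y))" by (intro continuous_intros cg)
   from continuous_on_tendsto_compose[OF this pt] show "(%n. cdot (u x) (grad f (x + tn n *\<^sub>R up))) \<longlonglongrightarrow> cdot (u x) (grad f x)" by simp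
  qed
  show "AE x in lborel. norm (cdot (u x) (grad f (x + tn n *\<^sub>R up))) <= norm (u x) * B" for n
   by (intro always_eventually allI order_trans[OF norm_cdot_le] mult_left_mono B(2)) simp
 qed (use mb ui in auto)
 have l2: "(%n. LI x. norm (u x) * (\<kappa> * norm (grad f (fold (x + tn n *\<^sub>R up))))) \<longlonglongrightarrow> (LI x. norm (u x) * (\<kappa> * norm (grad f (fold x))))"
 proof (rule integral_dominated_convergence[where w = "%x. (\<kappa> * B) * norm (u x)"])
  show "AE x in lborel. (%n. norm (u x) * (\<kappa> * norm (grad f (fold (x + tn n *\<^sub>R up))))) \<longlonglongrightarrow> norm (u x) * (\<kappa> * norm (grad f (fold x)))"
  proof (intro always_eventually allI)
   fix x
   have "continuous_on UNIV (%y. norm (u x) * (\<kappa> * norm (grad f (fold y))))"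
    by (intro continuous_intros continuous_on_compose2[OF cg] continuous_fold) auto
   from continuous_on_tendsto_compose[OF this pt]
   show "(%n. norm (u x) * (\<kappa> * norm (grad f (fold (x + tn n *\<^sub>R up))))) \<longlonglongrightarrow> norm (u x) * (\<kappa> * norm (grad f (fold x)))" by simp
  qed
  show "AE x in lborel. norm (norm (u x) * (\<kappa> * norm (grad f (fold (x + tn n *\<^sub>R up))))) <= (\<kappa> * B) * norm (u x)" for n
  proof (intro always_eventually allI)
   fix x
   have "norm (u x) * (\<kappa> * norm (grad f (fold (x + tn n *\<^sub>R up)))) <= norm (u x) * (\<kappa> * B)"
    using \<kappa> B by (intro mult_left_mono) auto
   then show "norm (norm (u x) * (\<kappa> * norm (grad f (fold (x + tn n *\<^sub>R up))))) <= (\<kappa> * B) * norm (u x)"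
    using \<kappa> by (simp add: abs_mult mult.commute)
  qed
 qed (use mb ui in auto)
 have "norm (LI x. cdot (u x) (grad f x)) <= 3 * (LI x. norm (u x) * (\<kappa> * norm (grad f (fold x))))"
  by (rule LIMSEQ_le[OF tendsto_norm[OF l1] tendsto_mult[OF tendsto_const l2]]) (use main[OF tn] in blast)
 then show ?thesis by (simp add: \<kappa>_def)
qed

text \<open>Only points of \<Omega> near z contribute, and \<open>fold\<close> carries them outside
  the closure. Cauchy-Schwarz separates u from the reflected gradient, whose norm is transported to
  the exterior by the measure preserving \<open>refl\<close>.\<close>

lemma reflection_estimate_L2:
 assumes \<Omega>: "open \<Omega>" and u: "divfree \<Omega> u"
  and loc: "!!x. x \<in> ball z \<delta> ==> x \<in> \<Omega> \<longleftrightarrow> height x < graph x"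
  and z: "graph z = height z"
  and \<rho>: "\<rho> > 0" "(3 + 2 * L) * \<rho> < \<delta>"
  and uL: "L2field (%x. indicator (ball z \<delta>) x *\<^sub>R u x)"
  and f: "Ck (Suc 0) f" "!!x. x \<notin> cball z \<rho> ==> f x = 0"
 shows "norm (LI x. cdot (u x) (grad f x)) <=
  3 * (3 + 2 * L) * sqrt (sqn (%x. indicator (ball z \<delta>) x *\<^sub>R u x)) * sqrt (sqn (%x. indicator (ball z \<delta> - closure \<Omega>) x *\<^sub>R grad f x))"
proof -
 define \<kappa> where "\<kappa> = 3 + 2 * L"
 have \<kappa>: "\<kappa> > 0" "\<kappa> >= 1" using L_nonneg by (auto simp: \<kappa>_def)
 have "1 * \<rho> <= (3 + 2 * L) * \<rho>" using \<rho> L_nonneg by (intro mult_right_mono) auto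
 then have "1 * \<rho> < \<delta>" using \<rho>(2) by (rule le_less_trans)
 then have \<rho>\<delta>: "\<rho> < \<delta>" by simp
 have cgo: "grad f x = 0" if "x \<notin> cball z \<rho>" for x
  using pderiv3_zero_off_support[OF closed_cball f(2) that] by (simp add: grad_def vec_eq_iff)
 have gb [measurable]: "grad f \<in> borel_measurable borel" by (rule borel_grad[OF f(1)])
 have [measurable]: "fold \<in> borel_measurable borel" using borel_measurable_continuous_onI[OF continuous_fold] by auto
 have ext: "x \<in> ball z \<delta> - closure \<Omega>" if "x \<in> ball z \<delta>" "graph x < height x" for x
 proof -
  have "open (ball z \<delta> \<inter> {x. graph x - height x < 0})"
   by (intro open_Int open_ball open_Collect_less continuous_gap continuous_on_const)
  moreover have "\<Omega> \<inter> (ball z \<delta> \<inter> {x. graph x - height x < 0}) = {}" using loc by fastforce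
  ultimately have "closure \<Omega> \<inter> (ball z \<delta> \<inter> {x. graph x - height x < 0}) = {}" by (metis Int_commute open_Int_closure_eq_empty)
  with that show ?thesis by auto
 qed
 define W where "W x = indicator (ball z \<delta> - closure \<Omega>) x *\<^sub>R grad f x" for x
 have Wb [measurable]: "W \<in> borel_measurable borel" unfolding W_def by (intro borel_measurable_scaleR borel_measurable_indicator gb) auto
 obtain B where B: "B > 0" "!!x. norm (grad f x) <= B" using grad_bounded_compact_support[OF f(1) compact_cball f(2)] by metis
 have WL: "L2field W"
 proof (rule L2fieldI_nn_integral[OF Wb])
  have "(NI x. nsq (W x)) <= (NI x. ennreal (B\<^sup>2) * indicator (cball z \<rho>) x)"
  proof (rule nn_integral_mono)
   fix x
   show "nsq (W x) <= ennreal (B\<^sup>2) * indicator (cball z \<rho>) x"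
    using cgo[of x] B(2)[of x] by (auto simp: W_def indicator_def intro!: ennreal_leI power_mono)
  qed
  also have "\<dots> < \<infinity>" using emeasure_lborel_cball_finite[of z \<rho>] by (simp add: nn_integral_cmult_indicator ennreal_mult_less_top)
  finally show "(NI x. nsq (W x)) < \<infinity>" .
 qed
 define V where "V x = indicator {x. height x < graph x} x * norm (W (fold x))" for x
 have [measurable]: "Measurable.pred borel (%x. height x < graph x)"
 proof -
  have "Measurable.pred borel (%x. 0 < graph x - height x)" by measurable
  then show ?thesis by simp
 qed
 have Vb [measurable]: "V \<in> borel_measurable borel" unfolding V_def by measurable
 have "(NI x. nsq (V x)) <= (NI x. nsq (W (refl x)))"
 proof (rule nn_integral_mono)
  fix x
  show "nsq (V x) <= nsq (W (refl x))"
   by (auto simp: V_def indicator_def fold_def refl_def max_def)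
 qed
 also have "\<dots> = (NI x. nsq (W x))" by (rule nn_integral_refl) measurable
 also have "\<dots> = ennreal (sqn W)" by (rule nn_integral_sqn[OF WL])
 finally have V: "L2field V" "sqn V <= sqn W" using sqn_le[OF Vb _ sqn_nonneg] by auto
 define U where "U x = norm (indicator (ball z \<delta>) x *\<^sub>R u x)" for x
 have U: "L2field U" "sqn U = sqn (%x. indicator (ball z \<delta>) x *\<^sub>R u x)"
 proof -
  have "(%x. indicator (ball z \<delta>) x *\<^sub>R u x) \<in> borel_measurable borel" using uL by (simp add: L2field_def)
  then have "U \<in> borel_measurable borel" unfolding U_def by (rule measurable_compose[OF _ borel_measurable_norm])
  then show "L2field U" "sqn U = sqn (%x. indicator (ball z \<delta>) x *\<^sub>R u x)"
   using uL unfolding L2field_def sqn_def U_def real_norm_def abs_norm_cancel by blast+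
 qed
 have "norm (LI x. cdot (u x) (grad f x)) <= 3 * (LI x. norm (u x) * (\<kappa> * norm (grad f (fold x))))"
  unfolding \<kappa>_def by (rule reflection_estimate[OF \<Omega> u loc z \<rho> f])
 also have "(LI x. norm (u x) * (\<kappa> * norm (grad f (fold x)))) = (LI x. \<kappa> * (U x \<bullet> V x))"
 proof (rule Bochner_Integration.integral_cong[OF refl])
  fix x
  show "norm (u x) * (\<kappa> * norm (grad f (fold x))) = \<kappa> * (U x \<bullet> V x)"
  proof (cases "u x = 0 \<or> grad f (fold x) = 0")
   case True then show ?thesis by (auto simp: U_def V_def W_def)
  next
   case False
   then have "norm (fold x - z) <= \<rho>" using cgo[of "fold x"] by (auto simp: dist_norm norm_minus_commute)
   from fold_image_bound[OF this z] \<rho> have x: "x \<in> ball z \<delta>" by (simp add: dist_norm norm_minus_commute)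
   have "x \<in> \<Omega>" using False u by (auto simp: divfree_def)
   with loc[OF x] have h: "height x < graph x" by simp
   have "fold x \<in> ball z \<delta> - closure \<Omega>"
   proof (rule ext)
    show "fold x \<in> ball z \<delta>" using \<open>norm (fold x - z) <= \<rho>\<close> \<rho>\<delta> by (simp add: dist_norm norm_minus_commute)
    show "graph (fold x) < height (fold x)" using gap_fold[of x] h by simp
   qed
   with x h show ?thesis by (simp add: U_def V_def W_def)
  qed
 qed
 also have "3 * (LI x. \<kappa> * (U x \<bullet> V x)) = 3 * \<kappa> * (LI x. U x \<bullet> V x)" by simp
 also have "\<dots> <= 3 * \<kappa> * (sqrt (sqn U) * sqrt (sqn V))"
  using \<kappa> L2_Cauchy_Schwarz[OF U(1) V(1)] by (intro mult_left_mono) auto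
 also have "\<dots> <= 3 * \<kappa> * (sqrt (sqn U) * sqrt (sqn W))"
  using \<kappa> V(2) sqn_nonneg[of U] by (intro mult_left_mono) auto
 finally show ?thesis by (simp add: \<kappa>_def U(2) W_def[abs_def] mult.assoc)
qed

end

section \<open>Poincare inequalities near the boundary\<close>

context lipschitz_graph
begin

text \<open>Points of the graph belong to the closure: going down from them along \<open>up\<close>
  leads into \<Omega> at once.\<close>

lemma graph_side:
 assumes loc: "!!x. x \<in> ball z \<delta> ==> x \<in> \<Omega> \<longleftrightarrow> height x < graph x" and x: "x \<in> ball z \<delta>"
 shows "x \<notin> closure \<Omega> \<longleftrightarrow> graph x < height x"
proof
 assume gx: "graph x < height x"
 have "open (ball z \<delta> \<inter> {x. graph x - height x < 0})"
  by (intro open_Int open_ball open_Collect_less continuous_gap continuous_on_const)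
 moreover have "(ball z \<delta> \<inter> {x. graph x - height x < 0}) \<inter> \<Omega> = {}" using loc by fastforce
 ultimately have "(ball z \<delta> \<inter> {x. graph x - height x < 0}) \<inter> closure \<Omega> = {}" by (simp add: open_Int_closure_eq_empty)
 with x gx show "x \<notin> closure \<Omega>" by auto
next
 assume nc: "x \<notin> closure \<Omega>"
 show "graph x < height x"
 proof (rule ccontr)
  assume "\<not> graph x < height x"
  then have le: "height x <= graph x" by simp
  have "\<exists>y\<in>\<Omega>. dist y x < e" if "e > 0" for e
  proof -
   define s where "s = min e (\<delta> - dist z x) / 2"
   have s: "s > 0" "s < e" "s < \<delta> - dist z x" using that x by (auto simp: s_def)
   define y where "y = x + (- s) *\<^sub>R up"
   have d: "dist y x = s" using s by (simp add: y_def dist_norm norm_up)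
   have "dist z y <= dist z x + dist y x" by (metis dist_commute dist_triangle)
   then have "y \<in> ball z \<delta>" using s d by simp
   moreover have "height y < graph y" using le s unfolding y_def graph_shift height_shift by simp
   ultimately have "y \<in> \<Omega>" using loc by blast
   then show ?thesis using d s by (intro bexI[of _ y]) auto
  qed
  then show False using nc by (auto simp: closure_approachable)
 qed
qed

text \<open>The sign c = 1 stands for the exterior side, c = - 1 for the side of \<Omega>. Going a
  fraction s of the way to y is a vertical move by c s h, with h = 2 \<rho> (1 + L), plus a move of
  length at most 2 \<rho> s. The latter changes the gap by at most (L + 1) 2 \<rho> s = s h, so the
  signed gap cannot decrease.\<close>

lemma segment_gap:
 assumes x: "norm (x - z) < \<rho>" and y: "norm (y - (z + (c * (2 * \<rho> * (1 + L))) *\<^sub>R up)) < \<rho>" and s: "0 <= s" "s <= 1"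
  and c: "c = 1 \<or> c = - 1" and gap: "c * (height x - graph x) > 0"
 shows "c * (height (x + s *\<^sub>R (y - x)) - graph (x + s *\<^sub>R (y - x))) > 0"
proof -
 define h where "h = 2 * \<rho> * (1 + L)"
 define w where "w = y - x - (c * h) *\<^sub>R up"
 have "w = (y - (z + (c * h) *\<^sub>R up)) - (x - z)" by (simp add: w_def)
 then have w: "norm w <= 2 * \<rho>" using norm_triangle_ineq4[of "y - (z + (c * h) *\<^sub>R up)" "x - z"] x y by (simp add: h_def)
 have p: "x + s *\<^sub>R (y - x) = (x + s *\<^sub>R w) + (s * (c * h)) *\<^sub>R up" by (simp add: w_def algebra_simps)
 have cc: "c * c = 1" using c by auto
 have "\<bar>(graph (x + s *\<^sub>R w) - height (x + s *\<^sub>R w)) - (graph x - height x)\<bar> <= (L + 1) * norm (s *\<^sub>R w)"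
  using gap_lipschitz[of "x + s *\<^sub>R w" x] by simp
 also have "\<dots> <= (L + 1) * (s * (2 * \<rho>))" using s w L_nonneg by (intro mult_left_mono) (auto simp: mult_left_mono)
 also have "\<dots> = s * h" by (simp add: h_def algebra_simps)
 finally have k: "\<bar>(graph (x + s *\<^sub>R w) - height (x + s *\<^sub>R w)) - (graph x - height x)\<bar> <= s * h" .
 have "c * (height (x + s *\<^sub>R (y - x)) - graph (x + s *\<^sub>R (y - x))) = c * (height (x + s *\<^sub>R w) - graph (x + s *\<^sub>R w)) + s * h * (c * c)"
  unfolding p height_shift graph_shift by (simp add: algebra_simps)
 also have "\<dots> = c * (height (x + s *\<^sub>R w) - graph (x + s *\<^sub>R w)) + s * h" by (simp add: cc)
 also have "\<dots> >= c * (height x - graph x)"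
  using c k by (auto simp: abs_le_iff)
 finally show ?thesis using gap by linarith
qed

text \<open>The far endpoint y is at distance below \<rho> + 2 \<rho> (1 + L) = (3 + 2 L) \<rho>
  from z.\<close>

lemma segment_in_ball:
 assumes x: "norm (x - z) < \<rho>" and y: "norm (y - (z + (c * (2 * \<rho> * (1 + L))) *\<^sub>R up)) < \<rho>"
  and c: "c = 1 \<or> c = - 1" and \<rho>: "\<rho> > 0" "(3 + 2 * L) * \<rho> < \<delta>"
 shows "closed_segment x y \<subseteq> ball z \<delta>"
proof -
 have L: "2 * \<rho> * (1 + L) >= 0" using \<rho> L_nonneg by simp
 have "norm (y - z) <= norm (y - (z + (c * (2 * \<rho> * (1 + L))) *\<^sub>R up)) + norm ((c * (2 * \<rho> * (1 + L))) *\<^sub>R up)"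
  using norm_triangle_ineq[of "y - (z + (c * (2 * \<rho> * (1 + L))) *\<^sub>R up)" "(c * (2 * \<rho> * (1 + L))) *\<^sub>R up"] by (simp add: algebra_simps)
 also have "norm ((c * (2 * \<rho> * (1 + L))) *\<^sub>R up) = 2 * \<rho> * (1 + L)"
  using c L by (auto simp: norm_up)
 also have "norm (y - (z + (c * (2 * \<rho> * (1 + L))) *\<^sub>R up)) + 2 * \<rho> * (1 + L) < \<rho> + 2 * \<rho> * (1 + L)" using y by simp
 also have "\<dots> = (3 + 2 * L) * \<rho>" by (simp add: algebra_simps)
 finally have "y \<in> ball z \<delta>" using \<rho> by (simp add: dist_norm norm_minus_commute)
 moreover have "1 * \<rho> <= (3 + 2 * L) * \<rho>" using \<rho> L_nonneg by (intro mult_right_mono) auto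
 then have "1 * \<rho> < \<delta>" using \<rho>(2) by (rule le_less_trans)
 then have "x \<in> ball z \<delta>" using x by (simp add: dist_norm norm_minus_commute)
 ultimately show ?thesis by (intro closed_segment_subset) auto
qed

end

lemma in_closed_segment_param: "p \<in> closed_segment x y ==> \<exists>s. 0 <= s \<and> s <= 1 \<and> p = x + s *\<^sub>R (y - x)"
proof -
 assume "p \<in> closed_segment x y"
 then obtain s where "0 <= s" "s <= 1" "p = (1 - s) *\<^sub>R x + s *\<^sub>R y" by (auto simp: closed_segment_def)
 moreover have "(1 - s) *\<^sub>R x + s *\<^sub>R y = x + s *\<^sub>R (y - x)" by (simp add: algebra_simps)
 ultimately show ?thesis by blast
qed

lemma param_in_closed_segment:
 assumes "0 <= t" "t <= 1"
 shows "y + t *\<^sub>R (x - y) \<in> closed_segment x y"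
proof -
 have "y + t *\<^sub>R (x - y) = (1 - t) *\<^sub>R y + t *\<^sub>R x" by (simp add: algebra_simps)
 then have "y + t *\<^sub>R (x - y) \<in> closed_segment y x" using assms unfolding closed_segment_def by blast
 then show ?thesis by (simp add: closed_segment_commute)
qed

text \<open>The constants are arguments, so that they can be chosen separately at each boundary
  point. On the right the gradient is seen only outside the closure of \<Omega>; the radius r / 2
  fits the supports of a partition of unity.\<close>

definition boundary_estimate :: "(real^3) set => real^3 => real => real => real => bool" where
 "boundary_estimate \<Omega> z \<delta> r C \<longleftrightarrow> (\<forall>u f. divfree \<Omega> u --> L2field (%x. indicator (ball z \<delta>) x *\<^sub>R u x) -->
   Ck (Suc 0) f --> (\<forall>x. x \<notin> cball z (r / 2) --> f x = 0) -->
   norm (LI x. cdot (u x) (grad f x)) <=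
    C * sqrt (sqn (%x. indicator (ball z \<delta>) x *\<^sub>R u x)) * sqrt (sqn (%x. indicator (ball z r - closure \<Omega>) x *\<^sub>R grad f x)))"

text \<open>All that is drawn from the local graph: the reflection estimate, segments on either side
  to a ball of vertices, and adherence of the exterior to the boundary point. The exterior segments
  serve existence, the interior ones uniqueness.\<close>

lemma lipschitz_boundary_point:
 assumes \<Omega>: "open \<Omega>" and lip: "lipschitz_boundary \<Omega>" and z: "z \<in> frontier \<Omega>" and d: "d > 0"
 obtains \<delta> r C c1 c2 where "0 < r" "r < \<delta>" "\<delta> <= d" "C >= 0"
  "boundary_estimate \<Omega> z \<delta> r C"
  "!!x y. x \<in> ball z r - closure \<Omega> ==> y \<in> ball c1 r ==> closed_segment x y \<subseteq> ball z \<delta> - closure \<Omega>"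
  "!!x y. x \<in> ball z r \<inter> \<Omega> ==> y \<in> ball c2 r ==> closed_segment x y \<subseteq> ball z \<delta> \<inter> \<Omega>"
  "z \<in> closure (- closure \<Omega>)"
proof -
 obtain \<delta>0 L and T :: "real^3 => real^3" and g :: "real \<times> real => real" where 0: "\<delta>0 > 0" "orthogonal_transformation T" "L-lipschitz_on UNIV g"
  "\<forall>x \<in> ball z \<delta>0. x \<in> \<Omega> \<longleftrightarrow> T x $ 3 < g (T x $ 1, T x $ 2)"
  using lip z unfolding lipschitz_boundary_def by blast
 interpret lipschitz_graph T g L using 0 by unfold_locales
 define \<delta> where "\<delta> = min \<delta>0 d"
 have \<delta>: "\<delta> > 0" "\<delta> <= d" using 0 d by (auto simp: \<delta>_def)
 have loc: "x \<in> \<Omega> \<longleftrightarrow> height x < graph x" if "x \<in> ball z \<delta>" for x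
  using 0(4) that by (auto simp: \<delta>_def height_def graph_def)
 have zin: "z \<in> ball z \<delta>" using \<delta> by simp
 have "z \<in> closure \<Omega>" "z \<notin> \<Omega>" using z \<Omega> by (auto simp: frontier_def interior_open)
 then have gz: "graph z = height z" using graph_side[OF loc zin] loc[OF zin] by auto
 \<comment> \<open>Makes (3 + 2 L) r equal to \<delta> / 2, safely below \<delta> as the segment and
   support bounds require.\<close>
 define r where "r = (\<delta> / 2) / (3 + 2 * L)"
 have k: "3 + 2 * L > 0" using L_nonneg by simp
 have "(3 + 2 * L) * r = ((3 + 2 * L) * (\<delta> / 2)) / (3 + 2 * L)" by (simp only: r_def times_divide_eq_right)
 also have "\<dots> = \<delta> / 2" by (rule nonzero_mult_div_cancel_left) (use k in simp)
 finally have r2: "(3 + 2 * L) * r = \<delta> / 2" .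
 have r: "r > 0" "(3 + 2 * L) * r < \<delta>" using \<delta> k by (simp add: r_def) (simp add: r2 \<delta>)
 have rr: "(3 + 2 * L) * (r / 2) < \<delta>" using \<delta> by (simp only: times_divide_eq_right r2)
 have "1 * r <= (3 + 2 * L) * r" using r L_nonneg by (intro mult_right_mono) auto
 then have "1 * r < \<delta>" using r(2) by (rule le_less_trans)
 then have r\<delta>: "r < \<delta>" by simp
 show ?thesis
 proof (rule that[of r \<delta> "3 * (3 + 2 * L)" "z + (1 * (2 * r * (1 + L))) *\<^sub>R up" "z + ((- 1) * (2 * r * (1 + L))) *\<^sub>R up"])
  show "0 < r" "r < \<delta>" "\<delta> <= d" "3 * (3 + 2 * L) >= 0" using r r\<delta> \<delta> L_nonneg by auto
 next
  show "boundary_estimate \<Omega> z \<delta> r (3 * (3 + 2 * L))"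
  unfolding boundary_estimate_def
  proof (intro allI impI)
  fix u f assume u: "divfree \<Omega> u" "L2field (%x. indicator (ball z \<delta>) x *\<^sub>R u x)" and f1: "Ck (Suc 0) f" "\<forall>x. x \<notin> cball z (r / 2) --> f x = 0"
  then have f: "Ck (Suc 0) f" "!!x. x \<notin> cball z (r / 2) ==> f x = 0" by blast+
  have "indicator (ball z \<delta> - closure \<Omega>) x *\<^sub>R grad f x = indicator (ball z r - closure \<Omega>) x *\<^sub>R grad f x" for x
  proof (cases "x \<in> cball z (r / 2)")
   case True then show ?thesis using r r\<delta> by (auto simp: indicator_def)
  next
   case False
   then have "grad f x = 0" using pderiv3_zero_off_support[OF closed_cball f(2) False] by (simp add: grad_def vec_eq_iff)
   then show ?thesis by simp
  qed
  then have eq: "(%x. indicator (ball z \<delta> - closure \<Omega>) x *\<^sub>R grad f x) = (%x. indicator (ball z r - closure \<Omega>) x *\<^sub>R grad f x)"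
   by blast
  have r0: "r / 2 > 0" using r by simp
  show "norm (LI x. cdot (u x) (grad f x)) <=
     3 * (3 + 2 * L) * sqrt (sqn (%x. indicator (ball z \<delta>) x *\<^sub>R u x)) * sqrt (sqn (%x. indicator (ball z r - closure \<Omega>) x *\<^sub>R grad f x))"
   using reflection_estimate_L2[OF \<Omega> u(1) loc gz r0 rr u(2) f] unfolding eq .
  qed
 next
  fix x y assume x: "x \<in> ball z r - closure \<Omega>" and y: "y \<in> ball (z + (1 * (2 * r * (1 + L))) *\<^sub>R up) r"
  have xy: "norm (x - z) < r" "norm (y - (z + (1 * (2 * r * (1 + L))) *\<^sub>R up)) < r"
   using x y unfolding mem_ball dist_norm by (simp_all only: Diff_iff Int_iff mem_ball dist_norm norm_minus_commute)
  have sb: "closed_segment x y \<subseteq> ball z \<delta>" by (rule segment_in_ball[OF xy _ r]) simp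
  have xb: "x \<in> ball z \<delta>" using x r\<delta> by auto
  have g: "1 * (height x - graph x) > 0" using graph_side[OF loc xb] x by simp
  show "closed_segment x y \<subseteq> ball z \<delta> - closure \<Omega>"
  proof
   fix p assume p: "p \<in> closed_segment x y"
   then obtain s where s: "0 <= s" "s <= 1" "p = x + s *\<^sub>R (y - x)" using in_closed_segment_param by blast
   have pb: "p \<in> ball z \<delta>" using p sb by blast
   have "1 * (height p - graph p) > 0" unfolding s(3) by (rule segment_gap[OF xy s(1,2) _ g]) simp
   then show "p \<in> ball z \<delta> - closure \<Omega>" using graph_side[OF loc pb] pb by simp
  qed
 next
  fix x y assume x: "x \<in> ball z r \<inter> \<Omega>" and y: "y \<in> ball (z + ((- 1) * (2 * r * (1 + L))) *\<^sub>R up) r"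
  have xy: "norm (x - z) < r" "norm (y - (z + ((- 1) * (2 * r * (1 + L))) *\<^sub>R up)) < r"
   using x y unfolding mem_ball dist_norm by (simp_all only: Diff_iff Int_iff mem_ball dist_norm norm_minus_commute)
  have sb: "closed_segment x y \<subseteq> ball z \<delta>" by (rule segment_in_ball[OF xy _ r]) simp
  have xb: "x \<in> ball z \<delta>" using x r\<delta> by auto
  have g: "(- 1) * (height x - graph x) > 0" using loc[OF xb] x by simp
  show "closed_segment x y \<subseteq> ball z \<delta> \<inter> \<Omega>"
  proof
   fix p assume p: "p \<in> closed_segment x y"
   then obtain s where s: "0 <= s" "s <= 1" "p = x + s *\<^sub>R (y - x)" using in_closed_segment_param by blast
   have pb: "p \<in> ball z \<delta>" using p sb by blast
   have "(- 1) * (height p - graph p) > 0" unfolding s(3) by (rule segment_gap[OF xy s(1,2) _ g]) simp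
   then show "p \<in> ball z \<delta> \<inter> \<Omega>" using loc[OF pb] pb by simp
  qed
 next
  show "z \<in> closure (- closure \<Omega>)"
   unfolding closure_approachable
  proof (intro allI impI)
   fix e :: real assume e: "e > 0"
   define s where "s = min e \<delta> / 2"
   have s: "s > 0" "s < e" "s < \<delta>" using e \<delta> by (auto simp: s_def)
   define y where "y = z + s *\<^sub>R up"
   have "y \<in> ball z \<delta>" using s by (simp add: y_def dist_norm norm_up)
   from graph_side[OF loc this] have "y \<in> - closure \<Omega>" using s gz by (simp add: y_def graph_shift height_shift)
   moreover have "dist y z < e" using s by (simp add: y_def dist_norm norm_up)
   ultimately show "\<exists>y\<in>- closure \<Omega>. dist y z < e" by blast
  qed
 qed
qed

text \<open>The gradient is measured on E and the oscillation on W, so that several sets W can be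
  united under one and the same E.\<close>

definition poincare :: "(real^3) set => (real^3) set => bool" where
 "poincare E W \<longleftrightarrow> W \<in> sets borel \<and> emeasure lborel W < \<infinity> \<and> (\<exists>C::real. C > 0 \<and> (\<forall>q. Ck (Suc 0) q --> (\<exists>c.
   (NI x. nsq (q x - c) * indicator W x) <= ennreal C * (NI x. nsq (grad q x) * indicator E x))))"

lemma emeasure_ball_real:
 assumes "r > 0"
 shows "\<exists>v>0. emeasure lborel (ball (c :: 'a::euclidean_space) r) = ennreal v"
 using emeasure_lborel_ball_finite[of c r] content_ball_pos[OF assms, of c]
 by (intro exI[of _ "measure lborel (ball c r)"] conjI emeasure_eq_ennreal_measure) auto

text \<open>q(x) - q(y) is the line integral of grad q. The pigeonhole principle finds a vertex y in
  the ball for which the integral of |grad q|^2 along the segments to x, taken over all x in W, is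
  controlled by its integral over E; then q(y) is the constant.\<close>

lemma poincare_star_shaped:
 assumes [measurable]: "E \<in> sets borel" and W [measurable]: "W \<in> sets borel" "emeasure lborel W < \<infinity>"
  and \<rho>: "\<rho> > 0"
  and seg: "!!x y. x \<in> W ==> y \<in> ball c \<rho> ==> closed_segment x y \<subseteq> E"
  and d: "!!x y. x \<in> W ==> y \<in> ball c \<rho> ==> norm (x - y) <= d" and "d >= 0"
 shows "poincare E W"
proof -
 define D where "D = ball c \<rho>"
 have D [measurable]: "D \<in> sets borel" by (simp add: D_def)
 obtain vD where vD: "vD > 0" "emeasure lborel D = ennreal vD"
  using emeasure_ball_real[OF \<rho>, of c] unfolding D_def by blast
 obtain vW where vW: "vW >= 0" "emeasure lborel W = ennreal vW"
  using W(2) by (metis enn2real_nonneg ennreal_enn2real infinity_ennreal_def)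
 define K where "K = 8 * (vW + vD)"
 have K: "K > 0" using vW vD by (simp add: K_def)
 \<comment> \<open>The summand 1 makes C positive even for d = 0, so that the inequality is trivial
   when the gradient integral is infinite.\<close>
 define C where "C = d\<^sup>2 * (2 * K / vD) + 1"
 have C: "C > 0" using K vD by (simp add: C_def add_nonneg_pos)
 have "\<exists>b. (NI x. nsq (q x - b) * indicator W x) <= ennreal C * (NI x. nsq (grad q x) * indicator E x)"
  if q: "Ck (Suc 0) q" for q
 proof (cases "(NI x. nsq (grad q x) * indicator E x) = \<infinity>")
  case True
  then show ?thesis using C by (simp add: ennreal_mult_top)
 next
  case False
  have [measurable]: "grad q \<in> borel_measurable borel" "q \<in> borel_measurable borel"
   using borel_grad[OF q] borel_measurable_continuous_onI[OF Ck_continuous[OF q]] by auto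
  define F where "F x = nsq (grad q x) * indicator E x" for x
  have Fm [measurable]: "F \<in> borel_measurable borel" unfolding F_def by measurable
  obtain i where i: "i >= 0" "(NI x. F x) = ennreal i"
   using False unfolding F_def by (metis enn2real_nonneg ennreal_enn2real infinity_ennreal_def less_top)
  define G where "G y = (NI x. NI t. F (y + t *\<^sub>R (x - y)) * indicator {0..<1::real} t * indicator W x)" for y
  have Gm: "G \<in> borel_measurable borel" unfolding G_def by measurable
  have "(NI y. G y * indicator D y) = (NI y. NI x. NI t. F (y + t *\<^sub>R (x - y)) * indicator {0..<1::real} t * indicator W x * indicator D y)"
   unfolding G_def by (intro nn_integral_cong) (simp add: nn_integral_multc)
  also have "\<dots> <= 8 * (emeasure lborel W + emeasure lborel D) * (NI x. F x)"
   by (rule segment_estimate_unweighted) measurable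
  also have "\<dots> = ennreal (K * i)"
  proof -
   have "emeasure lborel W + emeasure lborel D = ennreal (vW + vD)"
    unfolding vW(2) vD(2) using vW(1) vD(1) by (simp add: ennreal_plus)
   moreover have "8 * ennreal (vW + vD) = ennreal K"
    using vW(1) vD(1) ennreal_mult[of 8 "vW + vD"] by (simp add: K_def)
   ultimately show ?thesis unfolding i(2) using K i(1) by (simp add: ennreal_mult)
  qed
  finally have "(NI y. G y * indicator D y) <= ennreal (K * i)" .
  then obtain y where y: "y \<in> D" "G y <= ennreal (2 * (K * i) / vD)"
   using pigeonhole_nn_integral[of G lborel D vD "K * i"] Gm D vD K i by auto
  have "(NI x. nsq (q x - q y) * indicator W x) <= (NI x. ennreal (d\<^sup>2) * (NI t. F (y + t *\<^sub>R (x - y)) * indicator {0..<1::real} t * indicator W x))"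
  proof (rule nn_integral_mono)
   fix x
   show "nsq (q x - q y) * indicator W x <= ennreal (d\<^sup>2) * (NI t. F (y + t *\<^sub>R (x - y)) * indicator {0..<1::real} t * indicator W x)"
   proof (cases "x \<in> W")
    case True
    have yc: "y \<in> ball c \<rho>" using y by (simp add: D_def)
    have "nsq (q x - q y) <= nsq (x - y) * (NI t. nsq (grad q (y + t *\<^sub>R (x - y))) * indicator {0..<1} t)"
     unfolding line_int_grad[OF q, symmetric] by (rule norm_line_int_square_le) measurable
    also have "\<dots> <= ennreal (d\<^sup>2) * (NI t. F (y + t *\<^sub>R (x - y)) * indicator {0..<1::real} t * indicator W x)"
    proof (rule mult_mono, intro ennreal_leI power_mono d[OF True yc], simp, rule nn_integral_mono)
     fix t :: real
     have "y + t *\<^sub>R (x - y) \<in> E" if "t \<in> {0..<1}"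
      using subsetD[OF seg[OF True yc] param_in_closed_segment[of t y x]] that by auto
     then show "nsq (grad q (y + t *\<^sub>R (x - y))) * indicator {0..<1} t <= F (y + t *\<^sub>R (x - y)) * indicator {0..<1::real} t * indicator W x"
      using True by (auto simp: F_def indicator_def)
    qed auto
    finally show ?thesis using True by simp
   qed simp
  qed
  also have "\<dots> = ennreal (d\<^sup>2) * G y" unfolding G_def by (rule nn_integral_cmult) measurable
  also have "\<dots> <= ennreal (d\<^sup>2) * ennreal (2 * (K * i) / vD)" by (intro mult_left_mono y) simp
  also have "\<dots> = ennreal (d\<^sup>2 * (2 * (K * i) / vD))" using K vD(1) i(1) by (intro ennreal_mult[symmetric]) auto
  also have "d\<^sup>2 * (2 * (K * i) / vD) = d\<^sup>2 * (2 * K / vD) * i" by simp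
  also have "\<dots> <= ennreal (C * i)" using i by (intro ennreal_leI mult_right_mono) (auto simp: C_def)
  also have "\<dots> = ennreal C * (NI x. F x)" using C i by (simp add: ennreal_mult)
  finally show ?thesis unfolding F_def by blast
 qed
 then show ?thesis unfolding poincare_def using W C by blast
qed

lemma norm_diff_square_le:
 fixes a b c :: "'a::real_normed_vector"
 shows "(norm (a - c))\<^sup>2 <= 2 * (norm (a - b))\<^sup>2 + 2 * (norm (b - c))\<^sup>2"
proof -
 have "norm (a - c) <= norm (a - b) + norm (b - c)"
  using norm_triangle_ineq[of "a - b" "b - c"] by simp
 then have "(norm (a - c))\<^sup>2 <= (norm (a - b) + norm (b - c))\<^sup>2" by (intro power_mono) auto
 also have "\<dots> <= 2 * (norm (a - b))\<^sup>2 + 2 * (norm (b - c))\<^sup>2"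
  using zero_le_power2[of "norm (a - b) - norm (b - c)"] by (simp add: power2_eq_square algebra_simps)
 finally show ?thesis .
qed

lemma nn_integral_square_diff_le:
 assumes [measurable]: "q \<in> borel_measurable borel" "W \<in> sets borel" "V \<in> sets borel" and "V \<subseteq> W"
 shows "(NI x. nsq (q x - c) * indicator V x) <=
  2 * (NI x. nsq (q x - b :: complex) * indicator W x) + 2 * (nsq (b - c) * emeasure lborel V)"
proof -
 have "(NI x. nsq (q x - c) * indicator V x) <=
  (NI x. 2 * (nsq (q x - b) * indicator W x) + 2 * nsq (b - c) * indicator V x)"
 proof (rule nn_integral_mono)
  fix x
  have "nsq (q x - c) <= ennreal (2 * (norm (q x - b))\<^sup>2 + 2 * (norm (b - c))\<^sup>2)"
   by (intro ennreal_leI norm_diff_square_le)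
  then show "nsq (q x - c) * indicator V x <= 2 * (nsq (q x - b) * indicator W x) + 2 * nsq (b - c) * indicator V x"
   using assms(4) by (auto simp: indicator_def ennreal_mult)
 qed
 also have "\<dots> = 2 * (NI x. nsq (q x - b) * indicator W x) + 2 * (nsq (b - c) * emeasure lborel V)"
  by (subst nn_integral_add) (simp_all add: nn_integral_cmult nn_integral_cmult_indicator mult.assoc)
 finally show ?thesis .
qed

lemma two_ennreal_add:
 assumes "0 <= a" "0 <= b"
 shows "2 * ennreal a + 2 * ennreal b = ennreal (2 * a + 2 * b)"
 using assms by (simp add: ennreal_plus ennreal_mult)

text \<open>On the common ball q is close to both constants, which bounds |c2 - c1|^2 by K times the
  gradient integral. Hence c1 serves on W2 as well.\<close>

lemma poincare_Un:
 assumes 1: "poincare E W1" and 2: "poincare E W2" and B: "ball c \<rho> \<subseteq> W1 \<inter> W2" "\<rho> > 0"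
 shows "poincare E (W1 \<union> W2)"
proof -
 obtain C1 where C1: "C1 > 0" "!!q. Ck (Suc 0) q ==> \<exists>c.
   (NI x. nsq (q x - c) * indicator W1 x) <= ennreal C1 * (NI x. nsq (grad q x) * indicator E x)"
  using 1 unfolding poincare_def by blast
 obtain C2 where C2: "C2 > 0" "!!q. Ck (Suc 0) q ==> \<exists>c.
   (NI x. nsq (q x - c) * indicator W2 x) <= ennreal C2 * (NI x. nsq (grad q x) * indicator E x)"
  using 2 unfolding poincare_def by blast
 have W [measurable]: "W1 \<in> sets borel" "W2 \<in> sets borel" and Wf: "emeasure lborel W1 < \<infinity>" "emeasure lborel W2 < \<infinity>"
  using 1 2 by (auto simp: poincare_def)
 obtain v2 where v2: "v2 >= 0" "emeasure lborel W2 = ennreal v2"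
  using Wf(2) by (metis enn2real_nonneg ennreal_enn2real infinity_ennreal_def)
 define D where "D = ball c \<rho>"
 have D [measurable]: "D \<in> sets borel" "D \<subseteq> W1" "D \<subseteq> W2" using B by (auto simp: D_def)
 obtain vD where vD: "vD > 0" "emeasure lborel D = ennreal vD"
  using emeasure_ball_real[OF B(2), of c] unfolding D_def by blast
 define K where "K = (2 * C1 + 2 * C2) / vD"
 define C where "C = C1 + (2 * C2 + 2 * (K * v2))"
 have "K >= 0" using C1(1) C2(1) vD by (simp add: K_def)
 then have C: "C > 0" using C1(1) C2(1) v2 by (simp add: C_def add_pos_nonneg)
 have "\<exists>c. (NI x. nsq (q x - c) * indicator (W1 \<union> W2) x) <= ennreal C * (NI x. nsq (grad q x) * indicator E x)"
  if q: "Ck (Suc 0) q" for q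
 proof (cases "(NI x. nsq (grad q x) * indicator E x) = \<infinity>")
  case True
  then show ?thesis using C by (simp add: ennreal_mult_top)
 next
  case False
  have [measurable]: "q \<in> borel_measurable borel"
   using borel_measurable_continuous_onI[OF Ck_continuous[OF q]] by auto
  obtain i where i: "i >= 0" "(NI x. nsq (grad q x) * indicator E x) = ennreal i"
   using False by (metis enn2real_nonneg ennreal_enn2real infinity_ennreal_def less_top)
  obtain c1 where c1: "(NI x. nsq (q x - c1) * indicator W1 x) <= ennreal (C1 * i)"
   using C1(2)[OF q] C1(1) i by (auto simp: ennreal_mult)
  obtain c2 where c2: "(NI x. nsq (q x - c2) * indicator W2 x) <= ennreal (C2 * i)"
   using C2(2)[OF q] C2(1) i by (auto simp: ennreal_mult)
  define n where "n = (norm (c2 - c1))\<^sup>2"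
  have n0: "n >= 0" by (simp add: n_def)
  have "ennreal (n * vD) = (NI x. ennreal n * indicator D x)"
   using vD n0 by (simp add: nn_integral_cmult_indicator ennreal_mult)
  also have "\<dots> <= (NI x. 2 * (nsq (q x - c1) * indicator W1 x) + 2 * (nsq (q x - c2) * indicator W2 x))"
  proof (rule nn_integral_mono)
   fix x
   have "n <= 2 * (norm (q x - c1))\<^sup>2 + 2 * (norm (q x - c2))\<^sup>2"
    using norm_diff_square_le[of c2 c1 "q x"] by (simp add: n_def norm_minus_commute add.commute)
   then have "ennreal n <= ennreal (2 * (norm (q x - c1))\<^sup>2 + 2 * (norm (q x - c2))\<^sup>2)" by (rule ennreal_leI)
   then show "ennreal n * indicator D x <= 2 * (nsq (q x - c1) * indicator W1 x) + 2 * (nsq (q x - c2) * indicator W2 x)"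
    using D by (auto simp: indicator_def ennreal_mult)
  qed
  also have "\<dots> = 2 * (NI x. nsq (q x - c1) * indicator W1 x) + 2 * (NI x. nsq (q x - c2) * indicator W2 x)"
   by (subst nn_integral_add) (simp_all add: nn_integral_cmult)
  also have "\<dots> <= 2 * ennreal (C1 * i) + 2 * ennreal (C2 * i)" by (intro add_mono mult_left_mono c1 c2) auto
  also have "\<dots> = ennreal (2 * (C1 * i) + 2 * (C2 * i))"
   using C1(1) C2(1) i(1) by (intro two_ennreal_add) auto
  also have "2 * (C1 * i) + 2 * (C2 * i) = (2 * C1 + 2 * C2) * i" by (simp add: algebra_simps)
  finally have "n * vD <= (2 * C1 + 2 * C2) * i" using C1(1) C2(1) i(1) by (subst (asm) ennreal_le_iff) auto
  then have n: "n <= K * i" using vD by (simp add: K_def field_simps)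
  have "(NI x. nsq (q x - c1) * indicator (W1 \<union> W2) x) <=
    (NI x. nsq (q x - c1) * indicator W1 x + nsq (q x - c1) * indicator W2 x)"
   by (intro nn_integral_mono) (auto simp: indicator_def)
  also have "\<dots> = (NI x. nsq (q x - c1) * indicator W1 x) + (NI x. nsq (q x - c1) * indicator W2 x)"
   by (rule nn_integral_add) measurable
  also have "\<dots> <= ennreal (C1 * i) + (2 * ennreal (C2 * i) + 2 * (ennreal n * ennreal v2))"
  proof (intro add_mono c1)
   have "(NI x. nsq (q x - c1) * indicator W2 x) <=
    2 * (NI x. nsq (q x - c2) * indicator W2 x) + 2 * (nsq (c2 - c1) * emeasure lborel W2)"
    by (rule nn_integral_square_diff_le) auto
   also have "\<dots> <= 2 * ennreal (C2 * i) + 2 * (ennreal n * ennreal v2)"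
    unfolding n_def v2 by (intro add_mono mult_left_mono c2) auto
   finally show "(NI x. nsq (q x - c1) * indicator W2 x) <= 2 * ennreal (C2 * i) + 2 * (ennreal n * ennreal v2)" .
  qed
  also have "\<dots> = ennreal (C1 * i + (2 * (C2 * i) + 2 * (n * v2)))"
  proof -
   have "2 * ennreal (C2 * i) + 2 * (ennreal n * ennreal v2) = ennreal (2 * (C2 * i) + 2 * (n * v2))"
    using C2(1) i(1) n0 v2(1) two_ennreal_add[of "C2 * i" "n * v2"] by (simp add: ennreal_mult)
   then show ?thesis using C1(1) C2(1) i(1) n0 v2(1) by (simp add: ennreal_plus)
  qed
  also have "\<dots> <= ennreal (C * i)"
  proof (rule ennreal_leI)
   have "n * v2 <= K * i * v2" using n v2 by (intro mult_right_mono) auto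
   then show "C1 * i + (2 * (C2 * i) + 2 * (n * v2)) <= C * i" by (simp add: C_def algebra_simps)
  qed
  also have "\<dots> = ennreal C * (NI x. nsq (grad q x) * indicator E x)" using C i by (simp add: ennreal_mult)
  finally show ?thesis by blast
 qed
 moreover have "emeasure lborel (W1 \<union> W2) < \<infinity>"
  using emeasure_subadditive[of W1 lborel W2] Wf W by (auto intro: le_less_trans)
 ultimately show ?thesis unfolding poincare_def using C W by blast
qed

text \<open>Take a maximal subset Y of Z whose union satisfies the inequality. If Y were not all of
  Z, then by connectedness of K some U over Y would meet some U over Z - Y on K, and the W of the
  latter could be added.\<close>

lemma poincare_chain:
 assumes Z: "finite Z" "Z ~= {}" "Z \<subseteq> K" and K: "connected K" "K \<subseteq> (\<Union>z\<in>Z. U z)"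
  and U: "!!z. z \<in> Z ==> open (U z) \<and> z \<in> U z"
  and P: "!!z. z \<in> Z ==> poincare E (W z)"
  and meet: "!!z z'. z \<in> Z ==> z' \<in> Z ==> U z \<inter> U z' \<inter> K ~= {} ==> \<exists>c \<rho>. \<rho> > 0 \<and> ball c \<rho> \<subseteq> W z \<inter> W z'"
 shows "poincare E (\<Union>z\<in>Z. W z)"
proof -
 define \<Z> where "\<Z> = {Y. Y \<subseteq> Z \<and> Y ~= {} \<and> poincare E (\<Union>z\<in>Y. W z)}"
 obtain z0 where z0: "z0 \<in> Z" using Z by blast
 then have "{z0} \<in> \<Z>" using P by (simp add: \<Z>_def)
 moreover have "finite \<Z>" using Z unfolding \<Z>_def by (auto intro: finite_subset[of _ "Pow Z"])
 ultimately obtain Y where Y: "Y \<in> \<Z>" "!!Y'. Y' \<in> \<Z> ==> Y \<subseteq> Y' ==> Y' = Y"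
  using finite_has_maximal[of \<Z>] by blast
 have "Y = Z"
 proof (rule ccontr)
  assume ne: "Y ~= Z"
  have YZ: "Y \<subseteq> Z" "Y ~= {}" using Y by (auto simp: \<Z>_def)
  define A B where "A = (\<Union>z\<in>Y. U z)" and "B = (\<Union>z\<in>Z - Y. U z)"
  have "open A" "open B" using U YZ unfolding A_def B_def by (auto intro!: open_UN)
  moreover have "K \<subseteq> A \<union> B" using K YZ by (auto simp: A_def B_def)
  moreover have "A \<inter> K ~= {}" using YZ U Z(3) unfolding A_def by blast
  moreover have "B \<inter> K ~= {}" using YZ ne U Z(3) unfolding B_def by blast
  ultimately have "A \<inter> B \<inter> K ~= {}" using K(1) unfolding connected_def by blast
  then obtain x where x: "x \<in> A" "x \<in> B" "x \<in> K" by blast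
  obtain z where z: "z \<in> Y" "x \<in> U z" using x by (auto simp: A_def)
  obtain z' where z': "z' \<in> Z" "z' \<notin> Y" "x \<in> U z'" using x by (auto simp: B_def)
  obtain c \<rho> where c: "\<rho> > 0" "ball c \<rho> \<subseteq> W z \<inter> W z'" using meet[of z z'] z z' x YZ by blast
  have "poincare E ((\<Union>z\<in>Y. W z) \<union> W z')"
   using c z by (intro poincare_Un[of _ _ _ c \<rho>] P z') (use Y in \<open>auto simp: \<Z>_def\<close>)
  moreover have "(\<Union>z\<in>insert z' Y. W z) = (\<Union>z\<in>Y. W z) \<union> W z'" by blast
  ultimately have "insert z' Y \<in> \<Z>" using YZ z' by (simp add: \<Z>_def)
  then show False using Y(2)[of "insert z' Y"] z' by blast
 qed
 then show ?thesis using Y by (simp add: \<Z>_def)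
qed

text \<open>The indicator of the ball of radius 3 a / 2, mollified at radius a / 2.\<close>

lemma smooth_bump:
 assumes "a > 0"
 obtains b where "smooth b" "!!x. x \<in> ball z a ==> b x = 1" "!!x. x \<notin> cball z (2 * a) ==> b x = 0"
proof -
 obtain m where "is_mollifier (a / 2) m" using mollifier_exists[of "a / 2"] assms by auto
 then interpret mollifier "a / 2" m by unfold_locales
 define F :: "real^3 => complex" where "F x = complex_of_real (indicator (ball z (3 / 2 * a)) x)" for x
 have Fi: "integrable lborel F"
  unfolding F_def using emeasure_lborel_ball_finite[of z "3 / 2 * a"]
  by (intro integrable_of_real integrable_real_indicator) auto
 show ?thesis
 proof (rule that[of "conv cm F"])
  show "smooth (conv cm F)" by (rule smooth_conv_cm[OF Fi])
  show "conv cm F x = 1" if x: "x \<in> ball z a" for x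
  proof -
   have "norm (conv cm F x - 1) <= 0"
   proof (rule conv_close[OF Fi])
    fix y assume "norm (x - y) < a / 2"
    then have "dist z y < 3 / 2 * a" using x dist_triangle[of z y x] by (simp add: dist_norm)
    then show "norm (F y - 1) <= 0" by (simp add: F_def)
   qed
   then show ?thesis by simp
  qed
  show "conv cm F x = 0" if x: "x \<notin> cball z (2 * a)" for x
  proof (rule conv_eq_0)
   fix y assume "norm (x - y) < a / 2"
   then have "\<not> dist z y < 3 / 2 * a" using x dist_triangle[of z x y] by (simp add: dist_norm norm_minus_commute)
   then show "F y = 0" by (simp add: F_def)
  qed
 qed
qed

lemma smooth_partition_of_unity:
 assumes "finite Z" "!!z. z \<in> Z ==> a z > 0"
 shows "\<exists>\<zeta>. (\<forall>z\<in>Z. smooth (\<zeta> z) \<and> (\<forall>x. x \<notin> cball z (2 * a z) --> \<zeta> z x = 0)) \<and>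
  (\<forall>x. (\<exists>z\<in>Z. x \<in> ball z (a z)) --> (\<Sum>z\<in>Z. \<zeta> z x) = 1)"
 using assms
proof (induction Z)
 case (insert z Z)
 then obtain \<zeta> where \<zeta>: "!!z. z \<in> Z ==> smooth (\<zeta> z)" "!!z x. z \<in> Z ==> x \<notin> cball z (2 * a z) ==> \<zeta> z x = 0"
  "!!x. (\<exists>z\<in>Z. x \<in> ball z (a z)) ==> (\<Sum>z\<in>Z. \<zeta> z x) = 1"
  by auto
 obtain b where b: "smooth b" "!!x. x \<in> ball z (a z) ==> b x = 1" "!!x. x \<notin> cball z (2 * a z) ==> b x = 0"
  using smooth_bump[of "a z" z] insert.prems by auto
 have ss: "smooth (%x. \<Sum>z\<in>Z. \<zeta> z x)"
  using insert.hyps(1) \<zeta>(1) by (induction Z rule: finite_induct) (auto intro: smooth_const smooth_add)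
 \<comment> \<open>The new sum is 1 - (1 - b) (1 - S), with S the old sum, hence 1 wherever b or S
   is 1.\<close>
 define \<zeta>' where "\<zeta>' = \<zeta>(z := (%x. b x * (1 - (\<Sum>z\<in>Z. \<zeta> z x))))"
 have sum: "(\<Sum>w\<in>insert z Z. \<zeta>' w x) = b x * (1 - (\<Sum>z\<in>Z. \<zeta> z x)) + (\<Sum>z\<in>Z. \<zeta> z x)" for x
 proof -
  have "(\<Sum>w\<in>Z. \<zeta>' w x) = (\<Sum>w\<in>Z. \<zeta> w x)" using insert.hyps by (intro sum.cong) (auto simp: \<zeta>'_def)
  then show ?thesis using insert.hyps by (simp add: \<zeta>'_def)
 qed
 show ?case
 proof (intro exI[of _ \<zeta>'] conjI ballI allI impI)
  fix w assume "w \<in> insert z Z"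
  then show "smooth (\<zeta>' w)" using \<zeta>(1) b(1) ss by (auto simp: \<zeta>'_def intro!: smooth_mult smooth_diff smooth_const)
  fix x assume "x \<notin> cball w (2 * a w)"
  then show "\<zeta>' w x = 0" using \<zeta>(2)[of w x] b(3)[of x] \<open>w \<in> insert z Z\<close> by (auto simp: \<zeta>'_def)
 next
  fix x assume "\<exists>w\<in>insert z Z. x \<in> ball w (a w)"
  then show "(\<Sum>w\<in>insert z Z. \<zeta>' w x) = 1"
  proof
   fix w assume w: "w \<in> insert z Z" "x \<in> ball w (a w)"
   show ?thesis
   proof (cases "w = z")
    case True with b(2)[of x] w show ?thesis unfolding sum by simp
   next
    case False
    with w have "\<exists>w\<in>Z. x \<in> ball w (a w)" by blast
    from \<zeta>(3)[OF this] show ?thesis unfolding sum by simp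
   qed
  qed
 qed
qed simp

section \<open>Cocycles on simply connected sets\<close>

lemma sum_lessThan_double:
 fixes f :: "nat => 'b::comm_monoid_add"
 shows "(\<Sum>j<2 * m. f j) = (\<Sum>j<m. f (2 * j) + f (2 * j + 1))"
 by (induction m) (simp_all add: add.assoc)

lemma sum_lessThan_split_add:
 fixes f :: "nat => 'b::comm_monoid_add"
 shows "(\<Sum>j<m + k. f j) = (\<Sum>j<m. f j) + (\<Sum>i<k. f (m + i))"
 by (induction k) (simp_all add: add.assoc)

lemma dyadic_in: "j <= 2 ^ n ==> real j / 2 ^ n \<in> {0..1}"
proof -
 assume "j <= 2 ^ n"
 then have "real j <= real (2 ^ n)" by (simp only: of_nat_le_iff)
 then show ?thesis by (simp add: divide_le_eq)
qed

text \<open>The primitive of a cocycle at \<open>x\<close> is its sum along a fine dyadic subdivision of a path from a base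
  point to \<open>x\<close>: refinement does not change the sum, and homotopic paths give the same sum.\<close>

definition dyadic_sum :: "('a => 'a => 'b::comm_monoid_add) => nat => (real => 'a) => 'b" where
 "dyadic_sum D n \<gamma> = (\<Sum>j<2 ^ n. D (\<gamma> (real j / 2 ^ n)) (\<gamma> (real (j + 1) / 2 ^ n)))"

text \<open>In the application \<open>D a b\<close> is the constant by which the potentials on the
  balls around a and b differ. Additivity is known only for triples inside one of the small
  balls.\<close>

locale local_cocycle =
 fixes S :: "'a::euclidean_space set" and r :: "'a => real" and D :: "'a => 'a => 'b::ab_group_add"
 assumes rpos: "!!z. z \<in> S ==> r z > 0"
  and cocycle: "!!z a b c. z \<in> S ==> a \<in> ball z (r z) ==> b \<in> ball z (r z) ==> c \<in> ball z (r z) ==> D a b + D b c = D a c"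
begin

lemma D_refl: "z \<in> S ==> a \<in> ball z (r z) ==> D a a = 0"
 using cocycle[of z a a a] by simp

lemma D_swap: "z \<in> S ==> a \<in> ball z (r z) ==> b \<in> ball z (r z) ==> D b a = - D a b"
 using cocycle[of z a b a] D_refl[of z a] by (simp add: eq_neg_iff_add_eq_0 add.commute)

lemma compact_uniform:
 assumes "compact K" "K \<subseteq> S"
 obtains \<delta> where "\<delta> > 0" "!!x. x \<in> K ==> \<exists>z\<in>S. ball x \<delta> \<subseteq> ball z (r z)"
proof -
 have "K \<subseteq> \<Union> ((%z. ball z (r z)) ` S)" using assms rpos by force
 then obtain e where "e > 0" "!!x. x \<in> K ==> \<exists>T\<in>(%z. ball z (r z)) ` S. ball x e \<subseteq> T"
  using Heine_Borel_lemma[OF assms(1)] by (metis (no_types, lifting) imageE open_ball)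
 then show ?thesis using that by blast
qed

text \<open>A Lebesgue number for the cover of the path by the balls, together with uniform
  continuity of the path.\<close>

lemma path_fine:
 assumes "path \<gamma>" "path_image \<gamma> \<subseteq> S"
 obtains N where "!!n s t. n >= N ==> s \<in> {0..1} ==> t \<in> {0..1} ==> \<bar>s - t\<bar> <= 1 / 2 ^ n ==>
   \<exists>z\<in>S. \<gamma> s \<in> ball z (r z) \<and> (\<forall>t\<in>{0..1}. \<bar>s - t\<bar> <= 1 / 2 ^ n --> \<gamma> t \<in> ball z (r z))"
proof -
 obtain \<delta> where \<delta>: "\<delta> > 0" "!!x. x \<in> path_image \<gamma> ==> \<exists>z\<in>S. ball x \<delta> \<subseteq> ball z (r z)"
  using compact_uniform[OF compact_path_image[OF assms(1)] assms(2)] by blast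
 have "uniformly_continuous_on {0..1} \<gamma>"
  using assms(1) by (intro compact_uniformly_continuous) (auto simp: path_def)
 then obtain \<eta> where \<eta>: "\<eta> > 0" "!!s t. s \<in> {0..1} ==> t \<in> {0..1} ==> dist t s < \<eta> ==> dist (\<gamma> t) (\<gamma> s) < \<delta>"
  using \<delta>(1) unfolding uniformly_continuous_on_def by metis
 obtain N where N: "(1 / 2) ^ N < \<eta>" using real_arch_pow_inv[of \<eta> "1 / 2"] \<eta>(1) by auto
 show ?thesis
 proof (rule that[of N])
  fix n and s t :: real assume n: "n >= N" and s: "s \<in> {0..1}" and t: "t \<in> {0..1}" "\<bar>s - t\<bar> <= 1 / 2 ^ n"
  have "(1 / 2 :: real) ^ n <= (1 / 2) ^ N" using n by (intro power_decreasing) auto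
  then have "1 / 2 ^ n < \<eta>" using N by (simp add: power_divide)
  then have close: "\<gamma> t \<in> ball (\<gamma> s) \<delta>" if "t \<in> {0..1}" "\<bar>s - t\<bar> <= 1 / 2 ^ n" for t
   using \<eta>(2)[OF s that(1)] that(2) by (auto simp: dist_real_def dist_commute abs_minus_commute)
  have "\<gamma> s \<in> path_image \<gamma>" using s by (simp add: path_image_def)
  then obtain z where z: "z \<in> S" "ball (\<gamma> s) \<delta> \<subseteq> ball z (r z)" using \<delta>(2) by blast
  have "\<gamma> s \<in> ball z (r z)" using \<delta>(1) by (intro subsetD[OF z(2)]) simp
  moreover have "\<gamma> t \<in> ball z (r z)" if "t \<in> {0..1}" "\<bar>s - t\<bar> <= 1 / 2 ^ n" for t
   by (rule subsetD[OF z(2) close[OF that]])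
  ultimately show "\<exists>z\<in>S. \<gamma> s \<in> ball z (r z) \<and> (\<forall>t\<in>{0..1}. \<bar>s - t\<bar> <= 1 / 2 ^ n --> \<gamma> t \<in> ball z (r z))"
   using z(1) by blast
 qed
qed

lemma dyadic_sum_refine:
 assumes "path \<gamma>" "path_image \<gamma> \<subseteq> S"
 obtains N where "!!n. n >= N ==> dyadic_sum D n \<gamma> = dyadic_sum D N \<gamma>"
proof -
 obtain N where N: "!!n s t. n >= N ==> s \<in> {0..1} ==> t \<in> {0..1} ==> \<bar>s - t\<bar> <= 1 / 2 ^ n ==>
   \<exists>z\<in>S. \<gamma> s \<in> ball z (r z) \<and> (\<forall>t\<in>{0..1}. \<bar>s - t\<bar> <= 1 / 2 ^ n --> \<gamma> t \<in> ball z (r z))"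
  using path_fine[OF assms] by blast
 have step: "dyadic_sum D (Suc n) \<gamma> = dyadic_sum D n \<gamma>" if n: "n >= N" for n
 proof -
  have "dyadic_sum D (Suc n) \<gamma> = (\<Sum>j<2 ^ n. D (\<gamma> (real (2 * j) / 2 ^ Suc n)) (\<gamma> (real (2 * j + 1) / 2 ^ Suc n))
    + D (\<gamma> (real (2 * j + 1) / 2 ^ Suc n)) (\<gamma> (real (2 * j + 1 + 1) / 2 ^ Suc n)))"
   unfolding dyadic_sum_def power_Suc sum_lessThan_double ..
  also have "\<dots> = dyadic_sum D n \<gamma>"
   unfolding dyadic_sum_def
  proof (rule sum.cong[OF refl])
   fix j :: nat assume j: "j \<in> {..<2 ^ n}"
   define p where "p = (2 :: real) ^ n"
   have "real (j + 1) <= real (2 ^ n)" using j unfolding of_nat_le_iff by simp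
   then have p: "p > 0" "real j + 1 <= p" by (auto simp: p_def)
   have e: "real (2 * j) / 2 ^ Suc n = real j / p" "real (2 * j + 1) / 2 ^ Suc n = (real j + 1 / 2) / p"
     "real (2 * j + 1 + 1) / 2 ^ Suc n = (real j + 1) / p" "real j / 2 ^ n = real j / p" "real (j + 1) / 2 ^ n = (real j + 1) / p"
    using p by (auto simp: p_def field_simps)
   have 0: "real j / p \<in> {0..1}" "\<bar>real j / p - real j / p\<bar> <= 1 / 2 ^ n"
    using p(2) dyadic_in[of j n] j by (simp_all add: p_def)
   obtain z where z: "z \<in> S" "\<forall>t\<in>{0..1}. \<bar>real j / p - t\<bar> <= 1 / 2 ^ n --> \<gamma> t \<in> ball z (r z)"
    using N[OF n 0(1) 0(1) 0(2)] by blast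
   have near: "\<gamma> ((real j + c) / p) \<in> ball z (r z)" if "0 <= c" "c <= 1" for c
   proof -
    have "(real j + c) / p \<in> {0..1}" using p that by (simp add: divide_le_eq)
    moreover have "\<bar>real j / p - (real j + c) / p\<bar> = c / p" using p that by (simp add: add_divide_distrib)
    moreover have "c / p <= 1 / 2 ^ n" using p that by (simp add: p_def divide_right_mono)
    ultimately show ?thesis using z(2) by auto
   qed
   have "\<gamma> (real j / p) \<in> ball z (r z)" "\<gamma> ((real j + 1 / 2) / p) \<in> ball z (r z)" "\<gamma> ((real j + 1) / p) \<in> ball z (r z)"
    using near[of 0] near[of "1 / 2"] near[of 1] by simp_all
   then show "D (\<gamma> (real (2 * j) / 2 ^ Suc n)) (\<gamma> (real (2 * j + 1) / 2 ^ Suc n))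
    + D (\<gamma> (real (2 * j + 1) / 2 ^ Suc n)) (\<gamma> (real (2 * j + 1 + 1) / 2 ^ Suc n)) = D (\<gamma> (real j / 2 ^ n)) (\<gamma> (real (j + 1) / 2 ^ n))"
    unfolding e using cocycle[OF z(1)] by blast
  qed
  finally show ?thesis .
 qed
 have "dyadic_sum D n \<gamma> = dyadic_sum D N \<gamma>" if "n >= N" for n
  using that by (induction rule: dec_induct) (auto simp: step)
 then show ?thesis using that by blast
qed

text \<open>Dyadic subdivision makes this an identity at every level: \<open>+++\<close> halves the
  parameter interval, so each path receives 2^n of the 2^(n+1) edges.\<close>

lemma dyadic_sum_joinpaths:
 assumes "pathfinish \<gamma> = pathstart \<gamma>'"
 shows "dyadic_sum D (Suc n) (\<gamma> +++ \<gamma>') = dyadic_sum D n \<gamma> + dyadic_sum D n \<gamma>'"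
proof -
 define p where "p = (2 :: real) ^ n"
 have p: "p > 0" "real (2 ^ n) = p" by (auto simp: p_def)
 have 1: "(\<gamma> +++ \<gamma>') (real j / 2 ^ Suc n) = \<gamma> (real j / 2 ^ n)" if "j <= 2 ^ n" for j
 proof -
  have "real j <= p" using that p(2) by (metis of_nat_le_iff)
  then show ?thesis using p by (auto simp: joinpaths_def p_def[symmetric] field_simps)
 qed
 have 2: "(\<gamma> +++ \<gamma>') (real (2 ^ n + j) / 2 ^ Suc n) = \<gamma>' (real j / 2 ^ n)" for j
 \<comment> \<open>At parameter 1/2 \<open>+++\<close> still follows the first path; there the
   common endpoint is used.\<close>
 proof (cases "j = 0")
  case True
  have "real (2 ^ n + j) / 2 ^ Suc n = 1 / 2" using True by simp
  then show ?thesis using assms True by (simp add: joinpaths_def pathfinish_def pathstart_def)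
 next
  case False
  have "2 * (real (2 ^ n + j) / 2 ^ Suc n) - 1 = real j / 2 ^ n" "\<not> real (2 ^ n + j) / 2 ^ Suc n <= 1 / 2"
   using False by (auto simp: field_simps)
  then show ?thesis by (simp only: joinpaths_def if_False)
 qed
 have "dyadic_sum D (Suc n) (\<gamma> +++ \<gamma>') = (\<Sum>j<2 ^ n + 2 ^ n. D ((\<gamma> +++ \<gamma>') (real j / 2 ^ Suc n)) ((\<gamma> +++ \<gamma>') (real (j + 1) / 2 ^ Suc n)))"
  unfolding dyadic_sum_def by (simp only: power_Suc mult_2)
 also have "\<dots> = dyadic_sum D n \<gamma> + dyadic_sum D n \<gamma>'"
  unfolding sum_lessThan_split_add add.assoc 2
  unfolding dyadic_sum_def by (intro arg_cong2[where f="(+)"] sum.cong refl arg_cong2[where f=D] 1) auto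
 finally show ?thesis .
qed

text \<open>Antisymmetry of D holds for edges inside one ball, hence the restriction to large
  n.\<close>

lemma dyadic_sum_reversepath:
 assumes "path \<gamma>" "path_image \<gamma> \<subseteq> S"
 obtains N where "!!n. n >= N ==> dyadic_sum D n (reversepath \<gamma>) = - dyadic_sum D n \<gamma>"
proof -
 obtain N where N: "!!n s t. n >= N ==> s \<in> {0..1} ==> t \<in> {0..1} ==> \<bar>s - t\<bar> <= 1 / 2 ^ n ==>
   \<exists>z\<in>S. \<gamma> s \<in> ball z (r z) \<and> (\<forall>t\<in>{0..1}. \<bar>s - t\<bar> <= 1 / 2 ^ n --> \<gamma> t \<in> ball z (r z))"
  using path_fine[OF assms] by blast
 have "dyadic_sum D n (reversepath \<gamma>) = - dyadic_sum D n \<gamma>" if n: "n >= N" for n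
 proof -
  define p where "p = (2 :: nat) ^ n"
  have "dyadic_sum D n (reversepath \<gamma>) = (\<Sum>j<p. D (\<gamma> (real (p - Suc j + 1) / 2 ^ n)) (\<gamma> (real (p - Suc j) / 2 ^ n)))"
   unfolding dyadic_sum_def p_def[symmetric]
  proof (rule sum.cong[OF refl])
   fix j assume "j \<in> {..<p}"
   then have "1 - real j / 2 ^ n = real (p - Suc j + 1) / 2 ^ n" "1 - real (j + 1) / 2 ^ n = real (p - Suc j) / 2 ^ n"
    by (auto simp: p_def field_simps of_nat_diff Suc_leI)
   then show "D (reversepath \<gamma> (real j / 2 ^ n)) (reversepath \<gamma> (real (j + 1) / 2 ^ n)) = D (\<gamma> (real (p - Suc j + 1) / 2 ^ n)) (\<gamma> (real (p - Suc j) / 2 ^ n))"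
    by (simp only: reversepath_def)
  qed
  also have "\<dots> = (\<Sum>j<p. D (\<gamma> (real (j + 1) / 2 ^ n)) (\<gamma> (real j / 2 ^ n)))"
   by (rule sum.nat_diff_reindex[of "%j. D (\<gamma> (real (j + 1) / 2 ^ n)) (\<gamma> (real j / 2 ^ n))"])
  also have "\<dots> = (\<Sum>j<p. - D (\<gamma> (real j / 2 ^ n)) (\<gamma> (real (j + 1) / 2 ^ n)))"
  proof (rule sum.cong[OF refl])
   fix j assume "j \<in> {..<p}"
   then have j: "real j / 2 ^ n \<in> {0..1}" "real (j + 1) / 2 ^ n \<in> {0..1}" "\<bar>real j / 2 ^ n - real (j + 1) / 2 ^ n\<bar> <= 1 / 2 ^ n"
    using dyadic_in[of j n] dyadic_in[of "j + 1" n] by (simp_all add: p_def flip: diff_divide_distrib)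
   from N[OF n j] j obtain z where "z \<in> S" "\<gamma> (real j / 2 ^ n) \<in> ball z (r z)" "\<gamma> (real (j + 1) / 2 ^ n) \<in> ball z (r z)" by blast
   then show "D (\<gamma> (real (j + 1) / 2 ^ n)) (\<gamma> (real j / 2 ^ n)) = - D (\<gamma> (real j / 2 ^ n)) (\<gamma> (real (j + 1) / 2 ^ n))"
    by (rule D_swap)
  qed
  finally show ?thesis by (simp add: dyadic_sum_def p_def sum_negf)
 qed
 then show ?thesis using that by blast
qed

lemma dyadic_sum_linepath:
 assumes z: "z \<in> S" "a \<in> ball z (r z)" "b \<in> ball z (r z)"
 shows "dyadic_sum D n (linepath a b) = D a b"
proof -
 have inb: "linepath a b t \<in> ball z (r z)" if "t \<in> {0..1}" for t
  using linepath_in_path[OF that, of a b] closed_segment_subset[OF z(2,3) convex_ball] by blast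
 have "(\<Sum>j<k. D (linepath a b (real j / 2 ^ n)) (linepath a b (real (j + 1) / 2 ^ n))) = D a (linepath a b (real k / 2 ^ n))"
  if "k <= 2 ^ n" for k
  using that
 proof (induction k)
  case 0 then show ?case using D_refl[OF z(1,2)] by (simp add: linepath_def)
 next
  case (Suc k)
  have "real k / 2 ^ n \<in> {0..1}" "real (Suc k) / 2 ^ n \<in> {0..1}" using Suc.prems by (intro dyadic_in, simp)+
  from cocycle[OF z(1,2) inb inb, OF this] show ?case using Suc by simp
 qed
 from this[of "2 ^ n"] show ?thesis by (simp add: dyadic_sum_def linepath_def)
qed

text \<open>On a fine grid of the homotopy square each cell lies in one ball, so both ways around it
  give the same sum. Consecutive rows then differ by a telescoping sum of the transversal edges,
  whose two ends cancel because every stage of the homotopy is a loop. The last row is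
  constant.\<close>

lemma dyadic_sum_null_homotopic:
 assumes "homotopic_loops S \<gamma> (linepath a a)"
 obtains N where "!!n. n >= N ==> dyadic_sum D n \<gamma> = 0"
proof -
 have aS: "a \<in> S" using homotopic_loops_imp_subset[OF assms] by (simp add: linepath_refl path_image_def image_subset_iff)
 obtain h where h: "continuous_on ({0..1::real} \<times> {0..1::real}) h" "h ` ({0..1} \<times> {0..1}) \<subseteq> S"
  "!!t. t \<in> {0..1} ==> h (0, t) = \<gamma> t" "!!t. t \<in> {0..1} ==> h (1, t) = a" "!!s. s \<in> {0..1} ==> h (s, 1) = h (s, 0)"
  using assms unfolding homotopic_loops by (auto simp: pathfinish_def pathstart_def linepath_refl image_subset_iff_funcset)
 let ?Q = "{0..1::real} \<times> {0..1::real}"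
 have cQ: "compact ?Q" by (intro compact_Times) auto
 obtain \<delta> where \<delta>: "\<delta> > 0" "!!x. x \<in> h ` ?Q ==> \<exists>z\<in>S. ball x \<delta> \<subseteq> ball z (r z)"
  using compact_uniform[OF compact_continuous_image[OF h(1) cQ] h(2)] by blast
 have "uniformly_continuous_on ?Q h" by (intro compact_uniformly_continuous h(1) cQ)
 then obtain \<eta> where \<eta>: "\<eta> > 0" "!!s t. s \<in> ?Q ==> t \<in> ?Q ==> dist t s < \<eta> ==> dist (h t) (h s) < \<delta>"
  using \<delta>(1) unfolding uniformly_continuous_on_def by metis
 obtain N where N: "(1 / 2) ^ N < \<eta> / 2" using real_arch_pow_inv[of "\<eta> / 2" "1 / 2"] \<eta>(1) by auto
 have "dyadic_sum D n \<gamma> = 0" if n: "n >= N" for n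
 proof -
  define M where "M = (2 :: nat) ^ n"
  have M: "M > 0" "real M = 2 ^ n" by (auto simp: M_def)
  have "(1 / 2 :: real) ^ n <= (1 / 2) ^ N" using n by (intro power_decreasing) auto
  then have sm: "1 / real M < \<eta> / 2" using N M by (simp add: power_divide)
  define x where "x i j = h (real i / real M, real j / real M)" for i j
  have inQ: "(real i / real M, real j / real M) \<in> ?Q" if "i <= M" "j <= M" for i j
   using that M by (auto simp: divide_le_eq)
  define row where "row i = (\<Sum>j<M. D (x i j) (x i (Suc j)))" for i
  have "row (Suc i) = row i" if i: "i < M" for i
  proof -
   define V where "V j = D (x i j) (x (Suc i) j)" for j
   have cell: "D (x (Suc i) j) (x (Suc i) (Suc j)) - D (x i j) (x i (Suc j)) = V (Suc j) - V j" if j: "j < M" for j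
   proof -
    have "x i j \<in> h ` ?Q" unfolding x_def using inQ[of i j] i j by auto
    then obtain z where z: "z \<in> S" "ball (x i j) \<delta> \<subseteq> ball z (r z)" using \<delta>(2) by blast
    have near: "x i' j' \<in> ball z (r z)" if "i' \<in> {i, Suc i}" "j' \<in> {j, Suc j}" for i' j'
    proof -
     have "dist (real i' / real M, real j' / real M) (real i / real M, real j / real M) <= dist (real i' / real M) (real i / real M) + dist (real j' / real M) (real j / real M)"
      unfolding dist_prod_def fst_conv snd_conv by (rule sqrt_sum_squares_le_sum) auto
     also have "\<dots> <= 1 / real M + 1 / real M"
      using that M by (intro add_mono) (auto simp: dist_real_def simp flip: diff_divide_distrib)
     also have "\<dots> < \<eta>" using sm by simp
     finally have "dist (x i' j') (x i j) < \<delta>" unfolding x_def using that i j by (intro \<eta>(2) inQ) auto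
     then show ?thesis using z(2) by (auto simp: dist_commute)
    qed
    have "D (x i j) (x i (Suc j)) + D (x i (Suc j)) (x (Suc i) (Suc j)) = D (x i j) (x (Suc i) (Suc j))"
     by (intro cocycle[OF z(1)] near) auto
    moreover have "D (x i j) (x (Suc i) j) + D (x (Suc i) j) (x (Suc i) (Suc j)) = D (x i j) (x (Suc i) (Suc j))"
     by (intro cocycle[OF z(1)] near) auto
    ultimately have "D (x i j) (x i (Suc j)) + V (Suc j) = V j + D (x (Suc i) j) (x (Suc i) (Suc j))"
     unfolding V_def by simp
    then show ?thesis by (simp add: algebra_simps)
   qed
   have "row (Suc i) - row i = (\<Sum>j<M. V (Suc j) - V j)"
    unfolding row_def sum_subtractf[symmetric] by (intro sum.cong refl cell) auto
   also have "\<dots> = V M - V 0" by (rule sum_lessThan_telescope)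
   also have "\<dots> = 0"
   proof -
    have "x k M = x k 0" if "k <= M" for k
     using h(5)[of "real k / real M"] that M by (simp add: x_def divide_le_eq)
    then show ?thesis using i by (simp add: V_def)
   qed
   finally show ?thesis by simp
  qed
  then have "row k = row 0" if "k <= M" for k using that by (induction k) auto
  from this[of M] have "row M = row 0" by simp
  moreover have "row 0 = dyadic_sum D n \<gamma>"
   unfolding row_def dyadic_sum_def M_def[symmetric]
  proof (rule sum.cong[OF refl])
   fix j assume "j \<in> {..<M}"
   then have "real j / real M \<in> {0..1}" "real (Suc j) / real M \<in> {0..1}"
    using dyadic_in[of j n] dyadic_in[of "Suc j" n] by (simp_all add: M_def)
   then show "D (x 0 j) (x 0 (Suc j)) = D (\<gamma> (real j / 2 ^ n)) (\<gamma> (real (j + 1) / 2 ^ n))"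
    using h(3) by (simp add: x_def M(2))
  qed
  moreover have "row M = 0"
  proof -
   have "x M j = a" if "j <= M" for j using h(4)[of "real j / real M"] that M by (simp add: x_def divide_le_eq)
   then have "row M = (\<Sum>j<M. D a a)" unfolding row_def by (intro sum.cong) auto
   also have "D a a = 0" using D_refl[OF aS] rpos[OF aS] by simp
   finally show ?thesis by simp
  qed
  ultimately show ?thesis by simp
 qed
 then show ?thesis using that by blast
qed

text \<open>The chosen path to a, the segment from a to b and the reversed path to b form a
  null-homotopic loop, so that 0 = C a + D a b - C b.\<close>

theorem cocycle_is_coboundary:
 assumes S: "simply_connected S"
  and sub: "!!z. z \<in> S ==> ball z (r z) \<subseteq> S"
 shows "\<exists>C. \<forall>z\<in>S. \<forall>a\<in>ball z (r z). \<forall>b\<in>ball z (r z). C b - C a = D a b"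
proof (cases "S = {}")
 case False
 then obtain x0 where x0: "x0 \<in> S" by blast
 have "path_connected S" using S by (rule simply_connected_imp_path_connected)
 then have "\<exists>\<gamma>. path \<gamma> \<and> path_image \<gamma> \<subseteq> S \<and> pathstart \<gamma> = x0 \<and> pathfinish \<gamma> = x" if "x \<in> S" for x
  using that x0 unfolding path_connected_def by blast
 then obtain \<gamma> where \<gamma>: "!!x. x \<in> S ==> path (\<gamma> x)" "!!x. x \<in> S ==> path_image (\<gamma> x) \<subseteq> S"
  "!!x. x \<in> S ==> pathstart (\<gamma> x) = x0" "!!x. x \<in> S ==> pathfinish (\<gamma> x) = x"
  by metis
 have "\<exists>N. \<forall>n\<ge>N. dyadic_sum D n (\<gamma> x) = dyadic_sum D N (\<gamma> x)" if "x \<in> S" for x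
  using dyadic_sum_refine[OF \<gamma>(1,2)[OF that]] by metis
 then obtain N where N: "!!x n. x \<in> S ==> n >= N x ==> dyadic_sum D n (\<gamma> x) = dyadic_sum D (N x) (\<gamma> x)"
  by metis
 define C where "C x = dyadic_sum D (N x) (\<gamma> x)" for x
 have "C b - C a = D a b" if z: "z \<in> S" and ab: "a \<in> ball z (r z)" "b \<in> ball z (r z)" for z a b
 proof -
  have S': "a \<in> S" "b \<in> S" using sub[OF z] ab by auto
  define L where "L = (\<gamma> a +++ linepath a b) +++ reversepath (\<gamma> b)"
  have ls: "path_image (linepath a b) \<subseteq> S"
   using closed_segment_subset[OF ab convex_ball] sub[OF z] by auto
  have L: "path L" "path_image L \<subseteq> S" "pathstart L = x0" "pathfinish L = x0"
   using \<gamma> S' ls unfolding L_def by (auto simp: path_image_join subset_path_image_join)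
  have "homotopic_loops S L (linepath x0 x0)"
  proof -
   have "path (linepath x0 x0)" "path_image (linepath x0 x0) \<subseteq> S" "pathfinish (linepath x0 x0) = pathstart (linepath x0 x0)"
    using x0 by auto
   moreover have "pathfinish L = pathstart L" using L by simp
   ultimately show ?thesis using S L(1,2) unfolding simply_connected_def by blast
  qed
  then obtain N1 where N1: "!!n. n >= N1 ==> dyadic_sum D n L = 0"
   using dyadic_sum_null_homotopic by blast
  obtain N2 where N2: "!!n. n >= N2 ==> dyadic_sum D n (reversepath (\<gamma> b)) = - dyadic_sum D n (\<gamma> b)"
   using dyadic_sum_reversepath[OF \<gamma>(1,2)[OF S'(2)]] by blast
  \<comment> \<open>Beyond every threshold involved. The nested joins split level n + 2 into level n
    for the path to a and the segment, and level n + 1 for the reversed path.\<close>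
  define n where "n = N1 + N2 + N a + N b"
  have "0 = dyadic_sum D (Suc (Suc n)) L" by (rule N1[symmetric]) (simp add: n_def)
  also have "\<dots> = (dyadic_sum D n (\<gamma> a) + dyadic_sum D n (linepath a b)) + dyadic_sum D (Suc n) (reversepath (\<gamma> b))"
   unfolding L_def using \<gamma> S' by (simp add: dyadic_sum_joinpaths)
  also have "dyadic_sum D (Suc n) (reversepath (\<gamma> b)) = - dyadic_sum D (Suc n) (\<gamma> b)" by (rule N2) (simp add: n_def)
  also have "dyadic_sum D (Suc n) (\<gamma> b) = C b" unfolding C_def by (rule N[OF S'(2)]) (simp add: n_def)
  also have "dyadic_sum D n (\<gamma> a) = C a" unfolding C_def by (rule N[OF S'(1)]) (simp add: n_def)
  also have "dyadic_sum D n (linepath a b) = D a b" by (rule dyadic_sum_linepath[OF z ab])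
  finally show ?thesis by (simp add: algebra_simps)
 qed
 then show ?thesis by blast
qed simp

end

section \<open>Existence of the potential\<close>

text \<open>Since h vanishes near the boundary, \<Omega> on the one hand and N with the exterior on
  the other are open sets that cover the space; k equals h on the first and 0 on the second.\<close>

lemma Ck_cut_off:
 assumes \<Omega>: "open \<Omega>" and N: "open N" "frontier \<Omega> \<subseteq> N" and h: "Ck (Suc 0) h" "!!x. x \<in> N ==> h x = 0"
 defines "k \<equiv> %x. if x \<in> \<Omega> then h x else 0"
 shows "Ck (Suc 0) k" and "!!x. x \<in> \<Omega> ==> grad k x = grad h x"
proof -
 define O' where "O' = N \<union> - closure \<Omega>"
 have O': "open O'" using N by (auto simp: O'_def)
 have cover: "x \<in> \<Omega> \<or> x \<in> O'" for x using N(2) \<Omega> by (auto simp: O'_def frontier_def interior_open)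
 have k0: "k x = 0" if "x \<in> O'" for x
  using that h(2) closure_subset[of \<Omega>] by (auto simp: k_def O'_def)
 have d1: "(k has_derivative (%v. \<Sum>i\<in>UNIV. v $ i *\<^sub>R pderiv3 i h x)) (at x)" if "x \<in> \<Omega>" for x
  by (rule has_derivative_transform_within_open[OF has_derivative_pderiv3[OF Ck_differentiable[OF h(1)]] \<Omega> that]) (simp add: k_def)
 have d2: "(k has_derivative (%v. 0)) (at x)" if "x \<in> O'" for x
  by (rule has_derivative_transform_within_open[OF has_derivative_const O' that]) (simp add: k0)
 have p1: "pderiv3 i k x = pderiv3 i h x" if "x \<in> \<Omega>" for x i
  by (rule trans[OF pderiv3_eqI[OF d1[OF that]] sum_axis_scaleR])
 have p2: "pderiv3 i k x = 0" if "x \<in> O'" for x i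
  using pderiv3_eqI[OF d2[OF that]] by simp
 have "continuous_on UNIV (pderiv3 i k)" for i
 proof (rule continuous_at_imp_continuous_on, intro ballI)
  fix x
  have ch: "isCont (pderiv3 i h) x" using h(1) by (simp add: continuous_on_eq_continuous_at)
  show "isCont (pderiv3 i k) x"
  proof (cases "x \<in> \<Omega>")
   case True
   have "\<forall>\<^sub>F y in nhds x. y \<in> \<Omega>" using eventually_nhds_in_open[OF \<Omega> True] .
   then have "\<forall>\<^sub>F y in nhds x. pderiv3 i k y = pderiv3 i h y" by eventually_elim (rule p1)
   then show ?thesis using ch isCont_cong by blast
  next
   case False
   then have x: "x \<in> O'" using cover by blast
   have "\<forall>\<^sub>F y in nhds x. y \<in> O'" using eventually_nhds_in_open[OF O' x] .
   then have "\<forall>\<^sub>F y in nhds x. pderiv3 i k y = 0" by eventually_elim (rule p2)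
   then show ?thesis using isCont_cong[of "pderiv3 i k" "%_. 0" x] by simp
  qed
 qed
 moreover have "k differentiable_on UNIV"
  unfolding differentiable_on_def differentiable_def using d1 d2 cover by blast
 ultimately show "Ck (Suc 0) k" by simp
 show "!!x. x \<in> \<Omega> ==> grad k x = grad h x" by (simp add: grad_def p1 vec_eq_iff)
qed

lemma curl_zero_off_support:
 assumes "closed K" "!!x. x \<notin> K ==> \<phi> x = 0" "x \<notin> K"
 shows "curl \<phi> x = 0"
proof -
 have "pderiv3 i (%x. \<phi> x $ j) x = 0" for i j
  using pderiv3_zero_off_support[of K "%x. \<phi> x $ j" x i] assms by simp
 then show ?thesis by (simp add: curl_def vec_eq_iff forall_3)
qed

lemma L2field_compact_support:
 assumes "continuous_on UNIV f" "compact K" "!!x. x \<notin> K ==> f x = 0"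
 shows "L2field f"
proof -
 have "integrable lborel (%x. (norm (f x))\<^sup>2)"
  using assms(3) by (intro integrable_compact_support[OF _ assms(2)] continuous_intros assms(1)) auto
 then show ?thesis using borel_measurable_continuous_onI[OF assms(1)] by (simp add: L2field_def)
qed

lemma L2field_dominated:
 assumes v: "L2field v" and f: "f \<in> borel_measurable borel" "!!x. norm (f x) <= c * norm (v x)"
 shows "L2field f"
proof (rule L2fieldI_nn_integral[OF f(1)])
 have "(NI x. nsq (f x)) <= (NI x. ennreal (c\<^sup>2) * nsq (v x))"
 proof (rule nn_integral_mono)
  fix x
  have "(norm (f x))\<^sup>2 <= (c * norm (v x))\<^sup>2" using f(2) by (intro power_mono) auto
  then show "nsq (f x) <= ennreal (c\<^sup>2) * nsq (v x)"
   by (simp add: power_mult_distrib ennreal_leI flip: ennreal_mult)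
 qed
 also have "\<dots> = ennreal (c\<^sup>2) * ennreal (sqn v)"
  unfolding nn_integral_sqn[OF v, symmetric] using v by (intro nn_integral_cmult) (auto simp: L2field_def)
 also have "\<dots> < \<infinity>" by (simp add: ennreal_mult_less_top)
 finally show "(NI x. nsq (f x)) < \<infinity>" .
qed

lemma grad_mult:
 assumes "f differentiable (at x)" "g differentiable (at x)"
 shows "grad (%x. f x * g x) x = (\<chi> i. f x * grad g x $ i + g x * grad f x $ i)"
proof -
 have "pderiv3 i (%x. f x * g x) x = f x * pderiv3 i g x + g x * pderiv3 i f x" for i
  unfolding pderiv3_mult[OF assms] by simp
 then show ?thesis by (simp add: grad_def)
qed

lemma norm_scale_vec: "norm (\<chi> i. c * (a :: complex^3) $ i) = norm c * norm a"
proof -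
 have "L2_set (%i. norm c * norm (a $ i)) UNIV = norm c * L2_set (%i. norm (a $ i)) UNIV"
  by (rule L2_set_right_distrib[symmetric]) simp
 then show ?thesis by (simp add: norm_vec_def norm_mult)
qed

lemma norm_grad_mult_square_le:
 assumes "f differentiable (at x)" "g differentiable (at x)"
 shows "(norm (grad (%x. f x * g x) x))\<^sup>2 <= 2 * (norm (f x))\<^sup>2 * (norm (grad g x))\<^sup>2 + 2 * (norm (grad f x))\<^sup>2 * (norm (g x))\<^sup>2"
proof -
 have "grad (%x. f x * g x) x = (\<chi> i. f x * grad g x $ i) + (\<chi> i. g x * grad f x $ i)"
  unfolding grad_mult[OF assms] by (simp add: vec_eq_iff)
 then have "norm (grad (%x. f x * g x) x) <= norm (f x) * norm (grad g x) + norm (g x) * norm (grad f x)"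
  using norm_triangle_ineq by (metis norm_scale_vec)
 then have "(norm (grad (%x. f x * g x) x))\<^sup>2 <= (norm (f x) * norm (grad g x) + norm (g x) * norm (grad f x))\<^sup>2"
  by (intro power_mono) auto
 also have "\<dots> <= 2 * (norm (f x) * norm (grad g x))\<^sup>2 + 2 * (norm (g x) * norm (grad f x))\<^sup>2"
  using zero_le_power2[of "norm (f x) * norm (grad g x) - norm (g x) * norm (grad f x)"] by (simp add: power2_sum power2_diff)
 finally show ?thesis by (simp add: power_mult_distrib mult.commute mult.left_commute)
qed

text \<open>The bound \<delta> z <= |z| / 2 keeps the patches away from the origin. The connected
  boundary is chained by balls of radius r / 4; two of them that meet at a boundary point share an
  exterior ball, since the exterior adheres to every boundary point.\<close>

lemma exterior_poincare_cover:
 assumes \<Omega>: "open \<Omega>" "bounded \<Omega>" and lip: "lipschitz_boundary \<Omega>" and con: "connected (frontier \<Omega>)" and 0: "0 \<in> \<Omega>"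
  and R: "closure \<Omega> \<subseteq> ball 0 R"
 obtains Z \<delta> r C where "finite Z" "Z \<subseteq> frontier \<Omega>" "frontier \<Omega> \<subseteq> (\<Union>z\<in>Z. ball z (r z / 4))"
  "!!z. z \<in> Z ==> 0 < r z \<and> r z < \<delta> z \<and> \<delta> z <= norm z / 2 \<and> ball z (\<delta> z) \<subseteq> ball 0 R \<and> C z >= (0::real)"
  "!!z. z \<in> Z ==> boundary_estimate \<Omega> z (\<delta> z) (r z) (C z)"
  "poincare (ball 0 R - closure \<Omega>) (\<Union>z\<in>Z. ball z (r z) - closure \<Omega>)"
proof -
 define pkg where "pkg z \<delta> r C c1 \<longleftrightarrow> 0 < r \<and> r < \<delta> \<and> \<delta> <= min (norm z / 2) (R - norm z) \<and> C >= 0 \<and>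
  boundary_estimate \<Omega> z \<delta> r C \<and>
  (\<forall>x y. x \<in> ball z r - closure \<Omega> --> y \<in> ball c1 r --> closed_segment x y \<subseteq> ball z \<delta> - closure \<Omega>) \<and>
  z \<in> closure (- closure \<Omega>)" for z c1 :: "real^3" and \<delta> r C :: real
 have ex: "\<exists>\<delta> r C c1. pkg z \<delta> r C c1" if z: "z \<in> frontier \<Omega>" for z
 proof -
  have "z \<in> closure \<Omega>" "z \<notin> \<Omega>" using z \<Omega> by (auto simp: frontier_def interior_open)
  then have "norm z < R" "z ~= 0" using R 0 by auto
  then have "min (norm z / 2) (R - norm z) > 0" by simp
  then show ?thesis
  proof (rule lipschitz_boundary_point[OF \<Omega>(1) lip z])
   fix \<delta> r C :: real and c1 c2 :: "real^3"
   assume "0 < r" "r < \<delta>" "\<delta> <= min (norm z / 2) (R - norm z)" "C >= 0"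
   "boundary_estimate \<Omega> z \<delta> r C"
   "!!x y. x \<in> ball z r - closure \<Omega> ==> y \<in> ball c1 r ==> closed_segment x y \<subseteq> ball z \<delta> - closure \<Omega>"
   "z \<in> closure (- closure \<Omega>)"
   then have "pkg z \<delta> r C c1" unfolding pkg_def by (intro conjI allI impI) simp_all
   then show ?thesis by blast
  qed
 qed
 then have "\<forall>z\<in>frontier \<Omega>. \<exists>q. pkg z (fst q) (fst (snd q)) (fst (snd (snd q))) (snd (snd (snd q)))" by simp
 from bchoice[OF this] obtain q where "\<forall>z\<in>frontier \<Omega>. pkg z (fst (q z)) (fst (snd (q z))) (fst (snd (snd (q z)))) (snd (snd (snd (q z))))" by blast
 then obtain \<delta> r C c1 where pkg: "!!z. z \<in> frontier \<Omega> ==> pkg z (\<delta> z) (r z) (C z) (c1 z)"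
  using that[of "%z. fst (q z)" "%z. fst (snd (q z))" "%z. fst (snd (snd (q z)))" "%z. snd (snd (snd (q z)))"] by blast
 have rpos: "r z > 0" if "z \<in> frontier \<Omega>" for z using pkg[OF that] by (simp add: pkg_def)
 have comp: "compact (frontier \<Omega>)" using \<Omega>(2) by (rule compact_frontier_bounded)
 have ne: "frontier \<Omega> ~= {}"
 proof -
  have "\<Omega> ~= UNIV" using \<Omega>(2) not_bounded_UNIV by blast
  then show ?thesis using 0 frontier_eq_empty[of \<Omega>] by blast
 qed
 have "frontier \<Omega> \<subseteq> (\<Union>z\<in>frontier \<Omega>. ball z (r z / 4))" using rpos by fastforce
 then obtain Z where Z: "Z \<subseteq> frontier \<Omega>" "finite Z" "frontier \<Omega> \<subseteq> (\<Union>z\<in>Z. ball z (r z / 4))"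
  using compactE_image[OF comp, of "frontier \<Omega>" "%z. ball z (r z / 4)"] by blast
 have sub: "ball z (\<delta> z) \<subseteq> ball 0 R" if "z \<in> frontier \<Omega>" for z
 proof
  fix x assume "x \<in> ball z (\<delta> z)"
  then have "norm (x - z) < R - norm z" using pkg[OF that] by (simp add: pkg_def dist_norm norm_minus_commute)
  then show "x \<in> ball 0 R" using norm_triangle_sub[of x z] by simp
 qed
 have Rpos: "R >= 0" using R 0 closure_subset[of \<Omega>] by force
 have P: "poincare (ball 0 R - closure \<Omega>) (ball z (r z) - closure \<Omega>)" if z: "z \<in> frontier \<Omega>" for z
 proof (rule poincare_star_shaped[where c = "c1 z" and \<rho> = "r z" and d = "2 * R"])
  show "emeasure lborel (ball z (r z) - closure \<Omega>) < \<infinity>"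
   using emeasure_mono[of "ball z (r z) - closure \<Omega>" "ball z (r z)" lborel] emeasure_lborel_ball_finite[of z "r z"] by (auto intro: le_less_trans)
  show "r z > 0" by (rule rpos[OF z])
  fix x y assume xy: "x \<in> ball z (r z) - closure \<Omega>" "y \<in> ball (c1 z) (r z)"
  have s: "closed_segment x y \<subseteq> ball z (\<delta> z) - closure \<Omega>" using pkg[OF z] xy unfolding pkg_def by blast
  then show "closed_segment x y \<subseteq> ball 0 R - closure \<Omega>" using sub[OF z] by blast
  then have "x \<in> ball 0 R" "y \<in> ball 0 R" by auto
  then show "norm (x - y) <= 2 * R" using norm_triangle_ineq4[of x y] by simp
 qed (use Rpos in auto)
 have chain: "poincare (ball 0 R - closure \<Omega>) (\<Union>z\<in>Z. ball z (r z) - closure \<Omega>)"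
 proof (rule poincare_chain[OF Z(2) _ Z(1) con Z(3)])
  show "Z ~= {}" using ne Z(3) by auto
  show "open (ball z (r z / 4)) \<and> z \<in> ball z (r z / 4)" if "z \<in> Z" for z using rpos that Z(1) by auto
  show "poincare (ball 0 R - closure \<Omega>) (ball z (r z) - closure \<Omega>)" if "z \<in> Z" for z using P that Z(1) by blast
  fix z z' assume z: "z \<in> Z" "z' \<in> Z" and "ball z (r z / 4) \<inter> ball z' (r z' / 4) \<inter> frontier \<Omega> ~= {}"
  then obtain p where p: "p \<in> ball z (r z / 4) \<inter> ball z' (r z' / 4)" "p \<in> frontier \<Omega>" by blast
  have "p \<in> closure (- closure \<Omega>)" using pkg[OF p(2)] by (simp add: pkg_def)
  then have "(ball z (r z / 4) \<inter> ball z' (r z' / 4)) \<inter> - closure \<Omega> ~= {}"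
   using p(1) open_Int_closure_eq_empty[of "ball z (r z / 4) \<inter> ball z' (r z' / 4)" "- closure \<Omega>"] by blast
  then obtain e where e: "e \<in> (ball z (r z / 4) \<inter> ball z' (r z' / 4)) \<inter> - closure \<Omega>" by blast
  have "open ((ball z (r z / 4) \<inter> ball z' (r z' / 4)) \<inter> - closure \<Omega>)" by (intro open_Int) auto
  from openE[OF this e] obtain \<rho> where \<rho>: "\<rho> > 0" "ball e \<rho> \<subseteq> (ball z (r z / 4) \<inter> ball z' (r z' / 4)) \<inter> - closure \<Omega>"
   using that by blast
  have rz: "r z > 0" "r z' > 0" using z Z(1) rpos by blast+
  have sb: "ball z (r z / 4) \<subseteq> ball z (r z)" "ball z' (r z' / 4) \<subseteq> ball z' (r z')"
   using rz by (simp_all add: subset_ball)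
  have "ball e \<rho> \<subseteq> (ball z (r z) - closure \<Omega>) \<inter> (ball z' (r z') - closure \<Omega>)"
  proof
   fix x assume "x \<in> ball e \<rho>"
   then have "x \<in> (ball z (r z / 4) \<inter> ball z' (r z' / 4)) \<inter> - closure \<Omega>" using \<rho>(2) by (rule rev_subsetD)
   then show "x \<in> (ball z (r z) - closure \<Omega>) \<inter> (ball z' (r z') - closure \<Omega>)" using sb by auto
  qed
  then show "\<exists>c \<rho>. \<rho> > 0 \<and> ball c \<rho> \<subseteq> (ball z (r z) - closure \<Omega>) \<inter> (ball z' (r z') - closure \<Omega>)"
   using \<rho>(1) by (intro exI[of _ e] exI[of _ \<rho>]) (rule conjI)
 qed
 show ?thesis
 proof (rule that[OF Z(2,1,3) _ _ chain, of \<delta> C])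
  show "0 < r z \<and> r z < \<delta> z \<and> \<delta> z <= norm z / 2 \<and> ball z (\<delta> z) \<subseteq> ball 0 R \<and> C z >= 0" if "z \<in> Z" for z
  proof -
   have z: "z \<in> frontier \<Omega>" using that Z(1) by blast
   show ?thesis using pkg[OF z] sub[OF z] by (simp add: pkg_def)
  qed
  show "boundary_estimate \<Omega> z (\<delta> z) (r z) (C z)" if "z \<in> Z" for z
  proof -
   have z: "z \<in> frontier \<Omega>" using that Z(1) by blast
   show ?thesis using pkg[OF z] by (simp add: pkg_def)
  qed
 qed
qed

lemma norm_square_vec3: "(norm (a :: complex^3))\<^sup>2 = (\<Sum>j\<in>UNIV. (norm (a $ j))\<^sup>2)"
 by (simp add: norm_vec_def L2_set_def sum_nonneg)

text \<open>The square of the remainder at x is bounded by the integral of |curl \<phi>|^2 along the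
  segment from the vertex, and the weighted segment estimate with exponent 2 \<beta> < 1 controls
  the average over vertices in the unit ball. The vertex depends on \<phi>, the constant c does
  not.\<close>

lemma homotopy_decomposition:
 fixes X :: "(real^3) set"
 assumes \<beta>: "0 <= \<beta>" "\<beta> < 1 / 2" and R: "R >= 1" and X: "X = ball 0 R"
 shows "\<exists>c\<ge>0. \<forall>\<phi>. (\<forall>i. Ck (Suc 0) (%x. \<phi> x $ i)) --> L2field (curl \<phi>) -->
  (\<exists>q. Ck (Suc 0) q \<and> L2field (%x. (indicator X x * norm x powr (- \<beta>)) *\<^sub>R (grad q x - \<phi> x)) \<and>
     sqn (%x. (indicator X x * norm x powr (- \<beta>)) *\<^sub>R (grad q x - \<phi> x)) <= c * sqn (curl \<phi>))"
proof -
 define D :: "(real^3) set" where "D = ball 0 1"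
 have D [measurable]: "D \<in> sets borel" by (simp add: D_def)
 have Xm [measurable]: "X \<in> sets borel" by (simp add: X)
 obtain vD where vD: "vD > 0" "emeasure lborel D = ennreal vD"
  using emeasure_ball_real[of 1 "0 :: real^3"] unfolding D_def by auto
 have "emeasure lborel D < \<infinity>" "emeasure lborel X < \<infinity>" unfolding D_def X by (rule emeasure_lborel_ball_finite)+
 moreover have "0 <= 2 * \<beta>" "2 * \<beta> < 1" using \<beta> by auto
 ultimately obtain C1 :: real where C1: "C1 >= 0" "!!F :: real^3 => ennreal. F \<in> borel_measurable borel ==>
  (NI y. NI x. NI t. ennreal (norm x powr (- (2 * \<beta>))) * F (y + t *\<^sub>R (x - y)) * indicator {0..<1::real} t * indicator X x * indicator D y)
  <= ennreal C1 * (NI x. F x)"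
  using segment_estimate_powr[of "2 * \<beta>" D X] D Xm by blast
 \<comment> \<open>27 is 9 for each of the three components, (2 R)^2 bounds |x - y|^2, and the last
   factor comes from the choice of the vertex by the pigeonhole principle.\<close>
 define c where "c = 27 * (2 * R)\<^sup>2 * (2 * C1 / vD)"
 have c: "c >= 0" using C1 vD by (simp add: c_def)
 have "\<exists>q. Ck (Suc 0) q \<and> L2field (%x. (indicator X x * norm x powr (- \<beta>)) *\<^sub>R (grad q x - \<phi> x)) \<and>
     sqn (%x. (indicator X x * norm x powr (- \<beta>)) *\<^sub>R (grad q x - \<phi> x)) <= c * sqn (curl \<phi>)"
  if \<phi>: "!!i. Ck (Suc 0) (%x. \<phi> x $ i)" and cL: "L2field (curl \<phi>)" for \<phi>
 proof -
  have [measurable]: "curl \<phi> \<in> borel_measurable borel" using cL by (simp add: L2field_def)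
  define s where "s = sqn (curl \<phi>)"
  have s: "s >= 0" by (simp add: s_def sqn_nonneg)
  define F where "F x = nsq (curl \<phi> x)" for x
  have [measurable]: "F \<in> borel_measurable borel" unfolding F_def by measurable
  have F: "(NI x. F x) = ennreal s" unfolding F_def s_def by (rule nn_integral_sqn[OF cL])
  define G where "G y = (NI x. NI t. ennreal (norm x powr (- (2 * \<beta>))) * F (y + t *\<^sub>R (x - y)) * indicator {0..<1::real} t * indicator X x)" for y
  have Gm: "G \<in> borel_measurable borel" unfolding G_def by measurable
  have "(NI y. G y * indicator D y) = (NI y. NI x. NI t. ennreal (norm x powr (- (2 * \<beta>))) * F (y + t *\<^sub>R (x - y)) * indicator {0..<1::real} t * indicator X x * indicator D y)"
   unfolding G_def by (intro nn_integral_cong) (simp add: nn_integral_multc)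
  also have "\<dots> <= ennreal C1 * (NI x. F x)" by (rule C1(2)) measurable
  also have "\<dots> = ennreal (C1 * s)" unfolding F using C1(1) s by (simp add: ennreal_mult)
  finally have "(NI y. G y * indicator D y) <= ennreal (C1 * s)" .
  then obtain y where y: "y \<in> D" "G y <= ennreal (2 * (C1 * s) / vD)"
   using pigeonhole_nn_integral[of G lborel D vD "C1 * s"] Gm D vD C1 s by auto
  define q where "q = line_int \<phi> y"
  have q: "Ck (Suc 0) q" unfolding q_def by (rule pderiv3_line_int(1)[OF \<phi>])
  define A where "A x = grad q x - \<phi> x" for x
  have A: "A x $ j = homotopy_rem \<phi> y x j" for x j
   unfolding A_def by (simp add: grad_def q_def pderiv3_line_int(2)[OF \<phi>])
  have "continuous_on UNIV \<phi>" using \<phi> Ck_continuous by (subst continuous_on_vec_nth_iff) blast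
  then have "continuous_on UNIV A" unfolding A_def by (intro continuous_intros continuous_grad q)
  then have [measurable]: "A \<in> borel_measurable borel" by (rule borel_measurable_continuous_onI)
  define B where "B x = (indicator X x * norm x powr (- \<beta>)) *\<^sub>R A x" for x
  have Bm: "B \<in> borel_measurable borel" unfolding B_def by measurable
  have "(NI x. nsq (B x)) <= (NI x. ennreal (27 * (2 * R)\<^sup>2) *
    (NI t. ennreal (norm x powr (- (2 * \<beta>))) * F (y + t *\<^sub>R (x - y)) * indicator {0..<1::real} t * indicator X x))"
  proof (rule nn_integral_mono)
   fix x
   show "nsq (B x) <= ennreal (27 * (2 * R)\<^sup>2) *
    (NI t. ennreal (norm x powr (- (2 * \<beta>))) * F (y + t *\<^sub>R (x - y)) * indicator {0..<1::real} t * indicator X x)"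
   proof (cases "x \<in> X")
    case True
    let ?I = "NI t. F (y + t *\<^sub>R (x - y)) * indicator {0..<1::real} t"
    have "norm (x - y) <= 2 * R"
     using norm_triangle_ineq4[of x y] True y R by (simp add: X D_def)
    then have xy: "(norm (x - y))\<^sup>2 <= (2 * R)\<^sup>2" by (intro power_mono) auto
    have "nsq (A x) = (\<Sum>j\<in>UNIV. nsq (A x $ j))"
     unfolding norm_square_vec3 by (rule sum_ennreal[symmetric]) simp
    also have "\<dots> <= (\<Sum>j\<in>(UNIV::3 set). ennreal (9 * (2 * R)\<^sup>2) * ?I)"
    proof (rule sum_mono)
     fix j
     have "nsq (A x $ j) <= ennreal (9 * (norm (x - y))\<^sup>2) * ?I"
      unfolding A F_def by (rule homotopy_rem_square_le[OF \<phi>])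
     also have "\<dots> <= ennreal (9 * (2 * R)\<^sup>2) * ?I" using xy by (intro mult_right_mono ennreal_leI) auto
     finally show "nsq (A x $ j) <= ennreal (9 * (2 * R)\<^sup>2) * ?I" .
    qed
    also have "\<dots> = ennreal 3 * (ennreal (9 * (2 * R)\<^sup>2) * ?I)" by simp
    also have "\<dots> = ennreal (27 * (2 * R)\<^sup>2) * ?I" by (subst mult.assoc[symmetric], subst ennreal_mult[symmetric]) simp_all
    finally have AI: "nsq (A x) <= ennreal (27 * (2 * R)\<^sup>2) * ?I" .
    have "(norm x powr (- \<beta>))\<^sup>2 = norm x powr (- (2 * \<beta>))"
     by (simp add: power2_eq_square powr_add[symmetric])
    then have "(norm (B x))\<^sup>2 = norm x powr (- (2 * \<beta>)) * (norm (A x))\<^sup>2"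
     using True by (simp add: B_def power_mult_distrib)
    then have "nsq (B x) = ennreal (norm x powr (- (2 * \<beta>))) * nsq (A x)"
     by (simp add: ennreal_mult)
    also have "\<dots> <= ennreal (norm x powr (- (2 * \<beta>))) * (ennreal (27 * (2 * R)\<^sup>2) * ?I)"
     by (intro mult_left_mono AI) simp
    also have "\<dots> = ennreal (27 * (2 * R)\<^sup>2) * (ennreal (norm x powr (- (2 * \<beta>))) * ?I)" by (rule mult.left_commute)
    also have "ennreal (norm x powr (- (2 * \<beta>))) * ?I = (NI t. ennreal (norm x powr (- (2 * \<beta>))) * (F (y + t *\<^sub>R (x - y)) * indicator {0..<1::real} t))"
     by (rule nn_integral_cmult[symmetric]) measurable
    finally show ?thesis using True by (simp add: mult.assoc)
   qed (simp add: B_def)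
  qed
  also have "\<dots> = ennreal (27 * (2 * R)\<^sup>2) * G y" unfolding G_def by (rule nn_integral_cmult) measurable
  also have "\<dots> <= ennreal (27 * (2 * R)\<^sup>2) * ennreal (2 * (C1 * s) / vD)" by (intro mult_left_mono y) simp
  also have "\<dots> = ennreal (27 * (2 * R)\<^sup>2 * (2 * (C1 * s) / vD))" using C1(1) s vD(1) by (intro ennreal_mult[symmetric]) auto
  also have "27 * (2 * R)\<^sup>2 * (2 * (C1 * s) / vD) = c * s" by (simp add: c_def)
  finally have "(NI x. nsq (B x)) <= ennreal (c * s)" .
  moreover have "0 <= c * s" using c s by simp
  ultimately have "L2field B \<and> sqn B <= c * s" using sqn_le[OF Bm] by blast
  then show ?thesis using q unfolding B_def A_def s_def by (intro exI[of _ q]) simp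
 qed
 then show ?thesis by (intro exI[of _ c] conjI c allI impI) simp_all
qed

text \<open>In the pairing with the remainder the weights r^\<beta> and r^(-\<beta>) balance. For
  grad q, a constant c is subtracted from q, and a partition of unity splits q - c into boundary
  pieces, covered by the boundary estimate, and a rest vanishing near the boundary, whose gradient
  is orthogonal to u.\<close>

theorem pairing_bound:
 assumes \<Omega>: "open \<Omega>" "bounded \<Omega>" and lip: "lipschitz_boundary \<Omega>" and con: "connected (frontier \<Omega>)" and 0: "0 \<in> \<Omega>"
  and \<beta>: "0 <= \<beta>" "\<beta> < 1 / 2"
  and u: "divfree \<Omega> u" and uL: "L2field (%x. norm x powr \<beta> *\<^sub>R u x)"
 shows "\<exists>C\<ge>0. \<forall>\<phi> K. (\<forall>i. Ck (Suc 0) (%x. \<phi> x $ i)) --> compact K --> K \<subseteq> \<Omega> --> (\<forall>x. x \<notin> K --> \<phi> x = 0) -->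
  norm (LI x. cdot (u x) (\<phi> x)) <= C * sqrt (sqn (curl \<phi>))"
proof -
 have ui: "integrable lborel u" and uoff: "!!x. x \<notin> \<Omega> ==> u x = 0" using u by (auto simp: divfree_def)
 have [measurable]: "u \<in> borel_measurable borel" using ui by auto
 have "bounded (closure \<Omega>)" using \<Omega>(2) by (rule bounded_closure)
 then obtain R0 where R0: "closure \<Omega> \<subseteq> ball 0 R0" using bounded_subset_ballD by blast
 obtain R where R: "R >= 1" "closure \<Omega> \<subseteq> ball 0 R"
  using that[of "max 1 R0"] subset_trans[OF R0 subset_ball[of R0 "max 1 R0" 0]] by simp
 define X :: "(real^3) set" where "X = ball 0 R"
 define E where "E = X - closure \<Omega>"
 have [measurable]: "X \<in> sets borel" "E \<in> sets borel" by (auto simp: X_def E_def)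
 have clX: "closure \<Omega> \<subseteq> X" unfolding X_def by (rule R(2))
 then have clX2: "\<Omega> \<subseteq> X" using closure_subset by (rule order_trans[rotated])
 obtain Z \<delta> r Cz where Z: "finite Z" "Z \<subseteq> frontier \<Omega>" "frontier \<Omega> \<subseteq> (\<Union>z\<in>Z. ball z (r z / 4))"
  and Zp: "!!z. z \<in> Z ==> 0 < r z \<and> r z < \<delta> z \<and> \<delta> z <= norm z / 2 \<and> ball z (\<delta> z) \<subseteq> ball 0 R \<and> Cz z >= (0::real)"
  and Ze: "!!z. z \<in> Z ==> boundary_estimate \<Omega> z (\<delta> z) (r z) (Cz z)"
  and Pc: "poincare E (\<Union>z\<in>Z. ball z (r z) - closure \<Omega>)"
 proof (rule exterior_poincare_cover[OF \<Omega> lip con 0 R(2)])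
  fix Z \<delta> r C
  assume a: "finite Z" "Z \<subseteq> frontier \<Omega>" "frontier \<Omega> \<subseteq> (\<Union>z\<in>Z. ball z (r z / 4))"
  "!!z. z \<in> Z ==> 0 < r z \<and> r z < \<delta> z \<and> \<delta> z <= norm z / 2 \<and> ball z (\<delta> z) \<subseteq> ball 0 R \<and> C z >= (0::real)"
  "!!z. z \<in> Z ==> boundary_estimate \<Omega> z (\<delta> z) (r z) (C z)"
  "poincare (ball 0 R - closure \<Omega>) (\<Union>z\<in>Z. ball z (r z) - closure \<Omega>)"
  show thesis by (rule that[unfolded E_def X_def, OF a])
 qed
 define W where "W = (\<Union>z\<in>Z. ball z (r z) - closure \<Omega>)"
 have Wm [measurable]: "W \<in> sets borel" using Pc by (simp add: W_def poincare_def)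
 obtain CP :: real where CP: "CP > 0" "!!q. Ck (Suc 0) q ==> \<exists>c.
   (NI x. nsq (q x - c) * indicator W x) <= ennreal CP * (NI x. nsq (grad q x) * indicator E x)"
  using Pc unfolding poincare_def W_def by blast
 obtain cH :: real where cH: "cH >= 0" "!!\<phi>. (!!i. Ck (Suc 0) (%x. \<phi> x $ i)) ==> L2field (curl \<phi>) ==>
  (\<exists>q. Ck (Suc 0) q \<and> L2field (%x. (indicator X x * norm x powr (- \<beta>)) *\<^sub>R (grad q x - \<phi> x)) \<and>
     sqn (%x. (indicator X x * norm x powr (- \<beta>)) *\<^sub>R (grad q x - \<phi> x)) <= cH * sqn (curl \<phi>))"
  using homotopy_decomposition[OF \<beta> R(1) X_def] by blast
 have "\<exists>\<zeta>. (\<forall>z\<in>Z. smooth (\<zeta> z) \<and> (\<forall>x. x \<notin> cball z (2 * (r z / 4)) --> \<zeta> z x = 0)) \<and>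
  (\<forall>x. (\<exists>z\<in>Z. x \<in> ball z (r z / 4)) --> (\<Sum>z\<in>Z. \<zeta> z x) = 1)"
  using Zp by (intro smooth_partition_of_unity Z) auto
 then obtain \<zeta> where \<zeta>: "!!z. z \<in> Z ==> smooth (\<zeta> z)" "!!z x. z \<in> Z ==> x \<notin> cball z (r z / 2) ==> \<zeta> z x = 0"
  "!!x. (\<exists>z\<in>Z. x \<in> ball z (r z / 4)) ==> (\<Sum>z\<in>Z. \<zeta> z x) = 1"
  by auto
 have \<zeta>C: "Ck (Suc 0) (\<zeta> z)" if "z \<in> Z" for z using smooth_Ck[OF \<zeta>(1)[OF that]] .
 have "\<exists>B\<ge>0. \<forall>x. norm (\<zeta> z x) <= B \<and> norm (grad (\<zeta> z) x) <= B" if z: "z \<in> Z" for z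
 proof -
  obtain B1 where B1: "!!x. norm (\<zeta> z x) <= B1"
   using bounded_compact_support[OF Ck_continuous[OF \<zeta>C[OF z]] compact_cball \<zeta>(2)[OF z]] by metis
  obtain B2 where B2: "!!x. norm (grad (\<zeta> z) x) <= B2"
   using grad_bounded_compact_support[OF \<zeta>C[OF z] compact_cball \<zeta>(2)[OF z]] by metis
  show ?thesis
   by (intro exI[of _ "max 0 (max B1 B2)"]) (use B1 B2 in \<open>auto simp: le_max_iff_disj\<close>)
 qed
 then obtain B where B: "!!z. z \<in> Z ==> B z >= 0" "!!z x. z \<in> Z ==> norm (\<zeta> z x) <= B z" "!!z x. z \<in> Z ==> norm (grad (\<zeta> z) x) <= B z"
  by metis
 \<comment> \<open>On the patch |x| is at least |z| / 2, so the weight r^\<beta> is bounded below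
   there.\<close>
 have uLz: "L2field (%x. indicator (ball z (\<delta> z)) x *\<^sub>R u x)" if z: "z \<in> Z" for z
 proof (rule L2field_dominated[OF uL, where c = "(norm z / 2) powr (- \<beta>)"])
  have z0: "z ~= 0" using Zp[OF z] by auto
  fix x
  show "norm (indicator (ball z (\<delta> z)) x *\<^sub>R u x) <= (norm z / 2) powr (- \<beta>) * norm (norm x powr \<beta> *\<^sub>R u x)"
  proof (cases "x \<in> ball z (\<delta> z)")
   case True
   then have "norm (z - x) < norm z / 2" using Zp[OF z] by (auto simp: dist_norm)
   then have nx: "norm z / 2 <= norm x" using norm_triangle_sub[of z x] by simp
   then have "norm x > 0" using z0 by (smt (verit) zero_less_norm_iff half_gt_zero)
   then have "1 = norm x powr (- \<beta>) * norm x powr \<beta>" by (simp flip: powr_add)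
   also have "\<dots> <= (norm z / 2) powr (- \<beta>) * norm x powr \<beta>"
    using nx z0 \<beta> by (intro mult_right_mono powr_mono2') auto
   finally have "1 * norm (u x) <= ((norm z / 2) powr (- \<beta>) * norm x powr \<beta>) * norm (u x)" by (intro mult_right_mono) auto
   then show ?thesis using True by (simp add: mult.assoc)
  qed simp
  have "indicator (ball z (\<delta> z)) \<in> borel_measurable (borel :: (real^3) measure)" by (rule borel_measurable_indicator) simp
  then show "(%x. indicator (ball z (\<delta> z)) x *\<^sub>R u x) \<in> borel_measurable borel" by measurable
 qed
 define Mv where "Mv = sqrt (sqn (%x. norm x powr \<beta> *\<^sub>R u x))"
 define RE where "RE = R powr (2 * \<beta>) * cH"
 have RE: "RE >= 0" using cH by (simp add: RE_def)
 \<comment> \<open>From the product rule on a cut-off times q - c: the first term accounts for the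
   exterior gradient of q, the second for q - c through the Poincare constant
   \<open>CP\<close>.\<close>
 define k where "k z = (2 * (B z)\<^sup>2 + 2 * (B z)\<^sup>2 * CP) * RE" for z
 have k: "k z >= 0" for z using CP RE by (simp add: k_def)
 define M where "M z = Cz z * sqrt (sqn (%x. indicator (ball z (\<delta> z)) x *\<^sub>R u x)) * sqrt (k z)" for z
 have M: "M z >= 0" if "z \<in> Z" for z
  unfolding M_def using Zp[OF that] k sqn_nonneg by (intro mult_nonneg_nonneg real_sqrt_ge_zero) auto
 define C where "C = Mv * sqrt cH + (\<Sum>z\<in>Z. M z)"
 have C: "C >= 0" unfolding C_def Mv_def using M cH sqn_nonneg by (intro add_nonneg_nonneg sum_nonneg mult_nonneg_nonneg real_sqrt_ge_zero) auto
 have "norm (LI x. cdot (u x) (\<phi> x)) <= C * sqrt (sqn (curl \<phi>))"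
  if \<phi>: "!!i. Ck (Suc 0) (%x. \<phi> x $ i)" and K: "compact K" "K \<subseteq> \<Omega>" "!!x. x \<notin> K ==> \<phi> x = 0" for \<phi> K
 proof -
  define s where "s = sqn (curl \<phi>)"
  have s: "s >= 0" by (simp add: s_def sqn_nonneg)
  have c\<phi>: "continuous_on UNIV \<phi>" using \<phi> Ck_continuous by (subst continuous_on_vec_nth_iff) blast
  have curlL: "L2field (curl \<phi>)"
   by (rule L2field_compact_support[OF continuous_curl[OF \<phi>] K(1)])
    (rule curl_zero_off_support[OF compact_imp_closed[OF K(1)] K(3)])
  obtain q where q: "Ck (Suc 0) q" and BL: "L2field (%x. (indicator X x * norm x powr (- \<beta>)) *\<^sub>R (grad q x - \<phi> x))"
   and Bs: "sqn (%x. (indicator X x * norm x powr (- \<beta>)) *\<^sub>R (grad q x - \<phi> x)) <= cH * s"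
   using cH(2)[OF \<phi> curlL] unfolding s_def by blast
  define BB where "BB x = (indicator X x * norm x powr (- \<beta>)) *\<^sub>R (grad q x - \<phi> x)" for x
  have bdX: "\<exists>b. \<forall>x. norm (indicator X x *\<^sub>R f x) <= b" if "continuous_on UNIV f" for f :: "real^3 => complex^3"
  proof -
   have "bounded (f ` cball 0 R)" using that by (intro compact_imp_bounded compact_continuous_image) (auto intro: continuous_on_subset)
   then obtain b where "\<forall>x\<in>cball 0 R. norm (f x) <= b" by (auto simp: bounded_iff)
   then have "norm (indicator X x *\<^sub>R f x) <= max b 0" for x by (auto simp: X_def indicator_def le_max_iff_disj)
   then show ?thesis by blast
  qed
  have intX: "integrable lborel (%x. cdot (u x) (f x))" if f: "continuous_on UNIV f" for f :: "real^3 => complex^3"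
  proof -
   obtain b where b: "!!x. norm (indicator X x *\<^sub>R f x) <= b" using bdX[OF f] by blast
   have "integrable lborel (%x. cdot (u x) (indicator X x *\<^sub>R f x))"
    by (rule integrable_cdot_bounded[OF ui _ b]) (use borel_measurable_continuous_onI[OF f] in measurable)
   moreover have "cdot (u x) (indicator X x *\<^sub>R f x) = cdot (u x) (f x)" for x
    using uoff[of x] clX2 by (cases "x \<in> \<Omega>") (auto simp: cdot_def subset_iff)
   ultimately show ?thesis by simp
  qed
  have cgq: "continuous_on UNIV (grad q)" by (rule continuous_grad[OF q])
  have i1: "integrable lborel (%x. cdot (u x) (grad q x))" by (rule intX[OF cgq])
  have i2: "integrable lborel (%x. cdot (u x) (\<phi> x))" by (rule intX[OF c\<phi>])
  have i3: "integrable lborel (%x. cdot (u x) (grad q x - \<phi> x))"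
   by (rule intX) (intro continuous_intros cgq c\<phi>)
  have part1: "norm (LI x. cdot (u x) (grad q x - \<phi> x)) <= Mv * sqrt cH * sqrt s"
  proof -
   define V1 where "V1 x = norm (norm x powr \<beta> *\<^sub>R u x)" for x
   define V2 where "V2 x = norm (BB x)" for x
   have V1: "L2field V1" "sqn V1 = sqn (%x. norm x powr \<beta> *\<^sub>R u x)"
    using uL unfolding L2field_def sqn_def V1_def by auto
   have V2: "L2field V2" "sqn V2 = sqn BB"
    using BL unfolding BB_def[symmetric] L2field_def sqn_def V2_def by auto
   have "norm (LI x. cdot (u x) (grad q x - \<phi> x)) <= (LI x. norm (cdot (u x) (grad q x - \<phi> x)))"
    by (rule integral_norm_bound)
   also have "\<dots> <= (LI x. V1 x \<bullet> V2 x)"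
   proof (rule integral_mono_AE)
    show "integrable lborel (%x. norm (cdot (u x) (grad q x - \<phi> x)))" using i3 by simp
    show "integrable lborel (%x. V1 x \<bullet> V2 x)" by (rule L2field_inner[OF V1(1) V2(1)])
    show "AE x in lborel. norm (cdot (u x) (grad q x - \<phi> x)) <= V1 x \<bullet> V2 x"
     using AE_lborel_singleton[of "0::real^3"]
    proof eventually_elim
     case (elim x)
     show ?case
     proof (cases "x \<in> \<Omega>")
      case True
      have "norm x powr \<beta> * norm x powr (- \<beta>) = 1" using elim by (simp flip: powr_add)
      then have "V1 x \<bullet> V2 x = norm (u x) * norm (grad q x - \<phi> x)"
       using True clX2 by (auto simp: V1_def V2_def BB_def mult_ac)
      then show ?thesis using norm_cdot_le[of "u x" "grad q x - \<phi> x"] by simp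
     next
      case False then show ?thesis using uoff by (simp add: V1_def cdot_def)
     qed
    qed
   qed
   also have "\<dots> <= sqrt (sqn V1) * sqrt (sqn V2)" using L2_Cauchy_Schwarz[OF V1(1) V2(1)] by simp
   also have "\<dots> <= Mv * sqrt (cH * s)"
    unfolding V1(2) V2(2) Mv_def using Bs sqn_nonneg by (intro mult_left_mono real_sqrt_le_mono) (auto simp: BB_def[abs_def])
   finally show ?thesis by (simp add: real_sqrt_mult mult.assoc)
  qed
  \<comment> \<open>Outside \<Omega> the field \<phi> vanishes, so grad q is the remainder itself.
    On \<open>E\<close> the norm of x is at most R, which removes the weight at the cost of R^(2
    \<beta>).\<close>
  have GE: "(NI x. nsq (grad q x) * indicator E x) <= ennreal (RE * s)"
  proof -
   have "(NI x. nsq (grad q x) * indicator E x) <= (NI x. ennreal (R powr (2 * \<beta>)) * nsq (BB x))"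
   proof (rule nn_integral_mono)
    fix x
    show "nsq (grad q x) * indicator E x <= ennreal (R powr (2 * \<beta>)) * nsq (BB x)"
    proof (cases "x \<in> E")
     case True
     then have x: "x \<in> X" "x \<notin> \<Omega>" using closure_subset[of \<Omega>] by (auto simp: E_def)
     then have phi0: "\<phi> x = 0" using K by blast
     have "x ~= 0" using x 0 by auto
     then have xp: "0 < norm x" "norm x <= R" using x by (auto simp: X_def)
     have "1 = norm x powr (2 * \<beta>) * norm x powr (- (2 * \<beta>))" using xp by (simp flip: powr_add)
     also have "\<dots> <= R powr (2 * \<beta>) * norm x powr (- (2 * \<beta>))"
      using xp \<beta> by (intro mult_right_mono powr_mono2) auto
     finally have "1 * (norm (grad q x))\<^sup>2 <= R powr (2 * \<beta>) * norm x powr (- (2 * \<beta>)) * (norm (grad q x))\<^sup>2"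
      by (intro mult_right_mono) auto
     moreover note phi0
     moreover have "(norm x powr (- \<beta>))\<^sup>2 = norm x powr (- (2 * \<beta>))"
      by (simp add: power2_eq_square powr_add[symmetric])
     ultimately have "(norm (grad q x))\<^sup>2 <= R powr (2 * \<beta>) * (norm (BB x))\<^sup>2"
      using x by (simp add: BB_def power_mult_distrib mult.assoc)
     then have "nsq (grad q x) <= ennreal (R powr (2 * \<beta>) * (norm (BB x))\<^sup>2)" by (rule ennreal_leI)
     then show ?thesis using True by (simp add: ennreal_mult)
    qed simp
   qed
   also have "\<dots> = ennreal (R powr (2 * \<beta>)) * ennreal (sqn BB)"
    using BL unfolding nn_integral_sqn[OF BL, folded BB_def, symmetric] by (intro nn_integral_cmult) (auto simp: L2field_def BB_def[symmetric])
   also have "\<dots> <= ennreal (R powr (2 * \<beta>)) * ennreal (cH * s)"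
    using Bs by (intro mult_left_mono ennreal_leI) (auto simp: BB_def[abs_def])
   also have "\<dots> = ennreal (RE * s)" using cH s by (simp add: RE_def mult.assoc flip: ennreal_mult)
   finally show ?thesis .
  qed
  \<comment> \<open>Only grad q enters the pairing, so an additive constant is free; the Poincare
    inequality on the exterior collar \<open>W\<close> selects it.\<close>
  obtain c where c: "(NI x. nsq (q x - c) * indicator W x) <= ennreal CP * (NI x. nsq (grad q x) * indicator E x)"
   using CP(2)[OF q] by blast
  define f where "f x = q x - c" for x
  have f: "Ck (Suc 0) f" unfolding f_def by (intro Ck_diff q Ck_const)
  have gf: "grad f x = grad q x" for x
   unfolding f_def grad_def by (simp add: pderiv3_diff Ck_differentiable[OF q])
  have PW: "(NI x. nsq (f x) * indicator W x) <= ennreal (CP * (RE * s))"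
  proof -
   have "ennreal CP * (NI x. nsq (grad q x) * indicator E x) <= ennreal CP * ennreal (RE * s)"
    by (intro mult_left_mono GE) simp
   also have "\<dots> = ennreal (CP * (RE * s))" using CP RE s by (simp add: ennreal_mult)
   finally show ?thesis using c unfolding f_def by (rule order_trans[rotated])
  qed
  have [measurable]: "f \<in> borel_measurable borel" "grad q \<in> borel_measurable borel"
   using borel_measurable_continuous_onI[OF Ck_continuous[OF f]] borel_grad[OF q] by auto
  have part2: "norm (LI x. cdot (u x) (grad (%x. \<zeta> z x * f x) x)) <= M z * sqrt s" if z: "z \<in> Z" for z
  proof -
   define fz where "fz x = \<zeta> z x * f x" for x
   have fz: "Ck (Suc 0) fz" unfolding fz_def by (intro Ck_mult \<zeta>C[OF z] f)
   define Wz where "Wz = ball z (r z) - closure \<Omega>"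
   have WzW: "Wz \<subseteq> W" "Wz \<subseteq> E" and [measurable]: "Wz \<in> sets borel"
    using z Zp[OF z] by (auto simp: Wz_def W_def E_def X_def subset_ball dest!: subsetD[of "ball z (\<delta> z)"])
   have [measurable]: "grad fz \<in> borel_measurable borel" by (rule borel_grad[OF fz])
   define H where "H x = indicator Wz x *\<^sub>R grad fz x" for x
   have Hm: "H \<in> borel_measurable borel" unfolding H_def by measurable
   have "(NI x. nsq (H x)) <=
    (NI x. ennreal (2 * (B z)\<^sup>2) * (nsq (grad q x) * indicator E x) + ennreal (2 * (B z)\<^sup>2) * (nsq (f x) * indicator W x))"
   proof (rule nn_integral_mono)
    fix x
    show "nsq (H x) <= ennreal (2 * (B z)\<^sup>2) * (nsq (grad q x) * indicator E x) + ennreal (2 * (B z)\<^sup>2) * (nsq (f x) * indicator W x)"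
    proof (cases "x \<in> Wz")
     case True
     have "(norm (H x))\<^sup>2 <= 2 * (norm (\<zeta> z x))\<^sup>2 * (norm (grad f x))\<^sup>2 + 2 * (norm (grad (\<zeta> z) x))\<^sup>2 * (norm (f x))\<^sup>2"
      using True norm_grad_mult_square_le[OF Ck_differentiable[OF \<zeta>C[OF z]] Ck_differentiable[OF f], of x] by (simp add: H_def fz_def[abs_def])
     also have "\<dots> <= 2 * (B z)\<^sup>2 * (norm (grad f x))\<^sup>2 + 2 * (B z)\<^sup>2 * (norm (f x))\<^sup>2"
      using B[OF z] by (intro add_mono mult_right_mono mult_left_mono power_mono) auto
     finally have "nsq (H x) <= ennreal (2 * (B z)\<^sup>2 * (norm (grad q x))\<^sup>2 + 2 * (B z)\<^sup>2 * (norm (f x))\<^sup>2)"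
      unfolding gf by (rule ennreal_leI)
     also have "\<dots> = ennreal (2 * (B z)\<^sup>2) * nsq (grad q x) + ennreal (2 * (B z)\<^sup>2) * nsq (f x)"
      by (subst (1 2) ennreal_mult[symmetric]) simp_all
     finally show ?thesis using subsetD[OF WzW(1) True] subsetD[OF WzW(2) True] by simp
    qed (simp add: H_def)
   qed
   also have "\<dots> = ennreal (2 * (B z)\<^sup>2) * (NI x. nsq (grad q x) * indicator E x) + ennreal (2 * (B z)\<^sup>2) * (NI x. nsq (f x) * indicator W x)"
    by (subst nn_integral_add) (simp_all add: nn_integral_cmult)
   also have "\<dots> <= ennreal (2 * (B z)\<^sup>2) * ennreal (RE * s) + ennreal (2 * (B z)\<^sup>2) * ennreal (CP * (RE * s))"
    by (intro add_mono mult_left_mono GE PW) auto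
   also have "\<dots> = ennreal (2 * (B z)\<^sup>2 * (RE * s) + 2 * (B z)\<^sup>2 * (CP * (RE * s)))"
    using RE CP s by (simp add: ennreal_plus ennreal_mult)
   also have "2 * (B z)\<^sup>2 * (RE * s) + 2 * (B z)\<^sup>2 * (CP * (RE * s)) = k z * s" by (simp add: k_def algebra_simps)
   finally have "(NI x. nsq (H x)) <= ennreal (k z * s)" .
   from sqn_le(2)[OF Hm this] k s have Hs: "sqn H <= k z * s" by simp
   have "norm (LI x. cdot (u x) (grad fz x)) <= Cz z * sqrt (sqn (%x. indicator (ball z (\<delta> z)) x *\<^sub>R u x)) * sqrt (sqn H)"
    unfolding H_def Wz_def
    using Ze[OF z, unfolded boundary_estimate_def, rule_format, OF u uLz[OF z] fz] by (simp add: fz_def \<zeta>(2)[OF z])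
   also have "\<dots> <= Cz z * sqrt (sqn (%x. indicator (ball z (\<delta> z)) x *\<^sub>R u x)) * sqrt (k z * s)"
    using Hs Zp[OF z] sqn_nonneg by (intro mult_left_mono real_sqrt_le_mono mult_nonneg_nonneg real_sqrt_ge_zero) auto
   finally show ?thesis by (simp add: M_def real_sqrt_mult mult.assoc fz_def[abs_def])
  qed
  define h where "h x = (1 - (\<Sum>z\<in>Z. \<zeta> z x)) * f x" for x
  have sm: "smooth (%x. \<Sum>z\<in>Y. \<zeta> z x)" if "Y \<subseteq> Z" for Y
   using finite_subset[OF that Z(1)] that \<zeta>(1) by (induction Y rule: finite_induct) (auto intro: smooth_const smooth_add)
  have hC: "Ck (Suc 0) h" unfolding h_def by (intro Ck_mult Ck_diff Ck_const f smooth_Ck sm) simp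
  define N where "N = (\<Union>z\<in>Z. ball z (r z / 4))"
  have N: "open N" "frontier \<Omega> \<subseteq> N" using Z by (auto simp: N_def)
  have hN: "h x = 0" if "x \<in> N" for x using that \<zeta>(3)[of x] by (auto simp: h_def N_def)
  \<comment> \<open>\<open>h\<close> vanishes near the boundary but not in the exterior. Cutting it
    off there gives a C^1 function of compact support in \<Omega> with the same gradient on
    \<Omega>, outside which u is 0.\<close>
  define h' where "h' = (%x. if x \<in> \<Omega> then h x else 0)"
  have h': "Ck (Suc 0) h'" "!!x. x \<in> \<Omega> ==> grad h' x = grad h x"
   using Ck_cut_off[OF \<Omega>(1) N hC hN] unfolding h'_def by auto
  have "(LI x. cdot (u x) (grad h' x)) = 0"
  proof (rule divfree_C1_test[OF \<Omega>(1) u h'(1)])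
   show "compact (closure \<Omega> - N)" using \<Omega>(2) N(1) by (intro compact_diff) (auto simp: compact_closure)
   show "closure \<Omega> - N \<subseteq> \<Omega>" using N(2) by (auto simp: frontier_def interior_open[OF \<Omega>(1)])
   show "h' x = 0" if "x \<notin> closure \<Omega> - N" for x using that hN closure_subset[of \<Omega>] by (auto simp: h'_def)
  qed
  moreover have "cdot (u x) (grad h' x) = cdot (u x) (grad h x)" for x using h'(2)[of x] uoff[of x] by (cases "x \<in> \<Omega>") (auto simp: cdot_def)
  ultimately have part3: "(LI x. cdot (u x) (grad h x)) = 0" by simp
  have gsum: "grad (%x. \<Sum>z\<in>Y. \<zeta> z x * f x) x = (\<Sum>z\<in>Y. grad (%x. \<zeta> z x * f x) x) \<and> (%x. \<Sum>z\<in>Y. \<zeta> z x * f x) differentiable (at x)"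
   if "Y \<subseteq> Z" for Y x
   using finite_subset[OF that Z(1)] that
  proof (induction Y rule: finite_induct)
   case (insert z Y)
   have d: "(%x. \<zeta> z x * f x) differentiable (at x)"
    using insert.prems by (intro Ck_differentiable[of 0] Ck_mult \<zeta>C f) auto
   show ?case using insert d by (simp add: grad_def vec_eq_iff pderiv3_add)
  qed (simp add: grad_def vec_eq_iff)
  have gq: "grad q x = (\<Sum>z\<in>Z. grad (%x. \<zeta> z x * f x) x) + grad h x" for x
  proof -
   have "f = (%x. (\<Sum>z\<in>Z. \<zeta> z x * f x) + h x)"
    by (auto simp: h_def fun_eq_iff algebra_simps sum_distrib_left)
   then have "grad f x = grad (%x. (\<Sum>z\<in>Z. \<zeta> z x * f x) + h x) x" by simp
   also have "\<dots> = grad (%x. \<Sum>z\<in>Z. \<zeta> z x * f x) x + grad h x"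
    using gsum[OF order_refl, of x] Ck_differentiable[OF hC] by (simp add: grad_def vec_eq_iff pderiv3_add)
   finally show ?thesis using gsum[OF order_refl, of x] gf by simp
  qed
  have cs: "cdot a (\<Sum>z\<in>Y. b z) = (\<Sum>z\<in>Y. cdot a (b z))" for a Y and b :: "real^3 => complex^3"
   by (induction Y rule: infinite_finite_induct) (auto simp: cdot_add_right)
  have iz: "integrable lborel (%x. cdot (u x) (grad (%x. \<zeta> z x * f x) x))" if "z \<in> Z" for z
   by (intro intX continuous_grad Ck_mult \<zeta>C that f)
  have ih: "integrable lborel (%x. cdot (u x) (grad h x))" by (intro intX continuous_grad hC)
  have "(LI x. cdot (u x) (grad q x)) = (\<Sum>z\<in>Z. LI x. cdot (u x) (grad (%x. \<zeta> z x * f x) x))"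
   unfolding gq cdot_add_right cs using iz ih part3 by simp
  then have "norm (LI x. cdot (u x) (grad q x)) <= (\<Sum>z\<in>Z. M z * sqrt s)"
   using part2 by (simp add: sum_norm_le)
  moreover have "(LI x. cdot (u x) (\<phi> x)) = (LI x. cdot (u x) (grad q x)) - (LI x. cdot (u x) (grad q x - \<phi> x))"
   unfolding cdot_diff_right using i1 i2 by simp
  ultimately have "norm (LI x. cdot (u x) (\<phi> x)) <= (\<Sum>z\<in>Z. M z * sqrt s) + Mv * sqrt cH * sqrt s"
   using part1 by (simp only:) (rule order_trans[OF norm_triangle_ineq4 add_mono])
  also have "\<dots> = C * sqrt s" by (simp add: C_def algebra_simps sum_distrib_left)
  finally show ?thesis by (simp add: s_def)
 qed
 with C show ?thesis by blast
qed

section \<open>Test functions, their derivatives, and conjugation\<close>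

lemma conv_commute:
 assumes "\<eta> \<in> borel_measurable borel" "F \<in> borel_measurable borel"
 shows "conv \<eta> F = conv F \<eta>"
proof
 fix x
 have "(%y. \<eta> (x - y) * F y) \<in> borel_measurable borel" using assms by measurable
 from integral_lborel_reflect[OF this, of x] show "conv \<eta> F x = conv F \<eta> x"
  unfolding conv_def by (simp add: mult.commute)
qed

text \<open>Convolution is commutative, so with both factors of class C^1 the derivative may be
  placed on either.\<close>

lemma pderiv3_conv_swap:
 assumes \<eta>: "Ck (Suc 0) \<eta>" "compact K" "!!x. x \<notin> K ==> \<eta> x = 0"
  and \<theta>: "Ck (Suc 0) \<theta>" "compact K'" "!!x. x \<notin> K' ==> \<theta> x = 0"
 shows "pderiv3 i (conv \<eta> \<theta>) = conv (pderiv3 i \<eta>) \<theta>" "pderiv3 i (conv \<eta> \<theta>) = conv \<eta> (pderiv3 i \<theta>)"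
proof -
 have c: "continuous_on UNIV \<eta>" "continuous_on UNIV \<theta>" "continuous_on UNIV (pderiv3 i \<theta>)"
  using \<eta>(1) \<theta>(1) Ck_continuous by (auto simp del: Ck.simps(2)) simp
 interpret A: compactly_supported \<eta> K using c \<eta> by unfold_locales
 interpret B: compactly_supported \<theta> K' using c \<theta> by unfold_locales
 have i: "integrable lborel \<eta>" "integrable lborel \<theta>"
  using integrable_compact_support[OF c(1) \<eta>(2,3)] integrable_compact_support[OF c(2) \<theta>(2,3)] by auto
 show "pderiv3 i (conv \<eta> \<theta>) = conv (pderiv3 i \<eta>) \<theta>" by (rule A.pderiv3_conv[OF \<eta>(1) i(2)])
 have m: "\<eta> \<in> borel_measurable borel" "\<theta> \<in> borel_measurable borel" "pderiv3 i \<theta> \<in> borel_measurable borel"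
  using c by (auto intro: borel_measurable_continuous_onI)
 show "pderiv3 i (conv \<eta> \<theta>) = conv \<eta> (pderiv3 i \<theta>)"
  unfolding conv_commute[OF m(1,2)] conv_commute[OF m(1,3)] by (rule B.pderiv3_conv[OF \<theta>(1) i(1)])
qed

text \<open>Both orders of differentiation of \<open>conv m \<phi>\<close> give \<open>conv (\<partial>\<^sub>i m) (\<partial>\<^sub>j \<phi>)\<close>.\<close>

lemma pderiv3_commute:
 assumes \<phi>: "Ck (Suc (Suc 0)) \<phi>"  and K': "compact K" "!!x. x \<notin> K ==> \<phi> x = 0"
 shows "pderiv3 i (pderiv3 j \<phi>) x = pderiv3 j (pderiv3 i \<phi>) x"
proof -
 have \<phi>1: "Ck (Suc 0) \<phi>" by (rule Ck_Suc_D[OF \<phi>])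
 have d\<phi>: "Ck (Suc 0) (pderiv3 k \<phi>)" for k using \<phi> by simp
 have off': "x \<notin> K ==> pderiv3 k \<phi> x = 0" for x k
  using pderiv3_zero_off_support[where f = \<phi>, OF compact_imp_closed[OF K'(1)] K'(2)] .
 have off2: "x \<notin> K ==> pderiv3 l (pderiv3 k \<phi>) x = 0" for x k l
  using pderiv3_zero_off_support[where f = "pderiv3 k \<phi>", OF compact_imp_closed[OF K'(1)] off'] .
 define d where "d x = pderiv3 i (pderiv3 j \<phi>) x - pderiv3 j (pderiv3 i \<phi>) x" for x
 have c2: "continuous_on UNIV (pderiv3 k (pderiv3 l \<phi>))" for k l using \<phi> by simp
 have int2: "integrable lborel (pderiv3 k (pderiv3 l \<phi>))" for k l
  by (rule integrable_compact_support[OF c2 K'(1) off2])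
 have conv0: "conv (%x. complex_of_real (m x)) d x = 0" if m: "is_mollifier \<epsilon> m" for \<epsilon> m x
 proof -
  interpret mollifier \<epsilon> m by unfold_locales (rule m)
  have m1: "Ck (Suc 0) (pderiv3 i cm)" using Ck_cm[of "Suc (Suc 0)"] by simp
  have moff: "x \<notin> cball 0 \<epsilon> ==> pderiv3 i cm x = 0" for x
   using pderiv3_zero_off_support[where f = cm, OF compact_imp_closed[OF compact_cball] off] .
  have sw: "pderiv3 k (conv cm \<theta>) = conv (pderiv3 k cm) \<theta>" "pderiv3 k (conv cm \<theta>) = conv cm (pderiv3 k \<theta>)"
   if "Ck (Suc 0) \<theta>" "!!x. x \<notin> K ==> \<theta> x = 0" for k \<theta>
   by (rule pderiv3_conv_swap[of cm "cball 0 \<epsilon>" \<theta> K k, OF Ck_cm compact_cball _ that(1) K'(1)]; (erule off | erule that(2)))+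
  have P1: "pderiv3 k (conv cm \<phi>) = conv (pderiv3 k cm) \<phi>" "pderiv3 k (conv cm \<phi>) = conv cm (pderiv3 k \<phi>)" for k
   using sw[of \<phi>, OF \<phi>1 K'(2)] by auto
  have P2: "conv cm (pderiv3 k (pderiv3 l \<phi>)) = pderiv3 k (pderiv3 l (conv cm \<phi>))" for k l
   unfolding P1(2) by (rule sw(2)[OF d\<phi> off', symmetric])
  have "pderiv3 j (pderiv3 i (conv cm \<phi>)) = conv (pderiv3 i cm) (pderiv3 j \<phi>)"
   unfolding P1(1) by (rule pderiv3_conv_swap(2)[of "pderiv3 i cm" "cball 0 \<epsilon>" \<phi> K, OF m1 compact_cball _ \<phi>1 K'(1)]; (erule moff | erule K'(2)))
  moreover have "pderiv3 i (pderiv3 j (conv cm \<phi>)) = conv (pderiv3 i cm) (pderiv3 j \<phi>)"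
   unfolding P1(2) by (rule sw(1)[OF d\<phi> off'])
  ultimately have "conv cm (pderiv3 i (pderiv3 j \<phi>)) = conv cm (pderiv3 j (pderiv3 i \<phi>))" unfolding P2 by simp
  moreover have "compactly_supported cm (cball 0 \<epsilon>)" by unfold_locales
  ultimately show ?thesis unfolding d_def[abs_def] using conv_diff[OF _ int2 int2] by simp
 qed
 have cd: "continuous_on UNIV d" unfolding d_def[abs_def] by (intro continuous_intros c2)
 have id: "integrable lborel d" unfolding d_def[abs_def] using int2 by simp
 have "norm (d x) <= e" if e: "e > 0" for e
 proof -
  obtain \<delta> where \<delta>: "\<delta> > 0" "!!y. dist y x < \<delta> ==> dist (d y) (d x) < e"
   using cd e unfolding continuous_on_iff by blast
  obtain m where m: "is_mollifier \<delta> m" using mollifier_exists[OF \<delta>(1)] by blast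
  interpret mollifier \<delta> m by unfold_locales (rule m)
  have "norm (conv cm d x - d x) <= e"
  proof (rule conv_close[OF id])
   fix y assume "norm (x - y) < \<delta>"
   then show "norm (d y - d x) <= e" using \<delta>(2)[of y] by (simp add: dist_norm norm_minus_commute)
  qed
  then show ?thesis using conv0[OF m] by simp
 qed
 then have "norm (d x) <= 0" by (rule field_le_epsilon) simp
 then show ?thesis by (simp add: d_def)
qed

lemma test_functionsE:
 assumes "\<phi> \<in> test_functions \<Omega>"
 obtains K where "smooth \<phi>" "compact K" "K \<subseteq> \<Omega>" "!!x. x \<notin> K ==> \<phi> x = 0"
 using assms by (auto simp: test_functions_def)

lemma test_functions_pderiv3:
 assumes "\<phi> \<in> test_functions \<Omega>"
 shows "pderiv3 i \<phi> \<in> test_functions \<Omega>"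
proof -
 obtain K where K: "smooth \<phi>" "compact K" "K \<subseteq> \<Omega>" "!!x. x \<notin> K ==> \<phi> x = 0" using assms by (rule test_functionsE) blast
 then have "\<forall>x. x \<notin> K --> pderiv3 i \<phi> x = 0"
  using pderiv3_zero_off_support[where f = \<phi>, OF compact_imp_closed[OF K(2)] K(4)] by blast
 with K smooth_pderiv3 show ?thesis unfolding test_functions_def by blast
qed

lemma test_functions_mult:
 assumes "\<phi> \<in> test_functions \<Omega>" "smooth \<zeta>"
 shows "(%x. \<zeta> x * \<phi> x) \<in> test_functions \<Omega>"
 using assms unfolding test_functions_def by (auto intro!: smooth_mult)

lemma test_functions_add:
 assumes "\<phi> \<in> test_functions \<Omega>" "\<theta> \<in> test_functions \<Omega>"
 shows "(%x. \<phi> x + \<theta> x) \<in> test_functions \<Omega>"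
proof -
 obtain K where K: "smooth \<phi>" "compact K" "K \<subseteq> \<Omega>" "!!x. x \<notin> K ==> \<phi> x = 0" using assms(1) by (rule test_functionsE) blast
 obtain L where L: "smooth \<theta>" "compact L" "L \<subseteq> \<Omega>" "!!x. x \<notin> L ==> \<theta> x = 0" using assms(2) by (rule test_functionsE) blast
 have "compact (K \<union> L)" "K \<union> L \<subseteq> \<Omega>" "\<forall>x. x \<notin> K \<union> L --> \<phi> x + \<theta> x = 0" using K L by auto
 with smooth_add[OF K(1) L(1)] show ?thesis unfolding test_functions_def by blast
qed

lemma test_functions_cnj:
 assumes "\<phi> \<in> test_functions \<Omega>"
 shows "(%x. cnj (\<phi> x)) \<in> test_functions \<Omega>"
 using assms unfolding test_functions_def by (auto intro!: smooth_cnj)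

lemma zero_test_function: "(%_. 0) \<in> test_functions \<Omega>"
 unfolding test_functions_def by (auto intro!: smooth_const exI[of _ "{}"])

lemma componentwise_testE:
 assumes "\<phi> \<in> componentwise (test_functions \<Omega>)"
 obtains K where "!!i. smooth (%x. \<phi> x $ i)" "compact K" "K \<subseteq> \<Omega>" "!!x. x \<notin> K ==> \<phi> x = 0"
proof -
 have t: "(%x. \<phi> x $ i) \<in> test_functions \<Omega>" for i using assms by (simp add: componentwise_def)
 then have "\<forall>i. \<exists>K. compact K \<and> K \<subseteq> \<Omega> \<and> (\<forall>x. x \<notin> K --> \<phi> x $ i = 0)" by (auto simp: test_functions_def)
 then obtain K where K: "!!i. compact (K i) \<and> K i \<subseteq> \<Omega> \<and> (\<forall>x. x \<notin> K i --> \<phi> x $ i = 0)" by metis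
 show ?thesis
 proof (rule that[of "\<Union>i\<in>UNIV. K i"])
  show "smooth (%x. \<phi> x $ i)" for i using t by (simp add: test_functions_def)
  show "compact (\<Union>i\<in>UNIV. K i)" using K by (intro compact_UN) auto
  show "(\<Union>i\<in>UNIV. K i) \<subseteq> \<Omega>" using K by blast
  show "\<phi> x = 0" if "x \<notin> (\<Union>i\<in>UNIV. K i)" for x using that K by (auto simp: vec_eq_iff)
 qed
qed

lemma continuous_componentwise_test:
 assumes "\<phi> \<in> componentwise (test_functions \<Omega>)"
 shows "continuous_on UNIV \<phi>" "continuous_on UNIV (curl \<phi>)"
proof -
 obtain K where K: "!!i. smooth (%x. \<phi> x $ i)" using assms by (rule componentwise_testE) blast
 show "continuous_on UNIV \<phi>" unfolding continuous_on_vec_nth_iff using K smooth_Ck[of _ 0] by auto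
 show "continuous_on UNIV (curl \<phi>)" using K smooth_Ck by (intro continuous_curl) blast
qed

lemma componentwise_test_L2:
 assumes "\<phi> \<in> componentwise (test_functions \<Omega>)"
 shows "L2field \<phi>" "L2field (curl \<phi>)" "x \<notin> \<Omega> ==> \<phi> x = 0" "x \<notin> \<Omega> ==> curl \<phi> x = 0"
proof -
 obtain K where K: "compact K" "K \<subseteq> \<Omega>" "!!x. x \<notin> K ==> \<phi> x = 0" using assms by (rule componentwise_testE) blast
 have c: "curl \<phi> x = 0" if "x \<notin> K" for x
  by (rule curl_zero_off_support[of K, OF compact_imp_closed[OF K(1)] _ that]) (rule K(3))
 note C = continuous_componentwise_test[OF assms]
 show "L2field \<phi>" by (rule L2field_compact_support[OF C(1) K(1,3)])
 show "L2field (curl \<phi>)" by (rule L2field_compact_support[OF C(2) K(1) c])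
 show "x \<notin> \<Omega> ==> \<phi> x = 0" by (rule K(3)) (use K(2) in blast)
 show "x \<notin> \<Omega> ==> curl \<phi> x = 0" by (rule c) (use K(2) in blast)+
qed

lemma curl_add_scaleR:
 assumes "!!i. smooth (%x. \<phi> x $ i)" "!!i. smooth (%x. \<theta> x $ i)"
 shows "curl (%x. \<phi> x + s *\<^sub>R \<theta> x) = (%x. curl \<phi> x + s *\<^sub>R curl \<theta> x)"
proof
 fix x
 have "pderiv3 i (%x. \<phi> x $ j + s *\<^sub>R \<theta> x $ j) x = pderiv3 i (%x. \<phi> x $ j) x + s *\<^sub>R pderiv3 i (%x. \<theta> x $ j) x" for i j
 proof -
  have "(%x. of_real s * \<theta> x $ j) differentiable (at x)"
   by (intro smooth_differentiable smooth_mult smooth_const assms(2))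
  then have "(%x. s *\<^sub>R \<theta> x $ j) differentiable (at x)" by (simp only: scaleR_conv_of_real)
  then show ?thesis
   using pderiv3_add[OF smooth_differentiable[OF assms(1)[of j]]]
    pderiv3_bounded_linear[OF bounded_linear_scaleR_right smooth_differentiable[OF assms(2)[of j]]] by simp
 qed
 then show "curl (%x. \<phi> x + s *\<^sub>R \<theta> x) x = curl \<phi> x + s *\<^sub>R curl \<theta> x"
  by (simp add: curl_def vec_eq_iff forall_3 algebra_simps)
qed

definition cnjv :: "complex^3 => complex^3" where
 "cnjv a = (\<chi> i. cnj (a $ i))"

lemma cnjv_nth [simp]: "cnjv a $ i = cnj (a $ i)" by (simp add: cnjv_def)

lemma norm_cnjv [simp]: "norm (cnjv a) = norm a" by (simp add: norm_vec_def)

lemma cnjv_diff: "cnjv (a - b) = cnjv a - cnjv b" by (simp add: vec_eq_iff)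

lemma borel_measurable_cnjv [measurable]: "f \<in> borel_measurable M ==> (%x. cnjv (f x)) \<in> borel_measurable M"
proof -
 assume f: "f \<in> borel_measurable M"
 have "continuous_on UNIV cnjv" unfolding cnjv_def by (intro continuous_on_vec_lambda continuous_intros)
 from measurable_compose[OF f borel_measurable_continuous_onI[OF this]] show ?thesis .
qed

lemma L2field_cnjv: "L2field f ==> L2field (%x. cnjv (f x))"
 by (simp add: L2field_def borel_measurable_cnjv)

lemma cdot_commute: "cdot a b = cdot b a" by (simp add: cdot_def mult.commute)

lemma Re_cdot_cnjv: "Re (cdot (cnjv a) b) = a \<bullet> b"
 by (simp add: cdot_def inner_vec_def inner_complex_def)

lemma curl_cnjv:
 assumes "!!i. smooth (%x. \<phi> x $ i)"
 shows "curl (%x. cnjv (\<phi> x)) x = cnjv (curl \<phi> x)"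
proof -
 have "pderiv3 i (%x. cnj (\<phi> x $ j)) x = cnj (pderiv3 i (%x. \<phi> x $ j) x)" for i j
  by (rule pderiv3_bounded_linear[OF bounded_linear_cnj smooth_differentiable[OF assms]])
 then show ?thesis by (simp add: curl_def vec_eq_iff forall_3)
qed

lemma cdot_L2:
 assumes "L2field a" "L2field b"
 shows "integrable lborel (%x. cdot (a x) (b x))"
  and "norm (LI x. cdot (a x) (b x)) <= sqrt (sqn a) * sqrt (sqn b)"
proof -
 have [measurable]: "a \<in> borel_measurable borel" "b \<in> borel_measurable borel" using assms by (auto simp: L2field_def)
 have n: "L2field (%x. norm (a x))" "L2field (%x. norm (b x))" using assms unfolding L2field_def by auto
 have i: "integrable lborel (%x. norm (a x) * norm (b x))" using L2field_inner[OF n] by simp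
 show c: "integrable lborel (%x. cdot (a x) (b x))"
  by (rule Bochner_Integration.integrable_bound[OF i]) (use norm_cdot_le in auto)
 have "norm (LI x. cdot (a x) (b x)) <= (LI x. norm (a x) * norm (b x))"
  by (rule norm_integral_le[OF c i norm_cdot_le])
 also have "\<dots> <= sqrt (sqn a) * sqrt (sqn b)"
  using L2_Cauchy_Schwarz[OF n] by (simp add: sqn_def)
 finally show "norm (LI x. cdot (a x) (b x)) <= sqrt (sqn a) * sqrt (sqn b)" .
qed

text \<open>Weak notions for fields extended by zero and integrated over the whole space with Borel
  measurability; the versions over \<Omega> with Lebesgue measurability are reached at the end
  through representatives.\<close>

definition curl_free :: "(real^3) set => (real^3 => complex^3) => bool" where
 "curl_free \<Omega> g \<longleftrightarrow> (\<forall>\<phi>\<in>componentwise (test_functions \<Omega>). (LI x. cdot (g x) (curl \<phi> x)) = 0)"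

definition weak_grad :: "(real^3) set => (real^3 => complex) => (real^3 => complex^3) => bool" where
 "weak_grad \<Omega> p g \<longleftrightarrow>
   (\<forall>\<phi>\<in>test_functions \<Omega>. \<forall>i. (LI x. p x * pderiv3 i \<phi> x) = - (LI x. g x $ i * \<phi> x))"

lemma integrable_nth: "integrable M (g :: 'a => complex^3) ==> integrable M (%x. g x $ i)"
 by (rule integrable_bounded_linear[OF bounded_linear_vec_nth])

lemma integrable_mult_test:
 assumes "integrable lborel (g :: real^3 => complex)" "\<phi> \<in> test_functions \<Omega>"
 shows "integrable lborel (%x. g x * \<phi> x)"
proof -
 obtain K where K: "smooth \<phi>" "compact K" "K \<subseteq> \<Omega>" "!!x. x \<notin> K ==> \<phi> x = 0" using assms(2) by (rule test_functionsE) blast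
 have c: "continuous_on UNIV \<phi>" using smooth_Ck[OF K(1), of 0] by simp
 obtain B where "!!x. norm (\<phi> x) <= B" using bounded_compact_support[OF c K(2,4)] by metis
 then have "integrable lborel (%x. \<phi> x * g x)"
  using assms(1) borel_measurable_continuous_onI[OF c] by (intro integrable_bounded_mult)
 then show ?thesis by (simp add: mult.commute)
qed

text \<open>Testing the weak gradient with first derivatives of \<phi> puts second derivatives on
  the test functions; by their symmetry the terms cancel in pairs.\<close>

lemma weak_grad_imp_curl_free:
 assumes w: "weak_grad \<Omega> p g" and i: "integrable lborel g"
 shows "curl_free \<Omega> g"
 unfolding curl_free_def
proof
 fix \<phi> assume \<phi>: "\<phi> \<in> componentwise (test_functions \<Omega>)"
 have t: "(%x. \<phi> x $ j) \<in> test_functions \<Omega>" for j using \<phi> by (simp add: componentwise_def)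
 have I: "integrable lborel (%x. g x $ i * pderiv3 j (%x. \<phi> x $ k) x)" for i j k
  by (rule integrable_mult_test[OF integrable_nth[OF i] test_functions_pderiv3[OF t]])
 define J where "J i j k = (LI x. g x $ i * pderiv3 j (%x. \<phi> x $ k) x)" for i j k
 have J: "J i j k = - (LI x. p x * pderiv3 i (pderiv3 j (%x. \<phi> x $ k)) x)" for i j k
  using w test_functions_pderiv3[OF t, of j k] unfolding weak_grad_def J_def by simp
 have "pderiv3 i (pderiv3 j (%x. \<phi> x $ k)) x = pderiv3 j (pderiv3 i (%x. \<phi> x $ k)) x" for i j k x
  using t[of k] by (rule test_functionsE) (rule pderiv3_commute[OF smooth_Ck])
 then have Js: "J i j k = J j i k" for i j k unfolding J by simp
 have "cdot (g x) (curl \<phi> x) =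
   (g x $ 1 * pderiv3 2 (%x. \<phi> x $ 3) x - g x $ 1 * pderiv3 3 (%x. \<phi> x $ 2) x) +
   (g x $ 2 * pderiv3 3 (%x. \<phi> x $ 1) x - g x $ 2 * pderiv3 1 (%x. \<phi> x $ 3) x) +
   (g x $ 3 * pderiv3 1 (%x. \<phi> x $ 2) x - g x $ 3 * pderiv3 2 (%x. \<phi> x $ 1) x)" for x
  by (simp add: cdot_def sum_3 curl_def right_diff_distrib)
 then have "(LI x. cdot (g x) (curl \<phi> x)) = (J 1 2 3 - J 1 3 2) + (J 2 3 1 - J 2 1 3) + (J 3 1 2 - J 3 2 1)"
  unfolding J_def using I by simp
 then show "(LI x. cdot (g x) (curl \<phi> x)) = 0" using Js[of 1 2 3] Js[of 1 3 2] Js[of 2 3 1] by simp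
qed

lemma grad_test_weak_grad:
 assumes \<eta>: "\<eta> \<in> test_functions \<Omega>"
 shows "weak_grad \<Omega> \<eta> (grad \<eta>)"
 unfolding weak_grad_def
proof (intro ballI allI)
 fix \<phi> i assume \<phi>: "\<phi> \<in> test_functions \<Omega>"
 obtain K where K: "smooth \<phi>" "compact K" "!!x. x \<notin> K ==> \<phi> x = 0" using \<phi> by (rule test_functionsE) blast
 have s: "smooth \<eta>" using \<eta> by (simp add: test_functions_def)
 have cont: "continuous_on UNIV \<eta>" using smooth_Ck[OF s, of 0] by simp
 obtain L where L: "compact L" "!!x. x \<notin> L ==> \<eta> x = 0" using \<eta> by (rule test_functionsE) blast
 have "integrable lborel \<eta>" by (rule integrable_compact_support[OF cont L])
 then have I1: "integrable lborel (%x. \<eta> x * pderiv3 i \<phi> x)" by (rule integrable_mult_test[OF _ test_functions_pderiv3[OF \<phi>]])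
 have "continuous_on UNIV (pderiv3 i \<eta>)" using smooth_Ck[OF smooth_pderiv3[OF s], of 0] by simp
 then have "integrable lborel (pderiv3 i \<eta>)"
  by (rule integrable_compact_support[OF _ L(1) pderiv3_zero_off_support[where f = \<eta>, OF compact_imp_closed[OF L(1)] L(2)]])
 then have I2: "integrable lborel (%x. pderiv3 i \<eta> x * \<phi> x)" by (rule integrable_mult_test[OF _ \<phi>])
 have "(LI x. pderiv3 i (%x. \<eta> x * \<phi> x) x) = 0"
  by (rule integral_pderiv3_eq_0[OF smooth_Ck[OF smooth_mult[OF s K(1)]] K(2)]) (simp add: K)
 then show "(LI x. \<eta> x * pderiv3 i \<phi> x) = - (LI x. grad \<eta> x $ i * \<phi> x)"
  using I1 I2 smooth_differentiable[OF s] smooth_differentiable[OF K(1)] by (simp add: pderiv3_mult grad_def add_eq_0_iff2)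
qed

text \<open>The bound makes the pairing with u a bounded functional of curl \<phi>, so it has a
  representative h in the L^2 closure of the curls. The last property, orthogonality to every
  curl-free field, later gives the zero divergence, the boundary condition and half of the
  uniqueness argument.\<close>

theorem vector_potential_exists:
 assumes \<Omega>: "open \<Omega>" "bounded \<Omega>" and lip: "lipschitz_boundary \<Omega>" and con: "connected (frontier \<Omega>)" and 0: "0 \<in> \<Omega>"
  and \<beta>: "0 <= \<beta>" "\<beta> < 1 / 2"
  and u: "divfree \<Omega> u" and uL: "L2field (%x. norm x powr \<beta> *\<^sub>R u x)"
 obtains \<psi> where "L2field \<psi>" "!!x. x \<notin> \<Omega> ==> \<psi> x = 0"
  "!!\<phi>. \<phi> \<in> componentwise (test_functions \<Omega>) ==> (LI x. cdot (\<psi> x) (curl \<phi> x)) = (LI x. cdot (u x) (\<phi> x))"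
  "!!g. L2field g ==> (!!x. x \<notin> \<Omega> ==> g x = 0) ==> curl_free \<Omega> g ==> (LI x. cdot (\<psi> x) (g x)) = 0"
proof -
 let ?T = "componentwise (test_functions \<Omega>)"
 obtain C where C: "!!\<phi> K. (!!i. Ck (Suc 0) (%x. \<phi> x $ i)) ==> compact K ==> K \<subseteq> \<Omega> ==> (!!x. x \<notin> K ==> \<phi> x = 0) ==>
  norm (LI x. cdot (u x) (\<phi> x)) <= C * sqrt (sqn (curl \<phi>))"
  using pairing_bound[OF assms] by blast
 have ui: "integrable lborel u" using u by (simp add: divfree_def)
 have I: "integrable lborel (%x. cdot (u x) (\<phi> x))" if \<phi>: "\<phi> \<in> ?T" for \<phi>
 proof -
  obtain K where K: "compact K" "!!x. x \<notin> K ==> \<phi> x = 0" using \<phi> by (rule componentwise_testE) blast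
  note c = continuous_componentwise_test(1)[OF \<phi>]
  obtain B where "!!x. norm (\<phi> x) <= B" using bounded_compact_support[OF c K] by metis
  then show ?thesis by (rule integrable_cdot_bounded[OF ui borel_measurable_continuous_onI[OF c]])
 qed
 define l where "l \<phi> = (LI x. cdot (u x) (\<phi> x))" for \<phi>
 have lbound: "norm (l \<phi>) <= C * sqrt (sqn (curl \<phi>))" if "\<phi> \<in> ?T" for \<phi>
  using that unfolding l_def by (rule componentwise_testE) (rule C[OF smooth_Ck])
 define P where "P = (\<lambda>\<phi>. (curl \<phi>, Re (l \<phi>))) ` ?T"
 have PI: "(curl \<phi>, Re (l \<phi>)) \<in> P" if "\<phi> \<in> ?T" for \<phi> using that by (auto simp: P_def)
 have comb: "(%x. \<phi> x + s *\<^sub>R \<theta> x) \<in> ?T" if "\<phi> \<in> ?T" "\<theta> \<in> ?T" for \<phi> \<theta> :: "real^3 => complex^3" and s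
 proof -
  have "(%x. \<phi> x $ i + of_real s * \<theta> x $ i) \<in> test_functions \<Omega>" for i
   using that by (intro test_functions_add test_functions_mult smooth_const) (auto simp: componentwise_def)
  then have "(%x. \<phi> x $ i + s *\<^sub>R \<theta> x $ i) \<in> test_functions \<Omega>" for i by (simp only: scaleR_conv_of_real)
  then show ?thesis by (simp add: componentwise_def)
 qed
 have smT: "smooth (%x. \<phi> x $ i)" if "\<phi> \<in> ?T" for \<phi> :: "real^3 => complex^3" and i
  using that by (simp add: componentwise_def test_functions_def)
 have zT: "(%_. 0 :: complex^3) \<in> ?T" using zero_test_function by (simp add: componentwise_def)
 obtain h p where h: "L2field h" and p: "!!n. p n \<in> P" and lim: "(%n. sqn (%x. fst (p n) x - h x)) \<longlonglongrightarrow> 0"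
  and rep: "!!f a. (f, a) \<in> P ==> (LI x. h x \<bullet> f x) = a"
 proof (rule riesz_L2[of P C])
  have "curl (%_. 0) = (%_. 0)" by (auto simp: curl_def vec_eq_iff forall_3)
  then show "(%_. 0, 0) \<in> P" using PI[OF zT] by (simp add: l_def)
  show "L2field f" if "(f, a) \<in> P" for f a using that componentwise_test_L2(2) by (auto simp: P_def)
  show "\<bar>a\<bar> <= C * sqrt (sqn f)" if "(f, a) \<in> P" for f a
   using that lbound abs_Re_le_cmod by (fastforce simp: P_def intro: order_trans)
  show "(%x. f x + s *\<^sub>R g x, a + s * b) \<in> P" if "(f, a) \<in> P" "(g, b) \<in> P" for f a g b s
  proof -
   obtain \<phi> where "\<phi> \<in> ?T" "f = curl \<phi>" "a = Re (l \<phi>)" using \<open>(f, a) \<in> P\<close> by (auto simp: P_def)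
   moreover obtain \<theta> where "\<theta> \<in> ?T" "g = curl \<theta>" "b = Re (l \<theta>)" using \<open>(g, b) \<in> P\<close> by (auto simp: P_def)
   ultimately have *: "\<phi> \<in> ?T" "\<theta> \<in> ?T" "f = curl \<phi>" "g = curl \<theta>" "a = Re (l \<phi>)" "b = Re (l \<theta>)" by blast+
   have "cdot (u x) (\<phi> x + s *\<^sub>R \<theta> x) = cdot (u x) (\<phi> x) + s *\<^sub>R cdot (u x) (\<theta> x)" for x
    by (simp add: cdot_def sum.distrib scaleR_sum_right algebra_simps)
   then have "l (%x. \<phi> x + s *\<^sub>R \<theta> x) = l \<phi> + s *\<^sub>R l \<theta>" unfolding l_def using I *(1,2) by simp
   then have "(%x. f x + s *\<^sub>R g x, a + s * b) = (curl (%x. \<phi> x + s *\<^sub>R \<theta> x), Re (l (%x. \<phi> x + s *\<^sub>R \<theta> x)))"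
    using * smT by (simp add: curl_add_scaleR)
   then show ?thesis using PI[OF comb[OF *(1,2)]] by simp
  qed
 qed blast
 have hm [measurable]: "h \<in> borel_measurable borel" using h by (simp add: L2field_def)
 \<comment> \<open>The cut-off to \<Omega> changes no pairing considered here: curls of test fields,
   and the fields g, vanish off \<Omega>.\<close>
 define \<psi> where "\<psi> x = indicator \<Omega> x *\<^sub>R cnjv (h x)" for x
 have \<Omega>m [measurable]: "\<Omega> \<in> sets borel" using \<Omega> by simp
 have hL: "L2field (%x. cnjv (h x))" by (rule L2field_cnjv[OF h])
 have \<psi>: "L2field \<psi>"
  by (rule L2field_dominated[OF h, where c = 1]) (auto simp: \<psi>_def[abs_def] indicator_def)
 have repc: "(LI x. cdot (cnjv (h x)) (curl \<phi> x)) = l \<phi>" if \<phi>: "\<phi> \<in> ?T" for \<phi>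
 proof -
  have R: "Re (LI x. cdot (cnjv (h x)) (curl \<theta> x)) = Re (l \<theta>)" if "\<theta> \<in> ?T" for \<theta>
  proof -
   have "Re (LI x. cdot (cnjv (h x)) (curl \<theta> x)) = (LI x. Re (cdot (cnjv (h x)) (curl \<theta> x)))"
    by (rule integral_Re[symmetric], rule cdot_L2(1)[OF hL componentwise_test_L2(2)[OF that]])
   then show ?thesis using rep[OF PI[OF that]] by (simp add: Re_cdot_cnjv)
  qed
  \<comment> \<open>The Riesz representation yields real parts; the real part for - i \<phi> is the
    imaginary part for \<phi>.\<close>
  define \<theta> :: "real^3 => complex^3" where "\<theta> x = (\<chi> i. - \<i> * \<phi> x $ i)" for x
  have "(%x. - \<i> * \<phi> x $ i) \<in> test_functions \<Omega>" for i
   using \<phi> by (intro test_functions_mult smooth_const) (simp add: componentwise_def)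
  then have \<theta>: "\<theta> \<in> ?T" by (simp add: componentwise_def \<theta>_def)
  have "pderiv3 i (%x. - \<i> * \<phi> x $ j) x = - \<i> * pderiv3 i (%x. \<phi> x $ j) x" for i j x
   by (rule pderiv3_bounded_linear[OF bounded_linear_mult_right smooth_differentiable[OF smT[OF \<phi>]]])
  then have "curl \<theta> x = (\<chi> i. - \<i> * curl \<phi> x $ i)" for x
   by (simp add: curl_def \<theta>_def vec_eq_iff forall_3 algebra_simps)
  then have c: "cdot a (curl \<theta> x) = - \<i> * cdot a (curl \<phi> x)" "cdot a (\<theta> x) = - \<i> * cdot a (\<phi> x)" for a x
   by (simp_all add: cdot_def \<theta>_def sum_distrib_left mult.left_commute)
  have "(LI x. cdot (cnjv (h x)) (curl \<theta> x)) = - \<i> * (LI x. cdot (cnjv (h x)) (curl \<phi> x))" "l \<theta> = - \<i> * l \<phi>"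
   unfolding c l_def by simp_all
  then show ?thesis using R[OF \<phi>] R[OF \<theta>] by (simp add: complex_eq_iff)
 qed
 show ?thesis
 proof (rule that[OF \<psi>])
  show "\<psi> x = 0" if "x \<notin> \<Omega>" for x using that by (simp add: \<psi>_def)
  show "(LI x. cdot (\<psi> x) (curl \<phi> x)) = (LI x. cdot (u x) (\<phi> x))" if \<phi>: "\<phi> \<in> ?T" for \<phi>
  proof -
   have "cdot (\<psi> x) (curl \<phi> x) = cdot (cnjv (h x)) (curl \<phi> x)" for x
    using componentwise_test_L2(4)[OF \<phi>, of x] by (cases "x \<in> \<Omega>") (auto simp: \<psi>_def)
   then show ?thesis using repc[OF \<phi>] by (simp add: l_def)
  qed
  show "(LI x. cdot (\<psi> x) (g x)) = 0" if g: "L2field g" "!!x. x \<notin> \<Omega> ==> g x = 0" "curl_free \<Omega> g" for g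
  proof -
   define G where "G = (LI x. cdot (\<psi> x) (g x))"
   have "cdot (\<psi> x) (g x) = cdot (cnjv (h x)) (g x)" for x
    using g(2)[of x] by (cases "x \<in> \<Omega>") (auto simp: \<psi>_def)
   then have G: "G = (LI x. cdot (cnjv (h x)) (g x))" by (simp add: G_def)
   \<comment> \<open>Conjugates of curls of test fields are again such curls, hence orthogonal to g,
     so only the distance of h to the approximating curls remains.\<close>
   have "norm G <= sqrt (sqn (%x. fst (p n) x - h x)) * sqrt (sqn g)" for n
   proof -
    obtain \<phi> where \<phi>: "\<phi> \<in> ?T" "fst (p n) = curl \<phi>" using p[of n] by (auto simp: P_def)
    have f: "L2field (curl \<phi>)" by (rule componentwise_test_L2(2)[OF \<phi>(1)])
    have "(%x. cnjv (\<phi> x)) \<in> ?T" using \<phi>(1) test_functions_cnj by (auto simp: componentwise_def)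
    then have "(LI x. cdot (g x) (curl (%x. cnjv (\<phi> x)) x)) = 0" using g(3) unfolding curl_free_def by blast
    then have 0: "(LI x. cdot (cnjv (curl \<phi> x)) (g x)) = 0"
     using curl_cnjv[OF smT[OF \<phi>(1)]] by (simp add: cdot_commute)
    have L: "L2field (%x. cnjv (h x) - cnjv (curl \<phi> x))" by (rule L2field_diff[OF hL L2field_cnjv[OF f]])
    have "G = (LI x. cdot (cnjv (h x) - cnjv (curl \<phi> x)) (g x))"
     unfolding G cdot_diff_left using 0 cdot_L2(1)[OF hL g(1)] cdot_L2(1)[OF L2field_cnjv[OF f] g(1)] by simp
    then have "norm G <= sqrt (sqn (%x. cnjv (h x) - cnjv (curl \<phi> x))) * sqrt (sqn g)" using cdot_L2(2)[OF L g(1)] by simp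
    also have "sqn (%x. cnjv (h x) - cnjv (curl \<phi> x)) = sqn (%x. fst (p n) x - h x)"
     unfolding sqn_def \<phi>(2) by (simp add: norm_minus_commute flip: cnjv_diff)
    finally show ?thesis .
   qed
   moreover have "(%n. sqrt (sqn (%x. fst (p n) x - h x)) * sqrt (sqn g)) \<longlonglongrightarrow> sqrt 0 * sqrt (sqn g)"
    by (intro tendsto_intros lim)
   ultimately have "norm G <= sqrt 0 * sqrt (sqn g)" by (intro LIMSEQ_le_const) auto
   then show ?thesis by (simp add: G_def)
  qed
 qed
qed

section \<open>Curl-free fields are gradients\<close>

context mollifier
begin

text \<open>Mollification at x is a pairing with this translate, admissible when the \<epsilon>-ball
  around x lies in V. Weak identities in V thus become pointwise ones away from its
  boundary.\<close>

lemma cm_translate_test: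
 assumes "cball x \<epsilon> \<subseteq> V"
 shows "(%y. cm (x - y)) \<in> test_functions V"
proof -
 have "smooth (%y. cm (x + (-1) *\<^sub>R y))" by (rule smooth_affine_arg[OF smooth_cm])
 moreover have "cm (x - y) = 0" if "y \<notin> cball x \<epsilon>" for y using off[of "x - y"] that by (simp add: dist_norm norm_minus_commute)
 ultimately show ?thesis
  using assms unfolding test_functions_def by (auto intro!: exI[of _ "cball x \<epsilon>"])
qed

lemma pderiv3_cm_translate: "pderiv3 i (%y. cm (x - y)) y = - pderiv3 i cm (x - y)"
 using pderiv3_affine_arg[of cm x "-1" y i] smooth_differentiable[OF smooth_cm] by simp

lemma conv_orthogonal:
 assumes "!!\<phi>. \<phi> \<in> test_functions V ==> (LI x. f x * \<phi> x) = 0" "cball x \<epsilon> \<subseteq> V"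
 shows "conv cm f x = 0"
 using assms(1)[OF cm_translate_test[OF assms(2)]] by (simp add: conv_def mult.commute)

lemma pderiv3_conv_eq_integral:
 assumes "integrable lborel f"
 shows "pderiv3 i (conv cm f) x = - (LI y. f y * pderiv3 i (%y. cm (x - y)) y)"
 unfolding pderiv3_conv[OF Ck_cm assms] pderiv3_cm_translate by (simp add: conv_def mult.commute)

lemma pderiv3_conv_weak_grad:
 assumes "weak_grad V p g" "integrable lborel p" "cball x \<epsilon> \<subseteq> V"
 shows "pderiv3 i (conv cm p) x = conv cm (%y. g y $ i) x"
 using assms(1) cm_translate_test[OF assms(3)] unfolding pderiv3_conv_eq_integral[OF assms(2)] weak_grad_def
 by (simp add: conv_def mult.commute)

end

text \<open>Test fields with a single nonzero component isolate one pair of partial derivatives at a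
  time.\<close>

lemma curl_free_test:
 assumes w: "curl_free V w" "integrable lborel w" and \<theta>: "\<theta> \<in> test_functions V"
 shows "(LI x. w x $ a * pderiv3 b \<theta> x) = (LI x. w x $ b * pderiv3 a \<theta> x)"
proof -
 have I: "integrable lborel (%x. w x $ a * pderiv3 b \<theta> x)" for a b
  by (rule integrable_mult_test[OF integrable_nth[OF w(2)] test_functions_pderiv3[OF \<theta>]])
 have T: "(%x. vector [\<theta> x, 0, 0] :: complex^3) \<in> componentwise (test_functions V)"
  "(%x. vector [0, \<theta> x, 0] :: complex^3) \<in> componentwise (test_functions V)"
  "(%x. vector [0, 0, \<theta> x] :: complex^3) \<in> componentwise (test_functions V)"
  using \<theta> zero_test_function by (auto simp: componentwise_def forall_3)
 note Z = T[THEN w(1)[unfolded curl_free_def, THEN bspec]]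
 have E1: "(LI x. w x $ 2 * pderiv3 3 \<theta> x) = (LI x. w x $ 3 * pderiv3 2 \<theta> x)"
  using Z(1) I by (simp add: cdot_def sum_3 curl_def)
 have E2: "(LI x. w x $ 1 * pderiv3 3 \<theta> x) = (LI x. w x $ 3 * pderiv3 1 \<theta> x)"
  using Z(2) I by (simp add: cdot_def sum_3 curl_def)
 have E3: "(LI x. w x $ 1 * pderiv3 2 \<theta> x) = (LI x. w x $ 2 * pderiv3 1 \<theta> x)"
  using Z(3) I by (simp add: cdot_def sum_3 curl_def)
 have "a = 1 \<or> a = 2 \<or> a = 3" "b = 1 \<or> b = 2 \<or> b = 3" using exhaust_3 by auto
 then show ?thesis using E1 E2 E3 by auto
qed

definition mollify :: "(real^3 => real) => (real^3 => complex^3) => real^3 => complex^3" where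
 "mollify m w x = (\<chi> i. conv (%x. complex_of_real (m x)) (%x. w x $ i) x)"

lemma (in mollifier) Ck_mollify: "integrable lborel w ==> Ck k (%x. mollify m w x $ i)"
 unfolding mollify_def vec_lambda_beta by (rule smooth_Ck[OF smooth_conv_cm[OF integrable_nth]])

lemma (in mollifier) curl_mollify:
 assumes "curl_free V w" "integrable lborel w" "cball x \<epsilon> \<subseteq> V"
 shows "curl (mollify m w) x = 0"
proof -
 have "pderiv3 a (%x. mollify m w x $ b) x = pderiv3 b (%x. mollify m w x $ a) x" for a b
  unfolding mollify_def vec_lambda_beta pderiv3_conv_eq_integral[OF integrable_nth[OF assms(2)]]
  using curl_free_test[OF assms(1,2) cm_translate_test[OF assms(3)]] by simp
 then show ?thesis by (simp add: curl_def vec_eq_iff forall_3)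
qed

text \<open>The rate (1/2)^n makes the errors summable, which later gives convergence almost
  everywhere and, through the segment estimate, along almost all segments from one vertex.\<close>

lemma mollify_sequence:
 assumes w: "integrable lborel w" "!!x. norm x >= R ==> w x = 0"
 obtains \<epsilon> m where "!!n. is_mollifier (\<epsilon> n) (m n)" "!!n. \<epsilon> n <= inverse (real (Suc n))"
  "!!n. (NI x. norm (mollify (m n) w x - w x)) <= ennreal ((1 / 2) ^ n)"
proof -
 have "\<exists>\<epsilon> m. is_mollifier \<epsilon> m \<and> \<epsilon> <= inverse (real (Suc n)) \<and> (NI x. norm (mollify m w x - w x)) <= ennreal ((1 / 2) ^ n)" for n
 proof -
  define \<delta> :: real where "\<delta> = (1 / 2) ^ n / 3"
  have \<delta>: "\<delta> > 0" by (simp add: \<delta>_def)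
  have "\<exists>\<epsilon>0>0. \<forall>\<epsilon> m. \<epsilon> <= \<epsilon>0 --> is_mollifier \<epsilon> m -->
   (NI x. norm (conv (%x. complex_of_real (m x)) (%x. w x $ i) x - w x $ i)) <= ennreal \<delta>" for i
   by (rule conv_L1_approx[OF integrable_nth[OF w(1)] _ \<delta>, of R]) (simp add: w(2))
  then have "\<forall>i. \<exists>\<epsilon>0>0. \<forall>\<epsilon> m. \<epsilon> <= \<epsilon>0 --> is_mollifier \<epsilon> m -->
   (NI x. norm (conv (%x. complex_of_real (m x)) (%x. w x $ i) x - w x $ i)) <= ennreal \<delta>" by blast
  from choice[OF this] obtain e where e: "!!i. e i > 0" "!!i \<epsilon> m. \<epsilon> <= e i ==> is_mollifier \<epsilon> m ==>
   (NI x. norm (conv (%x. complex_of_real (m x)) (%x. w x $ i) x - w x $ i)) <= ennreal \<delta>"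
   by blast
  define \<epsilon> where "\<epsilon> = min (inverse (real (Suc n))) (min (e 1) (min (e 2) (e 3)))"
  have \<epsilon>: "\<epsilon> > 0" "\<epsilon> <= inverse (real (Suc n))" using e(1) by (auto simp: \<epsilon>_def)
  have ei: "\<epsilon> <= e i" for i using exhaust_3[of i] by (auto simp: \<epsilon>_def min_le_iff_disj)
  obtain m where m: "is_mollifier \<epsilon> m" using mollifier_exists[OF \<epsilon>(1)] by blast
  interpret mollifier \<epsilon> m by unfold_locales (rule m)
  have [measurable]: "w \<in> borel_measurable borel" using w(1) by auto
  have cm': "(%x. conv cm (%x. w x $ i) x) \<in> borel_measurable borel" for i
   using borel_measurable_continuous_onI[OF continuous_conv[OF integrable_nth[OF w(1)]]] by simp
  have wm: "(%x. w x $ i) \<in> borel_measurable borel" for i using integrable_nth[OF w(1), of i] by auto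
  have "(NI x. norm (mollify m w x - w x)) <= (NI x. (\<Sum>i\<in>UNIV. ennreal (norm (conv cm (%x. w x $ i) x - w x $ i))))"
  proof (rule nn_integral_mono)
   fix x
   have "norm (mollify m w x - w x) <= (\<Sum>i\<in>UNIV. norm ((mollify m w x - w x) $ i))" unfolding norm_vec_def by (rule L2_set_le_sum) simp
   then show "ennreal (norm (mollify m w x - w x)) <= (\<Sum>i\<in>UNIV. ennreal (norm (conv cm (%x. w x $ i) x - w x $ i)))"
    by (simp add: mollify_def ennreal_leI)
  qed
  also have "\<dots> = (\<Sum>i\<in>UNIV. NI x. ennreal (norm (conv cm (%x. w x $ i) x - w x $ i)))"
   by (rule nn_integral_sum) (use cm' wm in measurable)
  also have "\<dots> <= (\<Sum>i\<in>(UNIV :: 3 set). ennreal \<delta>)" by (intro sum_mono e(2)[OF ei m])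
  also have "\<dots> = ennreal ((1 / 2) ^ n)"
   using \<delta> by (subst sum_ennreal) (auto simp: \<delta>_def)
  finally show ?thesis using m \<epsilon>(2) by blast
 qed
 then have "\<forall>n. \<exists>\<epsilon> m. is_mollifier \<epsilon> m \<and> \<epsilon> <= inverse (real (Suc n)) \<and> (NI x. norm (mollify m w x - w x)) <= ennreal ((1 / 2) ^ n)" by blast
 from choice[OF this] obtain \<epsilon> where "\<forall>n. \<exists>m. is_mollifier (\<epsilon> n) m \<and> \<epsilon> n <= inverse (real (Suc n)) \<and> (NI x. norm (mollify m w x - w x)) <= ennreal ((1 / 2) ^ n)" ..
 from choice[OF this] obtain m where "\<forall>n. is_mollifier (\<epsilon> n) (m n) \<and> \<epsilon> n <= inverse (real (Suc n)) \<and> (NI x. norm (mollify (m n) w x - w x)) <= ennreal ((1 / 2) ^ n)" ..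
 then show thesis by (intro that[of \<epsilon> m]) blast+
qed

lemma suminf_half_power: "(\<Sum>n. ennreal ((1 / 2) ^ n)) = 2"
proof -
 have "(%n. (1 / 2 :: real) ^ n) sums 2" using geometric_sums[of "1 / 2 :: real"] by simp
 then have "(\<Sum>n. ennreal ((1 / 2) ^ n)) = ennreal 2" by (intro suminf_ennreal_eq) auto
 then show ?thesis unfolding ennreal_numeral .
qed

text \<open>By Lindelof countably many of the balls cover V, and their exceptional null sets unite
  to a null set.\<close>

lemma AE_local:
 fixes V :: "'a::euclidean_space set"
 assumes "!!a. a \<in> V ==> \<exists>\<rho>>0. AE x in lborel. x \<in> ball a \<rho> --> Q x"
 shows "AE x in lborel. x \<in> V --> Q x"
proof -
 have "\<forall>a\<in>V. \<exists>\<rho>>0. AE x in lborel. x \<in> ball a \<rho> --> Q x" using assms by blast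
 from bchoice[OF this] obtain \<rho> where \<rho>: "!!a. a \<in> V ==> \<rho> a > 0" "!!a. a \<in> V ==> AE x in lborel. x \<in> ball a (\<rho> a) --> Q x"
  by blast
 have "open S" if "S \<in> (%a. ball a (\<rho> a)) ` V" for S using that by auto
 from Lindelof[OF this] obtain \<F> where F: "\<F> \<subseteq> (%a. ball a (\<rho> a)) ` V" "countable \<F>" "\<Union>\<F> = (\<Union>a\<in>V. ball a (\<rho> a))"
  by blast
 have "\<forall>B\<in>\<F>. AE x in lborel. x \<in> B --> Q x" using F(1) \<rho>(2) by blast
 then have "AE x in lborel. \<forall>B\<in>\<F>. x \<in> B --> Q x" by (simp only: AE_ball_countable[OF F(2)])
 then show ?thesis
 proof eventually_elim
  case (elim x)
  show ?case
  proof
   assume "x \<in> V"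
   then have "x \<in> \<Union>\<F>" using \<rho>(1) unfolding F(3) by force
   then show "Q x" using elim by blast
  qed
 qed
qed

text \<open>A nonempty open set is not null. For a Q that does not depend on the point, this turns
  an almost everywhere statement into a plain one.\<close>

lemma AE_open_ex:
 fixes U :: "'a::euclidean_space set"
 assumes "open U" "U ~= {}" "AE x in lborel. x \<in> U --> Q x"
 shows "\<exists>x\<in>U. Q x"
proof (rule ccontr)
 assume "\<not> (\<exists>x\<in>U. Q x)"
 with assms(3) have "AE x in lborel. x \<notin> U" by auto
 then have "U \<in> null_sets lborel" using assms(1) by (subst (asm) AE_iff_null_sets[symmetric]) auto
 then have "negligible U" using negligible_iff_null_sets null_sets_completionI by blast
 then show False using open_not_negligible[OF assms(1,2)] by blast
qed

lemma mollify_AE: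
 assumes "!!n. (NI x. norm (W n x - w x)) <= ennreal ((1 / 2) ^ n)"
  and [measurable]: "!!n. W n \<in> borel_measurable borel" "w \<in> borel_measurable borel"
 shows "(NI x. (\<Sum>n. ennreal (norm (W n x - w x)))) <= 2"
  and "AE x in lborel. (%n. W n x) \<longlonglongrightarrow> (w x :: complex^3)"
proof -
 have "(NI x. (\<Sum>n. ennreal (norm (W n x - w x)))) = (\<Sum>n. NI x. norm (W n x - w x))"
  by (rule nn_integral_suminf) measurable
 also have "\<dots> <= (\<Sum>n. ennreal ((1 / 2) ^ n))" using assms(1) by (intro suminf_le) auto
 finally show le: "(NI x. (\<Sum>n. ennreal (norm (W n x - w x)))) <= 2" by (simp add: suminf_half_power)
 have "AE x in lborel. (\<Sum>n. ennreal (norm (W n x - w x))) ~= \<infinity>"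
  by (rule nn_integral_PInf_AE) (use le in \<open>auto simp: top_unique\<close>)
 then show "AE x in lborel. (%n. W n x) \<longlonglongrightarrow> w x"
 proof eventually_elim
  case (elim x)
  then have "summable (%n. norm (W n x - w x))" by (intro summable_suminf_not_top) auto
  from summable_LIMSEQ_zero[OF this] have "(%n. W n x - w x) \<longlonglongrightarrow> 0" by (rule tendsto_norm_zero_cancel)
  then show ?case by (simp add: LIM_zero_iff)
 qed
qed

lemma mollify_scalar_sequence:
 assumes f: "integrable lborel f" "!!x. norm x >= R ==> f x = 0"
 obtains \<epsilon> m where "!!n. is_mollifier (\<epsilon> n) (m n)" "!!n. \<epsilon> n <= inverse (real (Suc n))"
  "AE x in lborel. (%n. conv (%x. complex_of_real (m n x)) f x) \<longlonglongrightarrow> f x"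
proof -
 \<comment> \<open>The scalar becomes a field with three equal components, to which the result for
   fields applies.\<close>
 define w :: "real^3 => complex^3" where "w x = (\<chi> i. f x)" for x
 have "bounded_linear (%z :: complex. (\<chi> i. z) :: complex^3)"
  by (intro linear_conv_bounded_linear[THEN iffD1] linearI) (auto simp: vec_eq_iff)
 from integrable_bounded_linear[OF this f(1)] have wi: "integrable lborel w" by (simp add: w_def[abs_def])
 have wR: "w x = 0" if "norm x >= R" for x using f(2)[OF that] by (simp add: w_def vec_eq_iff)
 obtain \<epsilon> m where m: "!!n. is_mollifier (\<epsilon> n) (m n)" "!!n. \<epsilon> n <= inverse (real (Suc n))"
  "!!n. (NI x. norm (mollify (m n) w x - w x)) <= ennreal ((1 / 2) ^ n)"
  using mollify_sequence[OF wi wR] by blast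
 have "mollify (m n) w \<in> borel_measurable borel" for n
 proof -
  interpret mollifier "\<epsilon> n" "m n" by unfold_locales (rule m)
  have "continuous_on UNIV (mollify (m n) w)"
   unfolding continuous_on_vec_nth_iff using Ck_mollify[OF wi, of 0] by simp
  then show ?thesis by (rule borel_measurable_continuous_onI)
 qed
 moreover have "w \<in> borel_measurable borel" using wi by auto
 ultimately have "AE x in lborel. (%n. mollify (m n) w x) \<longlonglongrightarrow> w x" using mollify_AE(2)[OF m(3)] by blast
 then have "AE x in lborel. (%n. conv (%x. complex_of_real (m n x)) f x) \<longlonglongrightarrow> f x"
 proof eventually_elim
  case (elim x)
  from tendsto_vec_nth[OF this, of 1] show ?case by (simp add: mollify_def w_def)
 qed
 with m that show thesis by blast
qed

lemma eventually_cball_subset: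
 assumes "open V" "x \<in> V" "!!n. \<epsilon> n <= inverse (real (Suc n))"
 shows "\<forall>\<^sub>F n in sequentially. cball x (\<epsilon> n) \<subseteq> V"
proof -
 obtain e where e: "e > 0" "cball x e \<subseteq> V" using assms(1,2) open_contains_cball by blast
 have "\<forall>\<^sub>F n in sequentially. inverse (real (Suc n)) < e"
  using order_tendstoD(2)[OF LIMSEQ_inverse_real_of_nat e(1)] .
 then show ?thesis
 proof eventually_elim
  case (elim n)
  then have "cball x (\<epsilon> n) \<subseteq> cball x e" using assms(3)[of n] by (intro subset_cball) simp
  with e show ?case by blast
 qed
qed

text \<open>At a point of V the mollifications are pairings with test functions once the radius is
  small, hence 0, and they converge to f almost everywhere.\<close>

lemma fundamental_lemma:
 assumes V: "open V" and f: "integrable lborel f" "!!x. norm x >= R ==> f x = 0"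
  and orth: "!!\<phi>. \<phi> \<in> test_functions V ==> (LI x. f x * \<phi> x) = 0"
 shows "AE x in lborel. x \<in> V --> f x = 0"
proof -
 obtain \<epsilon> m where m: "!!n. is_mollifier (\<epsilon> n) (m n)" "!!n. \<epsilon> n <= inverse (real (Suc n))"
  "AE x in lborel. (%n. conv (%x. complex_of_real (m n x)) f x) \<longlonglongrightarrow> f x"
  using mollify_scalar_sequence[OF f] by blast
 from m(3) show ?thesis
 proof eventually_elim
  case (elim x)
  show ?case
  proof
   assume "x \<in> V"
   from eventually_cball_subset[OF V this, of \<epsilon>, OF m(2)]
   have "\<forall>\<^sub>F n in sequentially. conv (%x. complex_of_real (m n x)) f x = 0"
   proof eventually_elim
    case (elim n)
    interpret mollifier "\<epsilon> n" "m n" by unfold_locales (rule m)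
    show ?case by (rule conv_orthogonal[OF orth elim])
   qed
   then show "f x = 0" using elim tendsto_unique[OF _ elim tendsto_eventually] by auto
  qed
 qed
qed

section \<open>Weak gradients of locally integrable functions\<close>

definition loc_integrable :: "(real^3) set => (real^3 => complex) => bool" where
 "loc_integrable V p \<longleftrightarrow> p \<in> borel_measurable borel \<and> (\<forall>a\<in>V. \<exists>\<rho>>0. integrable lborel (%x. indicator (ball a \<rho>) x *\<^sub>R p x))"

lemma loc_integrable_subset: "loc_integrable V p ==> W \<subseteq> V ==> loc_integrable W p"
 by (auto simp: loc_integrable_def)

lemma integrable_indicator_scaleR:
 fixes p :: "real^3 => 'b::{banach, second_countable_topology}"
 assumes "integrable lborel (%x. indicator B x *\<^sub>R p x)" "A \<subseteq> B" "A \<in> sets borel"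
 shows "integrable lborel (%x. indicator A x *\<^sub>R p x)"
proof -
 have "integrable lborel (%x. indicator A x *\<^sub>R (indicator B x *\<^sub>R p x))"
  by (rule integrable_mult_indicator[OF _ assms(1)]) (use assms(3) in simp)
 moreover have "(%x. indicator A x *\<^sub>R (indicator B x *\<^sub>R p x)) = (%x. indicator A x *\<^sub>R p x)"
  using assms(2) by (auto simp: indicator_def fun_eq_iff)
 ultimately show ?thesis by (simp only:)
qed

lemma integrable_imp_loc_integrable:
 assumes "integrable lborel p" shows "loc_integrable V p"
 unfolding loc_integrable_def
proof (intro conjI ballI exI[of _ "1::real"])
 fix a show "integrable lborel (%x. indicator (ball a 1) x *\<^sub>R p x)"
  using assms by (intro integrable_mult_indicator) auto
qed (use assms in auto)

lemma loc_integrable_compact: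
 assumes p: "loc_integrable V p" and K: "compact K" "K \<subseteq> V"
 shows "integrable lborel (%x. indicator K x *\<^sub>R p x)"
proof -
 have [measurable]: "p \<in> borel_measurable borel" and
  "\<forall>a\<in>K. \<exists>\<rho>>0. integrable lborel (%x. indicator (ball a \<rho>) x *\<^sub>R p x)"
  using p K(2) unfolding loc_integrable_def by auto
 from bchoice[OF this(2)] obtain \<rho> where \<rho>: "!!a. a \<in> K ==> \<rho> a > 0" "!!a. a \<in> K ==> integrable lborel (%x. indicator (ball a (\<rho> a)) x *\<^sub>R p x)"
  by blast
 have "K \<subseteq> (\<Union>a\<in>K. ball a (\<rho> a))" using \<rho>(1) by fastforce
 then obtain Z where Z: "Z \<subseteq> K" "finite Z" "K \<subseteq> (\<Union>a\<in>Z. ball a (\<rho> a))"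
  using compactE_image[OF K(1), of K "%a. ball a (\<rho> a)"] by blast
 have Km [measurable]: "K \<in> sets borel" using K(1) by (simp add: compact_imp_closed)
 show ?thesis
 proof (rule Bochner_Integration.integrable_bound)
  show "integrable lborel (%x. \<Sum>a\<in>Z. norm (indicator (ball a (\<rho> a)) x *\<^sub>R p x))"
   using \<rho>(2) Z(1) by (intro Bochner_Integration.integrable_sum integrable_norm) auto
  show "AE x in lborel. norm (indicator K x *\<^sub>R p x) <= norm (\<Sum>a\<in>Z. norm (indicator (ball a (\<rho> a)) x *\<^sub>R p x))"
  proof (rule AE_I2)
   fix x
   show "norm (indicator K x *\<^sub>R p x) <= norm (\<Sum>a\<in>Z. norm (indicator (ball a (\<rho> a)) x *\<^sub>R p x))"
   proof (cases "x \<in> K")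
    case True
    then obtain a where a: "a \<in> Z" "x \<in> ball a (\<rho> a)" using Z(3) by blast
    then have "norm (indicator K x *\<^sub>R p x) = norm (indicator (ball a (\<rho> a)) x *\<^sub>R p x)" using True by simp
    also have "\<dots> <= (\<Sum>a\<in>Z. norm (indicator (ball a (\<rho> a)) x *\<^sub>R p x))"
     using Z(2) a(1) by (intro member_le_sum) auto
    finally show ?thesis by simp
   qed simp
  qed
 qed measurable
qed

lemma loc_integrable_mult_test:
 assumes p: "loc_integrable V p" and \<phi>: "\<phi> \<in> test_functions V"
 shows "integrable lborel (%x. p x * \<phi> x)"
proof -
 obtain K where K: "compact K" "K \<subseteq> V" "!!x. x \<notin> K ==> \<phi> x = 0" using \<phi> by (rule test_functionsE) blast
 have "integrable lborel (%x. (indicator K x *\<^sub>R p x) * \<phi> x)"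
  by (rule integrable_mult_test[OF loc_integrable_compact[OF p K(1,2)] \<phi>])
 moreover have "(indicator K x *\<^sub>R p x) * \<phi> x = p x * \<phi> x" for x using K(3)[of x] by (cases "x \<in> K") auto
 ultimately show ?thesis by simp
qed

lemma test_functions_mono: "V \<subseteq> W ==> \<phi> \<in> test_functions V ==> \<phi> \<in> test_functions W"
 unfolding test_functions_def by blast

lemma weak_grad_mono: "weak_grad W p g ==> V \<subseteq> W ==> weak_grad V p g"
 unfolding weak_grad_def using test_functions_mono by blast

text \<open>On a smaller ball the mollifications have zero gradient and are constants
  \<open>F n a\<close>. As they converge almost everywhere, these constants converge, and p equals
  their limit almost everywhere.\<close>

lemma weak_grad_zero_locally_const:
 assumes p: "weak_grad V p (%_. 0)" "loc_integrable V p" and V: "open V" "a \<in> V"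
 shows "\<exists>c. \<exists>\<rho>>0. AE x in lborel. x \<in> ball a \<rho> --> p x = c"
proof -
 have [measurable]: "p \<in> borel_measurable borel" using p by (simp add: loc_integrable_def)
 obtain \<rho>1 where \<rho>1: "\<rho>1 > 0" "integrable lborel (%x. indicator (ball a \<rho>1) x *\<^sub>R p x)" using p(2) V(2) unfolding loc_integrable_def by blast
 obtain \<rho>2 where \<rho>2: "\<rho>2 > 0" "ball a \<rho>2 \<subseteq> V" using V openE by blast
 define r where "r = min \<rho>1 \<rho>2"
 have r: "r > 0" "ball a r \<subseteq> V" using \<rho>1 \<rho>2 subset_ball[of r \<rho>2 a] by (auto simp: r_def)
 define f where "f x = indicator (ball a r) x *\<^sub>R p x" for x
 have fi: "integrable lborel f"
  unfolding f_def[abs_def] by (rule integrable_indicator_scaleR[OF \<rho>1(2)]) (auto simp: r_def subset_ball)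
 have fR: "f x = 0" if "norm x >= norm a + r" for x
  using that norm_triangle_sub[of x a] by (auto simp: f_def indicator_def dist_norm norm_minus_commute)
 obtain \<epsilon> m where m: "!!n. is_mollifier (\<epsilon> n) (m n)" "!!n. \<epsilon> n <= inverse (real (Suc n))"
  "AE x in lborel. (%n. conv (%x. complex_of_real (m n x)) f x) \<longlonglongrightarrow> f x"
  using mollify_scalar_sequence[OF fi fR] by blast
 define F where "F n = conv (%x. complex_of_real (m n x)) f" for n
 have wg: "weak_grad (ball a r) f (%_. 0)"
  unfolding weak_grad_def
 proof (intro ballI allI)
  fix \<phi> i assume \<phi>: "\<phi> \<in> test_functions (ball a r)"
  obtain K where K: "K \<subseteq> ball a r" "!!x. x \<notin> K ==> pderiv3 i \<phi> x = 0"
   using test_functions_pderiv3[OF \<phi>, of i] by (rule test_functionsE) blast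
  have eq: "f x * pderiv3 i \<phi> x = p x * pderiv3 i \<phi> x" for x
   using subsetD[OF K(1), of x] K(2)[of x] by (cases "x \<in> K") (auto simp: f_def)
  show "(LI x. f x * pderiv3 i \<phi> x) = - (LI x. 0 $ i * \<phi> x)"
   unfolding eq using p(1) test_functions_mono[OF r(2) \<phi>] by (simp add: weak_grad_def)
 qed
 have const: "F n x = F n a" if n: "inverse (real (Suc n)) < r / 2" and x: "x \<in> ball a (r / 2)" for n x
 proof (rule has_derivative_zero_unique[OF convex_ball _ x])
  interpret mollifier "\<epsilon> n" "m n" by unfold_locales (rule m)
  show "a \<in> ball a (r / 2)" using r by simp
  fix y assume y: "y \<in> ball a (r / 2)"
  have "cball y (\<epsilon> n) \<subseteq> ball a r"
  proof
   fix z assume "z \<in> cball y (\<epsilon> n)"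
   then have "dist y z < r / 2" "dist a y < r / 2" using y n m(2)[of n] by auto
   then show "z \<in> ball a r" using dist_triangle[of a z y] by simp
  qed
  from pderiv3_conv_weak_grad[OF wg fi this] have z: "pderiv3 i (F n) y = 0" for i by (simp add: F_def conv_def)
  have "F n differentiable (at y)" unfolding F_def by (rule smooth_differentiable[OF smooth_conv_cm[OF fi]])
  from has_derivative_pderiv3[OF this] z show "(F n has_derivative (%h. 0)) (at y within ball a (r / 2))"
   by (simp add: has_derivative_at_withinI)
 qed
 have "\<forall>\<^sub>F n in sequentially. inverse (real (Suc n)) < r / 2"
  using order_tendstoD(2)[OF LIMSEQ_inverse_real_of_nat, of "r / 2"] r by simp
 then have ev: "\<forall>\<^sub>F n in sequentially. F n x = F n a" if "x \<in> ball a (r / 2)" for x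
  by (rule eventually_mono) (rule const[OF _ that])
 have lim: "AE x in lborel. x \<in> ball a (r / 2) --> (%n. F n a) \<longlonglongrightarrow> p x"
  using m(3)
 proof eventually_elim
  case (elim x)
  show ?case
  proof
   assume x: "x \<in> ball a (r / 2)"
   then have "f x = p x" using r by (simp add: f_def)
   then show "(%n. F n a) \<longlonglongrightarrow> p x" using elim Lim_transform_eventually[OF elim[folded F_def] ev[OF x]] by simp
  qed
 qed
 obtain y where "(%n. F n a) \<longlonglongrightarrow> p y" using AE_open_ex[OF open_ball _ lim] r by auto
 with lim have "AE x in lborel. x \<in> ball a (r / 2) --> p x = p y"
  by (auto elim!: eventually_mono dest: LIMSEQ_unique)
 then show ?thesis using r(1) by (intro exI[of _ "p y"] exI[of _ "r / 2"]) simp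
qed

lemma weak_grad_zero_const:
 assumes p: "weak_grad V p (%_. 0)" "loc_integrable V p" and V: "open V" "connected V"
 shows "\<exists>c. AE x in lborel. x \<in> V --> p x = c"
proof (cases "V = {}")
 case False
 then obtain b where b: "b \<in> V" by blast
 have "\<forall>a\<in>V. \<exists>c. \<exists>\<rho>>0. AE x in lborel. x \<in> ball a \<rho> --> p x = c"
  using weak_grad_zero_locally_const[OF p V(1)] by blast
 from bchoice[OF this] obtain c where "\<forall>a\<in>V. \<exists>\<rho>>0. AE x in lborel. x \<in> ball a \<rho> --> p x = c a" ..
 from bchoice[OF this] obtain \<rho> where c: "!!a. a \<in> V ==> \<rho> a > 0" "!!a. a \<in> V ==> AE x in lborel. x \<in> ball a (\<rho> a) --> p x = c a"
  by blast
 have cc: "c a = c b" if "a \<in> V" for a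
 proof (rule connected_equivalence_relation[OF V(2) that b, where R = "%a b. c a = c b"])
  fix a assume a: "a \<in> V"
  show "\<exists>T. openin (top_of_set V) T \<and> a \<in> T \<and> (\<forall>x\<in>T. c a = c x)"
  proof (intro exI[of _ "V \<inter> ball a (\<rho> a)"] conjI ballI)
   fix x assume x: "x \<in> V \<inter> ball a (\<rho> a)"
   have "AE y in lborel. y \<in> ball a (\<rho> a) \<inter> ball x (\<rho> x) --> c a = c x"
    using c(2)[OF a] c(2)[OF IntD1[OF x]] by eventually_elim auto
   moreover have "x \<in> ball a (\<rho> a) \<inter> ball x (\<rho> x)" using x c(1)[OF IntD1[OF x]] by simp
   ultimately show "c a = c x" using AE_open_ex[of "ball a (\<rho> a) \<inter> ball x (\<rho> x)" "%_. c a = c x"] by blast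
  qed (use a c(1) in auto)
 qed auto
 have "AE x in lborel. x \<in> V --> p x = c b"
 proof (rule AE_local)
  fix a assume a: "a \<in> V"
  then show "\<exists>\<rho>>0. AE x in lborel. x \<in> ball a \<rho> --> p x = c b" using c(1)[OF a] c(2)[OF a] unfolding cc[OF a] by blast
 qed
 then show ?thesis by blast
qed simp

lemma L2field_integrable:
 fixes f :: "real^3 => 'b::euclidean_space"
 assumes "L2field f" "bounded V" "!!x. x \<notin> V ==> f x = 0"
 shows "integrable lborel f"
proof -
 obtain R where R: "V \<subseteq> ball 0 R" using bounded_subset_ballD[OF assms(2), of 0] by blast
 show ?thesis
 proof (rule Bochner_Integration.integrable_bound)
  show "integrable lborel (%x. indicator (ball (0 :: real^3) R) x + (norm (f x))\<^sup>2)"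
   using assms(1) emeasure_lborel_ball_finite[of "0 :: real^3" R] by (auto simp: L2field_def)
  show "AE x in lborel. norm (f x) <= norm (indicator (ball 0 R) x + (norm (f x))\<^sup>2)"
  proof (rule AE_I2)
   fix x
   have "2 * norm (f x) <= 1 + (norm (f x))\<^sup>2" using zero_le_power2[of "norm (f x) - 1"] by (simp add: power2_diff)
   moreover have "norm (f x) >= 0" by simp
   ultimately have le: "norm (f x) <= 1 + (norm (f x))\<^sup>2" by linarith
   show "norm (f x) <= norm (indicator (ball 0 R) x + (norm (f x))\<^sup>2)"
    using le assms(3)[of x] R by (cases "x \<in> V") auto
  qed
 qed (use assms(1) in \<open>auto simp: L2field_def\<close>)
qed

lemma ennreal_suminf_finite_LIMSEQ:
 assumes "(\<Sum>n. f n :: ennreal) < \<infinity>"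
 shows "f \<longlonglongrightarrow> 0"
proof -
 have e: "ennreal (enn2real (f n)) = f n" for n using ennreal_suminf_lessD[OF assms] by (simp add: less_top)
 then have "summable (%n. enn2real (f n))" using assms by (intro summable_suminf_not_top) auto
 from summable_LIMSEQ_zero[OF this] have "(%n. ennreal (enn2real (f n))) \<longlonglongrightarrow> ennreal 0" by (rule tendsto_ennrealI)
 then show ?thesis unfolding e by simp
qed

lemma LIMSEQ_ennreal_bound:
 assumes "g \<longlonglongrightarrow> 0" "!!n. ennreal (norm (a n - b)) <= ennreal c * g n"
 shows "a \<longlonglongrightarrow> (b :: 'b::real_normed_vector)"
proof -
 have g: "(%n. ennreal c * g n) \<longlonglongrightarrow> 0" using ennreal_tendsto_cmult[OF ennreal_less_top assms(1), of c] by simp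
 have "(%n. ennreal (norm (a n - b))) \<longlonglongrightarrow> 0"
  by (rule tendsto_sandwich[OF _ _ tendsto_const g]) (use assms(2) in auto)
 then have "(%n. norm (a n - b)) \<longlonglongrightarrow> 0" by (simp add: ennreal_tendsto_0_iff)
 then show ?thesis by (simp add: tendsto_norm_zero_iff LIM_zero_iff)
qed

lemma homotopy_rem_zero:
 assumes "!!i. Ck (Suc 0) (%z. \<phi> z $ i)" "!!t. 0 <= t ==> t < 1 ==> curl \<phi> (y + t *\<^sub>R (x - y)) = 0"
 shows "homotopy_rem \<phi> y x j = 0"
proof -
 have "(NI t. nsq (curl \<phi> (y + t *\<^sub>R (x - y))) * indicator {0..<1::real} t) = (\<integral>\<^sup>+t. 0 \<partial>(lborel :: real measure))"
  by (rule nn_integral_cong) (auto simp: indicator_def assms(2))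
 then have "nsq (homotopy_rem \<phi> y x j) <= 0"
  using homotopy_rem_square_le[OF assms(1), of y x j] by simp
 then show ?thesis by (simp add: ennreal_eq_0_iff)
qed

text \<open>The potential is the line integral of w from a vertex y. As w is only square integrable,
  y is chosen so that for almost every x the segment to x is good: the mollified fields converge
  along it with summable error, and |w|^2 is integrable on it.\<close>

lemma local_potential:
 assumes V: "open V" "bounded V" and r: "r > 0" and star: "!!x y. x \<in> V ==> y \<in> ball c r ==> closed_segment x y \<subseteq> V"
  and w: "L2field w" "integrable lborel w" "!!x. norm x >= R ==> w x = 0" "curl_free V w"
 shows "\<exists>q. L2field q \<and> (\<forall>x. x \<notin> V --> q x = 0) \<and> weak_grad V q w"
proof -
 obtain \<epsilon> m where m: "!!n. is_mollifier (\<epsilon> n) (m n)" "!!n. \<epsilon> n <= inverse (real (Suc n))"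
  "!!n. (NI x. norm (mollify (m n) w x - w x)) <= ennreal ((1 / 2) ^ n)"
  using mollify_sequence[OF w(2,3)] by blast
 define W where "W n = mollify (m n) w" for n
 have WC: "Ck k (%x. W n x $ i)" for n k i
 proof -
  interpret mollifier "\<epsilon> n" "m n" by unfold_locales (rule m)
  show ?thesis unfolding W_def by (rule Ck_mollify[OF w(2)])
 qed
 have Wcurl: "curl (W n) x = 0" if "cball x (\<epsilon> n) \<subseteq> V" for n x
 proof -
  interpret mollifier "\<epsilon> n" "m n" by unfold_locales (rule m)
  show ?thesis unfolding W_def by (rule curl_mollify[OF w(4,2) that])
 qed
 have Wc: "continuous_on UNIV (W n)" for n unfolding continuous_on_vec_nth_iff using WC[of 0] by simp
 have [measurable]: "W n \<in> borel_measurable borel" for n by (rule borel_measurable_continuous_onI[OF Wc])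
 have [measurable]: "w \<in> borel_measurable borel" using w(1) by (simp add: L2field_def)
 have [measurable]: "V \<in> sets borel" using V(1) by simp
 define E where "E n x = ennreal (norm (W n x - w x))" for n x
 have [measurable]: "E n \<in> borel_measurable borel" for n unfolding E_def by measurable
 \<comment> \<open>One function for both demands on the vertex: the summed errors give convergence
   of the line integrals, the square of w the L^2 bound of q.\<close>
 define F where "F x = (\<Sum>n. E n x) + nsq (w x)" for x
 have Fm [measurable]: "F \<in> borel_measurable borel" unfolding F_def by measurable
 have "(NI x. F x) = (NI x. (\<Sum>n. E n x)) + (NI x. nsq (w x))"
  unfolding F_def by (rule nn_integral_add) measurable
 also have "\<dots> <= 2 + ennreal (sqn w)"
  unfolding nn_integral_sqn[OF w(1)] E_def
  by (intro add_mono mollify_AE(1)) (use m(3) in \<open>auto simp: W_def[symmetric]\<close>)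
 finally have "(NI x. F x) < \<infinity>" by (rule le_less_trans) simp
 define D where "D = ball c r"
 have [measurable]: "D \<in> sets borel" by (simp add: D_def)
 define J where "J y x = (NI t. F (y + t *\<^sub>R (x - y)) * indicator {0..<1::real} t)" for y x
 define G where "G y = (NI x. J y x * indicator V x)" for y
 have [measurable]: "G \<in> borel_measurable borel" unfolding G_def J_def by measurable
 have eV: "emeasure lborel V < \<infinity>" using V(2) by (rule emeasure_bounded_finite)
 have eD: "emeasure lborel D < \<infinity>" unfolding D_def by (rule emeasure_lborel_ball_finite)
 have "(NI y. G y * indicator D y) =
   (NI y. NI x. NI t. F (y + t *\<^sub>R (x - y)) * indicator {0..<1::real} t * indicator V x * indicator D y)"
  unfolding G_def J_def by (simp add: nn_integral_multc)
 also have "\<dots> <= 8 * (emeasure lborel V + emeasure lborel D) * (NI x. F x)"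
  by (rule segment_estimate_unweighted) measurable
 also have "\<dots> < \<infinity>" using \<open>(NI x. F x) < \<infinity>\<close> eV eD by (simp add: ennreal_mult_less_top)
 finally have "AE y in lborel. G y * indicator D y ~= \<infinity>" by (intro nn_integral_PInf_AE) auto
 then have "AE y in lborel. y \<in> D --> G y ~= \<infinity>" by (auto elim!: eventually_mono)
 from AE_open_ex[OF _ _ this] obtain y where y: "y \<in> D" "G y ~= \<infinity>" using r by (auto simp: D_def)
 obtain d where d: "d >= 0" "!!x. x \<in> V ==> norm (x - y) <= d"
 proof -
  obtain d where "V \<subseteq> ball y d" using bounded_subset_ballD[OF V(2)] by blast
  then have "norm (x - y) <= max d 0" if "x \<in> V" for x using that by (auto simp: dist_norm norm_minus_commute)
  then show ?thesis by (intro that[of "max d 0"]) auto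
 qed
 have Jy [measurable]: "J y \<in> borel_measurable borel" unfolding J_def by measurable
 have "AE x in lborel. J y x * indicator V x ~= \<infinity>"
  by (rule nn_integral_PInf_AE) (use y(2) in \<open>auto simp: G_def\<close>)
 then have Jfin: "AE x in lborel. x \<in> V --> J y x < \<infinity>" by (auto elim!: eventually_mono simp: less_top)
 define I where "I n x = (NI t. E n (y + t *\<^sub>R (x - y)) * indicator {0..<1::real} t)" for n x
 have [measurable]: "I n \<in> borel_measurable borel" for n unfolding I_def by measurable
 have IJ: "(\<Sum>n. I n x) <= J y x" for x
 proof -
  have "(\<Sum>n. I n x) = (NI t. (\<Sum>n. E n (y + t *\<^sub>R (x - y)) * indicator {0..<1::real} t))"
   unfolding I_def by (rule nn_integral_suminf[symmetric]) measurable
  also have "\<dots> <= J y x" unfolding J_def F_def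
   by (intro nn_integral_mono) (auto simp: indicator_def)
  finally show ?thesis .
 qed
 have In: "I n x <= J y x" for n x using order_trans[OF sum_le_suminf[OF summableI, of "{n}" "%n. I n x"] IJ] by simp
 define g where "g n = (NI x. I n x * indicator V x)" for n
 have "(\<Sum>n. g n) = (NI x. (\<Sum>n. I n x * indicator V x))"
  unfolding g_def by (rule nn_integral_suminf[symmetric]) measurable
 also have "\<dots> <= G y" unfolding G_def using IJ by (intro nn_integral_mono) (auto simp: indicator_def)
 also have "\<dots> < \<infinity>" using y(2) by (simp add: less_top)
 finally have g0: "g \<longlonglongrightarrow> 0" by (rule ennreal_suminf_finite_LIMSEQ)
 define qn where "qn n = line_int (W n) y" for n
 define q where "q x = indicator V x *\<^sub>R line_int w y x" for x
 have qn: "Ck (Suc 0) (qn n)" for n unfolding qn_def by (rule pderiv3_line_int(1)[OF WC])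
 have [measurable]: "line_int w y \<in> borel_measurable borel"
 proof -
  have [measurable]: "cvec \<in> borel_measurable borel"
   by (intro borel_measurable_continuous_onI continuous_on_cvec continuous_on_id)
  show ?thesis unfolding line_int_def uint_def by measurable
 qed
 have qm [measurable]: "q \<in> borel_measurable borel" unfolding q_def by measurable
 \<comment> \<open>For such x the error is integrable along the segment, so the line integral of w
   is a genuine one and not the default value 0.\<close>
 have diff: "ennreal (norm (qn n x - q x)) <= ennreal d * I n x" if x: "x \<in> V" "J y x < \<infinity>" for n x
 proof -
  let ?s = "%t. y + t *\<^sub>R (x - y)"
  have le: "norm (x - y) * norm (W n z - w z) >= norm (cdot (W n z - w z) (cvec (x - y)))" for z
   using norm_cdot_le[of "W n z - w z" "cvec (x - y)"] by (simp add: mult.commute)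
  have fin: "I n x < \<infinity>" using In x(2) by (rule le_less_trans)
  have "integrable lborel (%t. indicator {0..<1} t *\<^sub>R cdot (W n (?s t)) (cvec (x - y)))"
   by (intro uint_integrable continuous_intros continuous_on_line[OF Wc])
  moreover have "integrable lborel (%t. indicator {0..<1} t *\<^sub>R cdot (W n (?s t) - w (?s t)) (cvec (x - y)))"
  proof (rule integrableI_bounded)
   have "(NI t. ennreal (norm (indicator {0..<1} t *\<^sub>R cdot (W n (?s t) - w (?s t)) (cvec (x - y)))))
    <= (NI t. ennreal (norm (x - y)) * (E n (?s t) * indicator {0..<1} t))"
    using le by (intro nn_integral_mono) (auto simp: E_def indicator_def simp flip: ennreal_mult intro!: ennreal_leI)
   also have "\<dots> = ennreal (norm (x - y)) * I n x" unfolding I_def by (rule nn_integral_cmult) measurable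
   also have "\<dots> < \<infinity>" using fin by (simp add: ennreal_mult_less_top)
   finally show "(NI t. ennreal (norm (indicator {0..<1} t *\<^sub>R cdot (W n (?s t) - w (?s t)) (cvec (x - y))))) < \<infinity>" .
  qed measurable
  ultimately have "line_int w y x = line_int (W n) y x - line_int (%z. W n z - w z) y x"
   unfolding line_int_def uint_def by (subst Bochner_Integration.integral_diff[symmetric]) (auto simp: cdot_diff_left scaleR_diff_right)
  then have "qn n x - q x = line_int (%z. W n z - w z) y x" using x(1) by (simp add: qn_def q_def)
  then have "ennreal (norm (qn n x - q x)) <= ennreal (norm (x - y)) * I n x"
   using norm_line_int_le[of "%z. W n z - w z" y x] by (simp add: I_def E_def)
  also have "\<dots> <= ennreal d * I n x" using d(2)[OF x(1)] by (intro mult_right_mono ennreal_leI) auto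
  finally show ?thesis .
 qed
 have qL: "L2field q"
 proof (rule L2fieldI_nn_integral[OF qm])
  have "(NI x. nsq (q x)) <= (NI x. ennreal (d\<^sup>2) * (J y x * indicator V x))"
  proof (rule nn_integral_mono)
   fix x
   show "nsq (q x) <= ennreal (d\<^sup>2) * (J y x * indicator V x)"
   proof (cases "x \<in> V")
    case True
    have "nsq (q x) <= nsq (x - y) *
     (NI t. nsq (w (y + t *\<^sub>R (x - y))) * indicator {0..<1} t)"
     using True norm_line_int_square_le[of w y x] by (simp add: q_def)
    also have "\<dots> <= ennreal (d\<^sup>2) * J y x"
     unfolding J_def F_def using d(2)[OF True]
     by (intro mult_mono ennreal_leI power_mono nn_integral_mono) (auto simp: indicator_def)
    finally show ?thesis using True by simp
   qed (simp add: q_def)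
  qed
  also have "\<dots> = ennreal (d\<^sup>2) * G y" unfolding G_def by (rule nn_integral_cmult) measurable
  also have "\<dots> < \<infinity>" using y(2) by (simp add: ennreal_mult_less_top less_top)
  finally show "(NI x. nsq (q x)) < \<infinity>" .
 qed
 have q0: "q x = 0" if "x \<notin> V" for x using that by (simp add: q_def)
 have qi: "integrable lborel q" by (rule L2field_integrable[OF qL V(2) q0])
 have "weak_grad V q w"
  unfolding weak_grad_def
 proof (intro ballI allI)
  fix \<phi> i assume \<phi>: "\<phi> \<in> test_functions V"
  obtain K where K: "smooth \<phi>" "compact K" "K \<subseteq> V" "!!x. x \<notin> K ==> \<phi> x = 0" using \<phi> by (rule test_functionsE) blast
  define \<theta> where "\<theta> = pderiv3 i \<phi>"
  have \<theta>: "\<theta> \<in> test_functions V" unfolding \<theta>_def by (rule test_functions_pderiv3[OF \<phi>])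
  have \<theta>0: "\<theta> x = 0" if "x \<notin> K" for x
   unfolding \<theta>_def by (rule pderiv3_zero_off_support[OF compact_imp_closed[OF K(2)] _ that]) (rule K(4))
  have c: "continuous_on UNIV \<phi>" "continuous_on UNIV \<theta>"
   using smooth_Ck[OF K(1), of 0] smooth_Ck[OF smooth_pderiv3[OF K(1), of i], of 0] by (simp_all add: \<theta>_def)
  have [measurable]: "\<phi> \<in> borel_measurable borel" "\<theta> \<in> borel_measurable borel" using c by (auto intro: borel_measurable_continuous_onI)
  obtain B1 where B1: "!!x. norm (\<phi> x) <= B1" using bounded_compact_support[OF c(1) K(2,4)] by metis
  obtain B2 where B2: "!!x. norm (\<theta> x) <= B2" using bounded_compact_support[OF c(2) K(2) \<theta>0] by metis
  \<comment> \<open>The segments from y to the support of \<phi> fill a compact subset of V. The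
    mollified fields are curl-free where the ball of radius \<open>\<epsilon> n\<close> lies in V,
    hence on all of \<open>S\<close> for large n.\<close>
  define S where "S = (%(x, t). y + t *\<^sub>R (x - y)) ` (K \<times> {0..1})"
  have "compact S" unfolding S_def
   by (intro compact_continuous_image compact_Times K(2)) (auto simp: case_prod_unfold intro!: continuous_intros)
  moreover have "S \<subseteq> V"
  proof
   fix s assume "s \<in> S"
   then obtain x t where s: "x \<in> K" "0 <= t" "t <= 1" "s = y + t *\<^sub>R (x - y)" by (auto simp: S_def)
   then have "s \<in> closed_segment y x" unfolding closed_segment_def by (auto intro!: exI[of _ t] simp: algebra_simps)
   then show "s \<in> V" using star[of x y] s(1) K(3) y(1) by (auto simp: closed_segment_commute D_def)
  qed
  ultimately obtain e where e: "e > 0" "(\<Union>x\<in>S. cball x e) \<subseteq> V"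
   using compact_subset_open_imp_cball_epsilon_subset V(1) by metis
  have In1: "integrable lborel (%x. qn n x * \<theta> x)" for n
   by (rule integrable_compact_support[OF _ K(2)]) (auto intro!: continuous_intros c Ck_continuous[OF qn] simp: \<theta>0)
  have In2: "integrable lborel (%x. W n x $ i * \<phi> x)" for n
   by (rule integrable_compact_support[OF _ K(2)]) (auto intro!: continuous_intros c Ck_continuous[OF WC] simp: K(4))
  have i1: "integrable lborel (%x. q x * \<theta> x)" by (rule integrable_mult_test[OF qi \<theta>])
  have i2: "integrable lborel (%x. w x $ i * \<phi> x)" by (rule integrable_mult_test[OF integrable_nth[OF w(2)] \<phi>])
  have parts: "(LI x. qn n x * \<theta> x) = - (LI x. W n x $ i * \<phi> x)" if n: "inverse (real (Suc n)) < e" for n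
  proof -
   have pd: "pderiv3 i (qn n) x = W n x $ i" if x: "x \<in> K" for x
   proof -
    have "curl (W n) (y + t *\<^sub>R (x - y)) = 0" if t: "0 <= t" "t < 1" for t
    proof (rule Wcurl)
     have "y + t *\<^sub>R (x - y) \<in> S" unfolding S_def using x t by (auto intro!: image_eqI[of _ _ "(x, t)"])
     moreover have "cball (y + t *\<^sub>R (x - y)) (\<epsilon> n) \<subseteq> cball (y + t *\<^sub>R (x - y)) e"
      using n m(2)[of n] by (intro subset_cball) simp
     ultimately show "cball (y + t *\<^sub>R (x - y)) (\<epsilon> n) \<subseteq> V" using e(2) by blast
    qed
    from homotopy_rem_zero[OF WC this] show ?thesis unfolding qn_def pderiv3_line_int(2)[OF WC] by simp
   qed
   have "(LI x. pderiv3 i (%x. qn n x * \<phi> x) x) = 0"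
    by (rule integral_pderiv3_eq_0[OF Ck_mult[OF qn smooth_Ck[OF K(1)]] K(2)]) (simp add: K(4))
   moreover have "pderiv3 i (%x. qn n x * \<phi> x) x = qn n x * \<theta> x + W n x $ i * \<phi> x" for x
    using pd[of x] K(4)[of x] unfolding \<theta>_def
    by (subst pderiv3_mult[OF Ck_differentiable[OF qn] smooth_differentiable[OF K(1)]]) (cases "x \<in> K", auto)
   ultimately show ?thesis using In1[of n] In2[of n] by (simp add: add_eq_0_iff2)
  qed
  have l1: "(%n. LI x. qn n x * \<theta> x) \<longlonglongrightarrow> (LI x. q x * \<theta> x)"
  proof (rule LIMSEQ_ennreal_bound[OF g0, where c = "d * B2"])
   fix n
   have B2p: "B2 >= 0" using B2[of 0] norm_ge_zero order_trans by blast
   have "ennreal (norm ((LI x. qn n x * \<theta> x) - (LI x. q x * \<theta> x))) = ennreal (norm (LI x. qn n x * \<theta> x - q x * \<theta> x))"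
    using In1 i1 by simp
   also have "\<dots> <= (NI x. ennreal (norm (qn n x * \<theta> x - q x * \<theta> x)))"
    using In1 i1 by (intro integral_norm_bound_ennreal) auto
   also have "\<dots> <= (NI x. ennreal (d * B2) * (I n x * indicator V x))"
    using Jfin
   proof (intro nn_integral_mono_AE, eventually_elim)
    case (elim x)
    show ?case
    proof (cases "x \<in> V")
     case True
     have "ennreal (norm (qn n x * \<theta> x - q x * \<theta> x)) = ennreal (norm (qn n x - q x)) * ennreal (norm (\<theta> x))"
      by (simp add: norm_mult ennreal_mult flip: left_diff_distrib)
     also have "\<dots> <= (ennreal d * I n x) * ennreal B2"
      using True elim B2 by (intro mult_mono diff ennreal_leI) auto
     finally show ?thesis using True d(1) B2p by (simp add: ennreal_mult mult_ac)
    next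
     case False
     then have "\<theta> x = 0" using \<theta>0 K(3) by blast
     then show ?thesis by simp
    qed
   qed
   also have "\<dots> = ennreal (d * B2) * g n" unfolding g_def by (rule nn_integral_cmult) measurable
   finally show "ennreal (norm ((LI x. qn n x * \<theta> x) - (LI x. q x * \<theta> x))) <= ennreal (d * B2) * g n" .
  qed
  have l2: "(%n. LI x. W n x $ i * \<phi> x) \<longlonglongrightarrow> (LI x. w x $ i * \<phi> x)"
  proof (rule LIMSEQ_ennreal_bound[where c = B1])
   show "(%n. NI x. E n x) \<longlonglongrightarrow> 0"
   proof (rule ennreal_suminf_finite_LIMSEQ)
    have "(\<Sum>n. NI x. E n x) <= (\<Sum>n. ennreal ((1 / 2) ^ n))"
     using m(3) unfolding E_def W_def by (intro suminf_le) auto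
    also have "\<dots> < \<infinity>" by (simp add: suminf_half_power)
    finally show "(\<Sum>n. NI x. E n x) < \<infinity>" .
   qed
   fix n
   have "ennreal (norm ((LI x. W n x $ i * \<phi> x) - (LI x. w x $ i * \<phi> x))) = ennreal (norm (LI x. W n x $ i * \<phi> x - w x $ i * \<phi> x))"
    using In2 i2 by simp
   also have "\<dots> <= (NI x. ennreal (norm (W n x $ i * \<phi> x - w x $ i * \<phi> x)))"
    using In2 i2 by (intro integral_norm_bound_ennreal) auto
   also have "\<dots> <= (NI x. ennreal B1 * E n x)"
   proof (rule nn_integral_mono)
    fix x
    have "norm (W n x $ i * \<phi> x - w x $ i * \<phi> x) = norm ((W n x - w x) $ i) * norm (\<phi> x)"
     by (simp add: norm_mult flip: left_diff_distrib)
    also have "\<dots> <= norm (W n x - w x) * B1"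
     using B1 by (intro mult_mono Finite_Cartesian_Product.norm_nth_le) auto
    finally show "ennreal (norm (W n x $ i * \<phi> x - w x $ i * \<phi> x)) <= ennreal B1 * E n x"
     using order_trans[OF norm_ge_zero B1[of 0]] ennreal_leI by (simp add: E_def mult.commute[of _ B1] flip: ennreal_mult)
   qed
   also have "\<dots> = ennreal B1 * (NI x. E n x)" by (rule nn_integral_cmult) measurable
   finally show "ennreal (norm ((LI x. W n x $ i * \<phi> x) - (LI x. w x $ i * \<phi> x))) <= ennreal B1 * (NI x. E n x)" .
  qed
  have "\<forall>\<^sub>F n in sequentially. (LI x. qn n x * \<theta> x) = - (LI x. W n x $ i * \<phi> x)"
   using order_tendstoD(2)[OF LIMSEQ_inverse_real_of_nat e(1)] by (rule eventually_mono) (rule parts)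
  from Lim_transform_eventually[OF l1 this] tendsto_minus[OF l2]
  show "(LI x. q x * pderiv3 i \<phi> x) = - (LI x. w x $ i * \<phi> x)"
   unfolding \<theta>_def by (rule LIMSEQ_unique)
 qed
 with qL q0 show ?thesis by blast
qed

lemma pderiv3_sum:
 assumes "finite Y" "!!z. z \<in> Y ==> smooth (f z)"
 shows "smooth (%x. \<Sum>z\<in>Y. f z x) \<and> (\<forall>x. pderiv3 i (%x. \<Sum>z\<in>Y. f z x) x = (\<Sum>z\<in>Y. pderiv3 i (f z) x))"
 using assms
proof (induction Y)
 case (insert z Y)
 then have "smooth (f z)" "smooth (%x. \<Sum>z\<in>Y. f z x)" by auto
 then show ?case using insert by (simp add: smooth_add pderiv3_add smooth_differentiable)
qed (simp add: smooth_const)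

lemma curl_free_mono:
 assumes "curl_free W g" "V \<subseteq> W" shows "curl_free V g"
proof -
 have "componentwise (test_functions V) \<subseteq> componentwise (test_functions W)"
  using test_functions_mono[OF assms(2)] by (auto simp: componentwise_def)
 with assms(1) show ?thesis unfolding curl_free_def by blast
qed

text \<open>A partition of unity on the support of \<phi> splits it into test functions of the small
  balls.\<close>

lemma weak_grad_local:
 assumes loc: "!!a. a \<in> V ==> \<exists>\<rho>>0. weak_grad (ball a \<rho>) p g"
  and p: "loc_integrable V p" and g: "integrable lborel g"
 shows "weak_grad V p g"
 unfolding weak_grad_def
proof (intro ballI allI)
 fix \<phi> i assume \<phi>: "\<phi> \<in> test_functions V"
 obtain K where K: "smooth \<phi>" "compact K" "K \<subseteq> V" "!!x. x \<notin> K ==> \<phi> x = 0" using \<phi> by (rule test_functionsE) blast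
 have "\<forall>a\<in>K. \<exists>\<rho>>0. weak_grad (ball a \<rho>) p g" using loc K(3) by blast
 from bchoice[OF this] obtain \<rho> where \<rho>: "!!a. a \<in> K ==> \<rho> a > 0" "!!a. a \<in> K ==> weak_grad (ball a (\<rho> a)) p g" by blast
 have "K \<subseteq> (\<Union>a\<in>K. ball a (\<rho> a / 3))" using \<rho>(1) by fastforce
 then obtain Z where Z: "Z \<subseteq> K" "finite Z" "K \<subseteq> (\<Union>a\<in>Z. ball a (\<rho> a / 3))"
  using compactE_image[OF K(2), of K "%a. ball a (\<rho> a / 3)"] by blast
 have "\<rho> z / 3 > 0" if "z \<in> Z" for z using \<rho>(1) Z(1) that by auto
 from smooth_partition_of_unity[where a = "%z. \<rho> z / 3", OF Z(2) this] obtain \<zeta> where \<zeta>: "!!z. z \<in> Z ==> smooth (\<zeta> z)"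
  "!!z x. z \<in> Z ==> x \<notin> cball z (2 * (\<rho> z / 3)) ==> \<zeta> z x = 0" "!!x. (\<exists>z\<in>Z. x \<in> ball z (\<rho> z / 3)) ==> (\<Sum>z\<in>Z. \<zeta> z x) = 1"
  by blast
 define \<theta> where "\<theta> z x = \<zeta> z x * \<phi> x" for z x
 have \<theta>V: "\<theta> z \<in> test_functions V" if "z \<in> Z" for z
  unfolding \<theta>_def[abs_def] by (rule test_functions_mult[OF \<phi> \<zeta>(1)[OF that]])
 have \<theta>B: "\<theta> z \<in> test_functions (ball z (\<rho> z))" if z: "z \<in> Z" for z
 proof -
  have "compact (K \<inter> cball z (2 * (\<rho> z / 3)))" using K(2) by (intro compact_Int_closed) auto
  moreover have "K \<inter> cball z (2 * (\<rho> z / 3)) \<subseteq> ball z (\<rho> z)" using \<rho>(1)[of z] z Z(1) by auto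
  moreover have "\<forall>x. x \<notin> K \<inter> cball z (2 * (\<rho> z / 3)) --> \<theta> z x = 0" using K(4) \<zeta>(2)[OF z] by (auto simp: \<theta>_def)
  moreover have "smooth (\<theta> z)" using \<theta>V[OF z] by (simp add: test_functions_def)
  ultimately show ?thesis unfolding test_functions_def by blast
 qed
 have sum: "\<phi> = (%x. \<Sum>z\<in>Z. \<theta> z x)"
 proof
  fix x show "\<phi> x = (\<Sum>z\<in>Z. \<theta> z x)"
  proof (cases "x \<in> K")
   case True
   then have "(\<Sum>z\<in>Z. \<zeta> z x) = 1" using Z(3) by (intro \<zeta>(3)) blast
   then show ?thesis by (simp add: \<theta>_def flip: sum_distrib_right)
  qed (simp add: \<theta>_def K(4))
 qed
 have "pderiv3 i (%x. \<Sum>z\<in>Z. \<theta> z x) x = (\<Sum>z\<in>Z. pderiv3 i (\<theta> z) x)" for x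
  using pderiv3_sum[OF Z(2), of \<theta> i] \<theta>V by (auto simp: test_functions_def)
 then have "pderiv3 i \<phi> x = (\<Sum>z\<in>Z. pderiv3 i (\<theta> z) x)" for x by (simp only: sum[symmetric])
 then have "(LI x. p x * pderiv3 i \<phi> x) = (\<Sum>z\<in>Z. LI x. p x * pderiv3 i (\<theta> z) x)"
  using loc_integrable_mult_test[OF p test_functions_pderiv3[OF \<theta>V]] by (simp add: sum_distrib_left)
 also have "\<dots> = (\<Sum>z\<in>Z. - (LI x. g x $ i * \<theta> z x))"
  by (intro sum.cong refl) (use \<rho>(2) \<theta>B Z(1) in \<open>unfold weak_grad_def, blast\<close>)
 also have "\<dots> = - (LI x. (\<Sum>z\<in>Z. g x $ i * \<theta> z x))"
  using integrable_mult_test[OF integrable_nth[OF g] \<theta>V] by (simp add: sum_negf)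
 also have "\<dots> = - (LI x. g x $ i * \<phi> x)"
  by (simp only: sum_distrib_left[symmetric] sum[THEN fun_cong, symmetric])
 finally show "(LI x. p x * pderiv3 i \<phi> x) = - (LI x. g x $ i * \<phi> x)" .
qed

lemma weak_grad_diff:
 assumes "weak_grad V p g" "weak_grad V q g" "loc_integrable V p" "loc_integrable V q"
 shows "weak_grad V (%x. p x - q x) (%_. 0)"
 unfolding weak_grad_def
proof (intro ballI allI)
 fix \<phi> i assume \<phi>: "\<phi> \<in> test_functions V"
 have "(LI x. (p x - q x) * pderiv3 i \<phi> x) = (LI x. p x * pderiv3 i \<phi> x) - (LI x. q x * pderiv3 i \<phi> x)"
  unfolding left_diff_distrib
  by (rule Bochner_Integration.integral_diff) (intro loc_integrable_mult_test[OF _ test_functions_pderiv3[OF \<phi>]] assms)+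
 then show "(LI x. (p x - q x) * pderiv3 i \<phi> x) = - (LI x. 0 $ i * \<phi> x)"
  using assms(1,2) \<phi> by (simp add: weak_grad_def)
qed

lemma weak_grad_diff_const:
 assumes "weak_grad V p g" "loc_integrable V p"
 shows "weak_grad V (%x. p x - c) g"
 unfolding weak_grad_def
proof (intro ballI allI)
 fix \<phi> i assume \<phi>: "\<phi> \<in> test_functions V"
 obtain K where K: "smooth \<phi>" "compact K" "K \<subseteq> V" "!!x. x \<notin> K ==> \<phi> x = 0" using \<phi> by (rule test_functionsE) blast
 have "integrable lborel (pderiv3 i \<phi>)"
 proof (rule integrable_compact_support[OF _ K(2)])
  show "continuous_on UNIV (pderiv3 i \<phi>)" using smooth_Ck[OF smooth_pderiv3[OF K(1)], of 0] by simp
  show "pderiv3 i \<phi> x = 0" if "x \<notin> K" for x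
   by (rule pderiv3_zero_off_support[OF compact_imp_closed[OF K(2)] _ that]) (rule K(4))
 qed
 moreover have "(LI x. pderiv3 i \<phi> x) = 0" by (rule integral_pderiv3_eq_0[OF smooth_Ck[OF K(1)] K(2,4)])
 ultimately have "(LI x. (p x - c) * pderiv3 i \<phi> x) = (LI x. p x * pderiv3 i \<phi> x)"
  unfolding left_diff_distrib using loc_integrable_mult_test[OF assms(2) test_functions_pderiv3[OF \<phi>, of i]] by simp
 then show "(LI x. (p x - c) * pderiv3 i \<phi> x) = - (LI x. g x $ i * \<phi> x)"
  using assms(1) \<phi> by (simp add: weak_grad_def)
qed

lemma weak_grad_cong_AE:
 assumes "weak_grad V q g" "AE x in lborel. x \<in> V --> p x = q x" "p \<in> borel_measurable borel" "q \<in> borel_measurable borel"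
 shows "weak_grad V p g"
 unfolding weak_grad_def
proof (intro ballI allI)
 fix \<phi> i assume \<phi>: "\<phi> \<in> test_functions V"
 obtain K where K: "smooth (pderiv3 i \<phi>)" "K \<subseteq> V" "!!x. x \<notin> K ==> pderiv3 i \<phi> x = 0"
  using test_functions_pderiv3[OF \<phi>] by (rule test_functionsE) blast
 have m: "pderiv3 i \<phi> \<in> borel_measurable borel" using smooth_Ck[OF K(1), of 0] by (simp add: borel_measurable_continuous_onI)
 have "(LI x. p x * pderiv3 i \<phi> x) = (LI x. q x * pderiv3 i \<phi> x)"
 proof (rule integral_cong_AE)
  show "AE x in lborel. p x * pderiv3 i \<phi> x = q x * pderiv3 i \<phi> x"
   using assms(2)
  proof eventually_elim
   case (elim x) then show ?case using K(2) K(3)[of x] by (cases "x \<in> K") auto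
  qed
 qed (use assms(3,4) m in measurable)
 then show "(LI x. p x * pderiv3 i \<phi> x) = - (LI x. g x $ i * \<phi> x)"
  using assms(1) \<phi> by (simp add: weak_grad_def)
qed

lemma loc_integrable_diff:
 assumes "loc_integrable V p" "integrable lborel q"
 shows "loc_integrable V (%x. p x - q x)"
 unfolding loc_integrable_def
proof (intro conjI ballI)
 fix a assume "a \<in> V"
 then obtain \<rho> where \<rho>: "\<rho> > 0" "integrable lborel (%x. indicator (ball a \<rho>) x *\<^sub>R p x)" using assms(1) unfolding loc_integrable_def by blast
 have "integrable lborel (%x. indicator (ball a \<rho>) x *\<^sub>R q x)" by (rule integrable_mult_indicator[OF _ assms(2)]) simp
 then have "integrable lborel (%x. indicator (ball a \<rho>) x *\<^sub>R (p x - q x))"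
  unfolding scaleR_diff_right by (rule Bochner_Integration.integrable_diff[OF \<rho>(2)])
 with \<rho>(1) show "\<exists>\<rho>>0. integrable lborel (%x. indicator (ball a \<rho>) x *\<^sub>R (p x - q x))" by blast
qed (use assms in \<open>auto simp: loc_integrable_def\<close>)

text \<open>The segments from U to the ball of vertices may leave U. Their union, with the ball, is
  open, star-shaped with respect to every point of the ball, and still inside S.\<close>

lemma star_region:
 fixes U S :: "'a::euclidean_space set"
 assumes U: "open U" "U ~= {}" and r: "r > 0" and seg: "!!x y. x \<in> U ==> y \<in> ball c r ==> closed_segment x y \<subseteq> S"
 obtains V where "open V" "connected V" "U \<subseteq> V" "V \<subseteq> S" "!!x y. x \<in> V ==> y \<in> ball c r ==> closed_segment x y \<subseteq> V"
proof -
 \<comment> \<open>t = 1 is left out so that each map x -> t y + (1 - t) x is open; the endpoints y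
   are supplied by the ball itself.\<close>
 define V where "V = ball c r \<union> (\<Union>y\<in>ball c r. \<Union>t\<in>{0..<1}. (%x. t *\<^sub>R y + (1 - t) *\<^sub>R x) ` U)"
 have VI: "t *\<^sub>R y + (1 - t) *\<^sub>R x \<in> V" if "x \<in> U" "y \<in> ball c r" "0 <= t" "t <= 1" for x y t
 proof (cases "t = 1")
  case False
  then show ?thesis unfolding V_def using that by (intro UnI2) force
 qed (use that in \<open>simp add: V_def\<close>)
 have star: "closed_segment v y \<subseteq> V" if v: "v \<in> V" and y: "y \<in> ball c r" for v y
 proof (cases "v \<in> ball c r")
  case True
  then have "closed_segment v y \<subseteq> ball c r" using y by (intro closed_segment_subset) auto
  then show ?thesis by (auto simp: V_def)
 next
  case False
  then obtain x y' t where x: "x \<in> U" "y' \<in> ball c r" "0 <= t" "t < 1" "v = t *\<^sub>R y' + (1 - t) *\<^sub>R x"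
   using v unfolding V_def by auto
  show ?thesis
  proof
   fix z assume "z \<in> closed_segment v y"
   then obtain s where s: "0 <= s" "s <= 1" "z = (1 - s) *\<^sub>R v + s *\<^sub>R y" by (auto simp: closed_segment_def)
   \<comment> \<open>A point of the segment from v to y is a convex combination of x, y' and y. The
     total weight of y' and y is \<tau>; by convexity they merge into one point \<open>y''\<close>
     of the ball.\<close>
   define \<tau> where "\<tau> = s + (1 - s) * t"
   have "0 <= (1 - s) * t" using s(2) x(3) by simp
   then have \<tau>: "0 <= \<tau>" "1 - \<tau> = (1 - s) * (1 - t)" using s(1) by (simp_all add: \<tau>_def left_diff_distrib right_diff_distrib)
   have \<tau>1: "\<tau> <= 1" using s(1,2) x(3,4) mult_nonneg_nonneg[of "1 - s" "1 - t"] \<tau>(2) by linarith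
   have z: "z = (((1 - s) * t) *\<^sub>R y' + s *\<^sub>R y) + (1 - \<tau>) *\<^sub>R x"
    unfolding s(3) x(5) \<tau>(2) by (simp add: algebra_simps)
   show "z \<in> V"
   proof (cases "\<tau> = 0")
    case True
    then have "s = 0" "(1 - s) * t = 0" using s x mult_nonneg_nonneg[of "1 - s" t] by (auto simp: \<tau>_def add_nonneg_eq_0_iff)
    then have "z = 0 *\<^sub>R y' + (1 - 0) *\<^sub>R x" using z True by simp
    then show ?thesis using VI[OF x(1,2), of 0] by simp
   next
    case False
    define y'' where "y'' = ((1 - s) * t / \<tau>) *\<^sub>R y' + (s / \<tau>) *\<^sub>R y"
    have "(1 - s) * t / \<tau> + s / \<tau> = 1"
     using False by (simp add: \<tau>_def add.commute flip: add_divide_distrib)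
    then have "y'' \<in> ball c r"
     unfolding y''_def using s(1) x(2) y \<tau>(1) \<open>0 <= (1 - s) * t\<close>
     by (intro convexD[OF convex_ball]) (simp_all add: divide_nonneg_nonneg)
    moreover have "\<tau> *\<^sub>R y'' = ((1 - s) * t) *\<^sub>R y' + s *\<^sub>R y"
     unfolding y''_def using False by (simp add: scaleR_add_right)
    ultimately show ?thesis using VI[OF x(1) _ \<tau>(1) \<tau>1, of y''] z by simp
   qed
  qed
 qed
 have cV: "c \<in> ball c r" "ball c r \<subseteq> V" using r by (auto simp: V_def)
 show thesis
 proof (rule that[of V])
  show "open V" unfolding V_def
   using open_affinity[OF U(1)] by (intro open_Un open_UN ballI) auto
  have "starlike V" unfolding starlike_def using star cV by (intro bexI[of _ c]) (auto simp: closed_segment_commute)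
  then show "connected V" by (rule starlike_imp_connected)
  show "U \<subseteq> V" using VI[of _ c 0] cV by auto
  show "V \<subseteq> S"
  proof
   fix v assume "v \<in> V"
   then consider "v \<in> ball c r" | x y t where "x \<in> U" "y \<in> ball c r" "0 <= t" "t <= 1" "v = t *\<^sub>R y + (1 - t) *\<^sub>R x"
    unfolding V_def by force
   then show "v \<in> S"
   proof cases
    case 1
    obtain x where "x \<in> U" using U(2) by blast
    from seg[OF this 1] show ?thesis by auto
   next
    case (2 x y t)
    then have "v \<in> closed_segment x y" by (auto simp: closed_segment_def intro!: exI[of _ t])
    then show ?thesis using seg[OF 2(1,2)] by blast
   qed
  qed
 qed (rule star)
qed

text \<open>Potentials are determined only up to null sets, so the cocycle is indexed by the centres
  of the balls, and the gluing runs over a countable subfamily. Near the boundary p differs by a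
  constant from a square integrable potential on a star-shaped region.\<close>

theorem curl_free_imp_gradient:
 assumes \<Omega>: "open \<Omega>" "bounded \<Omega>" "\<Omega> ~= {}" "simply_connected \<Omega>" "lipschitz_boundary \<Omega>"
  and w: "L2field w" "!!x. x \<notin> \<Omega> ==> w x = 0" "curl_free \<Omega> w"
 shows "\<exists>p. L2field p \<and> (\<forall>x. x \<notin> \<Omega> --> p x = 0) \<and> weak_grad \<Omega> p w"
proof -
 have wi: "integrable lborel w" by (rule L2field_integrable[OF w(1) \<Omega>(2) w(2)])
 obtain R where R: "\<Omega> \<subseteq> ball 0 R" using bounded_subset_ballD[OF \<Omega>(2), of 0] by blast
 have wR: "w x = 0" if "norm x >= R" for x using that R by (intro w(2)) auto
 define d where "d a = infdist a (- \<Omega>)" for a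
 have ne: "- \<Omega> ~= {}" using \<Omega>(2) not_bounded_UNIV by (metis Compl_empty_eq double_complement)
 have dpos: "d a > 0" if "a \<in> \<Omega>" for a
  unfolding d_def using \<Omega>(1) ne that by (intro infdist_pos_not_in_closed) auto
 have dsub: "ball a (d a) \<subseteq> \<Omega>" for a
 proof
  fix x assume "x \<in> ball a (d a)"
  then show "x \<in> \<Omega>" using infdist_le[of x "- \<Omega>" a] by (auto simp: d_def)
 qed
 have dlip: "d a <= d b + dist a b" for a b unfolding d_def by (rule infdist_triangle)
 have "\<forall>a\<in>\<Omega>. \<exists>q. L2field q \<and> (\<forall>x. x \<notin> ball a (d a) --> q x = 0) \<and> weak_grad (ball a (d a)) q w"
 proof
  fix a assume a: "a \<in> \<Omega>"
  show "\<exists>q. L2field q \<and> (\<forall>x. x \<notin> ball a (d a) --> q x = 0) \<and> weak_grad (ball a (d a)) q w"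
   by (rule local_potential[OF open_ball bounded_ball dpos[OF a] _ w(1) wi wR curl_free_mono[OF w(3) dsub]])
    (intro closed_segment_subset convex_ball)
 qed
 from bchoice[OF this] obtain P where P: "!!a. a \<in> \<Omega> ==> L2field (P a)"
  "!!a x. a \<in> \<Omega> ==> x \<notin> ball a (d a) ==> P a x = 0" "!!a. a \<in> \<Omega> ==> weak_grad (ball a (d a)) (P a) w" by blast
 have Pi: "integrable lborel (P a)" if "a \<in> \<Omega>" for a by (rule L2field_integrable[OF P(1)[OF that] bounded_ball P(2)[OF that]])
 \<comment> \<open>A constant exists because the overlap is convex, hence connected. On an empty
   overlap any value qualifies; the cocycle relation is asserted only for centres whose balls share
   a point.\<close>
 define D where "D a b = (SOME c. AE x in lborel. x \<in> ball a (d a) \<inter> ball b (d b) --> P b x - P a x = c)" for a b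
 have D: "AE x in lborel. x \<in> ball a (d a) \<inter> ball b (d b) --> P b x - P a x = D a b" if ab: "a \<in> \<Omega>" "b \<in> \<Omega>" for a b
 proof -
  let ?I = "ball a (d a) \<inter> ball b (d b)"
  have "weak_grad ?I (%x. P b x - P a x) (%_. 0)"
   by (rule weak_grad_diff[where g = w]; intro weak_grad_mono[OF P(3)] integrable_imp_loc_integrable Pi ab) auto
  moreover have "loc_integrable ?I (%x. P b x - P a x)" using ab by (intro integrable_imp_loc_integrable Bochner_Integration.integrable_diff Pi)
  ultimately have "\<exists>c. AE x in lborel. x \<in> ?I --> P b x - P a x = c"
   by (rule weak_grad_zero_const) (auto intro!: convex_connected convex_Int)
  then show ?thesis unfolding D_def by (rule someI_ex)
 qed
 \<comment> \<open>d is 1-Lipschitz, so a centre a within d z / 2 of z has d a > d z / 2 and its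
   ball contains z. This gives the three balls of the cocycle relation a common point.\<close>
 have near: "a \<in> \<Omega> \<and> z \<in> ball a (d a)" if "a \<in> ball z (d z / 2)" for a z
 proof
  show "a \<in> \<Omega>" using that dsub[of z] zero_le_dist[of z a] by (auto simp del: zero_le_dist)
  show "z \<in> ball a (d a)" using that dlip[of z a] by (auto simp: dist_commute)
 qed
 interpret local_cocycle \<Omega> "%z. d z / 2" D
 proof
  show "d z / 2 > 0" if "z \<in> \<Omega>" for z using dpos[OF that] by simp
  fix z a b c assume z: "z \<in> \<Omega>" and abc: "a \<in> ball z (d z / 2)" "b \<in> ball z (d z / 2)" "c \<in> ball z (d z / 2)"
  let ?U = "ball a (d a) \<inter> ball b (d b) \<inter> ball c (d c)"
  have m: "a \<in> \<Omega>" "b \<in> \<Omega>" "c \<in> \<Omega>" "z \<in> ?U" using near abc by auto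
  have "AE x in lborel. x \<in> ?U --> D a b + D b c = D a c"
   using D[OF m(1,2)] D[OF m(2,3)] D[OF m(1,3)]
  proof (eventually_elim, intro impI)
   fix x assume "x \<in> ball a (d a) \<inter> ball b (d b) --> P b x - P a x = D a b" "x \<in> ball b (d b) \<inter> ball c (d c) --> P c x - P b x = D b c"
    "x \<in> ball a (d a) \<inter> ball c (d c) --> P c x - P a x = D a c" "x \<in> ?U"
   then have "D a b = P b x - P a x" "D b c = P c x - P b x" "D a c = P c x - P a x" by auto
   then show "D a b + D b c = D a c" by simp
  qed
  then show "D a b + D b c = D a c" using AE_open_ex[of ?U "%_. D a b + D b c = D a c"] m(4) by blast
 qed
 have "ball z (d z / 2) \<subseteq> \<Omega>" for z using near by blast
 from cocycle_is_coboundary[OF \<Omega>(4) this] obtain C where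
  C: "!!z a b. z \<in> \<Omega> ==> a \<in> ball z (d z / 2) ==> b \<in> ball z (d z / 2) ==> C b - C a = D a b" by blast
 define Q where "Q a x = P a x - C a" for a x
 have agree: "AE x in lborel. x \<in> ball a (d a) \<inter> ball b (d b) --> Q a x = Q b x"
  if "z \<in> \<Omega>" "a \<in> ball z (d z / 2)" "b \<in> ball z (d z / 2)" for z a b
  using D[of a b] near that C[OF that] by (auto simp: Q_def algebra_simps elim!: eventually_mono)
 have Qm: "Q a \<in> borel_measurable borel" if "a \<in> \<Omega>" for a
 proof -
  have [measurable]: "P a \<in> borel_measurable borel" using P(1)[OF that] by (simp add: L2field_def)
  show ?thesis unfolding Q_def[abs_def] by measurable
 qed
 have "open S" if "S \<in> (%a. ball a (d a / 3)) ` \<Omega>" for S using that by auto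
 from Lindelof[OF this] obtain \<F> where F: "\<F> \<subseteq> (%a. ball a (d a / 3)) ` \<Omega>" "countable \<F>" "\<Union>\<F> = (\<Union>a\<in>\<Omega>. ball a (d a / 3))" by blast
 then have "countable \<F> \<and> \<F> \<subseteq> (%a. ball a (d a / 3)) ` \<Omega>" by blast
 then obtain A where A: "countable A" "A \<subseteq> \<Omega>" "\<F> = (%a. ball a (d a / 3)) ` A" unfolding countable_subset_image by blast
 have cov: "\<exists>a\<in>A. x \<in> ball a (d a / 3)" if "x \<in> \<Omega>" for x
 proof -
  have "x \<in> \<Union>\<F>" unfolding F(3) using that dpos[OF that] by (intro UN_I[of x]) auto
  then show ?thesis unfolding A(3) by blast
 qed
 have Ane: "A ~= {}" using cov \<Omega>(3) by blast
 define e where "e n = from_nat_into A n" for n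
 have e\<Omega>: "e n \<in> \<Omega>" for n using from_nat_into[OF Ane, of n] A(2) by (auto simp: e_def)
 \<comment> \<open>With radius d / 3, two balls that meet at z have both centres within d z / 2 of
   z, where the corrected potentials agree.\<close>
 define B where "B n = ball (e n) (d (e n) / 3)" for n
 have [measurable]: "B n \<in> sets borel" for n by (simp add: B_def)
 have B\<Omega>: "B n \<subseteq> ball (e n) (d (e n))" "B n \<subseteq> \<Omega>" for n
 proof -
  show "B n \<subseteq> ball (e n) (d (e n))" unfolding B_def using dpos[OF e\<Omega>[of n]] by (intro subset_ball) simp
  then show "B n \<subseteq> \<Omega>" using dsub by blast
 qed
 have Bcov: "\<exists>n. x \<in> B n" if x: "x \<in> \<Omega>" for x
 proof -
  obtain a where a: "a \<in> A" "x \<in> ball a (d a / 3)" using cov[OF x] by blast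
  then show ?thesis using from_nat_into_surj[OF A(1) a(1)] by (auto simp: B_def e_def)
 qed
 have QQ: "AE x in lborel. x \<in> B k \<inter> B n --> Q (e k) x = Q (e n) x" for k n
 proof (cases "B k \<inter> B n = {}")
  case False
  then obtain z where z: "z \<in> B k" "z \<in> B n" by blast
  have "e j \<in> ball z (d z / 2)" if "z \<in> B j" for j
   using that dlip[of "e j" z] by (auto simp: B_def dist_commute)
  with z agree[of z "e k" "e n"] B\<Omega>(2) have "AE x in lborel. x \<in> ball (e k) (d (e k)) \<inter> ball (e n) (d (e n)) --> Q (e k) x = Q (e n) x" by blast
  then show ?thesis
  proof eventually_elim
   case (elim x) then show ?case using B\<Omega>(1) by blast
  qed
 qed simp
 \<comment> \<open>The least index makes p a measurable selection among countably many functions; by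
   their agreement the choice affects p only on a null set.\<close>
 define N where "N x = (LEAST n. x \<in> B n)" for x
 define p where "p x = (if x \<in> \<Omega> then Q (e (N x)) x else 0)" for x
 have Nm: "N \<in> measurable borel (count_space UNIV)" unfolding N_def by measurable
 have \<Omega>m [measurable]: "\<Omega> \<in> sets borel" using \<Omega>(1) by simp
 have "(%x. Q (e (N x)) x) \<in> borel_measurable borel"
  by (rule measurable_compose_countable[OF Qm[OF e\<Omega>] Nm])
 then have pm [measurable]: "p \<in> borel_measurable borel" unfolding p_def[abs_def] by measurable
 have p0: "p x = 0" if "x \<notin> \<Omega>" for x using that by (simp add: p_def)
 have pQ: "AE x in lborel. x \<in> B n --> p x = Q (e n) x" for n
 proof -
  have "AE x in lborel. \<forall>k. x \<in> B k \<inter> B n --> Q (e k) x = Q (e n) x" unfolding AE_all_countable using QQ by blast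
  then show ?thesis
  proof eventually_elim
   case (elim x)
   show ?case
   proof
    assume x: "x \<in> B n"
    then have "x \<in> B (N x)" unfolding N_def by (rule LeastI)
    then have "Q (e (N x)) x = Q (e n) x" using elim x by blast
    moreover have "x \<in> \<Omega>" using x B\<Omega>(2) by blast
    ultimately show "p x = Q (e n) x" by (simp add: p_def)
   qed
  qed
 qed
 have ploc: "loc_integrable \<Omega> p"
  unfolding loc_integrable_def
 proof (intro conjI ballI pm)
  fix a assume "a \<in> \<Omega>"
  then obtain n where n: "a \<in> B n" using Bcov by blast
  then obtain \<rho> where \<rho>: "\<rho> > 0" "ball a \<rho> \<subseteq> B n" using openE[of "B n" a] by (auto simp: B_def)
  have "integrable lborel (%x. indicator (ball a \<rho>) x *\<^sub>R C (e n))"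
   using emeasure_lborel_ball_finite[of a \<rho>] by (intro integrable_scaleR_left integrable_real_indicator) auto
  then have "integrable lborel (%x. indicator (ball a \<rho>) x *\<^sub>R P (e n) x - indicator (ball a \<rho>) x *\<^sub>R C (e n))"
   by (intro Bochner_Integration.integrable_diff integrable_mult_indicator[of _ _ "P (e n)"] Pi e\<Omega>) auto
  moreover have "AE x in lborel. indicator (ball a \<rho>) x *\<^sub>R P (e n) x - indicator (ball a \<rho>) x *\<^sub>R C (e n) = indicator (ball a \<rho>) x *\<^sub>R p x"
   using pQ[of n]
  proof eventually_elim
   case (elim x) then show ?case using \<rho>(2) by (cases "x \<in> ball a \<rho>") (auto simp: Q_def)
  qed
  moreover have "indicator (ball a \<rho>) \<in> borel_measurable (borel :: (real^3) measure)" by (rule borel_measurable_indicator) simp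
  then have "(%x. indicator (ball a \<rho>) x *\<^sub>R p x) \<in> borel_measurable lborel" by measurable
  ultimately have "integrable lborel (%x. indicator (ball a \<rho>) x *\<^sub>R p x)" by (blast intro: integrable_cong_AE_imp)
  with \<rho>(1) show "\<exists>\<rho>>0. integrable lborel (%x. indicator (ball a \<rho>) x *\<^sub>R p x)" by blast
 qed
 have pw: "weak_grad \<Omega> p w"
 proof (rule weak_grad_local[OF _ ploc wi])
  fix a assume "a \<in> \<Omega>"
  then obtain n where n: "a \<in> B n" using Bcov by blast
  then obtain \<rho> where \<rho>: "\<rho> > 0" "ball a \<rho> \<subseteq> B n" using openE[of "B n" a] by (auto simp: B_def)
  have "weak_grad (B n) (Q (e n)) w"
   unfolding Q_def[abs_def]
   by (intro weak_grad_diff_const integrable_imp_loc_integrable Pi e\<Omega> weak_grad_mono[OF P(3)] B\<Omega>)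
  then have "weak_grad (B n) p w" by (rule weak_grad_cong_AE[OF _ pQ pm Qm[OF e\<Omega>]])
  then have "weak_grad (ball a \<rho>) p w" by (rule weak_grad_mono[OF _ \<rho>(2)])
  with \<rho>(1) show "\<exists>\<rho>>0. weak_grad (ball a \<rho>) p w" by blast
 qed
 \<comment> \<open>Square integrability up to a constant near every point of the closure;
   compactness then leaves finitely many balls.\<close>
 have "\<exists>\<rho>>0. \<exists>q c. L2field q \<and> (AE x in lborel. x \<in> ball z \<rho> \<inter> \<Omega> --> p x = q x + c)" if z: "z \<in> closure \<Omega>" for z
 proof (cases "z \<in> \<Omega>")
  case True
  then obtain n where n: "z \<in> B n" using Bcov by blast
  then obtain \<rho> where \<rho>: "\<rho> > 0" "ball z \<rho> \<subseteq> B n" using openE[of "B n" z] by (auto simp: B_def)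
  have "AE x in lborel. x \<in> ball z \<rho> \<inter> \<Omega> --> p x = P (e n) x + (- C (e n))"
   using pQ[of n]
  proof eventually_elim
   case (elim x) then show ?case using \<rho>(2) by (auto simp: Q_def)
  qed
  with \<rho>(1) P(1)[OF e\<Omega>] show ?thesis by blast
 next
  case False
  then have fr: "z \<in> frontier \<Omega>" using z \<Omega>(1) by (simp add: frontier_def interior_open)
  show ?thesis
  proof (rule lipschitz_boundary_point[OF \<Omega>(1,5) fr zero_less_one])
   fix \<delta> r :: real and c2
   assume r: "0 < r" and seg: "!!x y. x \<in> ball z r \<inter> \<Omega> ==> y \<in> ball c2 r ==> closed_segment x y \<subseteq> ball z \<delta> \<inter> \<Omega>"
   have "open (ball z r \<inter> \<Omega>)" using \<Omega>(1) by (intro open_Int) auto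
   moreover have "ball z r \<inter> \<Omega> ~= {}"
    using z r open_Int_closure_eq_empty[of "ball z r" \<Omega>] centre_in_ball[of z r] by blast
   ultimately obtain V where V: "open V" "connected V" "ball z r \<inter> \<Omega> \<subseteq> V" "V \<subseteq> ball z \<delta> \<inter> \<Omega>"
    "!!x y. x \<in> V ==> y \<in> ball c2 r ==> closed_segment x y \<subseteq> V"
    using star_region[OF _ _ r seg] by blast
   have V\<Omega>: "V \<subseteq> \<Omega>" using V(4) by blast
   have bV: "bounded V" using \<Omega>(2) V\<Omega> by (rule bounded_subset)
   obtain q where q: "L2field q" "!!x. x \<notin> V ==> q x = 0" "weak_grad V q w"
    using local_potential[OF V(1) bV r V(5) w(1) wi wR curl_free_mono[OF w(3) V\<Omega>]] by blast
   have qi: "integrable lborel q" by (rule L2field_integrable[OF q(1) bV q(2)])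
   have pV: "loc_integrable V p" by (rule loc_integrable_subset[OF ploc V\<Omega>])
   have "weak_grad V (%x. p x - q x) (%_. 0)"
    by (rule weak_grad_diff[OF weak_grad_mono[OF pw V\<Omega>] q(3) pV integrable_imp_loc_integrable[OF qi]])
   from weak_grad_zero_const[OF this loc_integrable_diff[OF pV qi] V(1,2)] obtain c where
    "AE x in lborel. x \<in> V --> p x - q x = c" by blast
   then have "AE x in lborel. x \<in> ball z r \<inter> \<Omega> --> p x = q x + c"
   proof eventually_elim
    case (elim x) then show ?case using V(3) by (auto simp: algebra_simps)
   qed
   with r q(1) show ?thesis by blast
  qed
 qed
 then have "\<forall>z\<in>closure \<Omega>. \<exists>\<rho>>0. \<exists>q c. L2field q \<and> (AE x in lborel. x \<in> ball z \<rho> \<inter> \<Omega> --> p x = q x + c)" by blast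
 from bchoice[OF this] obtain \<rho> where \<rho>: "!!z. z \<in> closure \<Omega> ==> \<rho> z > 0"
  "!!z. z \<in> closure \<Omega> ==> \<exists>q c. L2field q \<and> (AE x in lborel. x \<in> ball z (\<rho> z) \<inter> \<Omega> --> p x = q x + c)" by blast
 have "compact (closure \<Omega>)" using \<Omega>(2) by (simp add: compact_closure)
 moreover have "closure \<Omega> \<subseteq> (\<Union>z\<in>closure \<Omega>. ball z (\<rho> z))" using \<rho>(1) by fastforce
 ultimately obtain Z where Z: "Z \<subseteq> closure \<Omega>" "finite Z" "closure \<Omega> \<subseteq> (\<Union>z\<in>Z. ball z (\<rho> z))"
  using compactE_image[of "closure \<Omega>" "closure \<Omega>" "%z. ball z (\<rho> z)"] by blast
 have fin: "(NI x. nsq (p x) * indicator (ball z (\<rho> z) \<inter> \<Omega>) x) < \<infinity>" if z: "z \<in> Z" for z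
 proof -
  obtain q c where q: "L2field q" "AE x in lborel. x \<in> ball z (\<rho> z) \<inter> \<Omega> --> p x = q x + c" using \<rho>(2) z Z(1) by blast
  have [measurable]: "q \<in> borel_measurable borel" using q(1) by (simp add: L2field_def)
  have bm [measurable]: "ball z (\<rho> z) \<in> sets borel" by simp
  have "(NI x. nsq (p x) * indicator (ball z (\<rho> z) \<inter> \<Omega>) x)
   <= (NI x. 2 * nsq (q x) + ennreal (2 * (norm c)\<^sup>2) * indicator (ball z (\<rho> z)) x)"
   using q(2)
  proof (intro nn_integral_mono_AE, eventually_elim)
   case (elim x)
   show ?case
   proof (cases "x \<in> ball z (\<rho> z) \<inter> \<Omega>")
    case True
    then have "norm (p x) <= norm (q x) + norm c" using elim norm_triangle_ineq by auto
    then have "(norm (p x))\<^sup>2 <= (norm (q x) + norm c)\<^sup>2" by (intro power_mono) auto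
    also have "\<dots> <= 2 * (norm (q x))\<^sup>2 + 2 * (norm c)\<^sup>2"
     using zero_le_power2[of "norm (q x) - norm c"] by (simp add: power2_sum power2_diff)
    finally have "nsq (p x) <= ennreal (2 * (norm (q x))\<^sup>2 + 2 * (norm c)\<^sup>2)" by (rule ennreal_leI)
    also have "\<dots> = 2 * nsq (q x) + ennreal (2 * (norm c)\<^sup>2)" by (simp add: ennreal_mult)
    finally show ?thesis using True by simp
   qed simp
  qed
  also have "\<dots> = 2 * ennreal (sqn q) + ennreal (2 * (norm c)\<^sup>2) * emeasure lborel (ball z (\<rho> z))"
   unfolding nn_integral_sqn[OF q(1), symmetric]
   by (subst nn_integral_add) (simp_all add: nn_integral_cmult)
  also have "\<dots> < \<infinity>" using emeasure_lborel_ball_finite[of z "\<rho> z"] by (simp add: ennreal_mult_less_top)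
  finally show ?thesis .
 qed
 have "L2field p"
 proof (rule L2fieldI_nn_integral[OF pm])
  have bm: "ball z (\<rho> z) \<in> sets borel" for z by simp
  have "(NI x. nsq (p x)) <= (NI x. (\<Sum>z\<in>Z. nsq (p x) * indicator (ball z (\<rho> z) \<inter> \<Omega>) x))"
  proof (rule nn_integral_mono)
   fix x
   show "nsq (p x) <= (\<Sum>z\<in>Z. nsq (p x) * indicator (ball z (\<rho> z) \<inter> \<Omega>) x)"
   proof (cases "x \<in> \<Omega>")
    case True
    then obtain z where z: "z \<in> Z" "x \<in> ball z (\<rho> z)" using Z(3) closure_subset[of \<Omega>] by blast
    have "nsq (p x) = nsq (p x) * indicator (ball z (\<rho> z) \<inter> \<Omega>) x" using True z by simp
    also have "\<dots> <= (\<Sum>z\<in>Z. nsq (p x) * indicator (ball z (\<rho> z) \<inter> \<Omega>) x)"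
     using Z(2) z(1) by (intro member_le_sum) auto
    finally show ?thesis .
   qed (simp add: p0)
  qed
  also have "\<dots> = (\<Sum>z\<in>Z. NI x. nsq (p x) * indicator (ball z (\<rho> z) \<inter> \<Omega>) x)"
   by (rule nn_integral_sum) (use bm in measurable)
  also have "\<dots> < \<infinity>" using fin Z(2) by (simp add: ennreal_sum_less_top)
  finally show "(NI x. nsq (p x)) < \<infinity>" .
 qed
 with p0 pw show ?thesis by blast
qed

section \<open>Borel representatives and the theorem\<close>

text \<open>A field on \<open>\<Omega>\<close>, Lebesgue measurable up to null sets, is represented by a Borel field on the whole
  space that vanishes off \<open>\<Omega>\<close>.\<close>

definition represents :: "(real^3) set => (real^3 => 'b::euclidean_space) => (real^3 => 'b) => bool" where
 "represents \<Omega> f' f \<longleftrightarrow> f' \<in> borel_measurable borel \<and> (\<forall>x. x \<notin> \<Omega> --> f' x = 0) \<and>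
   (AE x in lborel. x \<in> \<Omega> --> f x = f' x)"

lemma
 fixes f f' :: "real^3 => 'b::euclidean_space"
 assumes r: "represents \<Omega> f' f" and \<Omega>: "open \<Omega>"
 shows represents_measurable: "f \<in> borel_measurable (lebesgue_on \<Omega>)"
  and represents_integral: "(\<integral>x. f x \<partial>lebesgue_on \<Omega>) = (LI x. f' x)"
  and represents_integrable: "integrable (lebesgue_on \<Omega>) f \<longleftrightarrow> integrable lborel f'"
proof -
 have \<Omega>s: "\<Omega> \<inter> space lebesgue \<in> sets lebesgue" using \<Omega> by (simp add: lebesgue_openin lmeasurable_open borel_open sets_completionI_sets)
 have m: "f' \<in> borel_measurable borel" using r by (simp add: represents_def)
 have m': "f' \<in> borel_measurable lebesgue" by (rule measurable_completion) (use m in simp)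
 have ae: "AE x in lebesgue. f' x = indicator \<Omega> x *\<^sub>R f x"
  using r unfolding represents_def AE_completion_iff by (auto simp: indicator_def elim!: eventually_mono)
 have fm: "(%x. indicator \<Omega> x *\<^sub>R f x) \<in> borel_measurable lebesgue" by (rule borel_measurable_AE[OF m' ae])
 show "f \<in> borel_measurable (lebesgue_on \<Omega>)" using fm by (simp add: borel_measurable_restrict_space_iff[OF \<Omega>s])
 have "(\<integral>x. indicator \<Omega> x *\<^sub>R f x \<partial>lebesgue) = (\<integral>x. f' x \<partial>lebesgue)"
  by (rule integral_cong_AE[OF fm m']) (use ae in \<open>auto elim!: eventually_mono\<close>)
 then show "(\<integral>x. f x \<partial>lebesgue_on \<Omega>) = (LI x. f' x)"
  using m by (simp add: integral_restrict_space[OF \<Omega>s] integral_completion)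
 have "integrable lebesgue (%x. indicator \<Omega> x *\<^sub>R f x) \<longleftrightarrow> integrable lebesgue f'"
  by (rule integrable_cong_AE[OF fm m']) (use ae in \<open>auto elim!: eventually_mono\<close>)
 then show "integrable (lebesgue_on \<Omega>) f \<longleftrightarrow> integrable lborel f'"
  using m by (simp add: integrable_restrict_space[OF \<Omega>s] integrable_completion)
qed

lemma represents_self:
 assumes "f \<in> borel_measurable borel" "!!x. x \<notin> \<Omega> ==> f x = 0"
 shows "represents \<Omega> f f"
 using assms by (simp add: represents_def)

text \<open>Real and imaginary parts are replaced by Borel functions separately.\<close>

lemma representative_exists:
 assumes f: "(f :: real^3 => complex) \<in> borel_measurable (lebesgue_on \<Omega>)" and \<Omega>: "open \<Omega>"
 shows "\<exists>f'. represents \<Omega> f' f"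
proof -
 have \<Omega>s: "\<Omega> \<inter> space lebesgue \<in> sets lebesgue" using \<Omega> by (simp add: sets_completionI_sets)
 have [measurable]: "\<Omega> \<in> sets borel" using \<Omega> by simp
 have "(%x. indicator \<Omega> x *\<^sub>R f x) \<in> borel_measurable lebesgue" using f by (simp add: borel_measurable_restrict_space_iff[OF \<Omega>s])
 then have "(%x. Re (indicator \<Omega> x *\<^sub>R f x)) \<in> borel_measurable lebesgue" "(%x. Im (indicator \<Omega> x *\<^sub>R f x)) \<in> borel_measurable lebesgue"
  by measurable
 from this[THEN completion_ex_borel_measurable_real] obtain a b where ab: "a \<in> borel_measurable lborel" "b \<in> borel_measurable lborel"
  "AE x in lborel. Re (indicator \<Omega> x *\<^sub>R f x) = a x" "AE x in lborel. Im (indicator \<Omega> x *\<^sub>R f x) = b x"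
  by blast
 have [measurable]: "a \<in> borel_measurable borel" "b \<in> borel_measurable borel" using ab by auto
 define f' where "f' x = indicator \<Omega> x *\<^sub>R (complex_of_real (a x) + \<i> * complex_of_real (b x))" for x
 have "AE x in lborel. x \<in> \<Omega> --> f x = f' x"
  using ab(3,4) by eventually_elim (auto simp: f'_def complex_eq_iff)
 moreover have "f' \<in> borel_measurable borel" unfolding f'_def[abs_def] by measurable
 ultimately have "represents \<Omega> f' f" by (simp add: represents_def f'_def)
 then show ?thesis by blast
qed

lemma represents_cdot:
 assumes a: "represents \<Omega> a' a" and b: "b \<in> borel_measurable borel"
 shows "represents \<Omega> (%x. cdot (a' x) (b x)) (%x. cdot (a x) (b x))"
proof -
 have [measurable]: "a' \<in> borel_measurable borel" "b \<in> borel_measurable borel" using assms by (auto simp: represents_def)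
 have "(%x. cdot (a' x) (b x)) \<in> borel_measurable borel" by measurable
 with a show ?thesis by (auto simp: represents_def elim!: eventually_mono)
qed

lemma represents_cdot2:
 assumes "represents \<Omega> a' a" "represents \<Omega> b' b"
 shows "represents \<Omega> (%x. cdot (a' x) (b' x)) (%x. cdot (a x) (b x))"
proof -
 have [measurable]: "a' \<in> borel_measurable borel" "b' \<in> borel_measurable borel" using assms by (auto simp: represents_def)
 have "(%x. cdot (a' x) (b' x)) \<in> borel_measurable borel" by measurable
 with assms show ?thesis by (auto simp: represents_def elim: eventually_elim2)
qed

lemma represents_mult:
 assumes a: "represents \<Omega> a' a" and b: "b \<in> borel_measurable borel"
 shows "represents \<Omega> (%x. a' x * b x) (%x. a x * (b x :: complex))"
proof -
 have [measurable]: "a' \<in> borel_measurable borel" "b \<in> borel_measurable borel" using assms by (auto simp: represents_def)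
 have "(%x. a' x * b x) \<in> borel_measurable borel" by measurable
 with a show ?thesis by (auto simp: represents_def elim!: eventually_mono)
qed

lemma represents_nth: "represents \<Omega> f' f ==> represents \<Omega> (%x. f' x $ i) (%x. (f x :: complex^3) $ i)"
proof -
 assume f: "represents \<Omega> f' f"
 have [measurable]: "f' \<in> borel_measurable borel" using f by (simp add: represents_def)
 have "(%x. f' x $ i) \<in> borel_measurable borel"
  by (rule measurable_compose[OF _ borel_measurable_continuous_onI]) (auto intro: continuous_intros)
 with f show ?thesis by (auto simp: represents_def elim!: eventually_mono)
qed

lemma represents_vec:
 assumes "!!i. represents \<Omega> (f' i) (%x. (f x :: complex^3) $ i)"
 shows "represents \<Omega> (%x. \<chi> i. f' i x) f"
proof -
 have ae: "AE x in lborel. x \<in> \<Omega> --> f x $ i = f' i x" for i using assms by (simp add: represents_def)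
 have "AE x in lborel. x \<in> \<Omega> --> f x = (\<chi> i. f' i x)"
  using ae[of 1] ae[of 2] ae[of 3] by eventually_elim (auto simp: vec_eq_iff forall_3)
 moreover have "(%x. \<chi> i. f' i x) \<in> borel_measurable borel"
 proof -
  have fm: "f' i \<in> borel_measurable borel" for i using assms by (simp add: represents_def)
  have "(%x. \<chi> i. f' i x) = (%x. \<Sum>i\<in>UNIV. axis i (f' i x))" by (auto simp: vec_eq_iff fun_eq_iff axis_def)
  moreover have "(%x. axis i (f' i x) :: complex^3) \<in> borel_measurable borel" for i
  proof -
   have "continuous_on UNIV (%z :: complex. if j = i then z else 0)" for j by (cases "j = i") auto
   then have "continuous_on UNIV (%z :: complex. axis i z :: complex^3)" unfolding axis_def by (rule continuous_on_vec_lambda)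
   from measurable_compose[OF fm borel_measurable_continuous_onI[OF this]] show ?thesis .
  qed
  ultimately show ?thesis by simp
 qed
 ultimately show ?thesis using assms by (simp add: represents_def vec_eq_iff)
qed

lemma vec_representative_exists:
 assumes "f \<in> componentwise (L2 \<Omega>)" "open \<Omega>"
 shows "\<exists>f'. represents \<Omega> f' f"
proof -
 have "\<forall>i. \<exists>f'. represents \<Omega> f' (%x. f x $ i)"
  using assms representative_exists by (auto simp: componentwise_def L2_def)
 from choice[OF this] obtain f' where "!!i. represents \<Omega> (f' i) (%x. f x $ i)" by blast
 from represents_vec[OF this] show ?thesis by blast
qed

lemma L2_iff_L2field:
 assumes r: "represents \<Omega> f' f" and \<Omega>: "open \<Omega>"
 shows "f \<in> L2 \<Omega> \<longleftrightarrow> L2field f'"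
proof -
 have "represents \<Omega> (%x. (cmod (f' x))\<^sup>2) (%x. (cmod (f x))\<^sup>2)"
  using r by (auto simp: represents_def elim!: eventually_mono)
 from represents_integrable[OF this \<Omega>] show ?thesis
  using represents_measurable[OF r \<Omega>] r by (simp add: L2_def L2field_def represents_def)
qed

lemma L2field_vec:
 fixes f :: "real^3 => complex^3"
 assumes m: "f \<in> borel_measurable borel"
 shows "L2field f \<longleftrightarrow> (\<forall>i. L2field (%x. f x $ i))"
proof
 assume f: "L2field f"
 have "(%x. f x $ i) \<in> borel_measurable borel" for i
  by (rule measurable_compose[OF m borel_measurable_continuous_onI]) (auto intro: continuous_intros)
 then show "\<forall>i. L2field (%x. f x $ i)"
  using L2field_dominated[OF f, where c = 1] Finite_Cartesian_Product.norm_nth_le by auto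
next
 assume "\<forall>i. L2field (%x. f x $ i)"
 then show "L2field f" using m unfolding L2field_def norm_square_vec3 by auto
qed

lemma componentwise_L2_iff:
 assumes r: "represents \<Omega> f' f" and \<Omega>: "open \<Omega>"
 shows "f \<in> componentwise (L2 \<Omega>) \<longleftrightarrow> L2field f'"
 using L2_iff_L2field[OF represents_nth[OF r] \<Omega>] r by (auto simp: componentwise_def L2field_vec represents_def)

lemma locally_integrable_represents:
 fixes f' :: "real^3 => 'b::euclidean_space"
 assumes r: "represents \<Omega> f' f" and i: "integrable lborel f'"
 shows "locally_integrable \<Omega> f"
 unfolding locally_integrable_def set_integrable_def
proof (intro allI impI)
 fix K assume K: "compact K \<and> K \<subseteq> \<Omega>"
 then have Km: "K \<in> sets borel" by (simp add: compact_imp_closed)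
 have k: "integrable lborel (%x. indicator K x *\<^sub>R f' x)" by (rule integrable_mult_indicator[OF _ i]) (use Km in simp)
 then have km: "(%x. indicator K x *\<^sub>R f' x) \<in> borel_measurable lborel" by auto
 have m': "(%x. indicator K x *\<^sub>R f' x) \<in> borel_measurable lebesgue" by (rule measurable_completion[OF km])
 have ae: "AE x in lebesgue. indicator K x *\<^sub>R f' x = indicator K x *\<^sub>R f x"
  using r K unfolding represents_def AE_completion_iff by (auto simp: indicator_def elim!: eventually_mono)
 have "integrable lebesgue (%x. indicator K x *\<^sub>R f' x)" using k integrable_completion[OF km] by simp
 then show "integrable lebesgue (%x. indicator K x *\<^sub>R f x)"
  by (subst integrable_cong_AE[OF borel_measurable_AE[OF m' ae] m']) (use ae in \<open>auto elim!: eventually_mono\<close>)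
qed

lemma borel_test:
 assumes "\<phi> \<in> test_functions \<Omega>"
 shows "\<phi> \<in> borel_measurable borel" "pderiv3 i \<phi> \<in> borel_measurable borel" "grad \<phi> \<in> borel_measurable borel"
 using assms smooth_Ck[of \<phi> "Suc 0"] Ck_continuous[of "Suc 0" \<phi>] borel_grad[of \<phi>]
 by (auto simp: test_functions_def intro!: borel_measurable_continuous_onI)

lemma weak_grad_cnj:
 assumes "weak_grad \<Omega> p g"
 shows "weak_grad \<Omega> (%x. cnj (p x)) (%x. cnjv (g x))"
 unfolding weak_grad_def
proof (intro ballI allI)
 fix \<phi> i assume \<phi>: "\<phi> \<in> test_functions \<Omega>"
 have s: "smooth \<phi>" using \<phi> by (simp add: test_functions_def)
 have "pderiv3 i (%x. cnj (\<phi> x)) x = cnj (pderiv3 i \<phi> x)" for x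
  by (rule pderiv3_bounded_linear[OF bounded_linear_cnj smooth_differentiable[OF s]])
 with assms[unfolded weak_grad_def, rule_format, OF test_functions_cnj[OF \<phi>], of i]
 have "(LI x. p x * cnj (pderiv3 i \<phi> x)) = - (LI x. g x $ i * cnj (\<phi> x))" by simp
 then have "cnj (LI x. p x * cnj (pderiv3 i \<phi> x)) = cnj (- (LI x. g x $ i * cnj (\<phi> x)))" by simp
 then show "(LI x. cnj (p x) * pderiv3 i \<phi> x) = - (LI x. cnjv (g x) $ i * \<phi> x)"
  by (simp flip: Bochner_Integration.integral_cnj)
qed

theorem propositionB2:
  fixes \<Omega> :: "(real^3) set" and \<beta> :: real and u :: "real^3 \<Rightarrow> complex^3"
  assumes "open \<Omega>" and "connected \<Omega>" and "bounded \<Omega>" and "lipschitz_boundary \<Omega>"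
    and "0 \<in> \<Omega>"
    and "simply_connected \<Omega>" and "connected (frontier \<Omega>)"
    and "0 \<le> \<beta>" and "\<beta> < 1/2"
    and "u \<in> componentwise (V0 \<beta> \<Omega>)"
    and "has_weak_div \<Omega> u (\<lambda>_. 0)"
  shows "\<exists>\<psi> \<in> ZT \<beta> \<Omega>. has_weak_curl \<Omega> \<psi> u \<and>
           (\<forall>\<psi>' \<in> ZT \<beta> \<Omega>. has_weak_curl \<Omega> \<psi>' u \<longrightarrow> (AE x in lebesgue_on \<Omega>. \<psi>' x = \<psi> x))"
proof -
 note op = assms(1) and bd = assms(3) and lip = assms(4)
 have [measurable]: "\<Omega> \<in> sets borel" using op by simp
 have wL2: "weighted \<beta> (%x. u x $ i) \<in> L2 \<Omega>" for i using assms(10) by (simp add: componentwise_def V0_def)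
 then have "\<exists>W. represents \<Omega> W (weighted \<beta> (%x. u x $ i))" for i by (intro representative_exists op) (simp add: L2_def)
 then have "\<forall>i. \<exists>W. represents \<Omega> W (weighted \<beta> (%x. u x $ i))" by blast
 from choice[OF this] obtain W where W: "!!i. represents \<Omega> (W i) (weighted \<beta> (%x. u x $ i))" by blast
 define w where "w x = (\<chi> i. W i x)" for x
 \<comment> \<open>The weight is divided out of a Borel representative of r^\<beta> u, whose square
   integrability is part of membership in \<open>V0\<close>. At the origin the factor is 0 by the
   convention for \<open>powr\<close>, which concerns a null set.\<close>
 define u' where "u' x = (\<chi> i. of_real (norm x powr (- \<beta>)) * W i x)" for x
 have [measurable]: "W i \<in> borel_measurable borel" for i using W by (simp add: represents_def)
 have ru: "represents \<Omega> u' u"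
  unfolding u'_def
 proof (rule represents_vec)
  fix i
  have "AE x in lborel. x \<in> \<Omega> --> u x $ i = of_real (norm x powr (- \<beta>)) * W i x"
   using W[of i, unfolded represents_def, THEN conjunct2, THEN conjunct2] AE_lborel_singleton[of "0 :: real^3"]
  proof eventually_elim
   case (elim x)
   then have "norm x powr (- \<beta>) * norm x powr \<beta> = 1" by (simp flip: powr_add)
   then have "complex_of_real (norm x powr (- \<beta>)) * complex_of_real (norm x powr \<beta>) = 1" by (metis of_real_1 of_real_mult)
   then have "complex_of_real (norm x powr (- \<beta>)) * (complex_of_real (norm x powr \<beta>) * u x $ i) = u x $ i" by (simp only: mult.assoc[symmetric] mult_1)
   then show ?case using elim(1) unfolding weighted_def by metis
  qed
  moreover have "(%x. of_real (norm x powr (- \<beta>)) * W i x) \<in> borel_measurable borel" by measurable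
  ultimately show "represents \<Omega> (%x. of_real (norm x powr (- \<beta>)) * W i x) (%x. u x $ i)"
   using W[of i] by (simp add: represents_def)
 qed
 have u'm [measurable]: "u' \<in> borel_measurable borel" using ru by (simp add: represents_def)
 have u'0: "u' x = 0" if "x \<notin> \<Omega>" for x using ru that by (simp add: represents_def)
 have wm [measurable]: "w \<in> borel_measurable borel"
  using represents_vec[of \<Omega> W w] represents_self[of _ \<Omega>] W by (simp add: represents_def w_def[abs_def])
 have wL: "L2field w" unfolding L2field_vec[OF wm] using L2_iff_L2field[OF W op] wL2 by (simp add: w_def)
 have nu': "norm (u' x) = norm x powr (- \<beta>) * norm (w x)" for x
  using norm_scale_vec[of "of_real (norm x powr (- \<beta>))" "w x"] by (simp add: u'_def w_def)
 have uL: "L2field (%x. norm x powr \<beta> *\<^sub>R u' x)"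
 proof (rule L2field_dominated[OF wL, where c = 1])
  show "norm (norm x powr \<beta> *\<^sub>R u' x) <= 1 * norm (w x)" for x
   by (cases "x = 0") (simp_all add: nu' flip: mult.assoc powr_add)
 qed measurable
 \<comment> \<open>By 2 r^(-\<beta>) |w| <= r^(-2 \<beta>) + |w|^2, where both terms are integrable
   over the bounded set \<Omega>.\<close>
 have ui: "integrable lborel u'"
 proof (rule integrableI_bounded)
  have "emeasure lborel \<Omega> < \<infinity>" using bd by (rule emeasure_bounded_finite)
  then obtain M :: real where M: "!!c :: real^3. (NI y. ennreal (norm (c - y) powr (- (2 * \<beta>))) * indicator \<Omega> y) <= ennreal M"
   using powr_weight_integral_bound[of "2 * \<beta>" \<Omega>] assms(8,9) by auto
  have "(NI x. ennreal (norm (u' x))) <= (NI x. ennreal (norm (0 - x) powr (- (2 * \<beta>))) * indicator \<Omega> x + nsq (w x))"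
  proof (rule nn_integral_mono)
   fix x
   show "ennreal (norm (u' x)) <= ennreal (norm (0 - x) powr (- (2 * \<beta>))) * indicator \<Omega> x + nsq (w x)"
   proof (cases "x \<in> \<Omega>")
    case True
    let ?a = "norm x powr (- \<beta>)" and ?b = "norm (w x)"
    have "norm (u' x) <= 2 * ?a * ?b" unfolding nu' by simp
    also have "\<dots> <= ?a\<^sup>2 + ?b\<^sup>2" by (rule sum_squares_bound)
    also have "?a\<^sup>2 = norm x powr (- (2 * \<beta>))" by (simp add: power2_eq_square flip: powr_add)
    finally have "norm (u' x) <= norm x powr (- (2 * \<beta>)) + ?b\<^sup>2" .
    then have "ennreal (norm (u' x)) <= ennreal (norm x powr (- (2 * \<beta>)) + ?b\<^sup>2)" by (rule ennreal_leI)
    then show ?thesis using True by (simp add: ennreal_plus)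
   qed (simp add: u'0)
  qed
  also have "\<dots> = (NI x. ennreal (norm (0 - x) powr (- (2 * \<beta>))) * indicator \<Omega> x) + ennreal (sqn w)"
   unfolding nn_integral_sqn[OF wL, symmetric] by (rule nn_integral_add) measurable
  also have "\<dots> <= ennreal M + ennreal (sqn w)" by (intro add_mono order_refl M)
  also have "\<dots> < \<infinity>" by simp
  finally show "(NI x. ennreal (norm (u' x))) < \<infinity>" .
 qed measurable
 have u_loc: "locally_integrable \<Omega> u" using assms(11) by (simp add: has_weak_div_def)
 have zloc: "locally_integrable \<Omega> (%_. 0 :: complex)" by (simp add: locally_integrable_def set_integrable_def)
 have "divfree \<Omega> u'"
  unfolding divfree_def
 proof (intro conjI ballI allI impI ui)
  fix \<phi> assume \<phi>: "\<phi> \<in> test_functions \<Omega>"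
  show "(LI x. cdot (u' x) (grad \<phi> x)) = 0"
   using assms(11) \<phi> represents_integral[OF represents_cdot[OF ru borel_test(3)[OF \<phi>]] op] by (simp add: has_weak_div_def)
 qed (rule u'0)
 from vector_potential_exists[OF op bd lip assms(7,5,8,9) this uL] obtain \<psi> where \<psi>: "L2field \<psi>" "!!x. x \<notin> \<Omega> ==> \<psi> x = 0"
  "!!\<phi>. \<phi> \<in> componentwise (test_functions \<Omega>) ==> (LI x. cdot (\<psi> x) (curl \<phi> x)) = (LI x. cdot (u' x) (\<phi> x))"
  "!!g. L2field g ==> (!!x. x \<notin> \<Omega> ==> g x = 0) ==> curl_free \<Omega> g ==> (LI x. cdot (\<psi> x) (g x)) = 0"
  by blast
 have \<psi>m: "\<psi> \<in> borel_measurable borel" using \<psi>(1) by (simp add: L2field_def)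
 have r\<psi>: "represents \<Omega> \<psi> \<psi>" by (rule represents_self[OF \<psi>m \<psi>(2)])
 have \<psi>c: "\<psi> \<in> componentwise (L2 \<Omega>)" using componentwise_L2_iff[OF r\<psi> op] \<psi>(1) by simp
 have Li: "integrable lborel f" if "L2field f" "represents \<Omega> f g" for f g :: "real^3 => 'b::euclidean_space"
  using L2field_integrable[OF that(1) bd] that(2) by (simp add: represents_def)
 have \<psi>loc: "locally_integrable \<Omega> \<psi>" by (rule locally_integrable_represents[OF r\<psi> Li[OF \<psi>(1) r\<psi>]])
 have bT: "\<phi> \<in> borel_measurable borel" "curl \<phi> \<in> borel_measurable borel" if "\<phi> \<in> componentwise (test_functions \<Omega>)" for \<phi> :: "real^3 => complex^3"
  using continuous_componentwise_test[OF that] by (auto intro: borel_measurable_continuous_onI)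
 have curl_iff: "has_weak_curl \<Omega> v u \<longleftrightarrow> locally_integrable \<Omega> v \<and>
   (\<forall>\<phi>\<in>componentwise (test_functions \<Omega>). (LI x. cdot (v' x) (curl \<phi> x)) = (LI x. cdot (u' x) (\<phi> x)))"
  if v: "represents \<Omega> v' v" for v v'
  unfolding has_weak_curl_def using u_loc bT
   represents_integral[OF represents_cdot[OF v] op] represents_integral[OF represents_cdot[OF ru] op] by auto
 have \<psi>curl: "has_weak_curl \<Omega> \<psi> u" unfolding curl_iff[OF r\<psi>] using \<psi>loc \<psi>(3) by blast
 have grad_rep: "curl_free \<Omega> g'" "weak_grad \<Omega> p' g'" if g: "represents \<Omega> g' g" "L2field g'" and p: "represents \<Omega> p' p" and pg: "has_weak_grad \<Omega> p g" for p p' g g'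
 proof -
  show wg: "weak_grad \<Omega> p' g'"
   unfolding weak_grad_def
  proof (intro ballI allI)
   fix \<phi> i assume \<phi>: "\<phi> \<in> test_functions \<Omega>"
   show "(LI x. p' x * pderiv3 i \<phi> x) = - (LI x. g' x $ i * \<phi> x)"
    using pg \<phi> represents_integral[OF represents_mult[OF p borel_test(2)[OF \<phi>]] op, of i]
     represents_integral[OF represents_mult[OF represents_nth[OF g(1)] borel_test(1)[OF \<phi>]] op, of i]
    by (simp add: has_weak_grad_def)
  qed
  show "curl_free \<Omega> g'" by (rule weak_grad_imp_curl_free[OF wg Li[OF g(2,1)]])
 qed
 \<comment> \<open>Gradients of test functions are curl-free, so this is an instance of the
   orthogonality of \<psi>.\<close>
 have \<psi>div: "has_weak_div \<Omega> \<psi> (%_. 0)"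
  unfolding has_weak_div_def
 proof (intro conjI ballI \<psi>loc zloc)
  fix \<phi> assume \<phi>: "\<phi> \<in> test_functions \<Omega>"
  obtain K where K: "smooth \<phi>" "compact K" "K \<subseteq> \<Omega>" "!!x. x \<notin> K ==> \<phi> x = 0" using \<phi> by (rule test_functionsE) blast
  have g0: "grad \<phi> x = 0" if "x \<notin> K" for x
   using pderiv3_zero_off_support[OF compact_imp_closed[OF K(2)] K(4) that] by (simp add: grad_def vec_eq_iff)
  have gL: "L2field (grad \<phi>)"
   by (rule L2field_compact_support[OF continuous_grad[OF smooth_Ck[OF K(1)]] K(2) g0])
  have "integrable lborel (grad \<phi>)"
   by (rule integrable_compact_support[OF continuous_grad[OF smooth_Ck[OF K(1)]] K(2) g0])
  then have "curl_free \<Omega> (grad \<phi>)" by (rule weak_grad_imp_curl_free[OF grad_test_weak_grad[OF \<phi>]])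
  then have "(LI x. cdot (\<psi> x) (grad \<phi> x)) = 0" using gL g0 K(3) by (intro \<psi>(4)) auto
  then show "(\<integral>x. cdot (\<psi> x) (grad \<phi> x) \<partial>lebesgue_on \<Omega>) = - (\<integral>x. 0 * \<phi> x \<partial>lebesgue_on \<Omega>)"
   using represents_integral[OF represents_cdot[OF r\<psi> borel_test(3)[OF \<phi>]] op] by simp
 qed
 have "zero_normal_trace \<Omega> \<psi>"
  unfolding zero_normal_trace_def
 proof (intro conjI \<psi>c bexI[of _ "%_. 0"] \<psi>div ballI impI)
  show "(%_. 0) \<in> L2 \<Omega>" by (simp add: L2_def)
  fix p g assume p: "p \<in> L2 \<Omega>" and g: "g \<in> componentwise (L2 \<Omega>)" and pg: "has_weak_grad \<Omega> p g"
  obtain p' where p': "represents \<Omega> p' p" using representative_exists[OF _ op, of p] p by (auto simp: L2_def)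
  obtain g' where g': "represents \<Omega> g' g" using vec_representative_exists[OF g op] by blast
  have gL: "L2field g'" using componentwise_L2_iff[OF g' op] g by simp
  have "(LI x. cdot (\<psi> x) (g' x)) = 0"
   using g' by (intro \<psi>(4) gL grad_rep(1)[OF g' gL p' pg]) (simp add: represents_def)
  then show "(\<integral>x. cdot (\<psi> x) (g x) + 0 * p x \<partial>lebesgue_on \<Omega>) = 0"
   using represents_integral[OF represents_cdot2[OF r\<psi> g'] op] by simp
 qed
 then have "\<psi> \<in> ZT \<beta> \<Omega>" unfolding ZT_def using \<psi>c \<psi>curl \<psi>div assms(10) by blast
 moreover have "AE x in lebesgue_on \<Omega>. v x = \<psi> x" if vZ: "v \<in> ZT \<beta> \<Omega>" and vu: "has_weak_curl \<Omega> v u" for v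
 proof -
  have v: "v \<in> componentwise (L2 \<Omega>)" "has_weak_div \<Omega> v (%_. 0)" "zero_normal_trace \<Omega> v" using vZ by (auto simp: ZT_def)
  obtain v' where v': "represents \<Omega> v' v" using vec_representative_exists[OF v(1) op] by blast
  have vL: "L2field v'" using componentwise_L2_iff[OF v' op] v(1) by simp
  \<comment> \<open>\<open>zero_normal_trace\<close> provides a divergence f of its own. Since v is
    also weakly divergence-free, f is orthogonal to all test functions and hence 0 almost
    everywhere.\<close>
  obtain f where f: "f \<in> L2 \<Omega>" "has_weak_div \<Omega> v f"
   and tr: "!!p g. p \<in> L2 \<Omega> ==> g \<in> componentwise (L2 \<Omega>) ==> has_weak_grad \<Omega> p g ==> (\<integral>x. cdot (v x) (g x) + f x * p x \<partial>lebesgue_on \<Omega>) = 0"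
   using v(3) unfolding zero_normal_trace_def by blast
  obtain f' where f': "represents \<Omega> f' f" using representative_exists[OF _ op, of f] f(1) by (auto simp: L2_def)
  have fL: "L2field f'" using L2_iff_L2field[OF f' op] f(1) by simp
  obtain R where R: "\<Omega> \<subseteq> ball 0 R" using bounded_subset_ballD[OF bd, of 0] by blast
  have "AE x in lborel. x \<in> \<Omega> --> f' x = 0"
  proof (rule fundamental_lemma[OF op Li[OF fL f']])
   show "f' x = 0" if "norm x >= R" for x using f' that R by (auto simp: represents_def)
   fix \<phi> assume \<phi>: "\<phi> \<in> test_functions \<Omega>"
   then have "(\<integral>x. f x * \<phi> x \<partial>lebesgue_on \<Omega>) = 0" using v(2) f(2) by (simp add: has_weak_div_def)
   then show "(LI x. f' x * \<phi> x) = 0" using represents_integral[OF represents_mult[OF f' borel_test(1)[OF \<phi>]] op] by simp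
  qed
  then have f0: "represents \<Omega> (%_. 0) f" using f' by (auto simp: represents_def elim: eventually_elim2)
  define w where "w x = v' x - \<psi> x" for x
  have w: "L2field w" "!!x. x \<notin> \<Omega> ==> w x = 0"
   using L2field_diff[OF vL \<psi>(1)] v' \<psi>(2) by (auto simp: w_def[abs_def] represents_def)
  have "curl_free \<Omega> w"
   unfolding curl_free_def
  proof
   fix \<phi> assume \<phi>: "\<phi> \<in> componentwise (test_functions \<Omega>)"
   note c = componentwise_test_L2(2)[OF \<phi>]
   show "(LI x. cdot (w x) (curl \<phi> x)) = 0"
    unfolding w_def cdot_diff_left using cdot_L2(1)[OF vL c] cdot_L2(1)[OF \<psi>(1) c] vu \<psi>(3)[OF \<phi>] \<phi> curl_iff[OF v'] by simp
  qed
  from curl_free_imp_gradient[OF op bd _ assms(6) lip w this] assms(5) obtain p where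
   p: "L2field p" "!!x. x \<notin> \<Omega> ==> p x = 0" "weak_grad \<Omega> p w" by blast
  \<comment> \<open>The pairing is bilinear, so the conjugate of w is used as the test field to
    produce |w|^2.\<close>
  define p' g where "p' x = cnj (p x)" and "g x = cnjv (w x)" for x
  have pL: "L2field p'"
   using p(1) borel_measurable_continuous_on[OF continuous_on_cnj[OF continuous_on_id], of p borel] unfolding p'_def[abs_def] L2field_def by auto
  have gL: "L2field g" unfolding g_def[abs_def] by (rule L2field_cnjv[OF w(1)])
  have rp: "represents \<Omega> p' p'" using pL p(2) by (intro represents_self) (auto simp: L2field_def p'_def)
  have rg: "represents \<Omega> g g" using gL w(2) by (intro represents_self) (auto simp: L2field_def g_def vec_eq_iff)
  have wg: "weak_grad \<Omega> p' g" unfolding p'_def[abs_def] g_def[abs_def] by (rule weak_grad_cnj[OF p(3)])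
  have "has_weak_grad \<Omega> p' g"
   unfolding has_weak_grad_def
  proof (intro conjI ballI allI locally_integrable_represents[OF rp Li[OF pL rp]] locally_integrable_represents[OF rg Li[OF gL rg]])
   fix \<phi> i assume \<phi>: "\<phi> \<in> test_functions \<Omega>"
   show "(\<integral>x. p' x * pderiv3 i \<phi> x \<partial>lebesgue_on \<Omega>) = - (\<integral>x. g x $ i * \<phi> x \<partial>lebesgue_on \<Omega>)"
    using wg \<phi> represents_integral[OF represents_mult[OF rp borel_test(2)[OF \<phi>]] op, of i]
     represents_integral[OF represents_mult[OF represents_nth[OF rg] borel_test(1)[OF \<phi>]] op, of i]
    by (simp add: weak_grad_def)
  qed
  moreover have "p' \<in> L2 \<Omega>" "g \<in> componentwise (L2 \<Omega>)"
   using L2_iff_L2field[OF rp op] pL componentwise_L2_iff[OF rg op] gL by auto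
  ultimately have "(\<integral>x. cdot (v x) (g x) + f x * p' x \<partial>lebesgue_on \<Omega>) = 0" by (intro tr)
  moreover have "represents \<Omega> (%x. cdot (v' x) (g x)) (%x. cdot (v x) (g x) + f x * p' x)"
   using represents_cdot2[OF v' rg] f0 by (auto simp: represents_def elim: eventually_elim2)
  ultimately have "(LI x. cdot (v' x) (g x)) = 0" using represents_integral op by metis
  \<comment> \<open>For v the orthogonality to g is Green's formula with zero trace; for \<psi> it
    comes from the construction.\<close>
  moreover have "(LI x. cdot (\<psi> x) (g x)) = 0"
   using w(2) by (intro \<psi>(4) gL weak_grad_imp_curl_free[OF wg Li[OF gL rg]]) (simp add: g_def vec_eq_iff)
  ultimately have "(LI x. cdot (w x) (g x)) = 0"
   unfolding w_def cdot_diff_left using cdot_L2(1)[OF vL gL] cdot_L2(1)[OF \<psi>(1) gL] by simp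
  moreover have eq: "cdot (w x) (g x) = of_real ((norm (w x))\<^sup>2)" for x
   unfolding norm_square_vec3 of_real_sum complex_norm_square by (simp add: cdot_def g_def)
  ultimately have "(LI x. (norm (w x))\<^sup>2) = 0"
   unfolding eq integral_complex_of_real by (simp only: of_real_eq_0_iff)
  then have "AE x in lborel. w x = 0"
   using w(1) integral_nonneg_eq_0_iff_AE[of lborel "%x. (norm (w x))\<^sup>2"] by (simp add: L2field_def)
  then have "AE x in lborel. x \<in> \<Omega> --> v x = \<psi> x"
   using v' by (auto simp: represents_def w_def elim: eventually_elim2)
  then show ?thesis using op by (simp add: AE_restrict_space_iff AE_completion_iff sets_completionI_sets)
 qed
 ultimately show ?thesis using \<psi>curl by blast
qed

end
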